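(* Let $\Lambda$ be an Artin algebra. Then $\Lambda$ satisfies the finitistic dimension conjecture (i.e. $\mathrm{fin.dim}(\mathrm{mod}\,\Lambda)<\infty$) if and only if $\Lambda$ is a special GLIT algebra.
   Context: All modules are finitely generated left modules over an Artin algebra $\Lambda$; $\mathrm{mod}\,\Lambda$ is the category of these. Subcategories of $\mathrm{mod}\,\Lambda$ are regarded as classes of modules, membership being understood up to isomorphism. $\Omega$ is the syzygy operator (kernel of a projective cover), $\Omega^0X=X$. For a class $\mathcal{C}$, $\Omega^t\mathcal{C}=\{\Omega^tX: X\in\mathcal{C}\}$, and $\mathrm{add}\,\mathcal{C}$ is the class of direct summands of finite direct sums of modules in $\mathcal{C}$ (for a module $V$, $\mathrm{add}\,V=\mathrm{add}\{V\}$). $\mathrm{fin.dim}(\mathcal{C})=\sup\{\mathrm{pd}(X): X\in\mathcal{C},\ \mathrm{pd}(X)<\infty\}$, and $\mathcal{P}^{<\infty}(\mathcal{C})$ is the class of modules in $\mathcal{C}$ of finite projective dimension. Igusa-Todorov functions: Let $K$ be the free abelian group on the isoclasses $[X]$ of indecomposable non-projective modules; for arbitrary $Y$ let $[Y]\in K$ be the sum (with multiplicities) of the classes of the non-projective indecomposable summands of $Y$. Let $L:K\to K$ be the endomorphism with $L([X])=[\Omega X]$. For a module $X$ let $\langle X\rangle\subseteq K$ be the subgroup generated by the classes of the indecomposable non-projective direct summands of $X$. Then $\Phi(X)=\min\{n\ge 0: \mathrm{rk}\,L^k(\langle X\rangle)=\mathrm{rk}\,L^{k+1}(\langle X\rangle)\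 \forall k\ge n\}$ and $\Psi(X)=\Phi(X)+\mathrm{fin.dim}(\mathrm{add}\,\Omega^{\Phi(X)}(X))$. $\Phi\,\mathrm{dim}(\mathcal{C})$ and $\Psi\,\mathrm{dim}(\mathcal{C})$ are the suprema of $\Phi$ and $\Psi$ over $\mathcal{C}$. GLIT classes: a class $\mathcal{C}$ is an $n$-GLIT class ($n\ge0$) if there are $t\ge1$, $V\in\mathrm{mod}\,\Lambda$, $\mathcal{D}\subseteq\mathrm{mod}\,\Lambda$ with: (a) $\mathrm{add}\,\mathcal{D}=\mathcal{D}$, $\Omega^t\mathcal{D}\subseteq\mathcal{D}$ and $\Phi\,\mathrm{dim}(\mathcal{D})<\infty$; (b) for each $C\in\mathcal{C}$ there is an exact sequence $0\to V_1\oplus D_1\to V_0\oplus D_0\to\Omega^nC\to0$ with $V_0,V_1\in\mathrm{add}\,V$ and $D_0,D_1\in\mathcal{D}$. Special GLIT: a class $\mathcal{C}\subseteq\mathrm{mod}\,\Lambda$ is special GLIT if it satisfies one of the following equivalent conditions: (i) $\mathrm{fin.dim}(\mathcal{C})<\infty$; (ii) $\mathcal{P}^{<\infty}(\mathcal{C})$ is a $0$-GLIT class; (iii) $\mathcal{P}^{<\infty}(\mathcal{C})$ is an $n$-GLIT class for every $n\ge0$; (iv) there are $m\ge0$ and a class $\mathcal{E}\subseteq\mathrm{mod}\,\Lambda$ closed under direct sums with $\Psi\,\mathrm{dim}(\mathcal{E})<\infty$ such that each $C\in\mathcal{P}^{<\infty}(\mathcal{C})$ admits a short exact sequence $0\to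 E_1\to E_0\to\Omega^mC\to0$ with $E_0,E_1\in\mathcal{E}$. $\Lambda$ is a special GLIT algebra if $\mathrm{mod}\,\Lambda$ is a special GLIT class. *)

theory Defs
  imports "HOL-Algebra.Module" "HOL-Algebra.Ideal" "HOL-Algebra.RingHom"
    "HOL-Algebra.Generated_Groups" "HOL-Algebra.Free_Abelian_Groups" "HOL-Library.Extended_Nat"
begin

section \<open>Left modules over a ring\<close>

text \<open>The library locale \<^locale>\<open>module\<close> requires a commutative ring of scalars.  We reuse its
  record type and its axioms over an arbitrary ring; the ring multiplication and unit that the
  record also contains are never referred to.\<close>

locale left_module = R?: ring R + M?: abelian_group M
  for R :: "('a, 'r) ring_scheme" (structure) and M :: "('a, 'm) module" (structure) +
  assumes smult_closed [simp, intro]: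
      "\<lbrakk>a \<in> carrier R; x \<in> carrier M\<rbrakk> \<Longrightarrow> a \<odot>\<^bsub>M\<^esub> x \<in> carrier M"
    and smult_l_distr:
      "\<lbrakk>a \<in> carrier R; b \<in> carrier R; x \<in> carrier M\<rbrakk> \<Longrightarrow>
      (a \<oplus> b) \<odot>\<^bsub>M\<^esub> x = a \<odot>\<^bsub>M\<^esub> x \<oplus>\<^bsub>M\<^esub> b \<odot>\<^bsub>M\<^esub> x"
    and smult_r_distr:
      "\<lbrakk>a \<in> carrier R; x \<in> carrier M; y \<in> carrier M\<rbrakk> \<Longrightarrow>
      a \<odot>\<^bsub>M\<^esub> (x \<oplus>\<^bsub>M\<^esub> y) = a \<odot>\<^bsub>M\<^esub> x \<oplus>\<^bsub>M\<^esub> a \<odot>\<^bsub>M\<^esub> y"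
    and smult_assoc1:
      "\<lbrakk>a \<in> carrier R; b \<in> carrier R; x \<in> carrier M\<rbrakk> \<Longrightarrow>
      (a \<otimes> b) \<odot>\<^bsub>M\<^esub> x = a \<odot>\<^bsub>M\<^esub> (b \<odot>\<^bsub>M\<^esub> x)"
    and smult_one [simp]:
      "x \<in> carrier M \<Longrightarrow> \<one> \<odot>\<^bsub>M\<^esub> x = x"

locale fg_left_module = left_module +
  assumes finitely_generated:
    "\<exists>S. finite S \<and> S \<subseteq> carrier M \<and>
       (\<forall>x\<in>carrier M. \<exists>c\<in>S \<rightarrow> carrier R. x = (\<Oplus>\<^bsub>M\<^esub>s\<in>S. c s \<odot>\<^bsub>M\<^esub> s))"

locale artinian_cring = cring +
  assumes descending_chain_condition:
    "\<lbrakk>\<And>n. ideal (I n) R; \<And>n::nat. I (Suc n) \<subseteq> I n\<rbrakk> \<Longrightarrow> \<exists>n. \<forall>m\<ge>n. I m = I n"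

locale artin_algebra = R?: artinian_cring R + A?: ring \<Lambda>
  for R (structure) and \<Lambda> (structure) and \<phi> +
  assumes structure_hom: "\<phi> \<in> ring_hom R \<Lambda>"
    and structure_central:
      "\<lbrakk>r \<in> carrier R; x \<in> carrier \<Lambda>\<rbrakk> \<Longrightarrow> \<phi> r \<otimes>\<^bsub>\<Lambda>\<^esub> x = x \<otimes>\<^bsub>\<Lambda>\<^esub> \<phi> r"
    and finitely_generated_algebra:
      "\<exists>S. finite S \<and> S \<subseteq> carrier \<Lambda> \<and>
         (\<forall>x\<in>carrier \<Lambda>. \<exists>c\<in>S \<rightarrow> carrier R. x = (\<Oplus>\<^bsub>\<Lambda>\<^esub>s\<in>S. \<phi> (c s) \<otimes>\<^bsub>\<Lambda>\<^esub> s))"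


subsection \<open>Homomorphisms, exact sequences, direct sums\<close>

definition mod_hom ::
  "('a, 'r) ring_scheme \<Rightarrow> ('a, 'm) module \<Rightarrow> ('a, 'n) module \<Rightarrow> ('m \<Rightarrow> 'n) set" where
  "mod_hom \<Lambda> M N = {f \<in> carrier M \<rightarrow> carrier N.
     (\<forall>x\<in>carrier M. \<forall>y\<in>carrier M. f (x \<oplus>\<^bsub>M\<^esub> y) = f x \<oplus>\<^bsub>N\<^esub> f y) \<and>
     (\<forall>a\<in>carrier \<Lambda>. \<forall>x\<in>carrier M. f (a \<odot>\<^bsub>M\<^esub> x) = a \<odot>\<^bsub>N\<^esub> f x)}"

definition mod_iso ::
  "('a, 'r) ring_scheme \<Rightarrow> ('a, 'm) module \<Rightarrow> ('a, 'n) module \<Rightarrow> bool" where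
  "mod_iso \<Lambda> M N \<longleftrightarrow> (\<exists>f\<in>mod_hom \<Lambda> M N. bij_betw f (carrier M) (carrier N))"

definition mod_ker :: "('a, 'm) module \<Rightarrow> ('a, 'n) module \<Rightarrow> ('m \<Rightarrow> 'n) \<Rightarrow> 'm set" where
  "mod_ker M N f = {x \<in> carrier M. f x = \<zero>\<^bsub>N\<^esub>}"

definition short_exact ::
  "('a, 'r) ring_scheme \<Rightarrow> ('a, 'l) module \<Rightarrow> ('l \<Rightarrow> 'm) \<Rightarrow> ('a, 'm) module \<Rightarrow> ('m \<Rightarrow> 'n) \<Rightarrow>
     ('a, 'n) module \<Rightarrow> bool" where
  "short_exact \<Lambda> A f B g C \<longleftrightarrow> f \<in> mod_hom \<Lambda> A B \<and> g \<in> mod_hom \<Lambda> B C \<and>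
     inj_on f (carrier A) \<and> f ` carrier A = mod_ker B C g \<and> g ` carrier B = carrier C"

definition dsum :: "('a, 'm) module list \<Rightarrow> ('a, 'm list) module" where
  "dsum Ms = \<lparr>
     carrier = {xs. list_all2 (\<lambda>x M. x \<in> carrier M) xs Ms},
     monoid.mult = undefined,
     one = undefined,
     ring.zero = map (\<lambda>M. \<zero>\<^bsub>M\<^esub>) Ms,
     ring.add = (\<lambda>xs ys. map (\<lambda>(M, x, y). x \<oplus>\<^bsub>M\<^esub> y) (zip Ms (zip xs ys))),
     smult = (\<lambda>a xs. map (\<lambda>(M, x). a \<odot>\<^bsub>M\<^esub> x) (zip Ms xs))\<rparr>"


section \<open>The category of finitely generated modules\<close>

text \<open>All modules live on one type, which is large enough: a module generated by \<open>n\<close> elements is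
  isomorphic to a quotient of the \<open>n\<close>-th power of the ring, whose elements are cosets, i.e. sets
  of coefficient functions.  Lemma \<open>fg_modules_universal\<close> below confirms that every finitely generated
  module, over whatever type, is isomorphic to a member of \<open>fg_modules\<close>.\<close>

type_synonym 'a fgmod = "('a, (nat \<Rightarrow> 'a) set) module"

definition fg_modules :: "('a, 'r) ring_scheme \<Rightarrow> 'a fgmod set" where
  "fg_modules \<Lambda> = {M. fg_left_module \<Lambda> M}"

definition transport :: "('m \<Rightarrow> 'n) \<Rightarrow> ('a, 'm) module \<Rightarrow> ('a, 'n) module" where
  "transport h M = (let g = inv_into (carrier M) h in \<lparr>
     carrier = h ` carrier M,
     monoid.mult = undefined,
     one = undefined,
     ring.zero = h \<zero>\<^bsub>M\<^esub>,
     ring.add = (\<lambda>x y. h (g x \<oplus>\<^bsub>M\<^esub> g y)),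
     smult = (\<lambda>a x. h (a \<odot>\<^bsub>M\<^esub> g x))\<rparr>)"

lemma transport_left_module:
  assumes "left_module \<Lambda> M" and inj: "inj_on h (carrier M)"
  shows "left_module \<Lambda> (transport h M)" and "h \<in> mod_hom \<Lambda> M (transport h M)"
    and "bij_betw h (carrier M) (carrier (transport h M))"
proof -
  interpret left_module \<Lambda> M by fact
  note [simp] = transport_def Let_def inj
  have ab: "abelian_group (transport h M)"
  proof (rule abelian_groupI, goal_cases)
    case (6 x)
    then obtain x' where x': "x' \<in> carrier M" "x = h x'" by auto
    then show ?case
      by (intro bexI[of _ "h (\<ominus>\<^bsub>M\<^esub> x')"]) (auto simp: M.l_neg)
  qed (auto simp: M.a_ac)
  show "left_module \<Lambda> (transport h M)"
    by (intro left_module.intro left_module_axioms.intro ab R.ring_axioms)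
       (auto simp: smult_l_distr smult_r_distr smult_assoc1)
  show "h \<in> mod_hom \<Lambda> M (transport h M)"
    by (auto simp: mod_hom_def)
  show "bij_betw h (carrier M) (carrier (transport h M))"
    by (auto simp: bij_betw_def)
qed

lemma mod_hom_finsum:
  assumes "left_module \<Lambda> M" "left_module \<Lambda> N" "h \<in> mod_hom \<Lambda> M N"
    and "finite S" "f \<in> S \<rightarrow> carrier M"
  shows "h (\<Oplus>\<^bsub>M\<^esub>s\<in>S. f s) = (\<Oplus>\<^bsub>N\<^esub>s\<in>S. h (f s))"
proof -
  interpret M: left_module \<Lambda> M by fact
  interpret N: left_module \<Lambda> N by fact
  have add: "h (x \<oplus>\<^bsub>M\<^esub> y) = h x \<oplus>\<^bsub>N\<^esub> h y" if "x \<in> carrier M" "y \<in> carrier M" for x y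
    using assms(3) that by (auto simp: mod_hom_def)
  have closed: "h x \<in> carrier N" if "x \<in> carrier M" for x
    using assms(3) that by (auto simp: mod_hom_def)
  have "h \<zero>\<^bsub>M\<^esub> \<oplus>\<^bsub>N\<^esub> h \<zero>\<^bsub>M\<^esub> = h \<zero>\<^bsub>M\<^esub>"
    using add[of "\<zero>\<^bsub>M\<^esub>" "\<zero>\<^bsub>M\<^esub>"] by simp
  then have zero: "h \<zero>\<^bsub>M\<^esub> = \<zero>\<^bsub>N\<^esub>"
    using closed[of "\<zero>\<^bsub>M\<^esub>"] by (simp add: N.M.add.l_cancel_one)
  show ?thesis
    using assms(4,5)
    by (induction S) (auto simp: zero add closed Pi_iff M.M.finsum_closed)
qed

lemma fg_modules_universal:
  fixes M :: "('a, 'm) module"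
  assumes "fg_left_module \<Lambda> M"
  shows "\<exists>N\<in>fg_modules \<Lambda>. mod_iso \<Lambda> M N"
proof -
  interpret fg_left_module \<Lambda> M by fact
  obtain S where S: "finite S" "S \<subseteq> carrier M"
    "\<forall>x\<in>carrier M. \<exists>c\<in>S \<rightarrow> carrier \<Lambda>. x = (\<Oplus>\<^bsub>M\<^esub>s\<in>S. c s \<odot>\<^bsub>M\<^esub> s)"
    using finitely_generated by blast
  obtain e :: "'m \<Rightarrow> nat" where e: "inj_on e S"
    using finite_imp_inj_to_nat_seg[OF S(1)] by blast
  define h where "h x = {c :: nat \<Rightarrow> 'a. (\<forall>s\<in>S. c (e s) \<in> carrier \<Lambda>) \<and>
     x = (\<Oplus>\<^bsub>M\<^esub>s\<in>S. c (e s) \<odot>\<^bsub>M\<^esub> s)}" for x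
  have nonempty: "h x \<noteq> {}" if x: "x \<in> carrier M" for x
  proof -
    obtain c where c: "c \<in> S \<rightarrow> carrier \<Lambda>" "x = (\<Oplus>\<^bsub>M\<^esub>s\<in>S. c s \<odot>\<^bsub>M\<^esub> s)"
      using S(3) x by blast
    have "(\<Oplus>\<^bsub>M\<^esub>s\<in>S. c s \<odot>\<^bsub>M\<^esub> s) = (\<Oplus>\<^bsub>M\<^esub>s\<in>S. c (inv_into S e (e s)) \<odot>\<^bsub>M\<^esub> s)"
      using c S(2) e by (intro M.finsum_cong') (auto simp: Pi_iff subset_iff)
    then have "(\<lambda>i. c (inv_into S e i)) \<in> h x"
      using c e by (auto simp: h_def)
    then show ?thesis by blast
  qed
  have inj: "inj_on h (carrier M)"
  proof (rule inj_onI)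
    fix x y assume "x \<in> carrier M" "y \<in> carrier M" "h x = h y"
    then obtain c where "c \<in> h x" "c \<in> h y" using nonempty by blast
    then show "x = y" by (simp add: h_def)
  qed
  note T = transport_left_module[OF left_module_axioms inj]
  let ?N = "transport h M"
  interpret N: left_module \<Lambda> ?N by (rule T(1))
  have h: "h x \<in> carrier ?N" if "x \<in> carrier M" for x
    using T(3) that by (auto simp: bij_betw_def)
  have hs: "h (a \<odot>\<^bsub>M\<^esub> x) = a \<odot>\<^bsub>?N\<^esub> h x" if "a \<in> carrier \<Lambda>" "x \<in> carrier M" for a x
    using T(2) that by (auto simp: mod_hom_def)
  have injS: "inj_on h S" using inj S(2) by (rule inj_on_subset)
  have "fg_left_module \<Lambda> ?N"
  proof (intro fg_left_module.intro fg_left_module_axioms.intro T(1) exI[of _ "h ` S"] conjI ballI)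
    fix y assume "y \<in> carrier ?N"
    then obtain x where x: "x \<in> carrier M" "y = h x"
      using T(3) by (auto simp: bij_betw_def)
    then obtain c where c: "c \<in> S \<rightarrow> carrier \<Lambda>" "x = (\<Oplus>\<^bsub>M\<^esub>s\<in>S. c s \<odot>\<^bsub>M\<^esub> s)"
      using S(3) by blast
    let ?d = "\<lambda>t. c (inv_into S h t)"
    have "y = (\<Oplus>\<^bsub>?N\<^esub>s\<in>S. h (c s \<odot>\<^bsub>M\<^esub> s))"
      unfolding x c(2) using c(1) S(1,2)
      by (intro mod_hom_finsum[OF left_module_axioms T(1,2)]) auto
    also have "\<dots> = (\<Oplus>\<^bsub>?N\<^esub>s\<in>S. ?d (h s) \<odot>\<^bsub>?N\<^esub> h s)"
      using c(1) S(2) injS h by (intro N.M.finsum_cong') (auto simp: hs Pi_iff subset_iff)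
    also have "\<dots> = (\<Oplus>\<^bsub>?N\<^esub>t\<in>h ` S. ?d t \<odot>\<^bsub>?N\<^esub> t)"
      using c(1) S(2) injS h by (subst N.M.add.finprod_reindex) (auto simp: Pi_iff subset_iff)
    finally show "\<exists>c\<in>h ` S \<rightarrow> carrier \<Lambda>. y = (\<Oplus>\<^bsub>?N\<^esub>s\<in>h ` S. c s \<odot>\<^bsub>?N\<^esub> s)"
      using c(1) injS by (intro bexI[of _ ?d]) auto
  qed (use S h in auto)
  then show ?thesis
    using T(2,3) by (auto simp: fg_modules_def mod_iso_def)
qed

text \<open>Subcategories are isomorphism-closed classes of modules.\<close>

definition module_class :: "('a, 'r) ring_scheme \<Rightarrow> 'a fgmod set \<Rightarrow> bool" where
  "module_class \<Lambda> \<C> \<longleftrightarrow> \<C> \<subseteq> fg_modules \<Lambda> \<and> (\<forall>X\<in>\<C>. \<forall>Y\<in>fg_modules \<Lambda>. mod_iso \<Lambda> X Y \<longrightarrow> Y \<in> \<C>)"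

definition direct_summand :: "('a, 'r) ring_scheme \<Rightarrow> 'a fgmod \<Rightarrow> ('a, 'm) module \<Rightarrow> bool" where
  "direct_summand \<Lambda> X Y \<longleftrightarrow> X \<in> fg_modules \<Lambda> \<and> (\<exists>Z\<in>fg_modules \<Lambda>. mod_iso \<Lambda> Y (dsum [X, Z]))"

definition add_cl :: "('a, 'r) ring_scheme \<Rightarrow> 'a fgmod set \<Rightarrow> 'a fgmod set" where
  "add_cl \<Lambda> \<C> = {X. \<exists>Cs. set Cs \<subseteq> \<C> \<and> direct_summand \<Lambda> X (dsum Cs)}"

definition closed_under_sums :: "('a, 'r) ring_scheme \<Rightarrow> 'a fgmod set \<Rightarrow> bool" where
  "closed_under_sums \<Lambda> \<C> \<longleftrightarrow>
     (\<forall>X\<in>\<C>. \<forall>Y\<in>\<C>. \<forall>Z\<in>fg_modules \<Lambda>. mod_iso \<Lambda> Z (dsum [X, Y]) \<longrightarrow> Z \<in> \<C>)"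


section \<open>Projective modules, syzygies, projective dimension\<close>

definition projective :: "('a, 'r) ring_scheme \<Rightarrow> 'a fgmod \<Rightarrow> bool" where
  "projective \<Lambda> P \<longleftrightarrow> P \<in> fg_modules \<Lambda> \<and>
     (\<forall>M\<in>fg_modules \<Lambda>. \<forall>N\<in>fg_modules \<Lambda>. \<forall>g\<in>mod_hom \<Lambda> M N. \<forall>f\<in>mod_hom \<Lambda> P N.
        g ` carrier M = carrier N \<longrightarrow>
        (\<exists>h\<in>mod_hom \<Lambda> P M. \<forall>x\<in>carrier P. g (h x) = f x))"

definition projective_cover ::
  "('a, 'r) ring_scheme \<Rightarrow> 'a fgmod \<Rightarrow> ((nat \<Rightarrow> 'a) set \<Rightarrow> (nat \<Rightarrow> 'a) set) \<Rightarrow> 'a fgmod \<Rightarrow> bool" where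
  "projective_cover \<Lambda> P \<pi> M \<longleftrightarrow> projective \<Lambda> P \<and> \<pi> \<in> mod_hom \<Lambda> P M \<and>
     \<pi> ` carrier P = carrier M \<and>
     (\<forall>H. submodule H \<Lambda> P \<longrightarrow> mod_ker P M \<pi> <+>\<^bsub>P\<^esub> H = carrier P \<longrightarrow> H = carrier P)"

text \<open>Projective covers over an Artin algebra exist and are unique up to isomorphism, so the
  choice of a cover affects the syzygy only up to isomorphism.\<close>

definition syzygy :: "('a, 'r) ring_scheme \<Rightarrow> 'a fgmod \<Rightarrow> 'a fgmod" where
  "syzygy \<Lambda> M =
     (SOME K. \<exists>P \<pi>. projective_cover \<Lambda> P \<pi> M \<and> K = P\<lparr>carrier := mod_ker P M \<pi>\<rparr>)"

definition syzygies :: "('a, 'r) ring_scheme \<Rightarrow> nat \<Rightarrow> 'a fgmod set \<Rightarrow> 'a fgmod set" where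
  "syzygies \<Lambda> t \<C> = {Y \<in> fg_modules \<Lambda>. \<exists>X\<in>\<C>. mod_iso \<Lambda> Y ((syzygy \<Lambda> ^^ t) X)}"

text \<open>The complex \<open>0 \<rightarrow> P n \<rightarrow> \<dots> \<rightarrow> P 0 \<rightarrow> M \<rightarrow> 0\<close> with augmentation \<open>d 0\<close> and differentials
  \<open>d (Suc i) : P (Suc i) \<rightarrow> P i\<close>.\<close>

definition projective_resolution ::
  "('a, 'r) ring_scheme \<Rightarrow> nat \<Rightarrow> (nat \<Rightarrow> 'a fgmod) \<Rightarrow>
     (nat \<Rightarrow> (nat \<Rightarrow> 'a) set \<Rightarrow> (nat \<Rightarrow> 'a) set) \<Rightarrow> 'a fgmod \<Rightarrow> bool" where
  "projective_resolution \<Lambda> n P d M \<longleftrightarrow>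
     (let Q = (\<lambda>i. case i of 0 \<Rightarrow> M | Suc j \<Rightarrow> P j) in
       (\<forall>i\<le>n. projective \<Lambda> (P i) \<and> d i \<in> mod_hom \<Lambda> (P i) (Q i)) \<and>
       d 0 ` carrier (P 0) = carrier M \<and>
       (\<forall>i<n. d (Suc i) ` carrier (P (Suc i)) = mod_ker (P i) (Q i) (d i)) \<and>
       inj_on (d n) (carrier (P n)))"

definition pd :: "('a, 'r) ring_scheme \<Rightarrow> 'a fgmod \<Rightarrow> enat" where
  "pd \<Lambda> M = Inf {enat n | n. \<exists>P d. projective_resolution \<Lambda> n P d M}"

definition P_fin :: "('a, 'r) ring_scheme \<Rightarrow> 'a fgmod set \<Rightarrow> 'a fgmod set" where
  "P_fin \<Lambda> \<C> = {X \<in> \<C>. pd \<Lambda> X < \<infinity>}"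

definition fin_dim :: "('a, 'r) ring_scheme \<Rightarrow> 'a fgmod set \<Rightarrow> enat" where
  "fin_dim \<Lambda> \<C> = (SUP X\<in>{X \<in> \<C>. pd \<Lambda> X < \<infinity>}. pd \<Lambda> X)"


section \<open>Igusa--Todorov functions\<close>

definition indecomposable :: "('a, 'r) ring_scheme \<Rightarrow> 'a fgmod \<Rightarrow> bool" where
  "indecomposable \<Lambda> X \<longleftrightarrow> X \<in> fg_modules \<Lambda> \<and> carrier X \<noteq> {\<zero>\<^bsub>X\<^esub>} \<and>
     (\<forall>Y\<in>fg_modules \<Lambda>. \<forall>Z\<in>fg_modules \<Lambda>. mod_iso \<Lambda> X (dsum [Y, Z]) \<longrightarrow>
        carrier Y = {\<zero>\<^bsub>Y\<^esub>} \<or> carrier Z = {\<zero>\<^bsub>Z\<^esub>})"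

definition isoclass :: "('a, 'r) ring_scheme \<Rightarrow> 'a fgmod \<Rightarrow> 'a fgmod set" where
  "isoclass \<Lambda> X = {Y \<in> fg_modules \<Lambda>. mod_iso \<Lambda> X Y}"

definition nonproj_indec :: "('a, 'r) ring_scheme \<Rightarrow> 'a fgmod set" where
  "nonproj_indec \<Lambda> = {X. indecomposable \<Lambda> X \<and> \<not> projective \<Lambda> X}"

definition IT_group :: "('a, 'r) ring_scheme \<Rightarrow> ('a fgmod set \<Rightarrow>\<^sub>0 int) monoid" where
  "IT_group \<Lambda> = free_Abelian_group (isoclass \<Lambda> ` nonproj_indec \<Lambda>)"

text \<open>The element is unique by the Krull--Schmidt theorem.\<close>

definition IT_class :: "('a, 'r) ring_scheme \<Rightarrow> 'a fgmod \<Rightarrow> 'a fgmod set \<Rightarrow>\<^sub>0 int" where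
  "IT_class \<Lambda> Y = (THE k. \<exists>Xs. (\<forall>X\<in>set Xs. indecomposable \<Lambda> X) \<and> mod_iso \<Lambda> Y (dsum Xs) \<and>
     k = (\<Sum>X\<leftarrow>Xs. if projective \<Lambda> X then 0 else frag_of (isoclass \<Lambda> X)))"

text \<open>The linear extension of \<open>[X] \<mapsto> [\<Omega> X]\<close>, computed on a representative of the isoclass.\<close>

definition IT_L ::
  "('a, 'r) ring_scheme \<Rightarrow> ('a fgmod set \<Rightarrow>\<^sub>0 int) \<Rightarrow> ('a fgmod set \<Rightarrow>\<^sub>0 int)" where
  "IT_L \<Lambda> = frag_extend (\<lambda>c. IT_class \<Lambda> (syzygy \<Lambda> (SOME X. X \<in> c)))"

definition IT_span :: "('a, 'r) ring_scheme \<Rightarrow> 'a fgmod \<Rightarrow> ('a fgmod set \<Rightarrow>\<^sub>0 int) set" where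
  "IT_span \<Lambda> X = generate (IT_group \<Lambda>)
     {frag_of (isoclass \<Lambda> Z) | Z. Z \<in> nonproj_indec \<Lambda> \<and> direct_summand \<Lambda> Z X}"

definition int_independent :: "('b \<Rightarrow>\<^sub>0 int) set \<Rightarrow> bool" where
  "int_independent B \<longleftrightarrow>
     (\<forall>c. (\<Sum>b\<in>B. frag_cmul (c b) b) = 0 \<longrightarrow> (\<forall>b\<in>B. c b = 0))"

definition int_rank :: "('b \<Rightarrow>\<^sub>0 int) set \<Rightarrow> enat" where
  "int_rank H = (SUP B\<in>{B. finite B \<and> B \<subseteq> H \<and> int_independent B}. enat (card B))"

definition IT_Phi :: "('a, 'r) ring_scheme \<Rightarrow> 'a fgmod \<Rightarrow> nat" where
  "IT_Phi \<Lambda> X = (LEAST n. \<forall>k\<ge>n.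
     int_rank ((IT_L \<Lambda> ^^ k) ` IT_span \<Lambda> X) = int_rank ((IT_L \<Lambda> ^^ (k + 1)) ` IT_span \<Lambda> X))"

definition IT_Psi :: "('a, 'r) ring_scheme \<Rightarrow> 'a fgmod \<Rightarrow> enat" where
  "IT_Psi \<Lambda> X =
     enat (IT_Phi \<Lambda> X) + fin_dim \<Lambda> (add_cl \<Lambda> {(syzygy \<Lambda> ^^ IT_Phi \<Lambda> X) X})"

definition Phi_dim :: "('a, 'r) ring_scheme \<Rightarrow> 'a fgmod set \<Rightarrow> enat" where
  "Phi_dim \<Lambda> \<C> = (SUP X\<in>\<C>. enat (IT_Phi \<Lambda> X))"

definition Psi_dim :: "('a, 'r) ring_scheme \<Rightarrow> 'a fgmod set \<Rightarrow> enat" where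
  "Psi_dim \<Lambda> \<C> = (SUP X\<in>\<C>. IT_Psi \<Lambda> X)"


section \<open>GLIT classes\<close>

definition GLIT_class :: "('a, 'r) ring_scheme \<Rightarrow> nat \<Rightarrow> 'a fgmod set \<Rightarrow> bool" where
  "GLIT_class \<Lambda> n \<C> \<longleftrightarrow>
     (\<exists>t\<ge>1. \<exists>V\<in>fg_modules \<Lambda>. \<exists>\<D>. module_class \<Lambda> \<D> \<and>
        add_cl \<Lambda> \<D> = \<D> \<and> syzygies \<Lambda> t \<D> \<subseteq> \<D> \<and> Phi_dim \<Lambda> \<D> < \<infinity> \<and>
        (\<forall>C\<in>\<C>. \<exists>V0\<in>add_cl \<Lambda> {V}. \<exists>V1\<in>add_cl \<Lambda> {V}. \<exists>D0\<in>\<D>. \<exists>D1\<in>\<D>. \<exists>f g.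
           short_exact \<Lambda> (dsum [V1, D1]) f (dsum [V0, D0]) g ((syzygy \<Lambda> ^^ n) C)))"

text \<open>"Satisfies one of the (equivalent) conditions" is read as the disjunction of the four
  conditions; their equivalence is a theorem and is not built into the definition.\<close>

definition special_GLIT_class :: "('a, 'r) ring_scheme \<Rightarrow> 'a fgmod set \<Rightarrow> bool" where
  "special_GLIT_class \<Lambda> \<C> \<longleftrightarrow>
     fin_dim \<Lambda> \<C> < \<infinity> \<or>
     GLIT_class \<Lambda> 0 (P_fin \<Lambda> \<C>) \<or>
     (\<forall>n. GLIT_class \<Lambda> n (P_fin \<Lambda> \<C>)) \<or>
     (\<exists>m \<E>. module_class \<Lambda> \<E> \<and> closed_under_sums \<Lambda> \<E> \<and> Psi_dim \<Lambda> \<E> < \<infinity> \<and>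
        (\<forall>C\<in>P_fin \<Lambda> \<C>. \<exists>E0\<in>\<E>. \<exists>E1\<in>\<E>. \<exists>f g.
           short_exact \<Lambda> E1 f E0 g ((syzygy \<Lambda> ^^ m) C)))"

definition special_GLIT_algebra :: "('a, 'r) ring_scheme \<Rightarrow> bool" where
  "special_GLIT_algebra \<Lambda> \<longleftrightarrow> special_GLIT_class \<Lambda> (fg_modules \<Lambda>)"

end

theory Submission
  imports Defs "HOL-Library.Multiset" "HOL-Library.Function_Algebras"
begin

text \<open>
  By the Krull--Schmidt theorem a module is a multiset of isoclasses of indecomposables, and a short
  exact sequence is a relation between three multisets.  If \<open>0 \<rightarrow> A \<rightarrow> B \<rightarrow> C \<rightarrow> 0\<close> is exact and
  \<open>pd C < \<infinity>\<close>, then \<open>L\<^sup>n([A] - [B]) = 0\<close> for large \<open>n\<close>.  Once this holds for some \<open>n = q\<close> that does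
  not depend on \<open>C\<close>, the non-projective parts of \<open>\<Omega>\<^sup>q A\<close> and \<open>\<Omega>\<^sup>q B\<close> agree, say with \<open>Y\<close>, and there is an
  exact sequence \<open>0 \<rightarrow> Y \<rightarrow> Y \<oplus> P \<rightarrow> W \<rightarrow> 0\<close> with \<open>P\<close> projective and \<open>W\<close> an extension of
  \<open>\<Omega>\<^sup>q C\<close> by a projective.  Fitting's lemma for the component \<open>a : Y \<rightarrow> Y\<close> replaces \<open>Y\<close> by the summand \<open>T\<close>
  on which \<open>a\<close> is nilpotent.  Iterating the embedding \<open>k\<close> times gives a cokernel filtered by copies
  of \<open>W\<close>; if \<open>a\<^sup>k = 0\<close> on \<open>T\<close>, then \<open>T\<close> is a direct summand of this cokernel.  So \<open>pd T\<close> is finite, and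
  \<open>pd C\<close> is bounded by \<open>q + 1\<close> plus any bound for the finite projective dimensions of
  indecomposable summands of \<open>Y\<close>.  For a class with finite \<open>\<Psi>\<close>-dimension take \<open>q = \<Phi>(A \<oplus> B)\<close>; for a
  GLIT class a uniform \<open>q\<close> comes from the stabilisation of the ranks of an ascending chain of
  subgroups of the finitely generated group \<open>\<langle>V\<rangle>\<close>.
\<close>

text \<open>One direction is a disjunct of the definition, and the third condition contains the
  second at n = 0, so two bounds have to be proved. In both, finiteness of pd C, without control of
  its size, does two things: some power of L kills [A] - [B], and the cokernel filtered by copies of
  W, hence T, has finite projective dimension. The size enters only through the bound for the
  indecomposable summands of T, and 0 \<rightarrow> T \<rightarrow> T \<oplus> P \<rightarrow> W
  \<rightarrow> 0 then costs one unit. T is a summand of the cokernel because the k-fold embedding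
  of Y has component a^k in Y: the projection to Y modulo the image of a^k kills it and so factors
  through the cokernel. For a GLIT class the differences of classes from \<D> may have infinite
  rank, and there only the bounded \<Phi> helps; \<langle>V\<rangle> has finite rank, but its
  elements satisfy no relation by themselves. The subgroups of \<langle>V\<rangle> separate the two
  parts. Equal ranks give membership only up to a nonzero multiple, which is cancelled because the
  free group is torsion free.\<close>

locale left_modules = ring L for L :: "('a, 'r) ring_scheme" (structure)
begin

text \<open>The locale \<open>left_module\<close> fixes a single module. Here only the ring is fixed
  and \<open>lm\<close> is a predicate, so modules on different element types can occur in one
  statement.\<close>

abbreviation lm :: "('a, 'm) module \<Rightarrow> bool" where "lm M \<equiv> left_module L M"
abbreviation hom :: "('a, 'm) module \<Rightarrow> ('a, 'n) module \<Rightarrow> ('m \<Rightarrow> 'n) set" where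
  "hom M N \<equiv> mod_hom L M N"
abbreviation submod :: "'m set \<Rightarrow> ('a, 'm) module \<Rightarrow> bool" where "submod H M \<equiv> submodule H L M"

section \<open>Arithmetic in modules\<close>

lemma lm_group: "lm M \<Longrightarrow> abelian_group M"
  by (simp add: left_module_def)

lemma lm_closed [simp]:
  "lm M \<Longrightarrow> \<zero>\<^bsub>M\<^esub> \<in> carrier M"
  "lm M \<Longrightarrow> x \<in> carrier M \<Longrightarrow> y \<in> carrier M \<Longrightarrow> x \<oplus>\<^bsub>M\<^esub> y \<in> carrier M"
  "lm M \<Longrightarrow> x \<in> carrier M \<Longrightarrow> \<ominus>\<^bsub>M\<^esub> x \<in> carrier M"
  "lm M \<Longrightarrow> a \<in> carrier L \<Longrightarrow> x \<in> carrier M \<Longrightarrow> a \<odot>\<^bsub>M\<^esub> x \<in> carrier M"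
  using lm_group left_module.smult_closed abelian_groupE abelian_group.a_inv_closed
  by (metis)+

lemma lm_simps [simp]:
  assumes "lm M"
  shows "x \<in> carrier M \<Longrightarrow> \<zero>\<^bsub>M\<^esub> \<oplus>\<^bsub>M\<^esub> x = x"
    and "x \<in> carrier M \<Longrightarrow> x \<oplus>\<^bsub>M\<^esub> \<zero>\<^bsub>M\<^esub> = x"
    and "x \<in> carrier M \<Longrightarrow> \<ominus>\<^bsub>M\<^esub> x \<oplus>\<^bsub>M\<^esub> x = \<zero>\<^bsub>M\<^esub>"
    and "x \<in> carrier M \<Longrightarrow> x \<oplus>\<^bsub>M\<^esub> \<ominus>\<^bsub>M\<^esub> x = \<zero>\<^bsub>M\<^esub>"
    and "x \<in> carrier M \<Longrightarrow> y \<in> carrier M \<Longrightarrow> \<ominus>\<^bsub>M\<^esub> x \<oplus>\<^bsub>M\<^esub> (x \<oplus>\<^bsub>M\<^esub> y) = y"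
    and "x \<in> carrier M \<Longrightarrow> y \<in> carrier M \<Longrightarrow> x \<oplus>\<^bsub>M\<^esub> (\<ominus>\<^bsub>M\<^esub> x \<oplus>\<^bsub>M\<^esub> y) = y"
    and "x \<in> carrier M \<Longrightarrow> \<ominus>\<^bsub>M\<^esub> (\<ominus>\<^bsub>M\<^esub> x) = x"
    and "\<ominus>\<^bsub>M\<^esub> \<zero>\<^bsub>M\<^esub> = \<zero>\<^bsub>M\<^esub>"
    and "x \<in> carrier M \<Longrightarrow> \<one> \<odot>\<^bsub>M\<^esub> x = x"
proof -
  interpret M: left_module L M by fact
  show "x \<in> carrier M \<Longrightarrow> \<zero>\<^bsub>M\<^esub> \<oplus>\<^bsub>M\<^esub> x = x"
    and "x \<in> carrier M \<Longrightarrow> x \<oplus>\<^bsub>M\<^esub> \<zero>\<^bsub>M\<^esub> = x"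
    and "x \<in> carrier M \<Longrightarrow> \<ominus>\<^bsub>M\<^esub> x \<oplus>\<^bsub>M\<^esub> x = \<zero>\<^bsub>M\<^esub>"
    and "x \<in> carrier M \<Longrightarrow> x \<oplus>\<^bsub>M\<^esub> \<ominus>\<^bsub>M\<^esub> x = \<zero>\<^bsub>M\<^esub>"
    and "x \<in> carrier M \<Longrightarrow> y \<in> carrier M \<Longrightarrow> \<ominus>\<^bsub>M\<^esub> x \<oplus>\<^bsub>M\<^esub> (x \<oplus>\<^bsub>M\<^esub> y) = y"
    and "x \<in> carrier M \<Longrightarrow> y \<in> carrier M \<Longrightarrow> x \<oplus>\<^bsub>M\<^esub> (\<ominus>\<^bsub>M\<^esub> x \<oplus>\<^bsub>M\<^esub> y) = y"
    and "x \<in> carrier M \<Longrightarrow> \<ominus>\<^bsub>M\<^esub> (\<ominus>\<^bsub>M\<^esub> x) = x"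
    and "\<ominus>\<^bsub>M\<^esub> \<zero>\<^bsub>M\<^esub> = \<zero>\<^bsub>M\<^esub>"
    and "x \<in> carrier M \<Longrightarrow> \<one> \<odot>\<^bsub>M\<^esub> x = x"
    by (auto simp: M.M.l_neg M.M.r_neg M.M.r_neg1 M.M.r_neg2)
qed

lemma lm_ac:
  assumes "lm M"
  shows "x \<in> carrier M \<Longrightarrow> y \<in> carrier M \<Longrightarrow> z \<in> carrier M \<Longrightarrow>
      x \<oplus>\<^bsub>M\<^esub> y \<oplus>\<^bsub>M\<^esub> z = x \<oplus>\<^bsub>M\<^esub> (y \<oplus>\<^bsub>M\<^esub> z)"
    and "x \<in> carrier M \<Longrightarrow> y \<in> carrier M \<Longrightarrow> x \<oplus>\<^bsub>M\<^esub> y = y \<oplus>\<^bsub>M\<^esub> x"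
    and "x \<in> carrier M \<Longrightarrow> y \<in> carrier M \<Longrightarrow> z \<in> carrier M \<Longrightarrow>
      x \<oplus>\<^bsub>M\<^esub> (y \<oplus>\<^bsub>M\<^esub> z) = y \<oplus>\<^bsub>M\<^esub> (x \<oplus>\<^bsub>M\<^esub> z)"
    and "x \<in> carrier M \<Longrightarrow> y \<in> carrier M \<Longrightarrow> \<ominus>\<^bsub>M\<^esub> (x \<oplus>\<^bsub>M\<^esub> y) = \<ominus>\<^bsub>M\<^esub> x \<oplus>\<^bsub>M\<^esub> \<ominus>\<^bsub>M\<^esub> y"
proof -
  interpret M: left_module L M by fact
  show "x \<in> carrier M \<Longrightarrow> y \<in> carrier M \<Longrightarrow> z \<in> carrier M \<Longrightarrow>
      x \<oplus>\<^bsub>M\<^esub> y \<oplus>\<^bsub>M\<^esub> z = x \<oplus>\<^bsub>M\<^esub> (y \<oplus>\<^bsub>M\<^esub> z)"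
    and "x \<in> carrier M \<Longrightarrow> y \<in> carrier M \<Longrightarrow> x \<oplus>\<^bsub>M\<^esub> y = y \<oplus>\<^bsub>M\<^esub> x"
    and "x \<in> carrier M \<Longrightarrow> y \<in> carrier M \<Longrightarrow> z \<in> carrier M \<Longrightarrow>
      x \<oplus>\<^bsub>M\<^esub> (y \<oplus>\<^bsub>M\<^esub> z) = y \<oplus>\<^bsub>M\<^esub> (x \<oplus>\<^bsub>M\<^esub> z)"
    and "x \<in> carrier M \<Longrightarrow> y \<in> carrier M \<Longrightarrow> \<ominus>\<^bsub>M\<^esub> (x \<oplus>\<^bsub>M\<^esub> y) = \<ominus>\<^bsub>M\<^esub> x \<oplus>\<^bsub>M\<^esub> \<ominus>\<^bsub>M\<^esub> y"
    by (auto simp: M.M.a_ac M.M.minus_add)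
qed

lemma smult_add:
  assumes "lm M" "a \<in> carrier L" "x \<in> carrier M" "y \<in> carrier M"
  shows "a \<odot>\<^bsub>M\<^esub> (x \<oplus>\<^bsub>M\<^esub> y) = a \<odot>\<^bsub>M\<^esub> x \<oplus>\<^bsub>M\<^esub> a \<odot>\<^bsub>M\<^esub> y"
  by (rule left_module.smult_r_distr[OF assms])

lemma add_smult:
  assumes "lm M" "a \<in> carrier L" "b \<in> carrier L" "x \<in> carrier M"
  shows "(a \<oplus> b) \<odot>\<^bsub>M\<^esub> x = a \<odot>\<^bsub>M\<^esub> x \<oplus>\<^bsub>M\<^esub> b \<odot>\<^bsub>M\<^esub> x"
  by (rule left_module.smult_l_distr[OF assms])

lemma mult_smult:
  assumes "lm M" "a \<in> carrier L" "b \<in> carrier L" "x \<in> carrier M"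
  shows "(a \<otimes> b) \<odot>\<^bsub>M\<^esub> x = a \<odot>\<^bsub>M\<^esub> (b \<odot>\<^bsub>M\<^esub> x)"
  by (rule left_module.smult_assoc1[OF assms])

lemma lm_add_eq_0:
  assumes "lm M" "x \<in> carrier M" "y \<in> carrier M" "x \<oplus>\<^bsub>M\<^esub> y = x"
  shows "y = \<zero>\<^bsub>M\<^esub>"
  using assms lm_simps(5)[OF assms(1-3)] by simp

lemma smult_zero [simp]:
  assumes "lm M"
  shows "a \<in> carrier L \<Longrightarrow> a \<odot>\<^bsub>M\<^esub> \<zero>\<^bsub>M\<^esub> = \<zero>\<^bsub>M\<^esub>" and "x \<in> carrier M \<Longrightarrow> \<zero> \<odot>\<^bsub>M\<^esub> x = \<zero>\<^bsub>M\<^esub>"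
proof -
  show "a \<odot>\<^bsub>M\<^esub> \<zero>\<^bsub>M\<^esub> = \<zero>\<^bsub>M\<^esub>" if "a \<in> carrier L"
    using smult_add[OF assms that, of "\<zero>\<^bsub>M\<^esub>" "\<zero>\<^bsub>M\<^esub>"] that assms
      lm_add_eq_0[OF assms, of "a \<odot>\<^bsub>M\<^esub> \<zero>\<^bsub>M\<^esub>" "a \<odot>\<^bsub>M\<^esub> \<zero>\<^bsub>M\<^esub>"] by simp
  show "\<zero> \<odot>\<^bsub>M\<^esub> x = \<zero>\<^bsub>M\<^esub>" if "x \<in> carrier M"
    using add_smult[OF assms zero_closed zero_closed that] that assms
      lm_add_eq_0[OF assms, of "\<zero> \<odot>\<^bsub>M\<^esub> x" "\<zero> \<odot>\<^bsub>M\<^esub> x"] by simp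
qed

lemma lm_neg_unique:
  assumes "lm M" "x \<in> carrier M" "y \<in> carrier M" "x \<oplus>\<^bsub>M\<^esub> y = \<zero>\<^bsub>M\<^esub>"
  shows "y = \<ominus>\<^bsub>M\<^esub> x"
  using assms lm_simps(2,5) lm_closed(3) by metis

lemma smult_neg:
  assumes "lm M" "a \<in> carrier L" "x \<in> carrier M"
  shows "a \<odot>\<^bsub>M\<^esub> (\<ominus>\<^bsub>M\<^esub> x) = \<ominus>\<^bsub>M\<^esub> (a \<odot>\<^bsub>M\<^esub> x)"
  using assms smult_add[of M a x "\<ominus>\<^bsub>M\<^esub> x"]
  by (intro lm_neg_unique) auto

lemma neg_smult:
  assumes "lm M" "a \<in> carrier L" "x \<in> carrier M"
  shows "(\<ominus> a) \<odot>\<^bsub>M\<^esub> x = \<ominus>\<^bsub>M\<^esub> (a \<odot>\<^bsub>M\<^esub> x)"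
  using assms add_smult[of M a "\<ominus> a" x]
  by (intro lm_neg_unique) (auto simp: r_neg)

lemma lm_diff_eq_0:
  assumes "lm M" "x \<in> carrier M" "y \<in> carrier M" "x \<oplus>\<^bsub>M\<^esub> \<ominus>\<^bsub>M\<^esub> y = \<zero>\<^bsub>M\<^esub>"
  shows "x = y"
  using lm_neg_unique[OF assms(1) _ _ assms(4)] assms by (metis lm_closed(3) lm_simps(7))

lemma left_moduleI:
  assumes closed: "\<And>x y. x \<in> carrier M \<Longrightarrow> y \<in> carrier M \<Longrightarrow> x \<oplus>\<^bsub>M\<^esub> y \<in> carrier M"
    and zero: "\<zero>\<^bsub>M\<^esub> \<in> carrier M"
    and smult: "\<And>a x. a \<in> carrier L \<Longrightarrow> x \<in> carrier M \<Longrightarrow> a \<odot>\<^bsub>M\<^esub> x \<in> carrier M"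
    and assoc: "\<And>x y z. x \<in> carrier M \<Longrightarrow> y \<in> carrier M \<Longrightarrow> z \<in> carrier M \<Longrightarrow>
      x \<oplus>\<^bsub>M\<^esub> y \<oplus>\<^bsub>M\<^esub> z = x \<oplus>\<^bsub>M\<^esub> (y \<oplus>\<^bsub>M\<^esub> z)"
    and comm: "\<And>x y. x \<in> carrier M \<Longrightarrow> y \<in> carrier M \<Longrightarrow> x \<oplus>\<^bsub>M\<^esub> y = y \<oplus>\<^bsub>M\<^esub> x"
    and l_zero: "\<And>x. x \<in> carrier M \<Longrightarrow> \<zero>\<^bsub>M\<^esub> \<oplus>\<^bsub>M\<^esub> x = x"
    and inverse: "\<And>x. x \<in> carrier M \<Longrightarrow> \<exists>y\<in>carrier M. y \<oplus>\<^bsub>M\<^esub> x = \<zero>\<^bsub>M\<^esub>"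
    and "\<And>a x y. a \<in> carrier L \<Longrightarrow> x \<in> carrier M \<Longrightarrow> y \<in> carrier M \<Longrightarrow>
      a \<odot>\<^bsub>M\<^esub> (x \<oplus>\<^bsub>M\<^esub> y) = a \<odot>\<^bsub>M\<^esub> x \<oplus>\<^bsub>M\<^esub> a \<odot>\<^bsub>M\<^esub> y"
    and "\<And>a b x. a \<in> carrier L \<Longrightarrow> b \<in> carrier L \<Longrightarrow> x \<in> carrier M \<Longrightarrow>
      (a \<oplus> b) \<odot>\<^bsub>M\<^esub> x = a \<odot>\<^bsub>M\<^esub> x \<oplus>\<^bsub>M\<^esub> b \<odot>\<^bsub>M\<^esub> x"
    and "\<And>a b x. a \<in> carrier L \<Longrightarrow> b \<in> carrier L \<Longrightarrow> x \<in> carrier M \<Longrightarrow>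
      (a \<otimes> b) \<odot>\<^bsub>M\<^esub> x = a \<odot>\<^bsub>M\<^esub> (b \<odot>\<^bsub>M\<^esub> x)"
    and "\<And>x. x \<in> carrier M \<Longrightarrow> \<one> \<odot>\<^bsub>M\<^esub> x = x"
  shows "lm M"
proof -
  have "abelian_group M"
    by (rule abelian_groupI) (use assms in auto)
  then show ?thesis
    using assms by (intro left_module.intro left_module_axioms.intro ring_axioms) auto
qed


subsection \<open>Submodules\<close>

lemma submodI:
  assumes "lm M" "H \<subseteq> carrier M" "\<zero>\<^bsub>M\<^esub> \<in> H"
    and "\<And>x y. x \<in> H \<Longrightarrow> y \<in> H \<Longrightarrow> x \<oplus>\<^bsub>M\<^esub> y \<in> H"
    and "\<And>a x. a \<in> carrier L \<Longrightarrow> x \<in> H \<Longrightarrow> a \<odot>\<^bsub>M\<^esub> x \<in> H"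
  shows "submod H M"
proof -
  have "\<ominus>\<^bsub>M\<^esub> x \<in> H" if "x \<in> H" for x
  proof -
    have "(\<ominus> \<one>) \<odot>\<^bsub>M\<^esub> x = \<ominus>\<^bsub>M\<^esub> x" using that assms neg_smult[of M \<one> x] by auto
    then show ?thesis using assms(5)[OF _ that, of "\<ominus> \<one>"] by simp
  qed
  then show ?thesis
    using assms by (intro submodule.intro subgroup.intro submodule_axioms.intro) (auto simp: a_inv_def)
qed

lemma submodD:
  assumes "submod H M"
  shows "H \<subseteq> carrier M" and "x \<in> H \<Longrightarrow> x \<in> carrier M" and "\<zero>\<^bsub>M\<^esub> \<in> H"
    and "x \<in> H \<Longrightarrow> y \<in> H \<Longrightarrow> x \<oplus>\<^bsub>M\<^esub> y \<in> H"
    and "a \<in> carrier L \<Longrightarrow> x \<in> H \<Longrightarrow> a \<odot>\<^bsub>M\<^esub> x \<in> H"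
    and "x \<in> H \<Longrightarrow> \<ominus>\<^bsub>M\<^esub> x \<in> H"
  using submodule.axioms(1)[OF assms] submodule.smult_closed[OF assms]
    subgroup.subset subgroup.m_closed subgroup.one_closed subgroup.m_inv_closed
  by (fastforce simp: a_inv_def)+

abbreviation restr :: "('a, 'm) module \<Rightarrow> 'm set \<Rightarrow> ('a, 'm) module" where
  "restr M H \<equiv> M\<lparr>carrier := H\<rparr>"

lemma submod_carrier: "lm M \<Longrightarrow> submod (carrier M) M"
  by (intro submodI) auto

lemma submod_zero: "lm M \<Longrightarrow> submod {\<zero>\<^bsub>M\<^esub>} M"
  by (intro submodI) auto

lemma restr_lm:
  assumes "lm M" "submod H M"
  shows "lm (restr M H)"
proof (intro left_moduleI)
  fix x assume "x \<in> carrier (restr M H)"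
  then show "\<exists>y\<in>carrier (restr M H). y \<oplus>\<^bsub>restr M H\<^esub> x = \<zero>\<^bsub>restr M H\<^esub>"
    using submodD[OF assms(2)] assms(1) by (intro bexI[of _ "\<ominus>\<^bsub>M\<^esub> x"]) auto
qed (use submodD[OF assms(2)] assms(1) in \<open>auto simp: lm_ac smult_add add_smult mult_smult\<close>)

lemma submod_restr:
  assumes "lm M" "submod H M"
  shows "submod K (restr M H) \<longleftrightarrow> submod K M \<and> K \<subseteq> H"
proof
  assume K: "submod K (restr M H)"
  show "submod K M \<and> K \<subseteq> H"
    using submodD[OF K] submodD[OF assms(2)] assms(1) by (auto intro!: submodI)
next
  assume K: "submod K M \<and> K \<subseteq> H"
  then show "submod K (restr M H)"
    using submodD[of K M] restr_lm[OF assms] by (intro submodI) auto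
qed

lemma submod_Int: "lm M \<Longrightarrow> submod H M \<Longrightarrow> submod K M \<Longrightarrow> submod (H \<inter> K) M"
  using submodD[of H M] submodD[of K M] by (intro submodI) auto


subsection \<open>Homomorphisms\<close>

lemma homI:
  assumes "\<And>x. x \<in> carrier M \<Longrightarrow> f x \<in> carrier N"
    and "\<And>x y. x \<in> carrier M \<Longrightarrow> y \<in> carrier M \<Longrightarrow> f (x \<oplus>\<^bsub>M\<^esub> y) = f x \<oplus>\<^bsub>N\<^esub> f y"
    and "\<And>a x. a \<in> carrier L \<Longrightarrow> x \<in> carrier M \<Longrightarrow> f (a \<odot>\<^bsub>M\<^esub> x) = a \<odot>\<^bsub>N\<^esub> f x"
  shows "f \<in> hom M N"
  using assms by (auto simp: mod_hom_def)

lemma homD: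
  assumes "f \<in> hom M N"
  shows "x \<in> carrier M \<Longrightarrow> f x \<in> carrier N"
    and "x \<in> carrier M \<Longrightarrow> y \<in> carrier M \<Longrightarrow> f (x \<oplus>\<^bsub>M\<^esub> y) = f x \<oplus>\<^bsub>N\<^esub> f y"
    and "a \<in> carrier L \<Longrightarrow> x \<in> carrier M \<Longrightarrow> f (a \<odot>\<^bsub>M\<^esub> x) = a \<odot>\<^bsub>N\<^esub> f x"
  using assms by (auto simp: mod_hom_def)

lemma hom_zero:
  assumes "lm M" "lm N" "f \<in> hom M N"
  shows "f \<zero>\<^bsub>M\<^esub> = \<zero>\<^bsub>N\<^esub>"
  using homD(2)[OF assms(3), of "\<zero>\<^bsub>M\<^esub>" "\<zero>\<^bsub>M\<^esub>"] homD(1)[OF assms(3)] assms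
    lm_add_eq_0[of N "f \<zero>\<^bsub>M\<^esub>" "f \<zero>\<^bsub>M\<^esub>"] by simp

lemma hom_neg:
  assumes "lm M" "lm N" "f \<in> hom M N" "x \<in> carrier M"
  shows "f (\<ominus>\<^bsub>M\<^esub> x) = \<ominus>\<^bsub>N\<^esub> f x"
  using homD(1,2)[OF assms(3)] assms hom_zero[OF assms(1-3)]
  by (intro lm_neg_unique) (auto simp flip: homD(2)[OF assms(3)])

lemma hom_comp: "f \<in> hom M N \<Longrightarrow> g \<in> hom N K \<Longrightarrow> (\<lambda>x. g (f x)) \<in> hom M K"
  by (auto simp: mod_hom_def Pi_iff)

lemma hom_id: "(\<lambda>x. x) \<in> hom M M"
  by (auto simp: mod_hom_def)

lemma hom_funpow: "f \<in> hom M M \<Longrightarrow> (f ^^ n) \<in> hom M M"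
proof (induction n)
  case 0
  then show ?case by (auto simp: mod_hom_def)
next
  case (Suc n)
  then show ?case using hom_comp[of "f ^^ n" M M f M] by (simp add: comp_def)
qed

lemma hom_incl: "H \<subseteq> carrier M \<Longrightarrow> (\<lambda>x. x) \<in> hom (restr M H) M"
  by (auto simp: mod_hom_def)

lemma hom_restr_dom: "f \<in> hom M N \<Longrightarrow> H \<subseteq> carrier M \<Longrightarrow> f \<in> hom (restr M H) N"
  by (auto simp: mod_hom_def Pi_iff subset_iff)

lemma hom_restr_cod: "f \<in> hom M N \<Longrightarrow> f ` carrier M \<subseteq> H \<Longrightarrow> f \<in> hom M (restr N H)"
  by (auto simp: mod_hom_def Pi_iff subset_iff)

lemma hom_zero_map: "lm N \<Longrightarrow> (\<lambda>x. \<zero>\<^bsub>N\<^esub>) \<in> hom M N"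
  by (auto intro!: homI)

lemma hom_add:
  assumes "lm N" "f \<in> hom M N" "g \<in> hom M N"
  shows "(\<lambda>x. f x \<oplus>\<^bsub>N\<^esub> g x) \<in> hom M N"
  using assms(1) homD[OF assms(2)] homD[OF assms(3)]
  by (auto intro!: homI simp: smult_add lm_ac)

lemma hom_uminus:
  assumes "lm N" "f \<in> hom M N"
  shows "(\<lambda>x. \<ominus>\<^bsub>N\<^esub> f x) \<in> hom M N"
  using assms(1) homD[OF assms(2)]
  by (auto intro!: homI simp: smult_neg lm_ac)

lemma hom_inv_into:
  assumes "lm M" "f \<in> hom M N" "bij_betw f (carrier M) (carrier N)"
  shows "inv_into (carrier M) f \<in> hom N M"
proof -
  have inj: "inj_on f (carrier M)" and N: "carrier N = f ` carrier M"
    using assms(3) by (auto simp: bij_betw_def)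
  show ?thesis
    unfolding mod_hom_def N using assms(1) inj
    by (auto simp flip: homD(2,3)[OF assms(2)])
qed

lemma image_submod:
  assumes "lm M" "lm N" "f \<in> hom M N" "submod H M"
  shows "submod (f ` H) N"
proof (rule submodI)
  note H = submodD[OF assms(4)] and f = homD[OF assms(3)]
  show "f ` H \<subseteq> carrier N" using H f by auto
  show "\<zero>\<^bsub>N\<^esub> \<in> f ` H" using H(3) hom_zero[OF assms(1-3)] by (metis image_eqI)
  show "x \<oplus>\<^bsub>N\<^esub> y \<in> f ` H" if "x \<in> f ` H" "y \<in> f ` H" for x y
    using that H(2,4) by (auto simp flip: f(2))
  show "a \<odot>\<^bsub>N\<^esub> x \<in> f ` H" if "a \<in> carrier L" "x \<in> f ` H" for a x
    using that H(2,5) by (auto simp flip: f(3))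
qed fact

lemma vimage_submod:
  assumes "lm M" "lm N" "f \<in> hom M N" "submod H N"
  shows "submod {x \<in> carrier M. f x \<in> H} M"
  using assms(1) submodD[OF assms(4)] homD[OF assms(3)] hom_zero[OF assms(1-3)]
  by (intro submodI) auto

lemma ker_submod:
  assumes "lm M" "lm N" "f \<in> hom M N"
  shows "submod (mod_ker M N f) M"
  using vimage_submod[OF assms submod_zero[OF assms(2)]] by (simp add: mod_ker_def)

lemma hom_injI:
  assumes "lm M" "lm N" "f \<in> hom M N" "\<And>x. x \<in> carrier M \<Longrightarrow> f x = \<zero>\<^bsub>N\<^esub> \<Longrightarrow> x = \<zero>\<^bsub>M\<^esub>"
  shows "inj_on f (carrier M)"
proof (rule inj_onI)
  fix x y assume *: "x \<in> carrier M" "y \<in> carrier M" "f x = f y"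
  then have "f (x \<oplus>\<^bsub>M\<^esub> \<ominus>\<^bsub>M\<^esub> y) = \<zero>\<^bsub>N\<^esub>"
    using homD[OF assms(3)] assms hom_neg[OF assms(1-3)] by auto
  then show "x = y" using * assms lm_diff_eq_0 by (metis lm_closed(2,3))
qed

lemma hom_inj_zero:
  assumes "lm M" "lm N" "f \<in> hom M N" "inj_on f (carrier M)" "x \<in> carrier M" "f x = \<zero>\<^bsub>N\<^esub>"
  shows "x = \<zero>\<^bsub>M\<^esub>"
  using assms hom_zero[OF assms(1-3)] by (metis inj_onD lm_closed(1))

lemma mod_iso_refl: "mod_iso L M M"
  unfolding mod_iso_def using hom_id[of M] by (metis bij_betw_def image_ident inj_on_id2)

lemma mod_iso_sym: "lm M \<Longrightarrow> mod_iso L M N \<Longrightarrow> mod_iso L N M"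
  unfolding mod_iso_def using hom_inv_into bij_betw_inv_into by metis

lemma mod_iso_trans: "mod_iso L M N \<Longrightarrow> mod_iso L N K \<Longrightarrow> mod_iso L M K"
proof -
  assume "mod_iso L M N" "mod_iso L N K"
  then obtain f g where "f \<in> hom M N" "bij_betw f (carrier M) (carrier N)"
      "g \<in> hom N K" "bij_betw g (carrier N) (carrier K)"
    by (auto simp: mod_iso_def)
  then show ?thesis unfolding mod_iso_def
    using hom_comp[of f M N g K] bij_betw_trans[of f _ _ g] by (auto simp: comp_def)
qed


subsection \<open>Direct sums\<close>

text \<open>A direct sum is described by injections and projections and not by a carrier of pairs,
  so the three modules may have different element types, and every isomorphic copy of a direct sum
  qualifies.\<close>

definition biprod where
  "biprod M A B i j p q \<longleftrightarrow> i \<in> hom A M \<and> j \<in> hom B M \<and> p \<in> hom M A \<and> q \<in> hom M B \<and>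
     (\<forall>a\<in>carrier A. p (i a) = a \<and> q (i a) = \<zero>\<^bsub>B\<^esub>) \<and>
     (\<forall>b\<in>carrier B. q (j b) = b \<and> p (j b) = \<zero>\<^bsub>A\<^esub>) \<and>
     (\<forall>m\<in>carrier M. i (p m) \<oplus>\<^bsub>M\<^esub> j (q m) = m)"

lemma biprodD:
  assumes "biprod M A B i j p q"
  shows "i \<in> hom A M" "j \<in> hom B M" "p \<in> hom M A" "q \<in> hom M B"
    and "a \<in> carrier A \<Longrightarrow> p (i a) = a" and "a \<in> carrier A \<Longrightarrow> q (i a) = \<zero>\<^bsub>B\<^esub>"
    and "b \<in> carrier B \<Longrightarrow> q (j b) = b" and "b \<in> carrier B \<Longrightarrow> p (j b) = \<zero>\<^bsub>A\<^esub>"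
    and "m \<in> carrier M \<Longrightarrow> i (p m) \<oplus>\<^bsub>M\<^esub> j (q m) = m"
    and "a \<in> carrier A \<Longrightarrow> i a \<in> carrier M" and "b \<in> carrier B \<Longrightarrow> j b \<in> carrier M"
    and "m \<in> carrier M \<Longrightarrow> p m \<in> carrier A" and "m \<in> carrier M \<Longrightarrow> q m \<in> carrier B"
  using assms by (auto simp: biprod_def mod_hom_def)

definition bsum where
  "bsum M A B \<longleftrightarrow> (\<exists>i j p q. biprod M A B i j p q)"

lemma bsumI: "biprod M A B i j p q \<Longrightarrow> bsum M A B"
  by (auto simp: bsum_def)

lemma bsum_comm: "lm M \<Longrightarrow> bsum M A B \<Longrightarrow> bsum M B A"
proof -
  assume "lm M" "bsum M A B"
  then obtain i j p q where b: "biprod M A B i j p q" by (auto simp: bsum_def)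
  note bD = biprodD[OF b]
  have "biprod M B A j i q p"
    unfolding biprod_def using bD(1-9) lm_ac(2)[OF \<open>lm M\<close> bD(10) bD(11)] bD(12,13) by auto
  then show ?thesis by (rule bsumI)
qed

lemma mod_iso_pair:
  assumes "lm M" "mod_iso L M N"
  obtains f g where "f \<in> hom M N" "g \<in> hom N M"
    "\<And>x. x \<in> carrier M \<Longrightarrow> f x \<in> carrier N" "\<And>x. x \<in> carrier N \<Longrightarrow> g x \<in> carrier M"
    "\<And>x. x \<in> carrier M \<Longrightarrow> g (f x) = x" "\<And>y. y \<in> carrier N \<Longrightarrow> f (g y) = y"
proof -
  obtain f where f: "f \<in> hom M N" "bij_betw f (carrier M) (carrier N)"
    using assms(2) by (auto simp: mod_iso_def)
  show thesis
  proof (rule that[of f "inv_into (carrier M) f"])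
    show "inv_into (carrier M) f \<in> hom N M" by (rule hom_inv_into[OF assms(1) f])
    then show "x \<in> carrier N \<Longrightarrow> inv_into (carrier M) f x \<in> carrier M" for x by (rule homD(1))
  qed (use f bij_betw_inv_into_left[OF f(2)] bij_betw_inv_into_right[OF f(2)] homD(1)[OF f(1)] in auto)
qed

lemma mod_isoI:
  assumes "f \<in> hom M N" "g \<in> hom N M"
    and "\<And>x. x \<in> carrier M \<Longrightarrow> g (f x) = x" "\<And>y. y \<in> carrier N \<Longrightarrow> f (g y) = y"
  shows "mod_iso L M N"
  unfolding mod_iso_def using assms homD(1)[OF assms(1)] homD(1)[OF assms(2)]
  by (intro bexI[of _ f] bij_betw_byWitness[of _ g]) auto

lemma bsum_iso:
  assumes lm: "lm M" "lm A" "lm B" "lm A'" "lm B'"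
    and M: "mod_iso L M M'" and A: "mod_iso L A A'" and B: "mod_iso L B B'" and s: "bsum M A B"
  shows "bsum M' A' B'"
proof -
  obtain i j p q where b: "biprod M A B i j p q" using s by (auto simp: bsum_def)
  note bD = biprodD[OF b]
  obtain f f' where f: "f \<in> hom M M'" "f' \<in> hom M' M"
    "\<And>x. x \<in> carrier M \<Longrightarrow> f x \<in> carrier M'" "\<And>x. x \<in> carrier M' \<Longrightarrow> f' x \<in> carrier M"
    "\<And>x. x \<in> carrier M \<Longrightarrow> f' (f x) = x" "\<And>y. y \<in> carrier M' \<Longrightarrow> f (f' y) = y"
    using mod_iso_pair[OF lm(1) M] by blast
  obtain g g' where g: "g \<in> hom A A'" "g' \<in> hom A' A"
    "\<And>x. x \<in> carrier A \<Longrightarrow> g x \<in> carrier A'" "\<And>x. x \<in> carrier A' \<Longrightarrow> g' x \<in> carrier A"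
    "\<And>x. x \<in> carrier A \<Longrightarrow> g' (g x) = x" "\<And>y. y \<in> carrier A' \<Longrightarrow> g (g' y) = y"
    using mod_iso_pair[OF lm(2) A] by blast
  obtain h h' where h: "h \<in> hom B B'" "h' \<in> hom B' B"
    "\<And>x. x \<in> carrier B \<Longrightarrow> h x \<in> carrier B'" "\<And>x. x \<in> carrier B' \<Longrightarrow> h' x \<in> carrier B"
    "\<And>x. x \<in> carrier B \<Longrightarrow> h' (h x) = x" "\<And>y. y \<in> carrier B' \<Longrightarrow> h (h' y) = y"
    using mod_iso_pair[OF lm(3) B] by blast
  have z: "g \<zero>\<^bsub>A\<^esub> = \<zero>\<^bsub>A'\<^esub>" "h \<zero>\<^bsub>B\<^esub> = \<zero>\<^bsub>B'\<^esub>"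
    using hom_zero lm g(1) h(1) by blast+
  have "biprod M' A' B' (\<lambda>x. f (i (g' x))) (\<lambda>x. f (j (h' x))) (\<lambda>x. g (p (f' x))) (\<lambda>x. h (q (f' x)))"
    unfolding biprod_def
    using hom_comp[OF hom_comp[OF g(2) bD(1)] f(1)] hom_comp[OF hom_comp[OF h(2) bD(2)] f(1)]
      hom_comp[OF hom_comp[OF f(2) bD(3)] g(1)] hom_comp[OF hom_comp[OF f(2) bD(4)] h(1)]
    by (simp add: bD f(3-6) g(3-6) h(3-6) z flip: homD(2)[OF f(1)])
  then show ?thesis by (rule bsumI)
qed

lemma bsum_unique:
  assumes lm: "lm M" "lm M'" "lm A" "lm B" and "bsum M A B" "bsum M' A B"
  shows "mod_iso L M M'"
proof -
  obtain i j p q where b: "biprod M A B i j p q" using assms by (auto simp: bsum_def)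
  obtain i' j' p' q' where b': "biprod M' A B i' j' p' q'" using assms by (auto simp: bsum_def)
  note D = biprodD[OF b] and D' = biprodD[OF b']
  show ?thesis
  proof (rule mod_isoI)
    show "(\<lambda>m. i' (p m) \<oplus>\<^bsub>M'\<^esub> j' (q m)) \<in> hom M M'"
      by (intro hom_add lm hom_comp[OF D(3) D'(1)] hom_comp[OF D(4) D'(2)])
    show "(\<lambda>m. i (p' m) \<oplus>\<^bsub>M\<^esub> j (q' m)) \<in> hom M' M"
      by (intro hom_add lm hom_comp[OF D'(3) D(1)] hom_comp[OF D'(4) D(2)])
  qed (use lm in \<open>simp_all add: D D' homD(2)[OF D(3)] homD(2)[OF D(4)]
    homD(2)[OF D'(3)] homD(2)[OF D'(4)]\<close>)
qed

lemma bsum_assoc: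
  assumes lm: "lm M" "lm N" "lm A" "lm B" "lm C" "lm K"
    and "bsum M A N" "bsum N B C" "bsum K A B"
  shows "bsum M K C"
proof -
  obtain i j p q where 1: "biprod M A N i j p q" using assms by (auto simp: bsum_def)
  obtain i' j' p' q' where 2: "biprod N B C i' j' p' q'" using assms by (auto simp: bsum_def)
  obtain a b c d where 3: "biprod K A B a b c d" using assms by (auto simp: bsum_def)
  note D1 = biprodD[OF 1] and D2 = biprodD[OF 2] and D3 = biprodD[OF 3]
  note h = homD(2)[OF D1(1)] homD(2)[OF D1(2)] homD(2)[OF D1(3)] homD(2)[OF D1(4)]
    homD(2)[OF D2(1)] homD(2)[OF D2(2)] homD(2)[OF D2(3)] homD(2)[OF D2(4)]
    homD(2)[OF D3(1)] homD(2)[OF D3(2)] homD(2)[OF D3(3)] homD(2)[OF D3(4)]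
  note z = hom_zero[OF lm(3,1) D1(1)] hom_zero[OF lm(2,1) D1(2)] hom_zero[OF lm(1,3) D1(3)]
    hom_zero[OF lm(1,2) D1(4)] hom_zero[OF lm(4,2) D2(1)] hom_zero[OF lm(5,2) D2(2)]
    hom_zero[OF lm(2,4) D2(3)] hom_zero[OF lm(2,5) D2(4)]
    hom_zero[OF lm(3,6) D3(1)] hom_zero[OF lm(4,6) D3(2)]
  have "biprod M K C (\<lambda>k. i (c k) \<oplus>\<^bsub>M\<^esub> j (i' (d k))) (\<lambda>x. j (j' x))
      (\<lambda>m. a (p m) \<oplus>\<^bsub>K\<^esub> b (p' (q m))) (\<lambda>m. q' (q m))"
    unfolding biprod_def
  proof (intro conjI ballI)
    show "(\<lambda>k. i (c k) \<oplus>\<^bsub>M\<^esub> j (i' (d k))) \<in> hom K M"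
      by (intro hom_add lm hom_comp[OF D3(3) D1(1)] hom_comp[OF hom_comp[OF D3(4) D2(1)] D1(2)])
    show "(\<lambda>x. j (j' x)) \<in> hom C M" by (rule hom_comp[OF D2(2) D1(2)])
    show "(\<lambda>m. a (p m) \<oplus>\<^bsub>K\<^esub> b (p' (q m))) \<in> hom M K"
      by (intro hom_add lm hom_comp[OF D1(3) D3(1)] hom_comp[OF hom_comp[OF D1(4) D2(3)] D3(2)])
    show "(\<lambda>m. q' (q m)) \<in> hom M C" by (rule hom_comp[OF D1(4) D2(4)])
    fix m assume m: "m \<in> carrier M"
    have "i (p m) \<oplus>\<^bsub>M\<^esub> (j (i' (p' (q m))) \<oplus>\<^bsub>M\<^esub> j (j' (q' (q m)))) = m"
      using m by (simp add: D1 D2 flip: h(2))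
    then show "i (c (a (p m) \<oplus>\<^bsub>K\<^esub> b (p' (q m)))) \<oplus>\<^bsub>M\<^esub> j (i' (d (a (p m) \<oplus>\<^bsub>K\<^esub> b (p' (q m)))))
      \<oplus>\<^bsub>M\<^esub> j (j' (q' (q m))) = m"
      using m lm by (simp add: D1 D2 D3 h z lm_ac)
  qed (use lm in \<open>simp_all add: D1 D2 D3 h z\<close>)
  then show ?thesis by (rule bsumI)
qed

text \<open>If \<open>h\<close> inverts \<open>p \<circ> i\<close>, then
  \<open>i \<circ> h \<circ> p\<close> is idempotent with the same image as \<open>i\<close>, and
  subtracting it from the identity projects onto the kernel of \<open>p\<close>.\<close>

lemma bsum_split:
  assumes lm: "lm M" "lm A" "lm C" and i: "i \<in> hom A M" and p: "p \<in> hom M C"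
    and bij: "bij_betw (\<lambda>a. p (i a)) (carrier A) (carrier C)"
  shows "bsum M A (restr M (mod_ker M C p))"
proof -
  define h where "h = inv_into (carrier A) (\<lambda>a. p (i a))"
  have pi: "(\<lambda>a. p (i a)) \<in> hom A C" using hom_comp[OF i p] .
  have h: "h \<in> hom C A" unfolding h_def by (rule hom_inv_into[OF lm(2) pi bij])
  have hl: "h (p (i a)) = a" if "a \<in> carrier A" for a
    unfolding h_def using bij_betw_inv_into_left[OF bij that] .
  have hr: "p (i (h c)) = c" if "c \<in> carrier C" for c
    unfolding h_def using bij_betw_inv_into_right[OF bij that] .
  note c = homD(1)[OF i] homD(1)[OF p] homD(1)[OF h]
  have r: "(\<lambda>m. i (h (p m))) \<in> hom M M" using hom_comp[OF hom_comp[OF p h] i] .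
  let ?q = "\<lambda>m. m \<oplus>\<^bsub>M\<^esub> \<ominus>\<^bsub>M\<^esub> i (h (p m))"
  have q: "?q \<in> hom M M" by (intro hom_add hom_id hom_uminus r lm)
  have K: "mod_ker M C p \<subseteq> carrier M" by (auto simp: mod_ker_def)
  have "biprod M A (restr M (mod_ker M C p)) i (\<lambda>x. x) (\<lambda>m. h (p m)) ?q"
    unfolding biprod_def
  proof (intro conjI ballI)
    show "?q \<in> hom M (restr M (mod_ker M C p))"
      using lm by (intro hom_restr_cod q)
        (auto simp: mod_ker_def c homD(2)[OF p] hom_neg[OF lm(1,3) p] hr)
  qed (use lm i hom_incl[OF K] hom_comp[OF p h] in
      \<open>auto simp: c hl hr mod_ker_def hom_zero[OF lm(3,2) h] hom_zero[OF lm(2,1) i] lm_ac\<close>)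
  then show ?thesis by (rule bsumI)
qed

text \<open>Both kernels are complements of the image of \<open>i\<close>, hence isomorphic to the
  same quotient. The isomorphism is written without a quotient: it is the projection onto one kernel
  along the image of \<open>i\<close>, restricted to the other kernel.\<close>

lemma complements_iso:
  assumes lm: "lm M" "lm A" "lm C" "lm D" and i: "i \<in> hom A M"
    and p: "p \<in> hom M C" "bij_betw (\<lambda>a. p (i a)) (carrier A) (carrier C)"
    and q: "q \<in> hom M D" "bij_betw (\<lambda>a. q (i a)) (carrier A) (carrier D)"
  shows "mod_iso L (restr M (mod_ker M C p)) (restr M (mod_ker M D q))"
proof -
  define h where "h = inv_into (carrier A) (\<lambda>a. p (i a))"
  define k where "k = inv_into (carrier A) (\<lambda>a. q (i a))"
  have h: "h \<in> hom C A" unfolding h_def by (rule hom_inv_into[OF lm(2) hom_comp[OF i p(1)] p(2)])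
  have k: "k \<in> hom D A" unfolding k_def by (rule hom_inv_into[OF lm(2) hom_comp[OF i q(1)] q(2)])
  have hi: "h (p (i a)) = a" "k (q (i a)) = a" if "a \<in> carrier A" for a
    unfolding h_def k_def
    using bij_betw_inv_into_left[OF p(2) that] bij_betw_inv_into_left[OF q(2) that] by auto
  have hr: "p (i (h c)) = c" if "c \<in> carrier C" for c
    unfolding h_def using bij_betw_inv_into_right[OF p(2) that] .
  have kr: "q (i (k c)) = c" if "c \<in> carrier D" for c
    unfolding k_def using bij_betw_inv_into_right[OF q(2) that] .
  note c = homD(1)[OF i] homD(1)[OF p(1)] homD(1)[OF h] homD(1)[OF q(1)] homD(1)[OF k]
  note a = homD(2)[OF i] homD(2)[OF p(1)] homD(2)[OF h] homD(2)[OF q(1)] homD(2)[OF k]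
  note n = hom_neg[OF lm(2,1) i] hom_neg[OF lm(1,3) p(1)] hom_neg[OF lm(1,4) q(1)]
    hom_neg[OF lm(3,2) h] hom_neg[OF lm(4,2) k]
  note z = hom_zero[OF lm(2,1) i] hom_zero[OF lm(3,2) h] hom_zero[OF lm(4,2) k]
  let ?f = "\<lambda>m. m \<oplus>\<^bsub>M\<^esub> \<ominus>\<^bsub>M\<^esub> i (k (q m))" and ?g = "\<lambda>m. m \<oplus>\<^bsub>M\<^esub> \<ominus>\<^bsub>M\<^esub> i (h (p m))"
  have f: "?f \<in> hom M M"
    by (intro hom_add hom_id hom_uminus hom_comp[OF hom_comp[OF q(1) k] i] lm)
  have g: "?g \<in> hom M M"
    by (intro hom_add hom_id hom_uminus hom_comp[OF hom_comp[OF p(1) h] i] lm)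
  show ?thesis
  proof (rule mod_isoI)
    show "?f \<in> hom (restr M (mod_ker M C p)) (restr M (mod_ker M D q))"
      using lm by (intro hom_restr_cod hom_restr_dom f) (auto simp: mod_ker_def c a n kr)
    show "?g \<in> hom (restr M (mod_ker M D q)) (restr M (mod_ker M C p))"
      using lm by (intro hom_restr_cod hom_restr_dom g) (auto simp: mod_ker_def c a n hr)
  qed (use lm in \<open>auto simp: mod_ker_def c a n z hi lm_ac\<close>)
qed

lemma biprod_ker_iso:
  assumes "lm M" "lm A" "lm B" "biprod M A B i j p q"
  shows "mod_iso L B (restr M (mod_ker M A p))"
proof (rule mod_isoI[of j _ _ q])
  note D = biprodD[OF assms(4)]
  have K: "mod_ker M A p \<subseteq> carrier M" by (auto simp: mod_ker_def)
  show "j \<in> hom B (restr M (mod_ker M A p))"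
    by (intro hom_restr_cod) (auto simp: D mod_ker_def)
  show "q \<in> hom (restr M (mod_ker M A p)) B" by (intro hom_restr_dom D K)
  fix y assume y: "y \<in> carrier (restr M (mod_ker M A p))"
  then have y': "y \<in> carrier M" "p y = \<zero>\<^bsub>A\<^esub>" by (auto simp: mod_ker_def)
  then have "\<zero>\<^bsub>M\<^esub> \<oplus>\<^bsub>M\<^esub> j (q y) = y"
    using D(9)[of y] hom_zero[OF assms(2,1) D(1)] by simp
  then show "j (q y) = y" using y' assms(1) by (simp add: D)
qed (simp add: biprodD[OF assms(4)])

definition zero_mod where "zero_mod M \<longleftrightarrow> carrier M = {\<zero>\<^bsub>M\<^esub>}"

lemma bsum_zero:
  assumes "lm A" "lm Z" "zero_mod Z"
  shows "bsum A A Z"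
proof -
  have "biprod A A Z (\<lambda>x. x) (\<lambda>_. \<zero>\<^bsub>A\<^esub>) (\<lambda>x. x) (\<lambda>_. \<zero>\<^bsub>Z\<^esub>)"
    unfolding biprod_def using assms hom_id[of A] hom_zero_map[of A Z] hom_zero_map[of Z A]
    by (auto simp: zero_mod_def)
  then show ?thesis by (rule bsumI)
qed

lemma bsum_zero_iff:
  assumes "lm M" "lm A" "lm Z" "zero_mod Z"
  shows "bsum M A Z \<longleftrightarrow> mod_iso L M A"
  using assms bsum_zero[OF assms(2-4)] bsum_unique[OF assms(1,2,2,3)]
    bsum_iso[OF assms(2,2,3,2,3) mod_iso_sym[OF assms(1)] mod_iso_refl mod_iso_refl] by blast

lemma dsum_Nil: "lm (dsum [])" "zero_mod (dsum [])"
  by (rule left_moduleI) (auto simp: dsum_def zero_mod_def)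

lemma dsum_Cons_carrier:
  "carrier (dsum (M # Ms)) = {x # xs | x xs. x \<in> carrier M \<and> xs \<in> carrier (dsum Ms)}"
  by (auto simp: dsum_def list_all2_Cons2)

lemma dsum_Cons_simps:
  "\<zero>\<^bsub>dsum (M # Ms)\<^esub> = \<zero>\<^bsub>M\<^esub> # \<zero>\<^bsub>dsum Ms\<^esub>"
  "(x # xs) \<oplus>\<^bsub>dsum (M # Ms)\<^esub> (y # ys) = (x \<oplus>\<^bsub>M\<^esub> y) # (xs \<oplus>\<^bsub>dsum Ms\<^esub> ys)"
  "a \<odot>\<^bsub>dsum (M # Ms)\<^esub> (x # xs) = (a \<odot>\<^bsub>M\<^esub> x) # (a \<odot>\<^bsub>dsum Ms\<^esub> xs)"
  by (auto simp: dsum_def)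

lemma dsum_lm: "(\<And>M. M \<in> set Ms \<Longrightarrow> lm M) \<Longrightarrow> lm (dsum Ms)"
proof (induction Ms)
  case Nil
  then show ?case using dsum_Nil by simp
next
  case (Cons M Ms)
  then have lm: "lm M" "lm (dsum Ms)" by auto
  show ?case
  proof (rule left_moduleI)
    fix x assume "x \<in> carrier (dsum (M # Ms))"
    then obtain y ys where x: "x = y # ys" "y \<in> carrier M" "ys \<in> carrier (dsum Ms)"
      unfolding dsum_Cons_carrier by auto
    show "\<exists>y\<in>carrier (dsum (M # Ms)). y \<oplus>\<^bsub>dsum (M # Ms)\<^esub> x = \<zero>\<^bsub>dsum (M # Ms)\<^esub>"
      using x lm by (intro bexI[of _ "\<ominus>\<^bsub>M\<^esub> y # \<ominus>\<^bsub>dsum Ms\<^esub> ys"]) (auto simp: dsum_Cons_carrier dsum_Cons_simps)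
  qed (use lm in \<open>auto simp: dsum_Cons_carrier dsum_Cons_simps lm_ac smult_add add_smult mult_smult\<close>)
qed

lemma dsum_Cons:
  assumes "lm M" "\<And>M. M \<in> set Ms \<Longrightarrow> lm M"
  shows "bsum (dsum (M # Ms)) M (dsum Ms)"
proof -
  have lm: "lm M" "lm (dsum Ms)" using assms dsum_lm by auto
  have "biprod (dsum (M # Ms)) M (dsum Ms) (\<lambda>x. x # \<zero>\<^bsub>dsum Ms\<^esub>) (\<lambda>xs. \<zero>\<^bsub>M\<^esub> # xs) hd tl"
    unfolding biprod_def
    by (intro conjI homI ballI) (use lm in \<open>auto simp: dsum_Cons_carrier dsum_Cons_simps\<close>)
  then show ?thesis by (rule bsumI)
qed

lemma dsum_two:
  fixes A B :: "('a, 'b) module"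
  assumes "lm A" "lm B"
  shows "bsum (dsum [A, B]) A B"
proof -
  have B: "lm (dsum [B])" "lm (dsum [A, B])" using assms by (auto intro: dsum_lm)
  have "bsum (dsum [B]) B (dsum ([] :: ('a, 'b) module list))"
    using dsum_Cons[of B "[]"] assms by simp
  then have "mod_iso L (dsum [B]) B" using bsum_zero_iff[OF B(1) assms(2) dsum_Nil] by blast
  then show ?thesis
    using bsum_iso[OF B(2) assms(1) B(1) assms mod_iso_refl mod_iso_refl] dsum_Cons[of A "[B]"] assms by auto
qed

lemma bsum_dsum_iff:
  assumes "lm M" "lm A" "lm B"
  shows "mod_iso L M (dsum [A, B]) \<longleftrightarrow> bsum M A B"
proof -
  have D: "lm (dsum [A, B])" using assms by (auto intro: dsum_lm)
  show ?thesis
    using bsum_iso[OF D assms(2,3,2,3) mod_iso_sym[OF assms(1)] mod_iso_refl mod_iso_refl]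
      bsum_unique[OF assms(1) D assms(2,3)] dsum_two[OF assms(2,3)] by blast
qed


subsection \<open>Quotients\<close>

text \<open>\<open>N\<close> is only a structure at this stage: every axiom is pulled back along the
  surjection \<open>g\<close>. This is how \<open>quotient_exists\<close> obtains a module.\<close>

lemma image_lm:
  assumes "lm M" "g \<in> hom M N" "carrier N = g ` carrier M" "g \<zero>\<^bsub>M\<^esub> = \<zero>\<^bsub>N\<^esub>"
  shows "lm N"
proof (rule left_moduleI)
  note G = homD(2,3)[OF assms(2)]
  fix x assume "x \<in> carrier N"
  then obtain y where y: "x = g y" "y \<in> carrier M" using assms(3) by auto
  then show "\<exists>y\<in>carrier N. y \<oplus>\<^bsub>N\<^esub> x = \<zero>\<^bsub>N\<^esub>"
    using assms by (intro bexI[of _ "g (\<ominus>\<^bsub>M\<^esub> y)"]) (auto simp flip: G)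
next
  note G = homD(2,3)[OF assms(2)]
  show "x \<oplus>\<^bsub>N\<^esub> y \<oplus>\<^bsub>N\<^esub> z = x \<oplus>\<^bsub>N\<^esub> (y \<oplus>\<^bsub>N\<^esub> z)"
    if "x \<in> carrier N" "y \<in> carrier N" "z \<in> carrier N" for x y z
    using that assms(1,3) by (auto simp: lm_ac simp flip: G)
  show "x \<oplus>\<^bsub>N\<^esub> y = y \<oplus>\<^bsub>N\<^esub> x" if "x \<in> carrier N" "y \<in> carrier N" for x y
    using that assms(1,3) by (auto simp: lm_ac(2)[OF assms(1)] simp flip: G)
qed (use assms(1,3) in \<open>auto simp: smult_add add_smult mult_smult assms(4)[symmetric]
  simp flip: homD(2,3)[OF assms(2)]\<close>)

text \<open>Cosets would change the element type, and quotients would leave the type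
  \<open>fgmod\<close>. A choice of representatives keeps the type; it depends only on the coset
  because elements of one coset satisfy the same predicate.\<close>

lemma quotient_exists:
  fixes M :: "('a, 'm) module"
  assumes lm: "lm M" and H: "submod H M"
  obtains N :: "('a, 'm) module" and g where "lm N" "g \<in> hom M N" "g ` carrier M = carrier N"
    "mod_ker M N g = H"
proof -
  note HD = submodD[OF H]
  define g where "g x = (SOME y. y \<in> carrier M \<and> x \<oplus>\<^bsub>M\<^esub> \<ominus>\<^bsub>M\<^esub> y \<in> H)" for x
  have g: "g x \<in> carrier M" "x \<oplus>\<^bsub>M\<^esub> \<ominus>\<^bsub>M\<^esub> g x \<in> H" if "x \<in> carrier M" for x
    using someI[of "\<lambda>y. y \<in> carrier M \<and> x \<oplus>\<^bsub>M\<^esub> \<ominus>\<^bsub>M\<^esub> y \<in> H" x] that lm HD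
    unfolding g_def by auto
  have trans: "x \<oplus>\<^bsub>M\<^esub> \<ominus>\<^bsub>M\<^esub> z \<in> H" if "x \<in> carrier M" "y \<in> carrier M" "z \<in> carrier M"
    "x \<oplus>\<^bsub>M\<^esub> \<ominus>\<^bsub>M\<^esub> y \<in> H" "y \<oplus>\<^bsub>M\<^esub> \<ominus>\<^bsub>M\<^esub> z \<in> H" for x y z
    using HD(4)[OF that(4,5)] that lm by (simp add: lm_ac)
  have sym: "y \<oplus>\<^bsub>M\<^esub> \<ominus>\<^bsub>M\<^esub> x \<in> H" if "x \<in> carrier M" "y \<in> carrier M" "x \<oplus>\<^bsub>M\<^esub> \<ominus>\<^bsub>M\<^esub> y \<in> H" for x y
    using HD(6)[OF that(3)] that lm by (simp add: lm_ac)
  have eqI: "g x = g y" if xy: "x \<in> carrier M" "y \<in> carrier M" "x \<oplus>\<^bsub>M\<^esub> \<ominus>\<^bsub>M\<^esub> y \<in> H" for x y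
  proof -
    have "x \<oplus>\<^bsub>M\<^esub> \<ominus>\<^bsub>M\<^esub> z \<in> H \<longleftrightarrow> y \<oplus>\<^bsub>M\<^esub> \<ominus>\<^bsub>M\<^esub> z \<in> H" if "z \<in> carrier M" for z
      using xy that trans sym by blast
    then show ?thesis unfolding g_def by (metis (no_types, lifting))
  qed
  have gg: "g (g x) = g x" if "x \<in> carrier M" for x
    using eqI[of x "g x"] g that by simp
  have add: "g (g x \<oplus>\<^bsub>M\<^esub> g y) = g (x \<oplus>\<^bsub>M\<^esub> y)" if xy: "x \<in> carrier M" "y \<in> carrier M" for x y
  proof -
    have "x \<oplus>\<^bsub>M\<^esub> y \<oplus>\<^bsub>M\<^esub> \<ominus>\<^bsub>M\<^esub> (g x \<oplus>\<^bsub>M\<^esub> g y) \<in> H"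
      using HD(4)[OF g(2)[OF xy(1)] g(2)[OF xy(2)]] xy g lm by (simp add: lm_ac)
    then show ?thesis using eqI[of "x \<oplus>\<^bsub>M\<^esub> y" "g x \<oplus>\<^bsub>M\<^esub> g y"] xy g lm by simp
  qed
  have smult: "g (a \<odot>\<^bsub>M\<^esub> g x) = g (a \<odot>\<^bsub>M\<^esub> x)" if ax: "a \<in> carrier L" "x \<in> carrier M" for a x
  proof -
    have "a \<odot>\<^bsub>M\<^esub> x \<oplus>\<^bsub>M\<^esub> \<ominus>\<^bsub>M\<^esub> (a \<odot>\<^bsub>M\<^esub> g x) \<in> H"
      using HD(5)[OF ax(1) g(2)[OF ax(2)]] ax g lm by (simp add: smult_add smult_neg)
    then show ?thesis using eqI[of "a \<odot>\<^bsub>M\<^esub> x" "a \<odot>\<^bsub>M\<^esub> g x"] ax g lm by simp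
  qed
  have add1: "g (g x \<oplus>\<^bsub>M\<^esub> y) = g (x \<oplus>\<^bsub>M\<^esub> y)" "g (y \<oplus>\<^bsub>M\<^esub> g x) = g (y \<oplus>\<^bsub>M\<^esub> x)"
    if xy: "x \<in> carrier M" "y \<in> carrier M" for x y
    using add[of "g x" y] add[of x y] add[of y "g x"] add[of y x] gg g xy by auto
  define N :: "('a, 'm) module" where "N = \<lparr>carrier = g ` carrier M, monoid.mult = undefined,
     one = undefined, ring.zero = g \<zero>\<^bsub>M\<^esub>, ring.add = (\<lambda>x y. g (x \<oplus>\<^bsub>M\<^esub> y)),
     smult = (\<lambda>a x. g (a \<odot>\<^bsub>M\<^esub> x))\<rparr>"
  show thesis
  proof (rule that)
    show hom: "g \<in> hom M N" using lm by (intro homI) (auto simp: N_def add smult)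
    show "lm N" by (rule image_lm[OF lm hom]) (auto simp: N_def)
    show "g ` carrier M = carrier N" by (simp add: N_def)
    show "mod_ker M N g = H"
    proof -
      have "g x = g \<zero>\<^bsub>M\<^esub> \<longleftrightarrow> x \<in> H" if x: "x \<in> carrier M" for x
      proof
        assume e: "g x = g \<zero>\<^bsub>M\<^esub>"
        have "x \<oplus>\<^bsub>M\<^esub> \<ominus>\<^bsub>M\<^esub> \<zero>\<^bsub>M\<^esub> \<in> H"
          using trans[OF x g(1)[OF x] lm_closed(1)[OF lm] g(2)[OF x]] e
            sym[OF lm_closed(1)[OF lm] g(1) g(2)] lm by auto
        then show "x \<in> H" using lm x by simp
      qed (use eqI[OF x lm_closed(1)[OF lm]] lm x in simp)
      then show ?thesis using HD by (auto simp: mod_ker_def N_def)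
    qed
  qed
qed

lemma factor_hom:
  assumes lm: "lm M" "lm N" "lm K" and g: "g \<in> hom M N" "g ` carrier M = carrier N"
    and h: "h \<in> hom M K" and ker: "\<And>x. x \<in> carrier M \<Longrightarrow> g x = \<zero>\<^bsub>N\<^esub> \<Longrightarrow> h x = \<zero>\<^bsub>K\<^esub>"
  obtains k where "k \<in> hom N K" "\<And>x. x \<in> carrier M \<Longrightarrow> k (g x) = h x"
proof -
  note G = homD[OF g(1)] and Hh = homD[OF h]
  have eq: "h x = h y" if "x \<in> carrier M" "y \<in> carrier M" "g x = g y" for x y
  proof -
    have "g (x \<oplus>\<^bsub>M\<^esub> \<ominus>\<^bsub>M\<^esub> y) = \<zero>\<^bsub>N\<^esub>" using that lm G hom_neg[OF lm(1,2) g(1)] by auto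
    then have "h (x \<oplus>\<^bsub>M\<^esub> \<ominus>\<^bsub>M\<^esub> y) = \<zero>\<^bsub>K\<^esub>" using ker that lm by auto
    then have d: "h x \<oplus>\<^bsub>K\<^esub> \<ominus>\<^bsub>K\<^esub> h y = \<zero>\<^bsub>K\<^esub>"
      using that lm by (simp add: Hh(2) hom_neg[OF lm(1,3) h])
    show ?thesis by (rule lm_diff_eq_0[OF lm(3) Hh(1)[OF that(1)] Hh(1)[OF that(2)] d])
  qed
  define k where "k = (\<lambda>y. h (inv_into (carrier M) g y))"
  have k: "k (g x) = h x" if x: "x \<in> carrier M" for x
    unfolding k_def using x by (intro eq inv_into_into f_inv_into_f imageI)
  have "k \<in> hom N K"
    unfolding mod_hom_def g(2)[symmetric]
    using lm Hh by (auto simp: k simp flip: G(2,3))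
  then show thesis using k by (rule that)
qed


subsection \<open>Finite length\<close>

text \<open>A module has finite length iff its submodules carry a strictly monotone function to the
  naturals; no composition series are needed.\<close>

definition fin_len :: "('a, 'm) module \<Rightarrow> bool" where
  "fin_len M \<longleftrightarrow> (\<exists>l :: 'm set \<Rightarrow> nat. \<forall>H K. submod H M \<and> submod K M \<and> H \<subset> K \<longrightarrow> l H < l K)"

lemma fin_len_min:
  assumes "fin_len M" "H0 \<in> S" "\<And>H. H \<in> S \<Longrightarrow> submod H M"
  obtains H where "H \<in> S" "\<And>K. K \<in> S \<Longrightarrow> K \<subseteq> H \<Longrightarrow> K = H"
proof -
  obtain l :: "_ set \<Rightarrow> nat" where l: "\<And>H K. submod H M \<Longrightarrow> submod K M \<Longrightarrow> H \<subset> K \<Longrightarrow> l H < l K"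
    using assms(1) unfolding fin_len_def by blast
  obtain H where "H \<in> S" "\<And>K. K \<in> S \<Longrightarrow> l H \<le> l K"
    using ex_has_least_nat[of "\<lambda>H. H \<in> S" H0 l] assms(2) by blast
  then show thesis using that[of H] l assms(3) by (metis leD psubsetI)
qed

lemma fin_len_max:
  assumes "lm M" "fin_len M" "H0 \<in> S" "\<And>H. H \<in> S \<Longrightarrow> submod H M"
  obtains H where "H \<in> S" "\<And>K. K \<in> S \<Longrightarrow> H \<subseteq> K \<Longrightarrow> K = H"
proof -
  obtain l :: "_ set \<Rightarrow> nat" where l: "\<And>H K. submod H M \<Longrightarrow> submod K M \<Longrightarrow> H \<subset> K \<Longrightarrow> l H < l K"
    using assms(2) unfolding fin_len_def by blast
  have "l H \<le> l (carrier M)" if "H \<in> S" for H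
    using l[OF assms(4)[OF that] submod_carrier[OF assms(1)]] submodD(1)[OF assms(4)[OF that]]
    by (cases "H = carrier M") (auto simp: psubset_eq)
  then have "\<forall>H. H \<in> S \<longrightarrow> l H < Suc (l (carrier M))" by (simp add: less_Suc_eq_le)
  then obtain H where "H \<in> S" "\<And>K. K \<in> S \<Longrightarrow> l K \<le> l H"
    using ex_has_greatest_nat[of "\<lambda>H. H \<in> S" H0 l "Suc (l (carrier M))"] assms(3) by auto
  then show thesis using that[of H] l assms(4) by (metis leD psubsetI)
qed

text \<open>The images of the powers of \<open>f\<close> descend, so they stop at some
  \<open>I\<close> with \<open>f I = I\<close>; the kernels of the powers on \<open>I\<close> ascend
  and stop too. If \<open>f x = 0\<close> with \<open>x\<close> in \<open>I\<close>, write
  \<open>x = f^n y\<close> for an exponent \<open>n\<close> where the kernels have stopped: then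
  \<open>f^(n+1) y = 0\<close> forces \<open>f^n y = 0\<close>.\<close>

lemma fitting:
  assumes lm: "lm M" and fl: "fin_len M" and f: "f \<in> hom M M"
  obtains k where "bij_betw f ((f ^^ k) ` carrier M) ((f ^^ k) ` carrier M)"
proof -
  have fn: "(f ^^ n) \<in> hom M M" for n by (rule hom_funpow[OF f])
  have sub: "submod ((f ^^ n) ` carrier M) M" for n
    by (rule image_submod[OF lm lm fn submod_carrier[OF lm]])
  have closed: "(f ^^ n) x \<in> carrier M" if "x \<in> carrier M" for n x
    by (rule homD(1)[OF fn that])
  have anti: "(f ^^ Suc n) ` carrier M \<subseteq> (f ^^ n) ` carrier M" for n
    using closed[of _ 1] by (auto simp: funpow_swap1)
  obtain I where "I \<in> range (\<lambda>n. (f ^^ n) ` carrier M)"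
    and min: "\<And>K. K \<in> range (\<lambda>n. (f ^^ n) ` carrier M) \<Longrightarrow> K \<subseteq> I \<Longrightarrow> K = I"
    using fin_len_min[OF fl, of "(f ^^ 0) ` carrier M" "range (\<lambda>n. (f ^^ n) ` carrier M)"] sub by blast
  then obtain k where k: "I = (f ^^ k) ` carrier M" by blast
  have "(f ^^ Suc k) ` carrier M = I" using min[of "(f ^^ Suc k) ` carrier M"] anti[of k] k by blast
  then have onto: "f ` I = I" unfolding k by (simp add: image_comp)
  have onton: "(f ^^ n) ` I = I" for n
    by (induction n) (simp_all add: onto image_image[symmetric, of f "f ^^ _"])
  have I: "submod I M" "I \<subseteq> carrier M" using sub[of k] submodD k by auto
  define K where "K n = I \<inter> mod_ker M M (f ^^ n)" for n
  have Ksub: "submod (K n) M" for n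
    unfolding K_def by (intro submod_Int lm I ker_submod fn)
  have mono: "K n \<subseteq> K (Suc n)" for n
    using hom_zero[OF lm lm f] by (auto simp: K_def mod_ker_def)
  obtain J where "J \<in> range K" and max: "\<And>J'. J' \<in> range K \<Longrightarrow> J \<subseteq> J' \<Longrightarrow> J' = J"
    using fin_len_max[OF lm fl, of "K 0" "range K"] Ksub by blast
  then obtain n where "J = K n" by blast
  then have n: "K (Suc n) = K n" using max[of "K (Suc n)"] mono[of n] by simp
  have "inj_on f (carrier (restr M I))"
  proof (rule hom_injI[OF restr_lm[OF lm I(1)] lm hom_restr_dom[OF f I(2)]])
    fix x assume x: "x \<in> carrier (restr M I)" "f x = \<zero>\<^bsub>M\<^esub>"
    then obtain y where y: "y \<in> I" "x = (f ^^ n) y" using onton[of n] by auto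
    then have "y \<in> K (Suc n)" using x I by (auto simp: K_def mod_ker_def)
    then have "y \<in> K n" using n by simp
    then show "x = \<zero>\<^bsub>restr M I\<^esub>" using y by (simp add: K_def mod_ker_def)
  qed
  then have "bij_betw f I I" using onto by (simp add: bij_betw_def)
  then show thesis using that k by blast
qed

lemma funpow_bij_betw: "bij_betw f I I \<Longrightarrow> bij_betw (f ^^ n) I I"
  by (induction n) (auto simp: bij_betw_id intro: bij_betw_trans)

text \<open>\<open>bsum_split\<close> for the inclusion of the image and the map
  \<open>f ^^ k\<close>, which is bijective on the image.\<close>

lemma fitting_bsum:
  assumes lm: "lm M" and f: "f \<in> hom M M"
    and bij: "bij_betw f ((f ^^ k) ` carrier M) ((f ^^ k) ` carrier M)"
  shows "bsum M (restr M ((f ^^ k) ` carrier M)) (restr M (mod_ker M M (f ^^ k)))"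
proof -
  let ?I = "(f ^^ k) ` carrier M"
  have fk: "(f ^^ k) \<in> hom M M" by (rule hom_funpow[OF f])
  have I: "submod ?I M" by (rule image_submod[OF lm lm fk submod_carrier[OF lm]])
  have lmI: "lm (restr M ?I)" by (rule restr_lm[OF lm I])
  have "bsum M (restr M ?I) (restr M (mod_ker M (restr M ?I) (f ^^ k)))"
    using funpow_bij_betw[OF bij, of k]
    by (intro bsum_split[OF lm lmI lmI hom_incl] submodD(1)[OF I] hom_restr_cod[OF fk]) auto
  then show ?thesis by (simp add: mod_ker_def)
qed

text \<open>With \<open>k\<close> from Fitting's lemma, \<open>f^k x\<close> lies in
  \<open>f^k (f^k M)\<close>. Cancelling the injective \<open>f^k\<close> puts \<open>x\<close> into
  the image of \<open>f^k\<close>, so that image is all of \<open>M\<close>.\<close>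

lemma inj_endo_bij:
  assumes lm: "lm M" and fl: "fin_len M" and f: "f \<in> hom M M" and inj: "inj_on f (carrier M)"
  shows "bij_betw f (carrier M) (carrier M)"
proof -
  obtain k where k: "bij_betw f ((f ^^ k) ` carrier M) ((f ^^ k) ` carrier M)"
    using fitting[OF lm fl f] by blast
  have c: "f ` carrier M \<subseteq> carrier M" using homD(1)[OF f] by blast
  have injk: "inj_on (f ^^ n) (carrier M)" for n
  proof (induction n)
    case (Suc n)
    have "(f ^^ n) ` carrier M \<subseteq> carrier M" using homD(1)[OF hom_funpow[OF f]] by blast
    then show ?case using comp_inj_on[OF Suc inj_on_subset[OF inj]] by (simp add: comp_def)
  qed auto
  have "x \<in> (f ^^ k) ` carrier M" if x: "x \<in> carrier M" for x
  proof -
    have "(f ^^ k) x \<in> (f ^^ k) ` (f ^^ k) ` carrier M"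
      using funpow_bij_betw[OF k, of k] x by (auto simp: bij_betw_def)
    then obtain y where y: "y \<in> carrier M" "(f ^^ k) x = (f ^^ k) ((f ^^ k) y)" by blast
    then have "x = (f ^^ k) y"
      using inj_onD[OF injk[of k] y(2)] x homD(1)[OF hom_funpow[OF f]] by blast
    then show ?thesis using y by blast
  qed
  then have "(f ^^ k) ` carrier M = carrier M" using homD(1)[OF hom_funpow[OF f]] by blast
  then show ?thesis using k by simp
qed


subsection \<open>The exchange property\<close>

text \<open>The endomorphism ring of \<open>X\<close> is local: of two endomorphisms with sum the
  identity, one is invertible.\<close>

definition local_mod where
  "local_mod X \<longleftrightarrow> carrier X \<noteq> {\<zero>\<^bsub>X\<^esub>} \<and> (\<forall>f\<in>hom X X. \<forall>g\<in>hom X X.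
     (\<forall>x\<in>carrier X. f x \<oplus>\<^bsub>X\<^esub> g x = x) \<longrightarrow>
     bij_betw f (carrier X) (carrier X) \<or> bij_betw g (carrier X) (carrier X))"

lemma local_modD:
  assumes "local_mod X" "f \<in> hom X X" "g \<in> hom X X"
    and "\<And>x. x \<in> carrier X \<Longrightarrow> f x \<oplus>\<^bsub>X\<^esub> g x = x"
  shows "bij_betw f (carrier X) (carrier X) \<or> bij_betw g (carrier X) (carrier X)"
  using assms unfolding local_mod_def by blast

text \<open>Let \<open>v : Y \<rightarrow> X\<close> and \<open>w : M \<rightarrow> X\<close> be
  induced by \<open>p\<close>, the second one through the projection to \<open>Y\<close>. As
  \<open>X \<rightarrow> Y \<rightarrow> X\<close> is bijective, \<open>Y\<close> splits as
  \<open>X\<close> and the kernel \<open>H\<close> of \<open>v\<close>. The kernel of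
  \<open>w\<close> is the sum of \<open>H\<close> and \<open>B\<close>, and it is isomorphic to
  \<open>A\<close> because it and the kernel of \<open>p\<close> both complement the image of
  \<open>X\<close> in \<open>M\<close>.\<close>

lemma exchange_half:
  assumes lm: "lm M" "lm X" "lm A" "lm Y" "lm B"
    and b: "biprod M X A i j p q" and b': "biprod M Y B i' j' p' q'"
    and bij: "bij_betw (\<lambda>x. p (i' (p' (i x)))) (carrier X) (carrier X)"
  shows "\<exists>H. submod H Y \<and> bsum Y X (restr Y H) \<and> bsum A (restr Y H) B"
proof -
  note D = biprodD[OF b] and D' = biprodD[OF b']
  let ?u = "\<lambda>x. p' (i x)" and ?v = "\<lambda>y. p (i' y)"
  have u: "?u \<in> hom X Y" by (rule hom_comp[OF D(1) D'(3)])
  have v: "?v \<in> hom Y X" by (rule hom_comp[OF D'(1) D(3)])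
  let ?H = "mod_ker Y X ?v"
  have H: "submod ?H Y" by (rule ker_submod[OF lm(4,2) v])
  have Y: "bsum Y X (restr Y ?H)" by (rule bsum_split[OF lm(4,2,2) u v bij])
  let ?w = "\<lambda>m. p (i' (p' m))"
  have w: "?w \<in> hom M X" by (rule hom_comp[OF D'(3) v])
  let ?K = "mod_ker M X ?w"
  have K: "submod ?K M" by (rule ker_submod[OF lm(1,2) w])
  have "bij_betw (\<lambda>x. p (i x)) (carrier X) (carrier X)"
    using D(5) by (intro bij_betw_byWitness[of _ "\<lambda>x. x"]) auto
  then have "mod_iso L (restr M (mod_ker M X p)) (restr M ?K)"
    by (rule complements_iso[OF lm(1,2,2,2) D(1) D(3) _ w bij])
  then have iso: "mod_iso L (restr M ?K) A"
    using mod_iso_trans[OF biprod_ker_iso[OF lm(1-3) b]] mod_iso_sym[OF lm(3)] by blast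
  have "biprod (restr M ?K) (restr Y ?H) B i' j' p' q'"
    unfolding biprod_def
  proof (intro conjI)
    show "i' \<in> hom (restr Y ?H) (restr M ?K)"
      by (intro hom_restr_cod hom_restr_dom D' submodD(1)[OF H]) (auto simp: mod_ker_def D')
    show "j' \<in> hom B (restr M ?K)"
      using hom_zero[OF lm(4,2) v]
      by (intro hom_restr_cod D') (auto simp: mod_ker_def D')
    show "p' \<in> hom (restr M ?K) (restr Y ?H)"
      by (intro hom_restr_cod hom_restr_dom D' submodD(1)[OF K]) (auto simp: mod_ker_def D')
    show "q' \<in> hom (restr M ?K) B" by (intro hom_restr_dom D' submodD(1)[OF K])
  qed (auto simp: D' mod_ker_def)
  then have "bsum (restr M ?K) (restr Y ?H) B" by (rule bsumI)
  then have "bsum A (restr Y ?H) B"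
    using bsum_iso[OF restr_lm[OF lm(1) K] restr_lm[OF lm(4) H] lm(5) restr_lm[OF lm(4) H] lm(5)
      iso mod_iso_refl mod_iso_refl] by blast
  then show ?thesis using H Y by blast
qed

text \<open>The identity of \<open>X\<close> is the sum of the composite through \<open>Y\<close>
  and the composite through \<open>B\<close>. By locality one of them is invertible; the two cases
  are \<open>exchange_half\<close> and its mirror image.\<close>

lemma exchange:
  assumes lm: "lm M" "lm X" "lm A" "lm Y" "lm B" and X: "local_mod X"
    and XA: "bsum M X A" and YB: "bsum M Y B"
  shows "(\<exists>H. submod H Y \<and> bsum Y X (restr Y H) \<and> bsum A (restr Y H) B) \<or>
    (\<exists>H. submod H B \<and> bsum B X (restr B H) \<and> bsum A Y (restr B H))"
proof -
  obtain i j p q where b: "biprod M X A i j p q" using XA by (auto simp: bsum_def)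
  obtain i' j' p' q' where b': "biprod M Y B i' j' p' q'" using YB by (auto simp: bsum_def)
  note D = biprodD[OF b] and D' = biprodD[OF b']
  have b'': "biprod M B Y j' i' q' p'"
    unfolding biprod_def using D' lm_ac(2)[OF lm(1) D'(10,11)] by auto
  have f: "(\<lambda>x. p (i' (p' (i x)))) \<in> hom X X"
    by (rule hom_comp[OF hom_comp[OF hom_comp[OF D(1) D'(3)] D'(1)] D(3)])
  have g: "(\<lambda>x. p (j' (q' (i x)))) \<in> hom X X"
    by (rule hom_comp[OF hom_comp[OF hom_comp[OF D(1) D'(4)] D'(2)] D(3)])
  have "p (i' (p' (i x))) \<oplus>\<^bsub>X\<^esub> p (j' (q' (i x))) = x" if "x \<in> carrier X" for x
    using that by (simp add: D D' flip: homD(2)[OF D(3)])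
  then consider "bij_betw (\<lambda>x. p (i' (p' (i x)))) (carrier X) (carrier X)"
    | "bij_betw (\<lambda>x. p (j' (q' (i x)))) (carrier X) (carrier X)"
    using local_modD[OF X f g] by blast
  then show ?thesis
  proof cases
    case 1
    then show ?thesis using exchange_half[OF lm b b'] by blast
  next
    case 2
    then obtain H where H: "submod H B" "bsum B X (restr B H)" "bsum A (restr B H) Y"
      using exchange_half[OF lm(1-3) lm(5,4) b b''] by blast
    then show ?thesis using bsum_comm[OF lm(3)] by blast
  qed
qed

end

lemma strict_mono_le: "(A \<subset> B \<Longrightarrow> l A < l B) \<Longrightarrow> A \<subseteq> B \<Longrightarrow> l A \<le> (l B :: nat)"
  by (cases "A = B") (auto simp: psubset_eq)

context left_modules
begin

subsection \<open>Generation and finite length\<close>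

definition self_mod :: "('a, 'a) module" where
  "self_mod = \<lparr>carrier = carrier L, monoid.mult = undefined, one = undefined, ring.zero = \<zero>,
     ring.add = (\<oplus>), smult = (\<otimes>)\<rparr>"

lemma self_mod_simps [simp]:
  "carrier self_mod = carrier L" "\<zero>\<^bsub>self_mod\<^esub> = \<zero>" "x \<oplus>\<^bsub>self_mod\<^esub> y = x \<oplus> y"
  "a \<odot>\<^bsub>self_mod\<^esub> x = a \<otimes> x"
  by (simp_all add: self_mod_def)

lemma self_mod_lm: "lm self_mod"
proof (rule left_moduleI)
  show "\<exists>y\<in>carrier self_mod. y \<oplus>\<^bsub>self_mod\<^esub> x = \<zero>\<^bsub>self_mod\<^esub>" if "x \<in> carrier self_mod" for x
    using that by (intro bexI[of _ "\<ominus> x"]) (auto simp: l_neg)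
qed (auto simp: a_ac m_assoc l_distr r_distr)

lemma lm_cancel [simp]:
  assumes "lm M" "x \<in> carrier M" "y \<in> carrier M"
  shows "x \<oplus>\<^bsub>M\<^esub> (y \<oplus>\<^bsub>M\<^esub> \<ominus>\<^bsub>M\<^esub> x) = y" and "\<ominus>\<^bsub>M\<^esub> x \<oplus>\<^bsub>M\<^esub> (y \<oplus>\<^bsub>M\<^esub> x) = y"
  using assms by (simp_all add: lm_ac(3)[OF assms(1), of _ y])

lemma fin_lenI:
  "(\<And>H K. submod H M \<Longrightarrow> submod K M \<Longrightarrow> H \<subset> K \<Longrightarrow> l H < (l K :: nat)) \<Longrightarrow> fin_len M"
  unfolding fin_len_def by (intro exI[of _ l]) simp

lemma submod_diff: "submod H M \<Longrightarrow> x \<in> H \<Longrightarrow> y \<in> H \<Longrightarrow> x \<oplus>\<^bsub>M\<^esub> \<ominus>\<^bsub>M\<^esub> y \<in> H"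
  by (rule submodD(4)[OF _ _ submodD(6)])

text \<open>The lengths of \<open>H \<inter> ker f\<close> and of \<open>f H\<close> are added. If
  nested submodules \<open>H \<subseteq> H'\<close> agree in both, an element of \<open>H'\<close>
  differs from one of \<open>H\<close> by an element of
  \<open>H' \<inter> ker f = H \<inter> ker f\<close>, so they are equal; otherwise one of the two
  lengths grows strictly.\<close>

lemma fin_len_extension:
  fixes M :: "('a, 'm) module" and N :: "('a, 'n) module"
  assumes lm: "lm M" "lm N" and f: "f \<in> hom M N"
    and K: "fin_len (restr M (mod_ker M N f))" and I: "fin_len (restr N (f ` carrier M))"
  shows "fin_len M"
proof -
  have Ks: "submod (mod_ker M N f) M" by (rule ker_submod[OF lm f])
  have Is: "submod (f ` carrier M) N" by (rule image_submod[OF lm f submod_carrier[OF lm(1)]])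
  obtain l1 :: "'m set \<Rightarrow> nat" where l1: "\<And>H H'. submod H (restr M (mod_ker M N f)) \<Longrightarrow>
      submod H' (restr M (mod_ker M N f)) \<Longrightarrow> H \<subset> H' \<Longrightarrow> l1 H < l1 H'"
    using K unfolding fin_len_def by blast
  obtain l2 :: "'n set \<Rightarrow> nat" where l2: "\<And>H H'. submod H (restr N (f ` carrier M)) \<Longrightarrow>
      submod H' (restr N (f ` carrier M)) \<Longrightarrow> H \<subset> H' \<Longrightarrow> l2 H < l2 H'"
    using I unfolding fin_len_def by blast
  have "l1 (H \<inter> mod_ker M N f) + l2 (f ` H) < l1 (H' \<inter> mod_ker M N f) + l2 (f ` H')"
    if H: "submod H M" "submod H' M" "H \<subset> H'" for H H'
  proof -
    note D = submodD[OF H(1)] submodD[OF H(2)]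
    have s1: "submod (X \<inter> mod_ker M N f) (restr M (mod_ker M N f))" if "submod X M" for X
      using submod_Int[OF lm(1) that Ks] submod_restr[OF lm(1) Ks] by blast
    have s2: "submod (f ` X) (restr N (f ` carrier M))" if "submod X M" for X
      using image_submod[OF lm f that] submodD(1)[OF that] submod_restr[OF lm(2) Is] by blast
    have le1: "l1 (H \<inter> mod_ker M N f) \<le> l1 (H' \<inter> mod_ker M N f)"
      using H(3) by (intro strict_mono_le[where l = l1, OF l1[OF s1[OF H(1)] s1[OF H(2)]]]) blast+
    have le2: "l2 (f ` H) \<le> l2 (f ` H')"
      using H(3) by (intro strict_mono_le[where l = l2, OF l2[OF s2[OF H(1)] s2[OF H(2)]]]) blast+
    have "H \<inter> mod_ker M N f \<noteq> H' \<inter> mod_ker M N f \<or> f ` H \<noteq> f ` H'"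
    proof (rule ccontr)
      assume "\<not> ?thesis"
      then have eq: "H \<inter> mod_ker M N f = H' \<inter> mod_ker M N f" "f ` H = f ` H'" by auto
      have "y \<in> H" if y: "y \<in> H'" for y
      proof -
        have "f y \<in> f ` H" using y eq by auto
        then obtain h where h: "h \<in> H" "f y = f h" by blast
        have c: "y \<in> carrier M" "h \<in> carrier M" "h \<in> H'" using y h H D by auto
        have "f (y \<oplus>\<^bsub>M\<^esub> \<ominus>\<^bsub>M\<^esub> h) = \<zero>\<^bsub>N\<^esub>"
          using c h(2) lm homD[OF f] hom_neg[OF lm f] by auto
        moreover have "y \<oplus>\<^bsub>M\<^esub> \<ominus>\<^bsub>M\<^esub> h \<in> H'" by (rule submod_diff[OF H(2) y c(3)])
        ultimately have "y \<oplus>\<^bsub>M\<^esub> \<ominus>\<^bsub>M\<^esub> h \<in> H' \<inter> mod_ker M N f"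
          using lm c by (simp add: mod_ker_def)
        then have "y \<oplus>\<^bsub>M\<^esub> \<ominus>\<^bsub>M\<^esub> h \<in> H" using eq(1) by blast
        then have "h \<oplus>\<^bsub>M\<^esub> (y \<oplus>\<^bsub>M\<^esub> \<ominus>\<^bsub>M\<^esub> h) \<in> H" by (rule submodD(4)[OF H(1) h(1)])
        then show ?thesis using c lm by (simp add: lm_ac)
      qed
      then show False using H(3) by blast
    qed
    then show ?thesis
    proof
      assume "H \<inter> mod_ker M N f \<noteq> H' \<inter> mod_ker M N f"
      then have "H \<inter> mod_ker M N f \<subset> H' \<inter> mod_ker M N f" using H(3) by blast
      then show ?thesis using l1[OF s1[OF H(1)] s1[OF H(2)]] le2 by linarith
    next
      assume "f ` H \<noteq> f ` H'"
      then have "f ` H \<subset> f ` H'" using H(3) by blast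
      then show ?thesis using l2[OF s2[OF H(1)] s2[OF H(2)]] le1 by linarith
    qed
  qed
  then show ?thesis by (rule fin_lenI)
qed

text \<open>The hypothesis \<open>top\<close> says that \<open>M / J\<close> is zero or simple,
  without forming the quotient. The length of a submodule is that of its intersection with
  \<open>J\<close>, plus one if it is not contained in \<open>J\<close>: nested submodules outside
  \<open>J\<close> with the same intersection are equal.\<close>

lemma fin_len_simple_top:
  fixes M :: "('a, 'm) module"
  assumes lm: "lm M" and J: "submod J M" "fin_len (restr M J)"
    and top: "\<And>h y. h \<in> carrier M - J \<Longrightarrow> y \<in> carrier M \<Longrightarrow>
      \<exists>j\<in>J. \<exists>r\<in>carrier L. y = j \<oplus>\<^bsub>M\<^esub> r \<odot>\<^bsub>M\<^esub> h"
  shows "fin_len M"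
proof -
  obtain l :: "'m set \<Rightarrow> nat" where l: "\<And>H H'. submod H (restr M J) \<Longrightarrow>
      submod H' (restr M J) \<Longrightarrow> H \<subset> H' \<Longrightarrow> l H < l H'"
    using J(2) unfolding fin_len_def by blast
  define l' where "l' H = l (H \<inter> J) + (if H \<subseteq> J then 0 else 1)" for H
  have "l' H < l' K" if H: "submod H M" "submod K M" "H \<subset> K" for H K
  proof -
    note D = submodD[OF H(1)] submodD[OF H(2)]
    have s: "submod (X \<inter> J) (restr M J)" if "submod X M" for X
      using submod_Int[OF lm that J(1)] submod_restr[OF lm J(1)] by blast
    show ?thesis
    proof (cases "H \<inter> J = K \<inter> J")
      case False
      then have "l (H \<inter> J) < l (K \<inter> J)" using l[OF s[OF H(1)] s[OF H(2)]] H(3) by blast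
      then show ?thesis using H(3) by (auto simp: l'_def)
    next
      case True
      have "\<not> K \<subseteq> J" using True H(3) by blast
      moreover have "H \<subseteq> J"
      proof (rule ccontr)
        assume "\<not> H \<subseteq> J"
        then obtain h where h: "h \<in> H" "h \<notin> J" by blast
        have "y \<in> H" if y: "y \<in> K" for y
        proof -
          have c: "y \<in> carrier M" "h \<in> carrier M" "h \<in> K" using y h H D by auto
          obtain j r where jr: "j \<in> J" "r \<in> carrier L" "y = j \<oplus>\<^bsub>M\<^esub> r \<odot>\<^bsub>M\<^esub> h"
            using top[of h y] c h by blast
          have j: "j \<in> carrier M" using jr(1) submodD(2)[OF J(1)] by blast
          have "y \<oplus>\<^bsub>M\<^esub> \<ominus>\<^bsub>M\<^esub> (r \<odot>\<^bsub>M\<^esub> h) = j" using j c jr lm by (simp add: lm_ac)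
          moreover have "y \<oplus>\<^bsub>M\<^esub> \<ominus>\<^bsub>M\<^esub> (r \<odot>\<^bsub>M\<^esub> h) \<in> K"
            by (rule submod_diff[OF H(2) y submodD(5)[OF H(2) jr(2) c(3)]])
          ultimately have "j \<in> H" using jr(1) True by auto
          then show "y \<in> H"
            unfolding jr(3) by (rule submodD(4)[OF H(1) _ submodD(5)[OF H(1) jr(2) h(1)]])
        qed
        then show False using H(3) by blast
      qed
      ultimately show ?thesis using True by (simp add: l'_def)
    qed
  qed
  then show ?thesis by (rule fin_lenI)
qed

definition mspan :: "('a, 'm) module \<Rightarrow> 'm set \<Rightarrow> 'm set" where
  "mspan M S = \<Inter>{G. submod G M \<and> S \<subseteq> G}"

lemma mspan_submod:
  assumes "lm M" "S \<subseteq> carrier M"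
  shows "submod (mspan M S) M"
proof (rule submodI[OF assms(1)])
  show "mspan M S \<subseteq> carrier M"
    using submod_carrier[OF assms(1)] assms(2) by (auto simp: mspan_def)
qed (simp_all add: mspan_def submodD(3-5))

lemma mspan_superset: "S \<subseteq> mspan M S"
  by (auto simp: mspan_def)

lemma mspan_least: "submod G M \<Longrightarrow> S \<subseteq> G \<Longrightarrow> mspan M S \<subseteq> G"
  by (auto simp: mspan_def)

lemma mspan_insert:
  assumes lm: "lm M" and S: "S \<subseteq> carrier M" "x \<in> carrier M" and y: "y \<in> mspan M (insert x S)"
  shows "\<exists>r\<in>carrier L. \<exists>m\<in>mspan M S. y = r \<odot>\<^bsub>M\<^esub> x \<oplus>\<^bsub>M\<^esub> m"
proof -
  let ?G = "{r \<odot>\<^bsub>M\<^esub> x \<oplus>\<^bsub>M\<^esub> m | r m. r \<in> carrier L \<and> m \<in> mspan M S}"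
  note D = submodD[OF mspan_submod[OF lm S(1)]]
  have "submod ?G M"
  proof (rule submodI[OF lm])
    show "?G \<subseteq> carrier M" using lm S D by auto
    show "\<zero>\<^bsub>M\<^esub> \<in> ?G"
      using lm S D(3) by (auto intro!: exI[of _ \<zero>] exI[of _ "\<zero>\<^bsub>M\<^esub>"])
    fix u v assume "u \<in> ?G" "v \<in> ?G"
    then obtain r m r' m' where *: "u = r \<odot>\<^bsub>M\<^esub> x \<oplus>\<^bsub>M\<^esub> m" "v = r' \<odot>\<^bsub>M\<^esub> x \<oplus>\<^bsub>M\<^esub> m'"
      "r \<in> carrier L" "r' \<in> carrier L" "m \<in> mspan M S" "m' \<in> mspan M S" by auto
    have "u \<oplus>\<^bsub>M\<^esub> v = (r \<oplus> r') \<odot>\<^bsub>M\<^esub> x \<oplus>\<^bsub>M\<^esub> (m \<oplus>\<^bsub>M\<^esub> m')"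
      using * D(2) S lm by (simp add: add_smult lm_ac)
    moreover have "m \<oplus>\<^bsub>M\<^esub> m' \<in> mspan M S" "r \<oplus> r' \<in> carrier L" using * D(4) by auto
    ultimately show "u \<oplus>\<^bsub>M\<^esub> v \<in> ?G" by blast
  next
    fix a u assume a: "a \<in> carrier L" and "u \<in> ?G"
    then obtain r m where *: "u = r \<odot>\<^bsub>M\<^esub> x \<oplus>\<^bsub>M\<^esub> m" "r \<in> carrier L" "m \<in> mspan M S" by auto
    have "a \<odot>\<^bsub>M\<^esub> u = (a \<otimes> r) \<odot>\<^bsub>M\<^esub> x \<oplus>\<^bsub>M\<^esub> a \<odot>\<^bsub>M\<^esub> m"
      using * D(2) S lm a by (simp add: smult_add mult_smult)
    moreover have "a \<odot>\<^bsub>M\<^esub> m \<in> mspan M S" "a \<otimes> r \<in> carrier L" using * D(5) a by auto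
    ultimately show "a \<odot>\<^bsub>M\<^esub> u \<in> ?G" by blast
  qed
  moreover have "insert x S \<subseteq> ?G"
  proof -
    have "x = \<one> \<odot>\<^bsub>M\<^esub> x \<oplus>\<^bsub>M\<^esub> \<zero>\<^bsub>M\<^esub>" using lm S by simp
    then have "x \<in> ?G" using D(3) by blast
    moreover have "s \<in> ?G" if "s \<in> S" for s
    proof -
      have "s = \<zero> \<odot>\<^bsub>M\<^esub> x \<oplus>\<^bsub>M\<^esub> s" using lm S that by auto
      then show ?thesis using that mspan_superset[of S M] by blast
    qed
    ultimately show ?thesis by blast
  qed
  ultimately show ?thesis using mspan_least y by blast
qed

lemma submod_finsum:
  assumes "lm M" "submod H M" "finite S" "f \<in> S \<rightarrow> H"
  shows "(\<Oplus>\<^bsub>M\<^esub>s\<in>S. f s) \<in> H"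
proof -
  interpret M: abelian_group M using lm_group[OF assms(1)] .
  show ?thesis
    using assms(3,4)
  proof (induction S)
    case empty
    then show ?case using submodD(3)[OF assms(2)] by simp
  next
    case (insert x S)
    have "f \<in> S \<rightarrow> carrier M" "f x \<in> carrier M" using insert submodD(2)[OF assms(2)] by auto
    then show ?case using insert submodD(4)[OF assms(2)] by auto
  qed
qed

text \<open>Replaces coefficient functions by the smallest submodule containing \<open>S\<close>,
  whose behaviour under images and direct sums follows from minimality alone.\<close>

lemma fg_iff_mspan:
  "fg_left_module L M \<longleftrightarrow> lm M \<and> (\<exists>S. finite S \<and> S \<subseteq> carrier M \<and> mspan M S = carrier M)"
proof
  assume fg: "fg_left_module L M"
  then have lm: "lm M" by (simp add: fg_left_module_def)
  obtain S where S: "finite S" "S \<subseteq> carrier M"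
    "\<forall>x\<in>carrier M. \<exists>c\<in>S \<rightarrow> carrier L. x = (\<Oplus>\<^bsub>M\<^esub>s\<in>S. c s \<odot>\<^bsub>M\<^esub> s)"
    using fg_left_module.finitely_generated[OF fg] by blast
  have sub: "submod (mspan M S) M" by (rule mspan_submod[OF lm S(2)])
  have "x \<in> mspan M S" if x: "x \<in> carrier M" for x
  proof -
    obtain c where c: "c \<in> S \<rightarrow> carrier L" "x = (\<Oplus>\<^bsub>M\<^esub>s\<in>S. c s \<odot>\<^bsub>M\<^esub> s)" using S x by blast
    show ?thesis unfolding c(2)
      using c(1) submodD(5)[OF sub] mspan_superset[of S M]
      by (intro submod_finsum[OF lm sub S(1)]) blast
  qed
  then show "lm M \<and> (\<exists>S. finite S \<and> S \<subseteq> carrier M \<and> mspan M S = carrier M)"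
    using lm S(1,2) submodD(1)[OF sub] by blast
next
  assume "lm M \<and> (\<exists>S. finite S \<and> S \<subseteq> carrier M \<and> mspan M S = carrier M)"
  then obtain S where lm: "lm M" and S: "finite S" "S \<subseteq> carrier M" "mspan M S = carrier M" by blast
  interpret M: abelian_group M using lm_group[OF lm] .
  have "\<exists>c\<in>S \<rightarrow> carrier L. x = (\<Oplus>\<^bsub>M\<^esub>s\<in>S. c s \<odot>\<^bsub>M\<^esub> s)" if "x \<in> mspan M S" for x
    using S(1,2) that
  proof (induction S arbitrary: x)
    case empty
    have "x \<in> {\<zero>\<^bsub>M\<^esub>}" using empty(2) mspan_least[OF submod_zero[OF lm], of "{}"] by blast
    then show ?case by simp
  next
    case (insert s S)
    obtain r m where rm: "r \<in> carrier L" "m \<in> mspan M S" "x = r \<odot>\<^bsub>M\<^esub> s \<oplus>\<^bsub>M\<^esub> m"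
      using mspan_insert[OF lm _ _ insert.prems(2)] insert.prems(1) by auto
    obtain c where c: "c \<in> S \<rightarrow> carrier L" "m = (\<Oplus>\<^bsub>M\<^esub>s\<in>S. c s \<odot>\<^bsub>M\<^esub> s)"
      using insert.IH[OF _ rm(2)] insert.prems(1) by auto
    have "(\<Oplus>\<^bsub>M\<^esub>t\<in>S. (c(s := r)) t \<odot>\<^bsub>M\<^esub> t) = m"
      unfolding c(2) using c(1) insert.prems(1) insert.hyps lm
      by (intro M.finsum_cong') (auto simp: Pi_iff subset_iff)
    moreover have "(\<lambda>t. (c(s := r)) t \<odot>\<^bsub>M\<^esub> t) \<in> S \<rightarrow> carrier M"
      using c(1) insert.prems(1) insert.hyps lm rm(1) by (auto simp: Pi_iff subset_iff)
    ultimately have "(\<Oplus>\<^bsub>M\<^esub>t\<in>insert s S. (c(s := r)) t \<odot>\<^bsub>M\<^esub> t) = x"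
      using insert.hyps insert.prems(1) lm rm by (subst M.finsum_insert) auto
    then show ?case using c(1) rm(1) by (intro bexI[of _ "c(s := r)"]) auto
  qed
  then show "fg_left_module L M"
    using lm S by (intro fg_left_module.intro fg_left_module_axioms.intro exI[of _ S]) auto
qed

text \<open>The colon ideal \<open>{r. r x \<in> H + \<langle>S\<rangle>}\<close> measures what the generator \<open>x\<close> contributes.\<close>

lemma fin_len_generated:
  fixes M :: "('a, 'm) module"
  assumes lm: "lm M" and self: "fin_len self_mod"
    and S: "finite S" "S \<subseteq> carrier M"
  shows "fin_len (restr M (mspan M S))"
  using S
proof (induction S)
  case empty
  have "mspan M {} = {\<zero>\<^bsub>M\<^esub>}"
    using mspan_least[OF submod_zero[OF lm], of "{}"] submodD(3)[OF mspan_submod[OF lm, of "{}"]] by auto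
  moreover have "fin_len (restr M {\<zero>\<^bsub>M\<^esub>})"
    unfolding fin_len_def
  proof (intro exI allI impI)
    fix H K assume "submod H (restr M {\<zero>\<^bsub>M\<^esub>}) \<and> submod K (restr M {\<zero>\<^bsub>M\<^esub>}) \<and> H \<subset> K"
    then have "\<zero>\<^bsub>M\<^esub> \<in> H" "K \<subseteq> {\<zero>\<^bsub>M\<^esub>}" "H \<subset> K"
      using submodD(3)[of H "restr M {\<zero>\<^bsub>M\<^esub>}"] submodD(1)[of K "restr M {\<zero>\<^bsub>M\<^esub>}"] by auto
    then show "0 < (0::nat)" by blast
  qed
  ultimately show ?case by simp
next
  case (insert x S)
  then have xS: "x \<in> carrier M" "S \<subseteq> carrier M" by auto
  let ?A = "mspan M S" and ?B = "mspan M (insert x S)"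
  have A: "submod ?A M" and B: "submod ?B M"
    using mspan_submod[OF lm] insert.prems by auto
  note AD = submodD[OF A]
  obtain l1 :: "'m set \<Rightarrow> nat" where l1: "\<And>H K. submod H (restr M ?A) \<Longrightarrow>
      submod K (restr M ?A) \<Longrightarrow> H \<subset> K \<Longrightarrow> l1 H < l1 K"
    using insert.IH[OF xS(2)] unfolding fin_len_def by blast
  obtain l2 :: "'a set \<Rightarrow> nat" where l2: "\<And>H K. submod H self_mod \<Longrightarrow>
      submod K self_mod \<Longrightarrow> H \<subset> K \<Longrightarrow> l2 H < l2 K"
    using self unfolding fin_len_def by blast
  define C where "C H = {r \<in> carrier L. \<exists>m\<in>?A. r \<odot>\<^bsub>M\<^esub> x \<oplus>\<^bsub>M\<^esub> m \<in> H}" for H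
  have C: "submod (C H) self_mod" if H: "submod H M" for H
  proof (rule submodI[OF self_mod_lm])
    note HD = submodD[OF H]
    show "C H \<subseteq> carrier self_mod" by (auto simp: C_def)
    show "\<zero>\<^bsub>self_mod\<^esub> \<in> C H"
      using AD(3) HD(3) lm xS(1) by (auto simp: C_def intro!: bexI[of _ "\<zero>\<^bsub>M\<^esub>"])
    fix u v assume "u \<in> C H" "v \<in> C H"
    then obtain m n where *: "u \<in> carrier L" "v \<in> carrier L" "m \<in> ?A" "n \<in> ?A"
      "u \<odot>\<^bsub>M\<^esub> x \<oplus>\<^bsub>M\<^esub> m \<in> H" "v \<odot>\<^bsub>M\<^esub> x \<oplus>\<^bsub>M\<^esub> n \<in> H" by (auto simp: C_def)
    have "(u \<oplus> v) \<odot>\<^bsub>M\<^esub> x \<oplus>\<^bsub>M\<^esub> (m \<oplus>\<^bsub>M\<^esub> n) = (u \<odot>\<^bsub>M\<^esub> x \<oplus>\<^bsub>M\<^esub> m) \<oplus>\<^bsub>M\<^esub> (v \<odot>\<^bsub>M\<^esub> x \<oplus>\<^bsub>M\<^esub> n)"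
      using * AD(2) xS lm by (simp add: add_smult lm_ac)
    then have "(u \<oplus> v) \<odot>\<^bsub>M\<^esub> x \<oplus>\<^bsub>M\<^esub> (m \<oplus>\<^bsub>M\<^esub> n) \<in> H" using HD(4)[OF *(5,6)] by simp
    then show "u \<oplus>\<^bsub>self_mod\<^esub> v \<in> C H" using AD(4)[OF *(3,4)] * by (auto simp: C_def)
  next
    note HD = submodD[OF H]
    fix a u assume a: "a \<in> carrier L" and "u \<in> C H"
    then obtain m where *: "u \<in> carrier L" "m \<in> ?A" "u \<odot>\<^bsub>M\<^esub> x \<oplus>\<^bsub>M\<^esub> m \<in> H" by (auto simp: C_def)
    have "(a \<otimes> u) \<odot>\<^bsub>M\<^esub> x \<oplus>\<^bsub>M\<^esub> a \<odot>\<^bsub>M\<^esub> m = a \<odot>\<^bsub>M\<^esub> (u \<odot>\<^bsub>M\<^esub> x \<oplus>\<^bsub>M\<^esub> m)"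
      using * AD(2) xS lm a by (simp add: smult_add mult_smult)
    then have "(a \<otimes> u) \<odot>\<^bsub>M\<^esub> x \<oplus>\<^bsub>M\<^esub> a \<odot>\<^bsub>M\<^esub> m \<in> H" using HD(5)[OF a *(3)] by simp
    then show "a \<odot>\<^bsub>self_mod\<^esub> u \<in> C H" using AD(5)[OF a *(2)] * a by (auto simp: C_def)
  qed
  have "l1 (H \<inter> ?A) + l2 (C H) < l1 (K \<inter> ?A) + l2 (C K)"
    if H: "submod H M" "submod K M" "H \<subset> K" "K \<subseteq> ?B" for H K
  proof -
    note D = submodD[OF H(1)] submodD[OF H(2)]
    have s1: "submod (X \<inter> ?A) (restr M ?A)" if "submod X M" for X
      using submod_Int[OF lm that A] submod_restr[OF lm A] by blast
    have CC: "C H \<subseteq> C K" using H(3) by (auto simp: C_def)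
    have le1: "l1 (H \<inter> ?A) \<le> l1 (K \<inter> ?A)"
      using H(3) by (intro strict_mono_le[where l = l1, OF l1[OF s1[OF H(1)] s1[OF H(2)]]]) blast+
    have le2: "l2 (C H) \<le> l2 (C K)"
      by (rule strict_mono_le[where l = l2, OF l2[OF C[OF H(1)] C[OF H(2)]] CC])
    have "H \<inter> ?A \<noteq> K \<inter> ?A \<or> C H \<noteq> C K"
    proof (rule ccontr)
      assume "\<not> ?thesis"
      then have eq: "H \<inter> ?A = K \<inter> ?A" "C H = C K" by auto
      have "y \<in> H" if y: "y \<in> K" for y
      proof -
        have "y \<in> ?B" using y H(4) by blast
        then obtain r m where rm: "r \<in> carrier L" "m \<in> ?A" "y = r \<odot>\<^bsub>M\<^esub> x \<oplus>\<^bsub>M\<^esub> m"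
          using mspan_insert[OF lm xS(2,1)] by blast
        then have "r \<in> C K" using y by (auto simp: C_def)
        \<comment> \<open>\<open>H\<close> thus contains an element with the same coefficient
          \<open>r\<close> at \<open>x\<close> as \<open>y\<close>. Their difference lies in
          \<open>K\<close> and in the span of \<open>S\<close>, hence in \<open>H\<close>.\<close>
        then have "r \<in> C H" using eq(2) by simp
        then obtain n where n: "n \<in> ?A" "r \<odot>\<^bsub>M\<^esub> x \<oplus>\<^bsub>M\<^esub> n \<in> H" by (auto simp: C_def)
        have c: "n \<in> carrier M" "m \<in> carrier M" "r \<odot>\<^bsub>M\<^esub> x \<in> carrier M" using AD(2) rm n xS lm by auto
        have e: "y \<oplus>\<^bsub>M\<^esub> \<ominus>\<^bsub>M\<^esub> (r \<odot>\<^bsub>M\<^esub> x \<oplus>\<^bsub>M\<^esub> n) = m \<oplus>\<^bsub>M\<^esub> \<ominus>\<^bsub>M\<^esub> n"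
          using c lm unfolding rm(3) by (simp add: lm_ac(1,4) lm_ac(3)[of M m])
        have nK: "r \<odot>\<^bsub>M\<^esub> x \<oplus>\<^bsub>M\<^esub> n \<in> K" using n(2) H(3) by blast
        have "m \<oplus>\<^bsub>M\<^esub> \<ominus>\<^bsub>M\<^esub> n \<in> K" using submod_diff[OF H(2) y nK] unfolding e .
        moreover have "m \<oplus>\<^bsub>M\<^esub> \<ominus>\<^bsub>M\<^esub> n \<in> ?A" using AD(4)[OF rm(2) AD(6)[OF n(1)]] .
        ultimately have "m \<oplus>\<^bsub>M\<^esub> \<ominus>\<^bsub>M\<^esub> n \<in> H" using eq(1) by blast
        then have "(r \<odot>\<^bsub>M\<^esub> x \<oplus>\<^bsub>M\<^esub> n) \<oplus>\<^bsub>M\<^esub> (m \<oplus>\<^bsub>M\<^esub> \<ominus>\<^bsub>M\<^esub> n) \<in> H"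
          by (rule submodD(4)[OF H(1) n(2)])
        then show "y \<in> H" using c lm unfolding rm(3) by (simp add: lm_ac(1))
      qed
      then show False using H(3) by blast
    qed
    then show ?thesis
    proof
      assume "H \<inter> ?A \<noteq> K \<inter> ?A"
      then have "H \<inter> ?A \<subset> K \<inter> ?A" using H(3) by blast
      then show ?thesis using l1[OF s1[OF H(1)] s1[OF H(2)]] le2 by linarith
    next
      assume "C H \<noteq> C K"
      then have "C H \<subset> C K" using CC by blast
      then show ?thesis using l2[OF C[OF H(1)] C[OF H(2)]] le1 by linarith
    qed
  qed
  then show ?case
    by (intro fin_lenI[where l = "\<lambda>H. l1 (H \<inter> ?A) + l2 (C H)"]) (simp add: submod_restr[OF lm B])
qed

end

text \<open>A minimal ideal \<open>I\<close> of infinite length satisfies \<open>aI = 0\<close> or \<open>aI = I\<close> for every \<open>a\<close>, so it is a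
  vector space over a residue field; a maximal subspace avoiding a given vector is a hyperplane.\<close>

lemma (in artinian_cring) artinian_fin_len: "left_modules.fin_len R (left_modules.self_mod R)"
proof -
  interpret left_modules R by unfold_locales
  note lm = self_mod_lm
  have ideal: "submod I self_mod \<Longrightarrow> ideal I R" for I
  proof -
    assume I: "submod I self_mod"
    note D = submodD[OF I]
    show "ideal I R"
    proof (rule idealI[OF ring_axioms])
      show "subgroup I (add_monoid R)"
      proof
        fix x assume "x \<in> I"
        moreover from this have "(\<ominus> \<one>) \<otimes> x = \<ominus> x" using D(2)[of x] by (simp add: l_minus)
        ultimately have "\<ominus> x \<in> I" using D(5)[of "\<ominus> \<one>" x] by simp
        then show "inv\<^bsub>add_monoid R\<^esub> x \<in> I" by (simp add: a_inv_def)
      qed (use D in auto)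
      fix a x assume ax: "a \<in> I" "x \<in> carrier R"
      show xa: "x \<otimes> a \<in> I" using D(5)[OF ax(2,1)] by simp
      then show "a \<otimes> x \<in> I" using m_comm[OF ax(2)] D(2)[OF ax(1)] by simp
    qed
  qed
  have min: "\<exists>I\<in>S. \<forall>K\<in>S. K \<subseteq> I \<longrightarrow> K = I"
    if "H0 \<in> S" and S: "\<And>H. H \<in> S \<Longrightarrow> submod H self_mod" for S and H0 :: "'a set"
  proof (rule ccontr)
    assume "\<not> ?thesis"
    then have "\<forall>I\<in>S. \<exists>K\<in>S. K \<subset> I" by blast
    then have "\<exists>f. \<forall>n::nat. f n \<in> S \<and> f (Suc n) \<subset> f n"
      using dependent_nat_choice[of "\<lambda>_ I. I \<in> S" "\<lambda>_ I K. K \<subset> I"] \<open>H0 \<in> S\<close> by blast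
    then obtain f :: "nat \<Rightarrow> 'a set" where f: "\<And>n. f n \<in> S" "\<And>n. f (Suc n) \<subset> f n" by blast
    have "\<exists>n. \<forall>m\<ge>n. f m = f n"
      using f ideal[OF S] by (intro descending_chain_condition) auto
    then obtain n where "f (Suc n) = f n" by (meson le_Suc_eq le_refl)
    then show False using f(2)[of n] by simp
  qed
  have "fin_len (restr self_mod H)" if H: "submod H self_mod" for H
  proof (rule ccontr)
    assume "\<not> ?thesis"
    then have "H \<in> {H. submod H self_mod \<and> \<not> fin_len (restr self_mod H)}" using H by blast
    then obtain I where I: "submod I self_mod" "\<not> fin_len (restr self_mod I)"
      and min_I: "\<And>K. submod K self_mod \<Longrightarrow> K \<subset> I \<Longrightarrow> fin_len (restr self_mod K)"
      using min[of H "{H. submod H self_mod \<and> \<not> fin_len (restr self_mod H)}"] by blast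
    note ID = submodD[OF I(1)]
    let ?I = "restr self_mod I"
    have lmI: "lm ?I" by (rule restr_lm[OF lm I(1)])
    have sub: "submod K ?I \<longleftrightarrow> submod K self_mod \<and> K \<subseteq> I" for K by (rule submod_restr[OF lm I(1)])
    have flK: "fin_len (restr ?I K)" if "submod K ?I" "K \<noteq> I" for K
      using min_I[of K] that sub by (simp add: psubset_eq)
    \<comment> \<open>Kernel and image of multiplication by \<open>a\<close> are submodules of
      \<open>I\<close>. If both were proper, they would have finite length by minimality, and then
      so would \<open>I\<close>.\<close>
    have dich: "(\<forall>x\<in>I. a \<otimes> x = \<zero>) \<or> (\<lambda>x. a \<otimes> x) ` I = I" if a: "a \<in> carrier R" for a
    proof (rule ccontr)
      assume c: "\<not> ?thesis"
      have h: "(\<lambda>x. a \<otimes> x) \<in> hom ?I ?I"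
        using a ID by (intro homI) (auto simp: r_distr m_lcomm)
      have "fin_len ?I"
      proof (rule fin_len_extension[OF lmI lmI h])
        show "fin_len (restr ?I (mod_ker ?I ?I ((\<otimes>) a)))"
          using c by (intro flK ker_submod[OF lmI lmI h]) (auto simp: mod_ker_def)
        show "fin_len (restr ?I ((\<otimes>) a ` carrier ?I))"
          using c by (intro flK image_submod[OF lmI lmI h] submod_carrier[OF lmI]) auto
      qed
      then show False using I(2) by blast
    qed
    \<comment> \<open>The chain of ideals generated by the powers of \<open>a\<close> stops, so
      \<open>a^n = b a^(n+1)\<close> for some \<open>b\<close>. If \<open>a I = I\<close>, every
      \<open>x\<close> in \<open>I\<close> is some \<open>a^n y\<close>, whence
      \<open>b a x = x\<close>.\<close>
    have inv: "(\<forall>x\<in>I. a \<otimes> x = \<zero>) \<or> (\<exists>b\<in>carrier R. \<forall>x\<in>I. b \<otimes> (a \<otimes> x) = x)" if a: "a \<in> carrier R" for a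
    proof (cases "\<forall>x\<in>I. a \<otimes> x = \<zero>")
      case False
      then have aI: "(\<lambda>x. a \<otimes> x) ` I = I" using dich a by blast
      have anI: "(\<lambda>x. a [^] n \<otimes> x) ` I = I" for n :: nat
      proof (induction n)
        case 0
        then show ?case using ID by (auto simp: image_def)
      next
        case (Suc n)
        have "(\<lambda>x. a [^] Suc n \<otimes> x) ` I = (\<lambda>x. a [^] n \<otimes> x) ` (\<lambda>x. a \<otimes> x) ` I"
          unfolding image_image using ID(2) a by (intro image_cong) (auto simp: m_assoc)
        then show ?case using aI Suc by simp
      qed
      have "\<exists>n::nat. \<forall>m\<ge>n. PIdl (a [^] m) = PIdl (a [^] n)"
      proof (rule descending_chain_condition[of "\<lambda>n. PIdl (a [^] n)"])
        fix n :: nat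
        show "ideal (PIdl (a [^] n)) R" using a by (intro cgenideal_ideal) simp
        have "PIdl (a [^] Suc n) \<subseteq> PIdl (a [^] n)"
          using cgenideal_ideal[of "a [^] n"] a
          by (intro cgenideal_minimal) (auto simp: cgenideal_def m_comm)
        then show "PIdl (a [^] Suc n) \<subseteq> PIdl (a [^] n)" .
      qed
      then obtain n :: nat where n: "PIdl (a [^] Suc n) = PIdl (a [^] n)" by (meson le_Suc_eq le_refl)
      have "a [^] n \<in> PIdl (a [^] Suc n)" unfolding n using a by (intro cgenideal_self) auto
      then obtain b where b: "b \<in> carrier R" "a [^] n = b \<otimes> a [^] Suc n"
        unfolding cgenideal_def by blast
      have "b \<otimes> (a \<otimes> x) = x" if "x \<in> I" for x
      proof -
        have "x \<in> (\<lambda>x. a [^] n \<otimes> x) ` I" unfolding anI by (rule that)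
        then obtain y where y: "y \<in> I" "x = a [^] n \<otimes> y" by (rule imageE)
        have c: "y \<in> carrier R" "a [^] n \<in> carrier R" using y(1) ID(2)[of y] a by auto
        have e: "a [^] Suc n = a \<otimes> a [^] n" using a m_comm[OF a c(2)] by simp
        have "b \<otimes> (a \<otimes> x) = (b \<otimes> a [^] Suc n) \<otimes> y"
          unfolding y(2) e using b(1) a c by (simp add: m_assoc)
        then show ?thesis unfolding b(2)[symmetric] y(2)[symmetric] .
      qed
      then show ?thesis using b(1) by blast
    qed auto
    obtain x where x: "x \<in> I" "x \<noteq> \<zero>"
    proof (rule ccontr)
      assume "\<not> thesis"
      then have "I \<subseteq> {\<zero>}" using that by blast
      then have "\<not> (submod H ?I \<and> submod K ?I \<and> H \<subset> K)" for H K
        using sub[of H] sub[of K] submodD(3)[of H self_mod] by auto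
      then show False using I(2) unfolding fin_len_def by blast
    qed
    let ?Z = "{J. submod J ?I \<and> x \<notin> J}"
    have "\<exists>J\<in>?Z. \<forall>X\<in>?Z. J \<subseteq> X \<longrightarrow> X = J"
    proof (rule subset_Zorn_nonempty)
      show "?Z \<noteq> {}" using submod_zero[OF lmI] x by auto
      fix C assume C: "C \<noteq> {}" "subset.chain ?Z C"
      have CZ: "\<And>J. J \<in> C \<Longrightarrow> submod J ?I \<and> x \<notin> J"
        and tot: "\<And>J K. J \<in> C \<Longrightarrow> K \<in> C \<Longrightarrow> J \<subseteq> K \<or> K \<subseteq> J"
        using C(2) by (auto simp: subset_chain_def)
      have "submod (\<Union>C) ?I"
      proof (rule submodI[OF lmI])
        show "\<Union>C \<subseteq> carrier ?I" using CZ submodD(1) by blast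
        show "\<zero>\<^bsub>?I\<^esub> \<in> \<Union>C" using C(1) CZ submodD(3) by blast
        fix u v assume "u \<in> \<Union>C" "v \<in> \<Union>C"
        then obtain J where J: "J \<in> C" "u \<in> J" "v \<in> J" using tot by blast
        have "u \<oplus>\<^bsub>?I\<^esub> v \<in> J" using CZ[OF J(1)] J(2,3) by (intro submodD(4)) auto
        then show "u \<oplus>\<^bsub>?I\<^esub> v \<in> \<Union>C" using J(1) by blast
      next
        fix a u assume a: "a \<in> carrier R" and "u \<in> \<Union>C"
        then obtain J where J: "J \<in> C" "u \<in> J" by blast
        have "a \<odot>\<^bsub>?I\<^esub> u \<in> J" using CZ[OF J(1)] J(2) a by (intro submodD(5)) auto
        then show "a \<odot>\<^bsub>?I\<^esub> u \<in> \<Union>C" using J(1) by blast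
      qed
      then show "\<Union>C \<in> ?Z" using CZ by blast
    qed
    then obtain J where J: "submod J ?I" "x \<notin> J"
      and max: "\<And>X. submod X ?I \<Longrightarrow> x \<notin> X \<Longrightarrow> J \<subseteq> X \<Longrightarrow> X = J" by blast
    note JD = submodD[OF J(1)]
    have JI: "J \<subseteq> I" using J(1) sub by blast
    have "fin_len ?I"
    proof (rule fin_len_simple_top[OF lmI J(1)])
      show "fin_len (restr ?I J)" using flK[OF J(1)] J(2) x(1) by blast
      fix h y assume h: "h \<in> carrier ?I - J" and "y \<in> carrier ?I"
      then have hI: "h \<in> I" "h \<notin> J" "y \<in> I" by auto
      \<comment> \<open>By maximality of \<open>J\<close>, the vector \<open>x\<close> is modulo
        \<open>J\<close> a multiple of any element outside \<open>J\<close>, with a coefficient that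
        acts invertibly on \<open>I\<close>. So \<open>y\<close> is a multiple of \<open>x\<close>,
        and thus of \<open>h\<close>, modulo \<open>J\<close>.\<close>
      let ?X = "mspan ?I (insert h J)"
      have X: "submod ?X ?I" using hI JI by (intro mspan_submod[OF lmI]) auto
      have "J \<subseteq> ?X" "h \<in> ?X" using mspan_superset[of "insert h J" ?I] by auto
      then have "x \<in> ?X" using max[OF X] hI(2) by blast
      then obtain r j where rj: "r \<in> carrier R" "j \<in> mspan ?I J" "x = r \<odot>\<^bsub>?I\<^esub> h \<oplus>\<^bsub>?I\<^esub> j"
        using mspan_insert[OF lmI, of J h x] hI JI by auto
      have j: "j \<in> J" using rj(2) mspan_least[OF J(1), of J] by blast
      have rh: "r \<otimes> h \<noteq> \<zero>"
      proof
        assume "r \<otimes> h = \<zero>"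
        then have "x = j" using rj(3) j JI ID(2) by auto
        then show False using J(2) j by blast
      qed
      then obtain b where b: "b \<in> carrier R" "\<And>z. z \<in> I \<Longrightarrow> b \<otimes> (r \<otimes> z) = z"
        using inv[OF rj(1)] hI(1) by blast
      have "h = b \<otimes> (r \<otimes> h)" using b hI by simp
      obtain s i where si: "s \<in> carrier R" "i \<in> J" "y = i \<oplus> s \<otimes> h"
      proof (cases "y \<in> J")
        case True
        then show thesis using that[of \<zero> y] hI ID(2) by auto
      next
        case False
        let ?Y = "mspan ?I (insert y J)"
        have Y: "submod ?Y ?I" using hI JI by (intro mspan_submod[OF lmI]) auto
        have "J \<subseteq> ?Y" "y \<in> ?Y" using mspan_superset[of "insert y J" ?I] by auto
        then have "x \<in> ?Y" using max[OF Y] False by blast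
        then obtain t i where ti: "t \<in> carrier R" "i \<in> mspan ?I J" "x = t \<odot>\<^bsub>?I\<^esub> y \<oplus>\<^bsub>?I\<^esub> i"
          using mspan_insert[OF lmI, of J y x] hI JI by auto
        have i: "i \<in> J" using ti(2) mspan_least[OF J(1), of J] by blast
        have "t \<otimes> y \<noteq> \<zero>"
        proof
          assume "t \<otimes> y = \<zero>"
          then have "x = i" using ti(3) i JI ID(2) by auto
          then show False using J(2) i by blast
        qed
        then obtain c where c: "c \<in> carrier R" "\<And>z. z \<in> I \<Longrightarrow> c \<otimes> (t \<otimes> z) = z"
          using inv[OF ti(1)] hI(3) by blast
        have cr: "h \<in> carrier R" "y \<in> carrier R" "i \<in> carrier R" "j \<in> carrier R"
          using hI i j JI ID(2) by auto
        have "t \<otimes> y = (t \<otimes> y \<oplus> i) \<oplus> \<ominus> i" using cr ti(1) by (simp add: a_assoc r_neg)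
        also have "t \<otimes> y \<oplus> i = r \<otimes> h \<oplus> j" using ti(3) rj(3) by simp
        also have "r \<otimes> h \<oplus> j \<oplus> \<ominus> i = r \<otimes> h \<oplus> (j \<oplus> \<ominus> i)" using cr rj(1) by (simp add: a_assoc)
        finally have "y = c \<otimes> (r \<otimes> h \<oplus> (j \<oplus> \<ominus> i))" using c(2)[OF hI(3)] by simp
        also have "\<dots> = c \<otimes> (j \<oplus> \<ominus> i) \<oplus> (c \<otimes> r) \<otimes> h"
          using cr c(1) rj(1) by (simp add: r_distr m_assoc a_ac)
        finally have y: "y = c \<otimes> (j \<oplus> \<ominus> i) \<oplus> (c \<otimes> r) \<otimes> h" .
        have "\<ominus> i = (\<ominus> \<one>) \<odot>\<^bsub>?I\<^esub> i" using cr by (simp add: l_minus)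
        then have "\<ominus> i \<in> J" using JD(5)[OF _ i, of "\<ominus> \<one>"] by simp
        then have "c \<otimes> (j \<oplus> \<ominus> i) \<in> J" using JD(4)[OF j] JD(5)[OF c(1)] by simp
        then show thesis using that[of "c \<otimes> r" "c \<otimes> (j \<oplus> \<ominus> i)"] y c(1) rj(1) by simp
      qed
      then show "\<exists>j\<in>J. \<exists>r\<in>carrier R. y = j \<oplus>\<^bsub>?I\<^esub> r \<odot>\<^bsub>?I\<^esub> h" by auto
    qed
    then show False using I(2) by blast
  qed
  from this[OF submod_carrier[OF lm]] show ?thesis by (simp add: self_mod_def)
qed

text \<open>Over \<open>R\<close> the module is generated by the finitely many products of algebra
  generators with module generators, so it has finite length over \<open>R\<close>. Submodules over
  the algebra are submodules over \<open>R\<close>, and the same length function serves.\<close>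

lemma artin_algebra_fin_len:
  fixes R :: "('k, 'r) ring_scheme" (structure) and \<Lambda> :: "('a, 's) ring_scheme"
    and \<phi> :: "'k \<Rightarrow> 'a" and M :: "('a, 'm) module"
  assumes "artin_algebra R \<Lambda> \<phi>" and fg: "fg_left_module \<Lambda> M"
  shows "left_modules.fin_len \<Lambda> M"
proof -
  interpret artin_algebra R \<Lambda> \<phi> by fact
  interpret LR: left_modules R by unfold_locales
  interpret LA: left_modules \<Lambda> by unfold_locales
  have lm: "left_module \<Lambda> M" using fg by (simp add: fg_left_module_def)
  obtain S where S: "finite S" "S \<subseteq> carrier M" "LA.mspan M S = carrier M"
    using fg unfolding LA.fg_iff_mspan by blast
  obtain T where T: "finite T" "T \<subseteq> carrier \<Lambda>"
    "\<forall>x\<in>carrier \<Lambda>. \<exists>c\<in>T \<rightarrow> carrier R. x = (\<Oplus>\<^bsub>\<Lambda>\<^esub>s\<in>T. \<phi> (c s) \<otimes>\<^bsub>\<Lambda>\<^esub> s)"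
    using finitely_generated_algebra by blast
  have phi1: "\<phi> \<one> = \<one>\<^bsub>\<Lambda>\<^esub>" and phi0: "r \<in> carrier R \<Longrightarrow> \<phi> r \<in> carrier \<Lambda>" for r
    using structure_hom by (auto simp: ring_hom_def)
  have phi: "\<phi> (r \<otimes> s) = \<phi> r \<otimes>\<^bsub>\<Lambda>\<^esub> \<phi> s" "\<phi> (r \<oplus> s) = \<phi> r \<oplus>\<^bsub>\<Lambda>\<^esub> \<phi> s" if "r \<in> carrier R" "s \<in> carrier R" for r s
    using structure_hom that by (auto simp: ring_hom_def)
  define N :: "('k, 'm) module" where "N = \<lparr>carrier = carrier M, monoid.mult = undefined,
     one = undefined, ring.zero = \<zero>\<^bsub>M\<^esub>, ring.add = (\<oplus>\<^bsub>M\<^esub>),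
     smult = (\<lambda>r x. \<phi> r \<odot>\<^bsub>M\<^esub> x)\<rparr>"
  have N [simp]: "carrier N = carrier M" "\<zero>\<^bsub>N\<^esub> = \<zero>\<^bsub>M\<^esub>" "x \<oplus>\<^bsub>N\<^esub> y = x \<oplus>\<^bsub>M\<^esub> y"
    "r \<odot>\<^bsub>N\<^esub> x = \<phi> r \<odot>\<^bsub>M\<^esub> x" for r x y by (simp_all add: N_def)
  have lmN: "left_module R N"
  proof (rule LR.left_moduleI)
    show "\<exists>y\<in>carrier N. y \<oplus>\<^bsub>N\<^esub> x = \<zero>\<^bsub>N\<^esub>" if "x \<in> carrier N" for x
      using that lm by (intro bexI[of _ "\<ominus>\<^bsub>M\<^esub> x"]) auto
  qed (use lm phi phi0 phi1 in \<open>auto simp: LA.lm_ac LA.smult_add LA.add_smult LA.mult_smult\<close>)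
  define G where "G = LR.mspan N ((\<lambda>(t, s). t \<odot>\<^bsub>M\<^esub> s) ` (T \<times> S))"
  have gens: "finite ((\<lambda>(t, s). t \<odot>\<^bsub>M\<^esub> s) ` (T \<times> S))" "(\<lambda>(t, s). t \<odot>\<^bsub>M\<^esub> s) ` (T \<times> S) \<subseteq> carrier N"
    using S(1) T(1) subsetD[OF S(2)] subsetD[OF T(2)] lm by auto
  have G: "submodule G R N" unfolding G_def by (rule LR.mspan_submod[OF lmN gens(2)])
  note GD = LR.submodD[OF G]
  have ts: "t \<odot>\<^bsub>M\<^esub> s \<in> G" if "t \<in> T" "s \<in> S" for t s
    using LR.mspan_superset[of "(\<lambda>(t, s). t \<odot>\<^bsub>M\<^esub> s) ` (T \<times> S)" N] that by (auto simp: G_def)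
  have smultG: "\<phi> r \<odot>\<^bsub>M\<^esub> x \<in> G" if "r \<in> carrier R" "x \<in> G" for r x using GD(5)[OF that] by simp
  have gen_smult: "a \<odot>\<^bsub>M\<^esub> s \<in> G" if a: "a \<in> carrier \<Lambda>" and s: "s \<in> S" for a s
  proof -
    obtain c where c: "c \<in> T \<rightarrow> carrier R" "a = (\<Oplus>\<^bsub>\<Lambda>\<^esub>t\<in>T. \<phi> (c t) \<otimes>\<^bsub>\<Lambda>\<^esub> t)" using T a by blast
    have sM: "s \<in> carrier M" using s S by blast
    have "(\<Oplus>\<^bsub>\<Lambda>\<^esub>t\<in>U. \<phi> (c t) \<otimes>\<^bsub>\<Lambda>\<^esub> t) \<odot>\<^bsub>M\<^esub> s \<in> G" if "finite U" "U \<subseteq> T" for U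
      using that
    proof (induction U)
      case empty
      then show ?case using GD(3) lm sM by simp
    next
      case (insert t U)
      have ct: "c t \<in> carrier R" "t \<in> carrier \<Lambda>" "t \<in> T" using insert.prems c(1) T(2) by auto
      have pc: "\<phi> (c u) \<otimes>\<^bsub>\<Lambda>\<^esub> u \<in> carrier \<Lambda>" if "u \<in> insert t U" for u
        using that insert.prems c(1) T(2) phi0[of "c u"] by (intro A.m_closed) auto
      have f: "(\<Oplus>\<^bsub>\<Lambda>\<^esub>t\<in>U. \<phi> (c t) \<otimes>\<^bsub>\<Lambda>\<^esub> t) \<in> carrier \<Lambda>" using pc by (intro A.finsum_closed) auto
      have "(\<Oplus>\<^bsub>\<Lambda>\<^esub>t\<in>insert t U. \<phi> (c t) \<otimes>\<^bsub>\<Lambda>\<^esub> t) = \<phi> (c t) \<otimes>\<^bsub>\<Lambda>\<^esub> t \<oplus>\<^bsub>\<Lambda>\<^esub> (\<Oplus>\<^bsub>\<Lambda>\<^esub>t\<in>U. \<phi> (c t) \<otimes>\<^bsub>\<Lambda>\<^esub> t)"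
        using insert.hyps pc by (intro A.finsum_insert) auto
      then have "(\<Oplus>\<^bsub>\<Lambda>\<^esub>t\<in>insert t U. \<phi> (c t) \<otimes>\<^bsub>\<Lambda>\<^esub> t) \<odot>\<^bsub>M\<^esub> s =
          \<phi> (c t) \<odot>\<^bsub>M\<^esub> (t \<odot>\<^bsub>M\<^esub> s) \<oplus>\<^bsub>M\<^esub> (\<Oplus>\<^bsub>\<Lambda>\<^esub>t\<in>U. \<phi> (c t) \<otimes>\<^bsub>\<Lambda>\<^esub> t) \<odot>\<^bsub>M\<^esub> s"
        using pc[of t] f sM ct phi0[OF ct(1)] lm by (simp add: LA.add_smult LA.mult_smult)
      moreover have "\<phi> (c t) \<odot>\<^bsub>M\<^esub> (t \<odot>\<^bsub>M\<^esub> s) \<in> G" by (rule smultG[OF ct(1) ts[OF ct(3) s]])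
      ultimately show ?case using GD(4) insert by simp
    qed
    from this[OF T(1)] show ?thesis unfolding c(2) by simp
  qed
  \<comment> \<open>\<open>G\<close> is only known to be an \<open>R\<close>-submodule. The set of
    all \<open>x\<close> with \<open>\<Lambda> x\<close> inside \<open>G\<close> is a submodule over
    the algebra and contains the generators \<open>S\<close>, so it is everything.\<close>
  let ?H = "{x \<in> carrier M. \<forall>a\<in>carrier \<Lambda>. a \<odot>\<^bsub>M\<^esub> x \<in> G}"
  have "submodule ?H \<Lambda> M"
  proof (rule LA.submodI[OF lm])
    show "\<zero>\<^bsub>M\<^esub> \<in> ?H" using GD(3) lm by auto
    show "x \<oplus>\<^bsub>M\<^esub> y \<in> ?H" if "x \<in> ?H" "y \<in> ?H" for x y
      using GD(4) lm that by (auto simp: LA.smult_add)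
    show "a \<odot>\<^bsub>M\<^esub> x \<in> ?H" if "a \<in> carrier \<Lambda>" "x \<in> ?H" for a x
      using lm that by (auto simp flip: LA.mult_smult)
  qed auto
  moreover have "S \<subseteq> ?H" using gen_smult S(2) by blast
  ultimately have "carrier M \<subseteq> ?H" using LA.mspan_least[of ?H M S] S(3) by simp
  then have "\<one>\<^bsub>\<Lambda>\<^esub> \<odot>\<^bsub>M\<^esub> x \<in> G" if "x \<in> carrier M" for x using that by blast
  then have "carrier M \<subseteq> G" using lm by auto
  then have "G = carrier N" using GD(1) by auto
  then have "LR.fin_len (N\<lparr>carrier := carrier N\<rparr>)"
    using LR.fin_len_generated[OF lmN artinian_fin_len gens] by (simp add: G_def)
  then have "LR.fin_len N" by (simp add: N_def)
  then obtain l :: "'m set \<Rightarrow> nat" where l: "\<And>H K. submodule H R N \<Longrightarrow> submodule K R N \<Longrightarrow> H \<subset> K \<Longrightarrow> l H < l K"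
    unfolding LR.fin_len_def by blast
  have sub: "submodule H R N" if H: "submodule H \<Lambda> M" for H
    using LA.submodD[OF H] phi0 by (intro LR.submodI[OF lmN]) auto
  show ?thesis by (rule LA.fin_lenI[of M l]) (rule l[OF sub sub])
qed

text \<open>From here on Artin algebras enter only through finite length of their finitely generated
  modules, which gives kernels inside the category, Fitting's lemma and unique
  decompositions.\<close>

locale finite_length_modules = left_modules L for L :: "('a, 'r) ring_scheme" (structure) +
  assumes fg_fin_len: "M \<in> fg_modules L \<Longrightarrow> fin_len (M :: 'a fgmod)"
begin

abbreviation U :: "'a fgmod set" where "U \<equiv> fg_modules L"

section \<open>Finitely generated modules: images, sums and submodules\<close>

lemma U_lm [simp]: "M \<in> U \<Longrightarrow> lm M"
  by (simp add: fg_modules_def fg_left_module_def)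

lemma U_iff: "M \<in> U \<longleftrightarrow> fg_left_module L M"
  by (simp add: fg_modules_def)

lemma fg_image:
  assumes fg: "fg_left_module L M" and lm: "lm N" and g: "g \<in> hom M N" "g ` carrier M = carrier N"
  shows "fg_left_module L N"
proof -
  obtain S where S: "finite S" "S \<subseteq> carrier M" "mspan M S = carrier M" and lmM: "lm M"
    using fg unfolding fg_iff_mspan by blast
  have gS: "g ` S \<subseteq> carrier N" using S(2) g by blast
  have "submod {x \<in> carrier M. g x \<in> mspan N (g ` S)} M"
    by (rule vimage_submod[OF lmM lm g(1) mspan_submod[OF lm gS]])
  moreover have "S \<subseteq> {x \<in> carrier M. g x \<in> mspan N (g ` S)}"
    using S(2) mspan_superset[of "g ` S" N] by blast
  ultimately have "carrier M \<subseteq> {x \<in> carrier M. g x \<in> mspan N (g ` S)}"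
    using mspan_least[of _ M S] S(3) by blast
  then have "g ` carrier M \<subseteq> mspan N (g ` S)" by auto
  then have "mspan N (g ` S) = carrier N"
    unfolding g(2) using submodD(1)[OF mspan_submod[OF lm gS]] by (rule subset_antisym[rotated])
  then show ?thesis unfolding fg_iff_mspan using lm gS S(1) by blast
qed

lemma fg_bsum:
  assumes fg: "fg_left_module L A" "fg_left_module L B" and lm: "lm M" and b: "bsum M A B"
  shows "fg_left_module L M"
proof -
  obtain i j p q where b: "biprod M A B i j p q" using b by (auto simp: bsum_def)
  note D = biprodD[OF b]
  obtain S where S: "finite S" "S \<subseteq> carrier A" "mspan A S = carrier A" and lmA: "lm A"
    using fg(1) unfolding fg_iff_mspan by blast
  obtain T where T: "finite T" "T \<subseteq> carrier B" "mspan B T = carrier B" and lmB: "lm B"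
    using fg(2) unfolding fg_iff_mspan by blast
  let ?G = "i ` S \<union> j ` T"
  have G: "?G \<subseteq> carrier M" "finite ?G" using S T D(10,11) by auto
  note sub = mspan_submod[OF lm G(1)]
  have "mspan A S \<subseteq> {x \<in> carrier A. i x \<in> mspan M ?G}"
    using mspan_superset[of ?G M] S(2)
    by (intro mspan_least vimage_submod[OF lmA lm D(1) sub]) auto
  then have i: "\<And>x. x \<in> carrier A \<Longrightarrow> i x \<in> mspan M ?G" using S(3) by blast
  have "mspan B T \<subseteq> {x \<in> carrier B. j x \<in> mspan M ?G}"
    using mspan_superset[of ?G M] T(2)
    by (intro mspan_least vimage_submod[OF lmB lm D(2) sub]) auto
  then have j: "\<And>x. x \<in> carrier B \<Longrightarrow> j x \<in> mspan M ?G" using T(3) by blast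
  have "m \<in> mspan M ?G" if "m \<in> carrier M" for m
    using submodD(4)[OF sub i[OF D(12)[OF that]] j[OF D(13)[OF that]]] D(9)[OF that] by simp
  then have "mspan M ?G = carrier M" using submodD(1)[OF sub] by blast
  then show ?thesis unfolding fg_iff_mspan using lm G by blast
qed

text \<open>Finite length yields a maximal member among the submodules generated by finite subsets
  of \<open>H\<close>. Adjoining a further element of \<open>H\<close> cannot enlarge it, so it is
  \<open>H\<close>.\<close>

lemma U_restr:
  assumes "M \<in> U" "submod H M"
  shows "restr M H \<in> U"
proof -
  have lm: "lm M" using assms by simp
  have HM: "H \<subseteq> carrier M" using submodD(1)[OF assms(2)] .
  let ?F = "mspan M ` {S. finite S \<and> S \<subseteq> H}"
  have F: "submod G M" if "G \<in> ?F" for G using that mspan_submod[OF lm] HM by auto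
  obtain G where "G \<in> ?F" and max: "\<And>K. K \<in> ?F \<Longrightarrow> G \<subseteq> K \<Longrightarrow> K = G"
    using fin_len_max[OF lm fg_fin_len[OF assms(1)], of "mspan M {}" ?F] F by auto
  then obtain S where S: "finite S" "S \<subseteq> H" "G = mspan M S" by auto
  have "x \<in> G" if x: "x \<in> H" for x
  proof -
    have K: "mspan M (insert x S) \<in> ?F" using S x by blast
    have "S \<subseteq> mspan M (insert x S)" "x \<in> mspan M (insert x S)"
      using mspan_superset[of "insert x S" M] by auto
    then have "G \<subseteq> mspan M (insert x S)" unfolding S(3) by (intro mspan_least F[OF K])
    then have "mspan M (insert x S) = G" by (rule max[OF K])
    then show ?thesis using \<open>x \<in> mspan M (insert x S)\<close> by simp
  qed
  moreover have "G \<subseteq> H" unfolding S(3) by (rule mspan_least[OF assms(2) S(2)])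
  ultimately have GH: "mspan M S = H" using S(3) by blast
  have "H \<subseteq> K" if "submod K (restr M H)" "S \<subseteq> K" for K
    using mspan_least[of K M S] that GH submod_restr[OF lm assms(2)] by blast
  then have "H \<subseteq> mspan (restr M H) S" by (auto simp: mspan_def)
  moreover have "mspan (restr M H) S \<subseteq> H"
    using mspan_least[OF submod_carrier[OF restr_lm[OF lm assms(2)]], of S] S(2) by simp
  ultimately show ?thesis
    unfolding U_iff fg_iff_mspan using restr_lm[OF lm assms(2)] S(1,2) by auto
qed

lemma U_universal:
  assumes "fg_left_module L (M :: ('a, 'm) module)"
  obtains N where "N \<in> U" "mod_iso L M N"
  using fg_modules_universal[OF assms] by blast

lemma bsum_exists:
  assumes "A \<in> U" "B \<in> U"
  obtains Z where "Z \<in> U" "bsum Z A B"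
proof -
  have lm: "lm (dsum [A, B])" by (rule dsum_lm) (use assms in auto)
  have "fg_left_module L (dsum [A, B])"
    using assms lm fg_bsum[OF _ _ lm dsum_two] by (simp add: U_iff)
  then obtain Z where Z: "Z \<in> U" "mod_iso L (dsum [A, B]) Z" by (rule U_universal)
  then have "mod_iso L Z (dsum [A, B])" using mod_iso_sym[OF lm] by blast
  then show thesis
    using that[OF Z(1)] bsum_dsum_iff[OF U_lm[OF Z(1)] U_lm[OF assms(1)] U_lm[OF assms(2)]] by blast
qed

lemma zero_exists: obtains Z where "Z \<in> U" "zero_mod Z"
proof -
  let ?E = "dsum ([] :: 'a fgmod list)"
  have lm: "lm ?E" by (rule dsum_Nil)
  have "zero_mod ?E" by (rule dsum_Nil(2))
  then have E: "carrier ?E = {\<zero>\<^bsub>?E\<^esub>}" by (simp only: zero_mod_def)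
  note sub = mspan_submod[OF lm empty_subsetI]
  have "carrier ?E \<subseteq> mspan ?E {}" unfolding E using submodD(3)[OF sub] by simp
  then have "mspan ?E {} = carrier ?E" using submodD(1)[OF sub] by (rule subset_antisym[rotated])
  then have "fg_left_module L ?E" unfolding fg_iff_mspan using lm by blast
  then obtain Z where Z: "Z \<in> U" "mod_iso L ?E Z" by (rule U_universal)
  obtain f where f: "f \<in> hom ?E Z" "bij_betw f (carrier ?E) (carrier Z)"
    using Z(2) by (auto simp: mod_iso_def)
  have "f ` {\<zero>\<^bsub>?E\<^esub>} = carrier Z"
    using bij_betw_imp_surj_on[OF f(2)] unfolding E .
  then have "zero_mod Z" using hom_zero[OF lm U_lm[OF Z(1)] f(1)] by (auto simp: zero_mod_def)
  then show thesis using that Z(1) by blast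
qed

lemma bsum_assoc_left:
  assumes U: "M \<in> U" "A \<in> U" "B \<in> U" "X \<in> U" "N \<in> U" and "bsum M A B" "bsum A X N"
  obtains K where "K \<in> U" "bsum K N B" "bsum M X K"
proof -
  obtain K where K: "K \<in> U" "bsum K B N" using bsum_exists[OF U(3,5)] .
  have "bsum M K X"
    by (rule bsum_assoc[OF U_lm[OF U(1)] U_lm[OF U(2)] U_lm[OF U(3)] U_lm[OF U(5)] U_lm[OF U(4)] U_lm[OF K(1)]
      bsum_comm[OF U_lm[OF U(1)] assms(6)] bsum_comm[OF U_lm[OF U(2)] assms(7)] K(2)])
  then show thesis using that[OF K(1)] bsum_comm[OF U_lm[OF K(1)] K(2)] bsum_comm[OF U_lm[OF U(1)]] by blast
qed

lemma bsum_assoc_right: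
  assumes U: "M \<in> U" "A \<in> U" "B \<in> U" "C \<in> U" "N \<in> U" and "bsum M A N" "bsum N B C"
  obtains K where "K \<in> U" "bsum K A B" "bsum M K C"
proof -
  obtain K where K: "K \<in> U" "bsum K A B" using bsum_exists[OF U(2,3)] .
  have "bsum M K C" by (rule bsum_assoc[of M N A B C K]) (use U K assms(6,7) in auto)
  then show thesis using that K by blast
qed

lemma bsum_cong:
  assumes "M \<in> U" "A \<in> U" "B \<in> U" "M' \<in> U" "A' \<in> U" "B' \<in> U"
    and "mod_iso L M M'" "mod_iso L A A'" "mod_iso L B B'" "bsum M A B"
  shows "bsum M' A' B'"
  by (rule bsum_iso[of M A B A' B' M']) (use assms in auto)

lemma zero_bsum: "M \<in> U \<Longrightarrow> A \<in> U \<Longrightarrow> B \<in> U \<Longrightarrow> bsum M A B \<Longrightarrow> zero_mod M \<Longrightarrow> zero_mod A"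
proof -
  assume U: "M \<in> U" "A \<in> U" "B \<in> U" "bsum M A B" "zero_mod M"
  then obtain i j p q where b: "biprod M A B i j p q" by (auto simp: bsum_def)
  note D = biprodD[OF b]
  have "a = \<zero>\<^bsub>A\<^esub>" if "a \<in> carrier A" for a
    using D(5)[OF that] D(10)[OF that] U(5) hom_zero[OF U_lm[OF U(1)] U_lm[OF U(2)] D(3)]
    unfolding zero_mod_def by auto
  then show "zero_mod A" using U by (auto simp: zero_mod_def)
qed

lemma zero_iso: "M \<in> U \<Longrightarrow> N \<in> U \<Longrightarrow> mod_iso L M N \<Longrightarrow> zero_mod M \<Longrightarrow> zero_mod N"
proof -
  assume U: "M \<in> U" "N \<in> U" "mod_iso L M N" "zero_mod M"
  have "bsum N N M" by (rule bsum_zero) (use U in auto)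
  then have "bsum M N M"
    by (rule bsum_cong[OF U(2,2,1,1,2,1) mod_iso_sym mod_iso_refl mod_iso_refl, rotated 2]) (use U in auto)
  then show "zero_mod N" using zero_bsum U by blast
qed


subsection \<open>The Krull--Schmidt theorem\<close>

lemma indecomposableD:
  assumes "indecomposable L X" "Y \<in> U" "Z \<in> U" "bsum X Y Z"
  shows "zero_mod Y \<or> zero_mod Z"
  using assms bsum_dsum_iff[of X Y Z] by (auto simp: indecomposable_def zero_mod_def)

lemma indecomposable_U: "indecomposable L X \<Longrightarrow> X \<in> U"
  and indecomposable_nonzero: "indecomposable L X \<Longrightarrow> \<not> zero_mod X"
  by (auto simp: indecomposable_def zero_mod_def)

lemma indecomposableI:
  assumes "X \<in> U" "\<not> zero_mod X" "\<And>Y Z. Y \<in> U \<Longrightarrow> Z \<in> U \<Longrightarrow> bsum X Y Z \<Longrightarrow> zero_mod Y \<or> zero_mod Z"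
  shows "indecomposable L X"
  unfolding indecomposable_def
proof (intro conjI ballI impI)
  show "carrier X \<noteq> {\<zero>\<^bsub>X\<^esub>}" using assms(2) by (simp add: zero_mod_def)
  fix Y Z assume YZ: "Y \<in> U" "Z \<in> U" "mod_iso L X (dsum [Y, Z])"
  then have "bsum X Y Z" using bsum_dsum_iff[of X Y Z] assms(1) by simp
  then show "carrier Y = {\<zero>\<^bsub>Y\<^esub>} \<or> carrier Z = {\<zero>\<^bsub>Z\<^esub>}"
    using assms(3)[OF YZ(1,2)] by (simp add: zero_mod_def)
qed fact

text \<open>By Fitting's lemma \<open>f\<close> is nilpotent or injective. If it is nilpotent,
  \<open>g x = 0\<close> gives \<open>f x = x\<close> and hence \<open>x = 0\<close>, so
  \<open>g\<close> is injective. Injective endomorphisms are bijective by finite length.\<close>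

lemma indecomposable_local:
  assumes "indecomposable L X"
  shows "local_mod X"
  unfolding local_mod_def
proof (intro conjI ballI impI)
  have X: "X \<in> U" "lm X" using indecomposable_U[OF assms] by auto
  have fl: "fin_len X" using fg_fin_len[OF X(1)] .
  show "carrier X \<noteq> {\<zero>\<^bsub>X\<^esub>}" using assms by (simp add: indecomposable_def)
  fix f g assume f: "f \<in> hom X X" and g: "g \<in> hom X X" and s: "\<forall>x\<in>carrier X. f x \<oplus>\<^bsub>X\<^esub> g x = x"
  obtain k where k: "bij_betw f ((f ^^ k) ` carrier X) ((f ^^ k) ` carrier X)"
    using fitting[OF X(2) fl f] by blast
  let ?I = "restr X ((f ^^ k) ` carrier X)" and ?K = "restr X (mod_ker X X (f ^^ k))"
  have fk: "(f ^^ k) \<in> hom X X" by (rule hom_funpow[OF f])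
  have IK: "?I \<in> U" "?K \<in> U"
    using U_restr[OF X(1) image_submod[OF X(2,2) fk submod_carrier[OF X(2)]]]
      U_restr[OF X(1) ker_submod[OF X(2,2) fk]] by auto
  consider "zero_mod ?I" | "zero_mod ?K"
    using indecomposableD[OF assms IK fitting_bsum[OF X(2) f k]] by blast
  then show "bij_betw f (carrier X) (carrier X) \<or> bij_betw g (carrier X) (carrier X)"
  proof cases
    case 1
    then have nil: "(f ^^ k) x = \<zero>\<^bsub>X\<^esub>" if "x \<in> carrier X" for x using that by (auto simp: zero_mod_def)
    have "inj_on g (carrier X)"
    proof (rule hom_injI[OF X(2,2) g])
      fix x assume x: "x \<in> carrier X" "g x = \<zero>\<^bsub>X\<^esub>"
      then have fx: "f x = x" using bspec[OF s x(1)] homD(1)[OF f x(1)] X(2) by simp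
      have "(f ^^ n) x = x" for n by (induction n) (auto simp: fx)
      then show "x = \<zero>\<^bsub>X\<^esub>" using nil[OF x(1)] by simp
    qed
    then show ?thesis using inj_endo_bij[OF X(2) fl g] by blast
  next
    case 2
    have "inj_on f (carrier X)"
    proof (rule hom_injI[OF X(2,2) f])
      fix x assume x: "x \<in> carrier X" "f x = \<zero>\<^bsub>X\<^esub>"
      then have z: "(f ^^ Suc k) x = \<zero>\<^bsub>X\<^esub>"
        using hom_zero[OF X(2,2) fk] by (simp add: funpow_swap1)
      have "f ((f ^^ k) x) = f \<zero>\<^bsub>X\<^esub>" using z hom_zero[OF X(2,2) f] by simp
      moreover have "\<zero>\<^bsub>X\<^esub> \<in> (f ^^ k) ` carrier X"
        using image_eqI[of "\<zero>\<^bsub>X\<^esub>" "f ^^ k" "\<zero>\<^bsub>X\<^esub>"] hom_zero[OF X(2,2) fk] X(2) by simp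
      ultimately have "(f ^^ k) x = \<zero>\<^bsub>X\<^esub>"
        using inj_onD[OF bij_betw_imp_inj_on[OF k]] x(1) by blast
      then have "x \<in> mod_ker X X (f ^^ k)" using x by (simp add: mod_ker_def)
      then show "x = \<zero>\<^bsub>X\<^esub>" using 2 by (simp add: zero_mod_def)
    qed
    then show ?thesis using inj_endo_bij[OF X(2) fl f] by blast
  qed
qed

text \<open>Counterpart of \<open>dsum\<close> inside \<open>U\<close>: the element type does not
  become a type of lists, so partial sums can be rearranged by \<open>bsum\<close>, and isomorphic
  copies are allowed.\<close>

primrec isum :: "'a fgmod \<Rightarrow> 'a fgmod list \<Rightarrow> bool" where
  "isum M [] = zero_mod M"
| "isum M (X # Xs) = (\<exists>N\<in>U. bsum M X N \<and> isum N Xs)"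

lemma isum_iso:
  assumes "M \<in> U" "N \<in> U" "mod_iso L M N" "set Xs \<subseteq> U" "isum M Xs"
  shows "isum N Xs"
proof (cases Xs)
  case Nil
  then show ?thesis using assms zero_iso by simp
next
  case (Cons X Ys)
  then obtain K where K: "K \<in> U" "bsum M X K" "isum K Ys" using assms by auto
  have X: "X \<in> U" using Cons assms(4) by simp
  have "bsum N X K"
    by (rule bsum_cong[OF assms(1) X K(1) assms(2) X K(1) assms(3) mod_iso_refl mod_iso_refl K(2)])
  then show ?thesis using K Cons by auto
qed

lemma isum_append:
  assumes "M \<in> U" "A \<in> U" "B \<in> U" "set Xs \<subseteq> U" "set Ys \<subseteq> U" "isum A Xs" "isum B Ys" "bsum M A B"
  shows "isum M (Xs @ Ys)"
  using assms
proof (induction Xs arbitrary: M A)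
  case Nil
  then have "bsum M B A" using bsum_comm[OF U_lm[OF Nil(1)]] by blast
  then have "mod_iso L M B" using bsum_zero_iff[of M B A] Nil by simp
  then have "isum M Ys" using isum_iso[OF Nil(3,1) mod_iso_sym] Nil by simp
  then show ?case by simp
next
  case (Cons X Xs)
  obtain N where N: "N \<in> U" "bsum A X N" "isum N Xs" using Cons.prems by auto
  have X: "X \<in> U" using Cons.prems by simp
  obtain K where K: "K \<in> U" "bsum K N B" "bsum M X K"
    using bsum_assoc_left[OF Cons.prems(1-3) X N(1) Cons.prems(8) N(2)] .
  have "isum K (Xs @ Ys)" by (rule Cons.IH[OF K(1) N(1)]) (use Cons.prems N K in auto)
  then show ?case using K by auto
qed

text \<open>Induction on the length of a submodule \<open>H\<close> of \<open>M\<close>. If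
  \<open>H\<close> is nonzero and not indecomposable, it has two nonzero parts, and each embeds in
  \<open>H\<close> as a proper submodule.\<close>

lemma decomposition_exists:
  assumes "M \<in> U"
  obtains Xs where "\<And>X. X \<in> set Xs \<Longrightarrow> indecomposable L X" "isum M Xs"
proof -
  have lm: "lm M" using assms by simp
  obtain l :: "_ set \<Rightarrow> nat" where l: "\<And>H K. submod H M \<Longrightarrow> submod K M \<Longrightarrow> H \<subset> K \<Longrightarrow> l H < l K"
    using fg_fin_len[OF assms] unfolding fin_len_def by blast
  have "\<exists>Xs. (\<forall>X\<in>set Xs. indecomposable L X) \<and> isum (restr M H) Xs" if "submod H M" for H
    using that
  proof (induction H rule: measure_induct_rule[of l])
    case (less H)
    let ?H = "restr M H"
    have HU: "?H \<in> U" by (rule U_restr[OF assms less.prems])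
    show ?case
    proof (cases "zero_mod ?H")
      case True
      then show ?thesis by (intro exI[of _ "[]"]) simp
    next
      case nz: False
      show ?thesis
      proof (cases "indecomposable L ?H")
        case True
        obtain Z where Z: "Z \<in> U" "zero_mod Z" by (rule zero_exists)
        have "bsum ?H ?H Z" by (rule bsum_zero) (use Z HU in auto)
        then show ?thesis using True Z by (intro exI[of _ "[?H]"]) auto
      next
        case False
        then obtain Y Z where YZ: "Y \<in> U" "Z \<in> U" "bsum ?H Y Z" "\<not> zero_mod Y" "\<not> zero_mod Z"
          using indecomposableI[OF HU nz] by blast
        obtain i j p q where b: "biprod ?H Y Z i j p q" using YZ(3) by (auto simp: bsum_def)
        note D = biprodD[OF b]
        have lmYZ: "lm Y" "lm Z" "lm ?H" using YZ HU by auto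
        \<comment> \<open>The induction hypothesis speaks of submodules of \<open>M\<close>, so it
          is applied to the image of \<open>W\<close>. The element \<open>y\<close> witnesses that
          this image is proper, and the decomposition is carried back along
          \<open>g\<close>.\<close>
        have part: "\<exists>Xs. (\<forall>X\<in>set Xs. indecomposable L X) \<and> isum W Xs"
          if W: "W \<in> U" "f \<in> hom W ?H" "g \<in> hom ?H W" "\<And>w. w \<in> carrier W \<Longrightarrow> g (f w) = w"
            and y: "y \<in> H" "y \<notin> f ` carrier W" for W f g y
        proof -
          have s: "submod (f ` carrier W) ?H"
            by (rule image_submod[OF U_lm[OF W(1)] lmYZ(3) W(2) submod_carrier[OF U_lm[OF W(1)]]])
          then have s': "submod (f ` carrier W) M" "f ` carrier W \<subset> H"
            using submod_restr[OF lm less.prems] y by auto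
          obtain Xs where Xs: "\<forall>X\<in>set Xs. indecomposable L X" "isum (restr M (f ` carrier W)) Xs"
            using less.IH[OF l[OF s'(1) less.prems s'(2)] s'(1)] by blast
          have "mod_iso L (restr M (f ` carrier W)) W"
          proof (rule mod_isoI[of g _ _ f])
            show "g \<in> hom (restr M (f ` carrier W)) W"
              using hom_restr_dom[OF W(3), of "f ` carrier W"] submodD(1)[OF s] by simp
            show "f \<in> hom W (restr M (f ` carrier W))"
              using hom_restr_cod[OF W(2), of "f ` carrier W"] by simp
          qed (use W(4) in auto)
          then have "isum W Xs"
            using isum_iso[OF U_restr[OF assms s'(1)] W(1)] Xs indecomposable_U by blast
          then show ?thesis using Xs by blast
        qed
        have ex: "\<exists>w\<in>carrier W. w \<noteq> \<zero>\<^bsub>W\<^esub>" if "W \<in> U" "\<not> zero_mod W" for W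
          using that unfolding zero_mod_def
            by (metis U_lm empty_iff lm_closed(1) singletonI subsetI subset_antisym subset_singleton_iff)
        obtain y where y: "y \<in> carrier Y" "y \<noteq> \<zero>\<^bsub>Y\<^esub>" using ex[OF YZ(1,4)] by blast
        obtain z where z: "z \<in> carrier Z" "z \<noteq> \<zero>\<^bsub>Z\<^esub>" using ex[OF YZ(2,5)] by blast
        have jz: "j z \<notin> i ` carrier Y"
        proof
          assume "j z \<in> i ` carrier Y"
          then obtain a where "a \<in> carrier Y" "j z = i a" by blast
          then show False using D(6)[of a] D(7)[OF z(1)] z(2) by simp
        qed
        have iy: "i y \<notin> j ` carrier Z"
        proof
          assume "i y \<in> j ` carrier Z"
          then obtain a where "a \<in> carrier Z" "i y = j a" by blast
          then show False using D(8)[of a] D(5)[OF y(1)] y(2) by simp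
        qed
        obtain Xs where Xs: "\<forall>X\<in>set Xs. indecomposable L X" "isum Y Xs"
          using part[OF YZ(1) D(1,3,5) _ jz] D(11)[OF z(1)] by auto
        obtain Ys where Ys: "\<forall>X\<in>set Ys. indecomposable L X" "isum Z Ys"
          using part[OF YZ(2) D(2,4,7) _ iy] D(10)[OF y(1)] by auto
        have "isum ?H (Xs @ Ys)"
          by (rule isum_append[OF HU YZ(1,2) _ _ Xs(2) Ys(2) YZ(3)]) (use Xs Ys indecomposable_U in auto)
        then show ?thesis using Xs Ys by (intro exI[of _ "Xs @ Ys"]) auto
      qed
    qed
  qed
  from this[OF submod_carrier[OF lm]] show thesis using that by auto
qed

abbreviation ic :: "'a fgmod \<Rightarrow> 'a fgmod set" where "ic \<equiv> isoclass L"

lemma ic_eq_iff: "X \<in> U \<Longrightarrow> Y \<in> U \<Longrightarrow> ic X = ic Y \<longleftrightarrow> mod_iso L X Y"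
proof
  assume U: "X \<in> U" "Y \<in> U" and "ic X = ic Y"
  then show "mod_iso L X Y" using mod_iso_refl[of Y] by (auto simp: isoclass_def)
next
  assume U: "X \<in> U" "Y \<in> U" and i: "mod_iso L X Y"
  have "mod_iso L Y X" using mod_iso_sym[OF U_lm[OF U(1)] i] .
  then have "mod_iso L X Z \<longleftrightarrow> mod_iso L Y Z" for Z :: "'a fgmod"
    using mod_iso_trans[OF i, of Z] mod_iso_trans[of Y X Z] by blast
  then show "ic X = ic Y" unfolding isoclass_def by simp
qed

text \<open>Exchange \<open>X\<close> into the splitting of \<open>M\<close> into \<open>Y\<close>
  and the rest \<open>B\<close>. If it lands in \<open>Y\<close>, indecomposability of
  \<open>Y\<close> gives \<open>X \<cong> Y\<close> and \<open>A \<cong> B\<close>. If it lands in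
  \<open>B\<close>, it is extracted from \<open>B\<close> by induction, and \<open>A\<close> is
  \<open>Y\<close> plus what remains.\<close>

lemma extract_summand:
  assumes "indecomposable L X" "M \<in> U" "A \<in> U" "bsum M X A"
    and "\<And>Y. Y \<in> set Ys \<Longrightarrow> indecomposable L Y" "isum M Ys"
  shows "\<exists>Zs. (\<forall>Z\<in>set Zs. indecomposable L Z) \<and> isum A Zs \<and>
    mset (map ic Ys) = add_mset (ic X) (mset (map ic Zs))"
  using assms(2-)
proof (induction Ys arbitrary: M A)
  case Nil
  then have "zero_mod X" using zero_bsum[of M X A] indecomposable_U[OF assms(1)] by simp
  then show ?case using indecomposable_nonzero[OF assms(1)] by blast
next
  case (Cons Y Ys)
  have X: "X \<in> U" "local_mod X" using indecomposable_U[OF assms(1)] indecomposable_local[OF assms(1)] .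
  have Y: "indecomposable L Y" "Y \<in> U" using Cons.prems(4)[of Y] indecomposable_U[of Y] by auto
  obtain B where B: "B \<in> U" "bsum M Y B" "isum B Ys" using Cons.prems by auto
  have YsU: "set Ys \<subseteq> U" using Cons.prems(4) indecomposable_U by auto
  consider H where "submod H Y" "bsum Y X (restr Y H)" "bsum A (restr Y H) B"
    | H where "submod H B" "bsum B X (restr B H)" "bsum A Y (restr B H)"
    using exchange[OF U_lm[OF Cons.prems(1)] U_lm[OF X(1)] U_lm[OF Cons.prems(2)] U_lm[OF Y(2)] U_lm[OF B(1)]
        X(2) Cons.prems(3) B(2)] by blast
  then show ?case
  proof cases
    case (1 H)
    have HU: "restr Y H \<in> U" by (rule U_restr[OF Y(2) 1(1)])
    have z: "zero_mod (restr Y H)"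
      using indecomposableD[OF Y(1) X(1) HU 1(2)] indecomposable_nonzero[OF assms(1)] by blast
    have "mod_iso L Y X"
      using bsum_zero_iff[OF U_lm[OF Y(2)] U_lm[OF X(1)] U_lm[OF HU] z] 1(2) by blast
    then have "ic Y = ic X" using ic_eq_iff Y X by blast
    have "bsum A B (restr Y H)" using bsum_comm[OF U_lm[OF Cons.prems(2)] 1(3)] .
    then have "mod_iso L A B"
      using bsum_zero_iff[OF U_lm[OF Cons.prems(2)] U_lm[OF B(1)] U_lm[OF HU] z] by blast
    then have "isum A Ys"
      using isum_iso[OF B(1) Cons.prems(2) mod_iso_sym[OF U_lm[OF Cons.prems(2)]] YsU B(3)] by blast
    then show ?thesis using Cons.prems(4) \<open>ic Y = ic X\<close> by (intro exI[of _ Ys]) auto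
  next
    case (2 H)
    have HU: "restr B H \<in> U" by (rule U_restr[OF B(1) 2(1)])
    obtain Zs where Zs: "\<forall>Z\<in>set Zs. indecomposable L Z" "isum (restr B H) Zs"
      "mset (map ic Ys) = add_mset (ic X) (mset (map ic Zs))"
      using Cons.IH[OF B(1) HU 2(2) _ B(3)] Cons.prems(4) by auto
    have "isum A (Y # Zs)" using HU 2(3) Zs(2) by auto
    then show ?thesis using Zs Y(1) by (intro exI[of _ "Y # Zs"]) auto
  qed
qed

lemma krull_schmidt:
  assumes "M \<in> U" "\<And>X. X \<in> set Xs \<Longrightarrow> indecomposable L X" "isum M Xs"
    and "\<And>Y. Y \<in> set Ys \<Longrightarrow> indecomposable L Y" "isum M Ys"
  shows "mset (map ic Xs) = mset (map ic Ys)"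
  using assms
proof (induction Xs arbitrary: M Ys)
  case Nil
  then have z: "zero_mod M" by simp
  have "Ys = []"
  proof (cases Ys)
    case (Cons Y Zs)
    then obtain N where N: "N \<in> U" "bsum M Y N" using Nil.prems(5) by auto
    have Y: "indecomposable L Y" using Nil.prems(4)[of Y] Cons by simp
    have "zero_mod Y" using zero_bsum[OF Nil.prems(1) indecomposable_U[OF Y] N z] .
    then show ?thesis using indecomposable_nonzero[OF Y] by blast
  qed
  then show ?case by simp
next
  case (Cons X Xs)
  obtain A where A: "A \<in> U" "bsum M X A" "isum A Xs" using Cons.prems(3) by auto
  have X: "indecomposable L X" using Cons.prems(2)[of X] by simp
  obtain Zs where Zs: "\<forall>Z\<in>set Zs. indecomposable L Z" "isum A Zs"
    "mset (map ic Ys) = add_mset (ic X) (mset (map ic Zs))"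
    using extract_summand[OF X Cons.prems(1) A(1,2) Cons.prems(4,5)] by blast
  have "mset (map ic Xs) = mset (map ic Zs)"
    by (rule Cons.IH[OF A(1) _ A(3)]) (use Zs Cons.prems(2) in auto)
  then show ?case using Zs(3) by simp
qed

text \<open>The description is unique by \<open>krull_schmidt\<close>. On \<open>U\<close> it is a
  complete invariant (\<open>dec_eq_iff\<close>), every finite multiset over \<open>IC\<close>
  occurs (\<open>dec_surj\<close>), and \<open>bsum\<close> becomes addition
  (\<open>bsum_iff_dec\<close>), so cancellation of summands is cancellation in multisets.\<close>

definition dec :: "'a fgmod \<Rightarrow> 'a fgmod set multiset" where
  "dec M = (THE m. \<exists>Xs. (\<forall>X\<in>set Xs. indecomposable L X) \<and> isum M Xs \<and> m = mset (map ic Xs))"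

lemma dec_eqI:
  assumes "M \<in> U" "\<And>X. X \<in> set Xs \<Longrightarrow> indecomposable L X" "isum M Xs"
  shows "dec M = mset (map ic Xs)"
  unfolding dec_def
proof (rule the_equality)
  show "\<exists>Ys. (\<forall>X\<in>set Ys. indecomposable L X) \<and> isum M Ys \<and> mset (map ic Xs) = mset (map ic Ys)"
    using assms by blast
  fix m assume "\<exists>Xs. (\<forall>X\<in>set Xs. indecomposable L X) \<and> isum M Xs \<and> m = mset (map ic Xs)"
  then obtain Ys where Ys: "\<forall>X\<in>set Ys. indecomposable L X" "isum M Ys" "m = mset (map ic Ys)" by blast
  show "m = mset (map ic Xs)"
    unfolding Ys(3) by (rule krull_schmidt[OF assms(1) _ Ys(2) assms(2,3)]) (use Ys(1) in auto)
qed

lemma dec_list: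
  assumes "M \<in> U"
  obtains Xs where "\<And>X. X \<in> set Xs \<Longrightarrow> indecomposable L X" "isum M Xs" "dec M = mset (map ic Xs)"
  using decomposition_exists[OF assms] dec_eqI[OF assms] by metis

lemma dec_bsum:
  assumes "M \<in> U" "A \<in> U" "B \<in> U" "bsum M A B"
  shows "dec M = dec A + dec B"
proof -
  obtain Xs where Xs: "\<And>X. X \<in> set Xs \<Longrightarrow> indecomposable L X" "isum A Xs" "dec A = mset (map ic Xs)"
    using dec_list[OF assms(2)] by blast
  obtain Ys where Ys: "\<And>X. X \<in> set Ys \<Longrightarrow> indecomposable L X" "isum B Ys" "dec B = mset (map ic Ys)"
    using dec_list[OF assms(3)] by blast
  have "isum M (Xs @ Ys)"
    by (rule isum_append[OF assms(1-3) _ _ Xs(2) Ys(2) assms(4)]) (use Xs(1) Ys(1) indecomposable_U in auto)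
  then have "dec M = mset (map ic (Xs @ Ys))" using Xs(1) Ys(1) by (intro dec_eqI[OF assms(1)]) auto
  then show ?thesis using Xs(3) Ys(3) by simp
qed

lemma dec_iso:
  assumes "M \<in> U" "N \<in> U" "mod_iso L M N"
  shows "dec M = dec N"
proof -
  obtain Xs where Xs: "\<And>X. X \<in> set Xs \<Longrightarrow> indecomposable L X" "isum M Xs" "dec M = mset (map ic Xs)"
    using dec_list[OF assms(1)] by blast
  have "isum N Xs" by (rule isum_iso[OF assms _ Xs(2)]) (use Xs(1) indecomposable_U in auto)
  then show ?thesis using dec_eqI[OF assms(2) Xs(1)] Xs(3) by simp
qed

lemma dec_zero: "M \<in> U \<Longrightarrow> zero_mod M \<Longrightarrow> dec M = {#}"
  using dec_eqI[of M "[]"] by simp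

lemma dec_indecomposable:
  assumes "indecomposable L X"
  shows "dec X = {#ic X#}"
proof -
  obtain Z where Z: "Z \<in> U" "zero_mod Z" by (rule zero_exists)
  have "bsum X X Z" by (rule bsum_zero) (use Z indecomposable_U[OF assms] in auto)
  then have "isum X [X]" using Z by auto
  then show ?thesis using dec_eqI[OF indecomposable_U[OF assms], of "[X]"] assms by simp
qed

lemma isum_member:
  assumes "M \<in> U" "set Ys \<subseteq> U" "isum M Ys" "Y \<in> set Ys"
  shows "\<exists>N\<in>U. bsum M Y N"
  using assms
proof (induction Ys arbitrary: M)
  case (Cons X Ys)
  obtain N where N: "N \<in> U" "bsum M X N" "isum N Ys" using Cons.prems by auto
  show ?case
  proof (cases "Y = X")
    case True
    then show ?thesis using N by blast
  next
    case False
    then obtain K where K: "K \<in> U" "bsum N Y K" using Cons.IH[OF N(1) _ N(3)] Cons.prems by auto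
    have U: "X \<in> U" "Y \<in> U" using Cons.prems by auto
    have "bsum M N X" using bsum_comm[OF U_lm[OF Cons.prems(1)] N(2)] .
    then obtain K' where "K' \<in> U" "bsum M Y K'"
      using bsum_assoc_left[OF Cons.prems(1) N(1) U(1,2) K(1) _ K(2)] by blast
    then show ?thesis by blast
  qed
qed simp

lemma dec_member:
  assumes "M \<in> U" "c \<in># dec M"
  obtains X N where "indecomposable L X" "c = ic X" "N \<in> U" "bsum M X N"
proof -
  obtain Xs where Xs: "\<And>X. X \<in> set Xs \<Longrightarrow> indecomposable L X" "isum M Xs" "dec M = mset (map ic Xs)"
    using dec_list[OF assms(1)] by blast
  then obtain X where X: "X \<in> set Xs" "c = ic X" using assms(2) by auto
  have "set Xs \<subseteq> U" using Xs(1) indecomposable_U by blast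
  then obtain N where "N \<in> U" "bsum M X N" using isum_member[OF assms(1) _ Xs(2) X(1)] by blast
  then show thesis using that[OF Xs(1)[OF X(1)] X(2)] by blast
qed

lemma dec_split:
  assumes "M \<in> U" "dec M = m + n"
  obtains A B where "A \<in> U" "B \<in> U" "dec A = m" "dec B = n" "bsum M A B"
proof -
  have "\<exists>A\<in>U. \<exists>B\<in>U. dec A = m \<and> dec B = n \<and> bsum M A B"
    using assms
  proof (induction m arbitrary: M)
    case empty
    obtain Z where Z: "Z \<in> U" "zero_mod Z" by (rule zero_exists)
    have "bsum M M Z" by (rule bsum_zero) (use Z empty in auto)
    then have "bsum M Z M" using bsum_comm[OF U_lm[OF empty(1)]] by blast
    then show ?case using Z dec_zero empty by auto
  next
    case (add c m)
    have "c \<in># dec M" using add.prems(2) by simp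
    then obtain X N where X: "indecomposable L X" "c = ic X" "N \<in> U" "bsum M X N"
      by (rule dec_member[OF add.prems(1)])
    have XU: "X \<in> U" by (rule indecomposable_U[OF X(1)])
    have "dec N = m + n"
      using dec_bsum[OF add.prems(1) XU X(3,4)] dec_indecomposable[OF X(1)] X(2) add.prems(2) by simp
    then obtain A B where AB: "A \<in> U" "B \<in> U" "dec A = m" "dec B = n" "bsum N A B"
      using add.IH[OF X(3)] by blast
    obtain K where K: "K \<in> U" "bsum K X A" "bsum M K B"
      using bsum_assoc_right[OF add.prems(1) XU AB(1,2) X(3,4) AB(5)] .
    have "dec K = add_mset c m"
      using dec_bsum[OF K(1) XU AB(1) K(2)] dec_indecomposable[OF X(1)] X(2) AB(3) by simp
    then show ?case using K AB by blast
  qed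
  then show thesis using that by blast
qed

lemma dec_empty: "M \<in> U \<Longrightarrow> dec M = {#} \<Longrightarrow> zero_mod M"
proof -
  assume M: "M \<in> U" "dec M = {#}"
  obtain Xs where Xs: "isum M Xs" "dec M = mset (map ic Xs)" using dec_list[OF M(1)] by blast
  then show "zero_mod M" using M by simp
qed

lemma dec_eq_iso:
  assumes "M \<in> U" "N \<in> U" "dec M = dec N"
  shows "mod_iso L M N"
  using assms
proof (induction "dec M" arbitrary: M N)
  case empty
  then have z: "zero_mod M" "zero_mod N" using dec_empty by auto
  have "bsum M M N" by (rule bsum_zero) (use z empty in auto)
  moreover have "bsum N N M" by (rule bsum_zero) (use z empty in auto)
  ultimately show ?case
    using bsum_unique[of M N M N] bsum_comm[OF U_lm, of N N M] empty by simp
next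
  case (add c m)
  have c: "c \<in># dec M" "c \<in># dec N" unfolding add.prems(3)[symmetric] add.hyps(2)[symmetric] by auto
  obtain X A where X: "indecomposable L X" "c = ic X" "A \<in> U" "bsum M X A"
    by (rule dec_member[OF add.prems(1) c(1)])
  obtain Y B where Y: "indecomposable L Y" "c = ic Y" "B \<in> U" "bsum N Y B"
    by (rule dec_member[OF add.prems(2) c(2)])
  note U = indecomposable_U[OF X(1)] indecomposable_U[OF Y(1)]
  have "dec A = m" "dec B = m"
    using dec_bsum[OF add.prems(1) U(1) X(3,4)] dec_bsum[OF add.prems(2) U(2) Y(3,4)]
      dec_indecomposable[OF X(1)] dec_indecomposable[OF Y(1)] X(2) Y(2) add.hyps(2) add.prems(3) by auto
  then have AB: "mod_iso L A B" using add.hyps(1)[of A B] X(3) Y(3) by simp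
  have "mod_iso L X Y" using ic_eq_iff[OF U] X(2) Y(2) by blast
  then have "bsum M Y B"
    using bsum_cong[OF add.prems(1) U(1) X(3) add.prems(1) U(2) Y(3) mod_iso_refl _ AB X(4)] by blast
  then show ?case
    using bsum_unique[OF U_lm[OF add.prems(1)] U_lm[OF add.prems(2)] U_lm[OF U(2)] U_lm[OF Y(3)] _ Y(4)]
    by blast
qed

lemma dec_eq_iff: "M \<in> U \<Longrightarrow> N \<in> U \<Longrightarrow> dec M = dec N \<longleftrightarrow> mod_iso L M N"
  using dec_eq_iso dec_iso by blast

definition IC :: "'a fgmod set set" where "IC = ic ` {X. indecomposable L X}"

lemma dec_IC: "M \<in> U \<Longrightarrow> set_mset (dec M) \<subseteq> IC"
proof
  fix c assume M: "M \<in> U" and c: "c \<in># dec M"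
  obtain X N where "indecomposable L X" "c = ic X" using dec_member[OF M c] by blast
  then show "c \<in> IC" by (auto simp: IC_def)
qed

lemma dec_surj:
  assumes "set_mset m \<subseteq> IC"
  obtains M where "M \<in> U" "dec M = m"
proof -
  have "\<exists>M\<in>U. dec M = m"
    using assms
  proof (induction m)
    case empty
    obtain Z where "Z \<in> U" "zero_mod Z" by (rule zero_exists)
    then show ?case using dec_zero by blast
  next
    case (add c m)
    then obtain M where M: "M \<in> U" "dec M = m" by auto
    obtain X where X: "indecomposable L X" "c = ic X" using add.prems by (auto simp: IC_def)
    obtain Z where Z: "Z \<in> U" "bsum Z X M" using bsum_exists[OF indecomposable_U[OF X(1)] M(1)] .
    then have "dec Z = add_mset c m"
      using dec_bsum[OF Z(1) indecomposable_U[OF X(1)] M(1) Z(2)] dec_indecomposable[OF X(1)] X M by simp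
    then show ?case using Z by blast
  qed
  then show thesis using that by blast
qed

lemma bsum_iff_dec:
  assumes "M \<in> U" "A \<in> U" "B \<in> U"
  shows "bsum M A B \<longleftrightarrow> dec M = dec A + dec B"
proof
  assume e: "dec M = dec A + dec B"
  obtain Z where Z: "Z \<in> U" "bsum Z A B" using bsum_exists[OF assms(2,3)] .
  then have "mod_iso L Z M" using dec_bsum[OF Z(1) assms(2,3) Z(2)] e dec_eq_iff[OF Z(1) assms(1)] by simp
  then show "bsum M A B"
    by (rule bsum_cong[OF Z(1) assms(2,3,1,2,3) _ mod_iso_refl mod_iso_refl Z(2)])
qed (rule dec_bsum[OF assms])

end

context left_modules
begin

subsection \<open>Short exact sequences\<close>

lemma short_exactD:
  assumes "short_exact L A f B g C"
  shows "f \<in> hom A B" "g \<in> hom B C" "inj_on f (carrier A)" "f ` carrier A = mod_ker B C g"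
    "g ` carrier B = carrier C"
  using assms by (auto simp: short_exact_def)

lemma same_kernel_iso:
  assumes lm: "lm M" "lm N" "lm N'" and g: "g \<in> hom M N" "g ` carrier M = carrier N"
    and h: "h \<in> hom M N'" "h ` carrier M = carrier N'" and ker: "mod_ker M N g = mod_ker M N' h"
  shows "mod_iso L N N'"
proof -
  have k: "g x = \<zero>\<^bsub>N\<^esub> \<longleftrightarrow> h x = \<zero>\<^bsub>N'\<^esub>" if "x \<in> carrier M" for x
    using ker that unfolding mod_ker_def by (auto simp: set_eq_iff)
  obtain u where u: "u \<in> hom N N'" "\<And>x. x \<in> carrier M \<Longrightarrow> u (g x) = h x"
    using factor_hom[OF lm g h(1)] k by blast
  obtain v where v: "v \<in> hom N' N" "\<And>x. x \<in> carrier M \<Longrightarrow> v (h x) = g x"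
    using factor_hom[OF lm(1,3,2) h g(1)] k by blast
  show ?thesis
  proof (rule mod_isoI[OF u(1) v(1)])
    fix y assume "y \<in> carrier N"
    then obtain x where "x \<in> carrier M" "y = g x" unfolding g(2)[symmetric] by (rule imageE)
    then show "v (u y) = y" using u(2) v(2) by simp
  next
    fix y assume "y \<in> carrier N'"
    then obtain x where "x \<in> carrier M" "y = h x" unfolding h(2)[symmetric] by (rule imageE)
    then show "u (v y) = y" using u(2) v(2) by simp
  qed
qed

lemma inj_image_iso:
  assumes lm: "lm M" "lm N" and f: "f \<in> hom M N" "inj_on f (carrier M)"
  shows "mod_iso L M (restr N (f ` carrier M))"
  unfolding mod_iso_def using hom_restr_cod[OF f(1), of "f ` carrier M"] f(2)
  by (intro bexI[of _ f]) (auto simp: bij_betw_def)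

lemma short_exact_kernel_iso:
  assumes "lm A" "lm B" "short_exact L A f B g C"
  shows "mod_iso L A (restr B (mod_ker B C g))"
  using inj_image_iso[OF assms(1,2) short_exactD(1,3)[OF assms(3)]]
  unfolding short_exactD(4)[OF assms(3)] .

lemma short_exact_surj:
  assumes "g \<in> hom B C" "g ` carrier B = carrier C"
  shows "short_exact L (restr B (mod_ker B C g)) (\<lambda>x. x) B g C"
  unfolding short_exact_def using assms hom_incl[of "mod_ker B C g" B] by (auto simp: mod_ker_def)

lemma short_exact_iso:
  assumes lm: "lm A" "lm B" "lm C" "lm A'" "lm B'" "lm C'"
    and iso: "mod_iso L A A'" "mod_iso L B B'" "mod_iso L C C'"
    and se: "short_exact L A f B g C"
  shows "\<exists>f g. short_exact L A' f B' g C'"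
proof -
  note S = short_exactD[OF se]
  obtain a a' where a: "a \<in> hom A A'" "a' \<in> hom A' A"
    "\<And>x. x \<in> carrier A \<Longrightarrow> a x \<in> carrier A'" "\<And>x. x \<in> carrier A' \<Longrightarrow> a' x \<in> carrier A"
    "\<And>x. x \<in> carrier A \<Longrightarrow> a' (a x) = x" "\<And>y. y \<in> carrier A' \<Longrightarrow> a (a' y) = y"
    using mod_iso_pair[OF lm(1) iso(1)] by blast
  obtain b b' where b: "b \<in> hom B B'" "b' \<in> hom B' B"
    "\<And>x. x \<in> carrier B \<Longrightarrow> b x \<in> carrier B'" "\<And>x. x \<in> carrier B' \<Longrightarrow> b' x \<in> carrier B"
    "\<And>x. x \<in> carrier B \<Longrightarrow> b' (b x) = x" "\<And>y. y \<in> carrier B' \<Longrightarrow> b (b' y) = y"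
    using mod_iso_pair[OF lm(2) iso(2)] by blast
  obtain c c' where c: "c \<in> hom C C'" "c' \<in> hom C' C"
    "\<And>x. x \<in> carrier C \<Longrightarrow> c x \<in> carrier C'" "\<And>x. x \<in> carrier C' \<Longrightarrow> c' x \<in> carrier C"
    "\<And>x. x \<in> carrier C \<Longrightarrow> c' (c x) = x" "\<And>y. y \<in> carrier C' \<Longrightarrow> c (c' y) = y"
    using mod_iso_pair[OF lm(3) iso(3)] by blast
  note fc = homD(1)[OF S(1)] and gc = homD(1)[OF S(2)]
  have gf: "g (f x) = \<zero>\<^bsub>C\<^esub>" if "x \<in> carrier A" for x
  proof -
    have "f x \<in> mod_ker B C g" unfolding S(4)[symmetric] using that by (rule imageI)
    then show ?thesis by (simp add: mod_ker_def)
  qed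
  have "short_exact L A' (\<lambda>x. b (f (a' x))) B' (\<lambda>y. c (g (b' y))) C'"
    unfolding short_exact_def
  proof (intro conjI subset_antisym subsetI)
    show "(\<lambda>x. b (f (a' x))) \<in> hom A' B'" by (rule hom_comp[OF hom_comp[OF a(2) S(1)] b(1)])
    show h: "(\<lambda>y. c (g (b' y))) \<in> hom B' C'" by (rule hom_comp[OF hom_comp[OF b(2) S(2)] c(1)])
    show "inj_on (\<lambda>x. b (f (a' x))) (carrier A')"
    proof (rule inj_onI)
      fix x y assume x: "x \<in> carrier A'" and y: "y \<in> carrier A'" and e: "b (f (a' x)) = b (f (a' y))"
      have "f (a' x) = f (a' y)" using arg_cong[OF e, of b'] x y by (simp add: a b fc)
      then have "a' x = a' y" using inj_onD[OF S(3)] a(4)[OF x] a(4)[OF y] by blast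
      then have "a (a' x) = a (a' y)" by simp
      then show "x = y" unfolding a(6)[OF x] a(6)[OF y] .
    qed
    fix y
    { assume "y \<in> (\<lambda>x. b (f (a' x))) ` carrier A'"
      then show "y \<in> mod_ker B' C' (\<lambda>y. c (g (b' y)))"
        by (auto simp: mod_ker_def a b fc gf hom_zero[OF lm(3,6) c(1)]) }
    { assume "y \<in> mod_ker B' C' (\<lambda>y. c (g (b' y)))"
      then have y: "y \<in> carrier B'" "c (g (b' y)) = \<zero>\<^bsub>C'\<^esub>" by (auto simp: mod_ker_def)
      have "g (b' y) = \<zero>\<^bsub>C\<^esub>"
        using arg_cong[OF y(2), of c'] y(1) hom_zero[OF lm(6,3) c(2)] by (simp add: b c gc)
      then have "b' y \<in> f ` carrier A" unfolding S(4) using b(4)[OF y(1)] by (simp add: mod_ker_def)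
      then obtain x where x: "x \<in> carrier A" "b' y = f x" by blast
      then have "y = b (f (a' (a x)))" using b(6)[OF y(1)] a(5) by simp
      then show "y \<in> (\<lambda>x. b (f (a' x))) ` carrier A'" using a(3)[OF x(1)] by blast }
    { assume "y \<in> (\<lambda>y. c (g (b' y))) ` carrier B'"
      then show "y \<in> carrier C'" using homD(1)[OF h] by blast }
    { assume y: "y \<in> carrier C'"
      have "c' y \<in> g ` carrier B" unfolding S(5) by (rule c(4)[OF y])
      then obtain x where x: "x \<in> carrier B" "c' y = g x" by blast
      then have "y = c (g (b' (b x)))" using c(6)[OF y] b(5) by simp
      then show "y \<in> (\<lambda>y. c (g (b' y))) ` carrier B'" using b(3)[OF x(1)] by blast }
  qed
  then show ?thesis by blast
qed

text \<open>The map \<open>r\<close> splits off the image of \<open>f\<close> with complement the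
  kernel of \<open>r\<close>, and \<open>g\<close> maps this kernel isomorphically onto
  \<open>C\<close> because it kills exactly the image of \<open>f\<close>.\<close>

lemma short_exact_retract:
  assumes lm: "lm A" "lm B" "lm C" "lm D" and se: "short_exact L A f B g C"
    and r: "r \<in> hom B D" "bij_betw (\<lambda>a. r (f a)) (carrier A) (carrier D)"
  shows "bsum B A C"
proof -
  note S = short_exactD[OF se]
  let ?K = "mod_ker B D r"
  have K: "submod ?K B" by (rule ker_submod[OF lm(2,4) r(1)])
  have lmK: "lm (restr B ?K)" by (rule restr_lm[OF lm(2) K])
  have s: "bsum B A (restr B ?K)" by (rule bsum_split[OF lm(2,1,4) S(1) r])
  have gK: "g \<in> hom (restr B ?K) C" by (rule hom_restr_dom[OF S(2) submodD(1)[OF K]])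
  have ker: "\<exists>a\<in>carrier A. x = f a" if "x \<in> carrier B" "g x = \<zero>\<^bsub>C\<^esub>" for x
  proof -
    have "x \<in> f ` carrier A" unfolding S(4) using that by (simp add: mod_ker_def)
    then show ?thesis by blast
  qed
  have gf: "g (f a) = \<zero>\<^bsub>C\<^esub>" if "a \<in> carrier A" for a
  proof -
    have "f a \<in> mod_ker B C g" unfolding S(4)[symmetric] using that by (rule imageI)
    then show ?thesis by (simp add: mod_ker_def)
  qed
  have "inj_on g (carrier (restr B ?K))"
  proof (rule hom_injI[OF lmK lm(3) gK])
    fix x assume "x \<in> carrier (restr B ?K)" "g x = \<zero>\<^bsub>C\<^esub>"
    then have x: "x \<in> carrier B" "r x = \<zero>\<^bsub>D\<^esub>" "g x = \<zero>\<^bsub>C\<^esub>" by (auto simp: mod_ker_def)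
    then obtain a where a: "a \<in> carrier A" "x = f a" using ker by blast
    then have "a = \<zero>\<^bsub>A\<^esub>"
      using hom_inj_zero[OF lm(1,4) hom_comp[OF S(1) r(1)] bij_betw_imp_inj_on[OF r(2)]] x by simp
    then show "x = \<zero>\<^bsub>restr B ?K\<^esub>" using a hom_zero[OF lm(1,2) S(1)] by simp
  qed
  moreover have "g ` ?K = carrier C"
  proof (intro subset_antisym subsetI)
    fix c assume "c \<in> carrier C"
    then have "c \<in> g ` carrier B" unfolding S(5) .
    then obtain b where b: "b \<in> carrier B" "c = g b" by blast
    have "r b \<in> (\<lambda>a. r (f a)) ` carrier A"
      unfolding bij_betw_imp_surj_on[OF r(2)] by (rule homD(1)[OF r(1) b(1)])
    then obtain a where a: "a \<in> carrier A" "r b = r (f a)" by blast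
    note fa = homD(1)[OF S(1) a(1)]
    have "r (b \<oplus>\<^bsub>B\<^esub> \<ominus>\<^bsub>B\<^esub> f a) = \<zero>\<^bsub>D\<^esub>"
      using b a fa lm homD(1)[OF r(1)] by (simp add: homD(2)[OF r(1)] hom_neg[OF lm(2,4) r(1)])
    moreover have "g (b \<oplus>\<^bsub>B\<^esub> \<ominus>\<^bsub>B\<^esub> f a) = c"
      using b a fa lm homD(1)[OF S(2)] by (simp add: homD(2)[OF S(2)] hom_neg[OF lm(2,3) S(2)] gf)
    moreover have "b \<oplus>\<^bsub>B\<^esub> \<ominus>\<^bsub>B\<^esub> f a \<in> carrier B" using b fa lm by simp
    ultimately show "c \<in> g ` ?K" by (intro image_eqI[of _ g "b \<oplus>\<^bsub>B\<^esub> \<ominus>\<^bsub>B\<^esub> f a"]) (auto simp: mod_ker_def)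
  qed (use S(5) in \<open>auto simp: mod_ker_def\<close>)
  ultimately have "mod_iso L (restr B ?K) C"
    unfolding mod_iso_def using gK by (intro bexI[of _ g]) (auto simp: bij_betw_def)
  then show ?thesis
    by (rule bsum_iso[OF lm(2,1) lmK lm(1,3) mod_iso_refl mod_iso_refl _ s])
qed

text \<open>Third isomorphism theorem in terms of epimorphisms: with \<open>F = D / ker q\<close>,
  the kernel of the induced map \<open>k\<close> is \<open>ker g / ker q\<close>, which is the last
  clause.\<close>

lemma quotient_factor:
  assumes lm: "lm D" "lm E" "lm F" and g: "g \<in> hom D E" "g ` carrier D = carrier E"
    and q: "q \<in> hom D F" "q ` carrier D = carrier F" and ker: "mod_ker D F q \<subseteq> mod_ker D E g"
  obtains k where "k \<in> hom F E" "k ` carrier F = carrier E" "\<And>x. x \<in> carrier D \<Longrightarrow> k (q x) = g x"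
    "q ` mod_ker D E g = mod_ker F E k"
proof -
  obtain k where k: "k \<in> hom F E" "\<And>x. x \<in> carrier D \<Longrightarrow> k (q x) = g x"
    using factor_hom[OF lm(1,3,2) q g(1)] ker unfolding mod_ker_def by blast
  have "k ` carrier F = g ` carrier D"
    unfolding q(2)[symmetric] image_image using k(2) by (intro image_cong) auto
  moreover have "q ` mod_ker D E g = mod_ker F E k"
  proof (intro subset_antisym subsetI)
    fix y assume "y \<in> mod_ker F E k"
    then have y: "y \<in> carrier F" "k y = \<zero>\<^bsub>E\<^esub>" by (auto simp: mod_ker_def)
    obtain x where x: "x \<in> carrier D" "y = q x" using y(1) unfolding q(2)[symmetric] by (rule imageE)
    then show "y \<in> q ` mod_ker D E g" using y(2) k(2)[OF x(1)] by (auto simp: mod_ker_def)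
  qed (use k(2) homD(1)[OF q(1)] in \<open>auto simp: mod_ker_def\<close>)
  ultimately show thesis using that[OF k(1) _ k(2)] g(2) by simp
qed

end

section \<open>Short exact sequences as relations between multisets\<close>

context finite_length_modules
begin

lemma quotient_U:
  assumes "B \<in> U" "submod H B"
  obtains F q where "F \<in> U" "q \<in> hom B F" "q ` carrier B = carrier F" "mod_ker B F q = H"
proof -
  obtain F :: "'a fgmod" and q where q: "lm F" "q \<in> hom B F" "q ` carrier B = carrier F" "mod_ker B F q = H"
    using quotient_exists[OF U_lm[OF assms(1)] assms(2)] by blast
  have "F \<in> U" using fg_image[OF _ q(1-3)] assms(1) by (simp add: U_iff)
  then show thesis using that q by blast
qed

lemma ker_U: "B \<in> U \<Longrightarrow> lm C \<Longrightarrow> g \<in> hom B C \<Longrightarrow> restr B (mod_ker B C g) \<in> U"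
  by (rule U_restr) (auto intro: ker_submod)

text \<open>The trace of a short exact sequence with kernel \<open>a\<close>, middle term
  \<open>b\<close> and end term \<open>c\<close>. The kernel is an actual submodule of
  \<open>B\<close>, so no monomorphism has to be carried along.\<close>

definition sesm where
  "sesm a b c \<longleftrightarrow> (\<exists>B\<in>U. \<exists>C\<in>U. \<exists>g\<in>hom B C. g ` carrier B = carrier C \<and>
     dec B = b \<and> dec C = c \<and> dec (restr B (mod_ker B C g)) = a)"

lemma sesmI:
  assumes "B \<in> U" "C \<in> U" "g \<in> hom B C" "g ` carrier B = carrier C"
  shows "sesm (dec (restr B (mod_ker B C g))) (dec B) (dec C)"
  unfolding sesm_def using assms by blast

lemma sesmE:
  assumes "sesm a b c"
  obtains B C g where "B \<in> U" "C \<in> U" "g \<in> hom B C" "g ` carrier B = carrier C"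
    "dec B = b" "dec C = c" "dec (restr B (mod_ker B C g)) = a"
  using assms unfolding sesm_def by blast

lemma short_exact_sesm:
  assumes "A \<in> U" "B \<in> U" "C \<in> U" "short_exact L A f B g C"
  shows "sesm (dec A) (dec B) (dec C)"
proof -
  note S = short_exactD[OF assms(4)]
  have "dec A = dec (restr B (mod_ker B C g))"
    by (rule dec_iso[OF assms(1) ker_U[OF assms(2) U_lm[OF assms(3)] S(2)]
        short_exact_kernel_iso[OF U_lm[OF assms(1)] U_lm[OF assms(2)] assms(4)]])
  then show ?thesis using sesmI[OF assms(2,3) S(2,5)] by simp
qed

text \<open>The end term can be any prescribed representative of its class, so that two sequences
  can be glued at a common end.\<close>

lemma sesm_target:
  assumes "sesm a b c" "C \<in> U" "dec C = c"
  obtains B g where "B \<in> U" "g \<in> hom B C" "g ` carrier B = carrier C"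
    "dec B = b" "dec (restr B (mod_ker B C g)) = a"
proof -
  obtain B C' g where g: "B \<in> U" "C' \<in> U" "g \<in> hom B C'" "g ` carrier B = carrier C'"
    "dec B = b" "dec C' = c" "dec (restr B (mod_ker B C' g)) = a"
    using assms(1) by (rule sesmE)
  have "mod_iso L C' C" using dec_eq_iso[OF g(2) assms(2)] g(6) assms(3) by simp
  then obtain h where h: "h \<in> hom C' C" "bij_betw h (carrier C') (carrier C)"
    by (auto simp: mod_iso_def)
  have "(\<lambda>x. h (g x)) ` carrier B = carrier C"
    using bij_betw_imp_surj_on[OF h(2)] g(4) by (simp add: image_image[symmetric])
  moreover have "mod_ker B C (\<lambda>x. h (g x)) = mod_ker B C' g"
    using hom_inj_zero[OF U_lm[OF g(2)] U_lm[OF assms(2)] h(1) bij_betw_imp_inj_on[OF h(2)]]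
      hom_zero[OF U_lm[OF g(2)] U_lm[OF assms(2)] h(1)] homD(1)[OF g(3)]
    by (auto simp: mod_ker_def)
  ultimately show thesis
    using that[OF g(1) hom_comp[OF g(3) h(1)]] g(5,7) by simp
qed

lemma sesm_closed: "sesm a b c \<Longrightarrow> set_mset a \<subseteq> IC \<and> set_mset b \<subseteq> IC \<and> set_mset c \<subseteq> IC"
proof (erule sesmE)
  fix B C g assume g: "B \<in> U" "C \<in> U" "g \<in> hom B C" "dec B = b" "dec C = c"
    "dec (restr B (mod_ker B C g)) = a"
  show "set_mset a \<subseteq> IC \<and> set_mset b \<subseteq> IC \<and> set_mset c \<subseteq> IC"
    using dec_IC[OF g(1)] dec_IC[OF g(2)] dec_IC[OF ker_U[OF g(1) U_lm[OF g(2)] g(3)]] g(4-6) by simp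
qed

lemma sesm_sum:
  assumes "set_mset a \<subseteq> IC" "set_mset c \<subseteq> IC"
  shows "sesm a (a + c) c"
proof -
  obtain A where A: "A \<in> U" "dec A = a" using dec_surj[OF assms(1)] .
  obtain C where C: "C \<in> U" "dec C = c" using dec_surj[OF assms(2)] .
  obtain Z where Z: "Z \<in> U" "bsum Z C A" using bsum_exists[OF C(1) A(1)] .
  obtain i j p q where b: "biprod Z C A i j p q" using Z(2) by (auto simp: bsum_def)
  note D = biprodD[OF b]
  have surj: "p ` carrier Z = carrier C"
    using D(12) D(5) D(10) by (auto simp: image_iff) metis
  have "dec A = dec (restr Z (mod_ker Z C p))"
    by (rule dec_iso[OF A(1) ker_U[OF Z(1) U_lm[OF C(1)] D(3)]
        biprod_ker_iso[OF U_lm[OF Z(1)] U_lm[OF C(1)] U_lm[OF A(1)] b]])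
  moreover have "dec Z = a + c" using dec_bsum[OF Z(1) C(1) A(1) Z(2)] A C by simp
  ultimately show ?thesis using sesmI[OF Z(1) C(1) D(3) surj] A C by simp
qed

lemma sesm_add:
  assumes "sesm a b c" "sesm a' b' c'"
  shows "sesm (a + a') (b + b') (c + c')"
proof -
  obtain B C g where g: "B \<in> U" "C \<in> U" "g \<in> hom B C" "g ` carrier B = carrier C"
    "dec B = b" "dec C = c" "dec (restr B (mod_ker B C g)) = a"
    using assms(1) by (rule sesmE)
  obtain B' C' g' where g': "B' \<in> U" "C' \<in> U" "g' \<in> hom B' C'" "g' ` carrier B' = carrier C'"
    "dec B' = b'" "dec C' = c'" "dec (restr B' (mod_ker B' C' g')) = a'"
    using assms(2) by (rule sesmE)
  obtain X where X: "X \<in> U" "bsum X B B'" using bsum_exists[OF g(1) g'(1)] .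
  obtain i j p q where b: "biprod X B B' i j p q" using X(2) by (auto simp: bsum_def)
  note D = biprodD[OF b]
  obtain Y where Y: "Y \<in> U" "bsum Y C C'" using bsum_exists[OF g(2) g'(2)] .
  obtain k l r s where b2: "biprod Y C C' k l r s" using Y(2) by (auto simp: bsum_def)
  note E = biprodD[OF b2]
  note lm = U_lm[OF X(1)] U_lm[OF Y(1)] U_lm[OF g(1)] U_lm[OF g(2)] U_lm[OF g'(1)] U_lm[OF g'(2)]
  note gc = homD(1)[OF g(3)] homD(1)[OF g'(3)]
  let ?G = "\<lambda>x. k (g (p x)) \<oplus>\<^bsub>Y\<^esub> l (g' (q x))"
  have G: "?G \<in> hom X Y"
    by (intro hom_add lm hom_comp[OF hom_comp[OF D(3) g(3)] E(1)] hom_comp[OF hom_comp[OF D(4) g'(3)] E(2)])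
  have rG: "r (?G x) = g (p x)" "s (?G x) = g' (q x)" if "x \<in> carrier X" for x
    using that lm by (simp_all add: D E gc homD(2)[OF E(3)] homD(2)[OF E(4)])
  have zero: "?G x = \<zero>\<^bsub>Y\<^esub> \<longleftrightarrow> g (p x) = \<zero>\<^bsub>C\<^esub> \<and> g' (q x) = \<zero>\<^bsub>C'\<^esub>" if "x \<in> carrier X" for x
  proof
    assume "?G x = \<zero>\<^bsub>Y\<^esub>"
    then show "g (p x) = \<zero>\<^bsub>C\<^esub> \<and> g' (q x) = \<zero>\<^bsub>C'\<^esub>"
      using rG[OF that] hom_zero[OF lm(2,4) E(3)] hom_zero[OF lm(2,6) E(4)] by simp
  qed (use lm hom_zero[OF lm(4,2) E(1)] hom_zero[OF lm(6,2) E(2)] in simp)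
  have surj: "?G ` carrier X = carrier Y"
  proof (intro subset_antisym subsetI)
    fix y assume y: "y \<in> carrier Y"
    have "r y \<in> g ` carrier B" "s y \<in> g' ` carrier B'" unfolding g(4) g'(4) using E(12,13) y by auto
    then obtain u v where uv: "u \<in> carrier B" "r y = g u" "v \<in> carrier B'" "s y = g' v" by blast
    have "?G (i u \<oplus>\<^bsub>X\<^esub> j v) = y"
      using uv lm E(9)[OF y] by (simp add: D homD(2)[OF D(3)] homD(2)[OF D(4)])
    then show "y \<in> ?G ` carrier X"
      using uv lm D(10,11) by (intro image_eqI[of _ _ "i u \<oplus>\<^bsub>X\<^esub> j v"]) auto
  qed (use homD(1)[OF G] in blast)
  let ?K = "mod_ker X Y ?G" and ?K1 = "mod_ker B C g" and ?K2 = "mod_ker B' C' g'"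
  have K: "x \<in> ?K \<longleftrightarrow> x \<in> carrier X \<and> p x \<in> ?K1 \<and> q x \<in> ?K2" for x
    using zero[of x] D(12,13) by (auto simp: mod_ker_def)
  have sub: "?K \<subseteq> carrier X" "?K1 \<subseteq> carrier B" "?K2 \<subseteq> carrier B'" by (auto simp: mod_ker_def)
  have z: "\<zero>\<^bsub>B\<^esub> \<in> ?K1" "\<zero>\<^bsub>B'\<^esub> \<in> ?K2"
    using lm hom_zero[OF lm(3,4) g(3)] hom_zero[OF lm(5,6) g'(3)] by (auto simp: mod_ker_def)
  have "biprod (restr X ?K) (restr B ?K1) (restr B' ?K2) i j p q"
    unfolding biprod_def
  proof (intro conjI)
    show "i \<in> hom (restr B ?K1) (restr X ?K)"
      using sub z D by (intro hom_restr_cod hom_restr_dom) (auto simp: K)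
    show "j \<in> hom (restr B' ?K2) (restr X ?K)"
      using sub z D by (intro hom_restr_cod hom_restr_dom) (auto simp: K)
    show "p \<in> hom (restr X ?K) (restr B ?K1)"
      using sub D by (intro hom_restr_cod hom_restr_dom) (auto simp: K)
    show "q \<in> hom (restr X ?K) (restr B' ?K2)"
      using sub D by (intro hom_restr_cod hom_restr_dom) (auto simp: K)
  qed (use D sub in \<open>auto simp: subset_iff\<close>)
  then have "bsum (restr X ?K) (restr B ?K1) (restr B' ?K2)" by (rule bsumI)
  then have "dec (restr X ?K) = a + a'"
    using dec_bsum[OF ker_U[OF X(1) lm(2) G] ker_U[OF g(1) lm(4) g(3)] ker_U[OF g'(1) lm(6) g'(3)]] g(7) g'(7)
    by simp
  then show ?thesis
    using sesmI[OF X(1) Y(1) G surj] dec_bsum[OF X(1) g(1) g'(1) X(2)] dec_bsum[OF Y(1) g(2) g'(2) Y(2)]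
      g g' by simp
qed

text \<open>\<open>e\<close> is the class of the fibre product of \<open>g\<close> and
  \<open>g'\<close>, cut out of the direct sum of \<open>B\<close> and \<open>B'\<close> as the
  kernel of the difference. Each projection is onto, and its kernel is isomorphic to that of the map
  on the other side.\<close>

lemma sesm_pullback:
  assumes "sesm a b c" "sesm a' b' c"
  shows "\<exists>e. sesm a e b' \<and> sesm a' e b"
proof -
  obtain B C g where g: "B \<in> U" "C \<in> U" "g \<in> hom B C" "g ` carrier B = carrier C"
    "dec B = b" "dec C = c" "dec (restr B (mod_ker B C g)) = a"
    using assms(1) by (rule sesmE)
  obtain B' g' where g': "B' \<in> U" "g' \<in> hom B' C" "g' ` carrier B' = carrier C"
    "dec B' = b'" "dec (restr B' (mod_ker B' C g')) = a'"
    using sesm_target[OF assms(2) g(2,6)] .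
  obtain X where X: "X \<in> U" "bsum X B B'" using bsum_exists[OF g(1) g'(1)] .
  obtain i j p q where b: "biprod X B B' i j p q" using X(2) by (auto simp: bsum_def)
  note D = biprodD[OF b]
  note lm = U_lm[OF X(1)] U_lm[OF g(1)] U_lm[OF g'(1)] U_lm[OF g(2)]
  note gc = homD(1)[OF g(3)] homD(1)[OF g'(2)]
  let ?d = "\<lambda>x. g (p x) \<oplus>\<^bsub>C\<^esub> \<ominus>\<^bsub>C\<^esub> g' (q x)"
  have d: "?d \<in> hom X C" by (intro hom_add hom_uminus lm hom_comp[OF D(3) g(3)] hom_comp[OF D(4) g'(2)])
  let ?H = "mod_ker X C ?d"
  have H: "submod ?H X" by (rule ker_submod[OF lm(1,4) d])
  have Hiff: "x \<in> ?H \<longleftrightarrow> x \<in> carrier X \<and> g (p x) = g' (q x)" for x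
    using lm_diff_eq_0[OF lm(4), of "g (p x)" "g' (q x)"] lm gc D(12,13) by (auto simp: mod_ker_def)
  let ?E = "restr X ?H"
  have E: "?E \<in> U" by (rule U_restr[OF X(1) H])
  have q: "q \<in> hom ?E B'" and p: "p \<in> hom ?E B"
    by (intro hom_restr_dom D submodD(1)[OF H])+
  have mem: "i u \<oplus>\<^bsub>X\<^esub> j v \<in> ?H" "p (i u \<oplus>\<^bsub>X\<^esub> j v) = u" "q (i u \<oplus>\<^bsub>X\<^esub> j v) = v"
    if "u \<in> carrier B" "v \<in> carrier B'" "g u = g' v" for u v
    using that lm by (simp_all add: Hiff D homD(2)[OF D(3)] homD(2)[OF D(4)])
  have qs: "q ` carrier ?E = carrier B'"
  proof (intro subset_antisym subsetI)
    fix v assume v: "v \<in> carrier B'"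
    have "g' v \<in> g ` carrier B" unfolding g(4) by (rule gc(2)[OF v])
    then obtain u where u: "u \<in> carrier B" "g u = g' v" by force
    show "v \<in> q ` carrier ?E" using mem[OF u(1) v u(2)] by (intro image_eqI[of _ _ "i u \<oplus>\<^bsub>X\<^esub> j v"]) auto
  qed (use homD(1)[OF q] in blast)
  have ps: "p ` carrier ?E = carrier B"
  proof (intro subset_antisym subsetI)
    fix u assume u: "u \<in> carrier B"
    have "g u \<in> g' ` carrier B'" unfolding g'(3) by (rule gc(1)[OF u])
    then obtain v where v: "v \<in> carrier B'" "g u = g' v" by force
    show "u \<in> p ` carrier ?E" using mem[OF u v] by (intro image_eqI[of _ _ "i u \<oplus>\<^bsub>X\<^esub> j v"]) auto
  qed (use homD(1)[OF p] in blast)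
  have z: "g \<zero>\<^bsub>B\<^esub> = \<zero>\<^bsub>C\<^esub>" "g' \<zero>\<^bsub>B'\<^esub> = \<zero>\<^bsub>C\<^esub>" "i \<zero>\<^bsub>B\<^esub> = \<zero>\<^bsub>X\<^esub>" "j \<zero>\<^bsub>B'\<^esub> = \<zero>\<^bsub>X\<^esub>"
    using hom_zero[OF lm(2,4) g(3)] hom_zero[OF lm(3,4) g'(2)] hom_zero[OF lm(2,1) D(1)]
      hom_zero[OF lm(3,1) D(2)] by auto
  let ?K = "mod_ker B C g" and ?K' = "mod_ker B' C g'"
  let ?A = "mod_ker ?E B' q" and ?A' = "mod_ker ?E B p"
  have sub: "?K \<subseteq> carrier B" "?K' \<subseteq> carrier B'" "?A \<subseteq> ?H" "?A' \<subseteq> ?H" "?A \<subseteq> carrier X" "?A' \<subseteq> carrier X"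
    by (auto simp: mod_ker_def)
  have ip: "i (p x) = x" if "x \<in> carrier X" "q x = \<zero>\<^bsub>B'\<^esub>" for x
    using D(9)[OF that(1)] that lm D(10,12) z(4) by simp
  have jq: "j (q x) = x" if "x \<in> carrier X" "p x = \<zero>\<^bsub>B\<^esub>" for x
    using D(9)[OF that(1)] that lm D(11,13) z(3) by simp
  have "mod_iso L (restr ?E ?A) (restr B ?K)"
  proof (rule mod_isoI[of p _ _ i])
    show "p \<in> hom (restr ?E ?A) (restr B ?K)"
      using sub by (intro hom_restr_cod hom_restr_dom p) (auto simp: mod_ker_def[of B] mod_ker_def[of "?E"] Hiff D z)
    have "i \<in> hom (restr B ?K) (restr X ?A)"
      using sub z by (intro hom_restr_cod hom_restr_dom D) (auto simp: mod_ker_def[of B] mod_ker_def[of "?E"] Hiff D)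
    then show "i \<in> hom (restr B ?K) (restr ?E ?A)" by simp
  qed (use sub ip D in \<open>auto simp: mod_ker_def Hiff\<close>)
  then have "dec (restr ?E ?A) = a"
    using dec_iso[OF ker_U[OF E lm(3) q] ker_U[OF g(1) lm(4) g(3)]] g(7) by simp
  moreover have "mod_iso L (restr ?E ?A') (restr B' ?K')"
  proof (rule mod_isoI[of q _ _ j])
    show "q \<in> hom (restr ?E ?A') (restr B' ?K')"
      using sub by (intro hom_restr_cod hom_restr_dom q) (auto simp: mod_ker_def[of B'] mod_ker_def[of "?E"] Hiff D z)
    have "j \<in> hom (restr B' ?K') (restr X ?A')"
      using sub z by (intro hom_restr_cod hom_restr_dom D) (auto simp: mod_ker_def[of B'] mod_ker_def[of "?E"] Hiff D)
    then show "j \<in> hom (restr B' ?K') (restr ?E ?A')" by simp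
  qed (use sub jq D in \<open>auto simp: mod_ker_def Hiff\<close>)
  then have "dec (restr ?E ?A') = a'"
    using dec_iso[OF ker_U[OF E lm(2) p] ker_U[OF g'(1) lm(4) g'(2)]] g'(5) by simp
  ultimately show ?thesis
    using sesmI[OF E g'(1) q qs] sesmI[OF E g(1) p ps] g(5) g'(4) by auto
qed

text \<open>For submodules \<open>A \<subseteq> B \<subseteq> D\<close> the class \<open>f\<close>
  is that of \<open>D / A\<close>, with \<open>B / A\<close> as kernel of
  \<open>D / A \<rightarrow> D / B\<close>. In the proof the kernel of \<open>g\<close> takes the
  place of \<open>B\<close>, and \<open>?H\<close> is the copy of \<open>A\<close> inside
  it.\<close>

lemma sesm_quotient:
  assumes "sesm a b c" "sesm b d e"
  shows "\<exists>f. sesm a d f \<and> sesm c f e"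
proof -
  obtain D E g where g: "D \<in> U" "E \<in> U" "g \<in> hom D E" "g ` carrier D = carrier E"
    "dec D = d" "dec E = e" "dec (restr D (mod_ker D E g)) = b"
    using assms(2) by (rule sesmE)
  obtain B C h where h: "B \<in> U" "C \<in> U" "h \<in> hom B C" "h ` carrier B = carrier C"
    "dec B = b" "dec C = c" "dec (restr B (mod_ker B C h)) = a"
    using assms(1) by (rule sesmE)
  note lm = U_lm[OF g(1)] U_lm[OF g(2)] U_lm[OF h(1)] U_lm[OF h(2)]
  let ?K = "restr D (mod_ker D E g)"
  have KU: "?K \<in> U" by (rule ker_U[OF g(1) lm(2) g(3)])
  have Ks: "submod (mod_ker D E g) D" by (rule ker_submod[OF lm(1,2) g(3)])
  have "mod_iso L ?K B" using dec_eq_iso[OF KU h(1)] g(7) h(5) by simp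
  then obtain u where u: "u \<in> hom ?K B" "bij_betw u (carrier ?K) (carrier B)"
    by (auto simp: mod_iso_def)
  have hu: "(\<lambda>x. h (u x)) \<in> hom ?K C" by (rule hom_comp[OF u(1) h(3)])
  have hus: "(\<lambda>x. h (u x)) ` carrier ?K = carrier C"
    using bij_betw_imp_surj_on[OF u(2)] h(4) by (simp only: image_image[symmetric])
  let ?H = "mod_ker ?K C (\<lambda>x. h (u x))"
  have HsK: "submod ?H ?K" by (rule ker_submod[OF U_lm[OF KU] lm(4) hu])
  have Hs: "submod ?H D" and HK: "?H \<subseteq> mod_ker D E g" using submod_restr[OF lm(1) Ks] HsK by auto
  have kU: "restr B (mod_ker B C h) \<in> U" by (rule ker_U[OF h(1) lm(4) h(3)])
  have "mod_iso L (restr D ?H) (restr B (mod_ker B C h))"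
    unfolding mod_iso_def
  proof (intro bexI[of _ u])
    have "u ` ?H = mod_ker B C h"
    proof (intro subset_antisym subsetI)
      fix y assume y: "y \<in> mod_ker B C h"
      then have "y \<in> u ` carrier ?K" unfolding bij_betw_imp_surj_on[OF u(2)] by (simp add: mod_ker_def)
      then obtain x where x: "x \<in> carrier ?K" "y = u x" by (rule imageE)
      then show "y \<in> u ` ?H" using y by (auto simp: mod_ker_def)
    qed (use homD(1)[OF u(1)] in \<open>auto simp: mod_ker_def\<close>)
    moreover have "inj_on u ?H" using inj_on_subset[OF bij_betw_imp_inj_on[OF u(2)]] HK by simp
    ultimately show "bij_betw u (carrier (restr D ?H)) (carrier (restr B (mod_ker B C h)))"
      by (simp add: bij_betw_def)
    have "u \<in> hom (restr ?K ?H) (restr B (mod_ker B C h))"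
      using \<open>u ` ?H = mod_ker B C h\<close> HK by (intro hom_restr_cod hom_restr_dom u(1)) simp_all
    then show "u \<in> hom (restr D ?H) (restr B (mod_ker B C h))" by simp
  qed
  then have a: "dec (restr D ?H) = a" using dec_iso[OF U_restr[OF g(1) Hs] kU] h(7) by simp
  obtain F q where q: "F \<in> U" "q \<in> hom D F" "q ` carrier D = carrier F" "mod_ker D F q = ?H"
    using quotient_U[OF g(1) Hs] .
  have lmF: "lm F" using q(1) by simp
  obtain k where k: "k \<in> hom F E" "k ` carrier F = carrier E" "\<And>x. x \<in> carrier D \<Longrightarrow> k (q x) = g x"
    "q ` mod_ker D E g = mod_ker F E k"
    using quotient_factor[OF lm(1,2) lmF g(3,4) q(2,3)] q(4) HK by auto
  let ?L = "restr F (mod_ker F E k)"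
  have LU: "?L \<in> U" by (rule ker_U[OF q(1) lm(2) k(1)])
  have qK: "q \<in> hom ?K ?L" using k(4) by (intro hom_restr_cod hom_restr_dom q(2) submodD(1)[OF Ks]) simp
  have "mod_iso L ?L C"
  proof (rule same_kernel_iso[OF U_lm[OF KU] U_lm[OF LU] lm(4) qK _ hu hus])
    show "q ` carrier ?K = carrier ?L" using k(4) by simp
    show "mod_ker ?K ?L q = ?H"
      using q(4) HK submodD(1)[OF Ks] unfolding mod_ker_def[of ?K ?L] mod_ker_def[of D F] by auto
  qed
  then have "dec ?L = c" using dec_iso[OF LU h(2)] h(6) by simp
  then show ?thesis using sesmI[OF g(1) q(1-3)] sesmI[OF q(1) g(2) k(1,2)] a q(4) g(5,6) by auto
qed

text \<open>\<open>f\<close> is the class of the preimage in \<open>B\<close> of the submodule of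
  \<open>C\<close> with class \<open>c1\<close>, which is the kernel of the composite from
  \<open>B\<close> to \<open>C2\<close>.\<close>

lemma sesm_preimage:
  assumes "sesm k b c" "sesm c1 c c2"
  shows "\<exists>f. sesm f b c2 \<and> sesm k f c1"
proof -
  obtain C C2 h where h: "C \<in> U" "C2 \<in> U" "h \<in> hom C C2" "h ` carrier C = carrier C2"
    "dec C = c" "dec C2 = c2" "dec (restr C (mod_ker C C2 h)) = c1"
    using assms(2) by (rule sesmE)
  obtain B g where g: "B \<in> U" "g \<in> hom B C" "g ` carrier B = carrier C"
    "dec B = b" "dec (restr B (mod_ker B C g)) = k"
    using sesm_target[OF assms(1) h(1,5)] .
  note lm = U_lm[OF g(1)] U_lm[OF h(1)] U_lm[OF h(2)]
  let ?hg = "\<lambda>x. h (g x)"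
  have hg: "?hg \<in> hom B C2" by (rule hom_comp[OF g(2) h(3)])
  have hgs: "?hg ` carrier B = carrier C2" using g(3) h(4) by (simp only: image_image[symmetric])
  let ?F = "restr B (mod_ker B C2 ?hg)" and ?M = "restr C (mod_ker C C2 h)"
  have F: "?F \<in> U" and M: "?M \<in> U" by (rule ker_U[OF g(1) lm(3) hg], rule ker_U[OF h(1) lm(3) h(3)])
  have gF: "g \<in> hom ?F ?M"
    using homD(1)[OF g(2)] by (intro hom_restr_cod hom_restr_dom g(2)) (auto simp: mod_ker_def)
  have gs: "g ` carrier ?F = carrier ?M"
  proof (intro subset_antisym subsetI)
    fix y assume "y \<in> carrier ?M"
    then have y: "y \<in> carrier C" "h y = \<zero>\<^bsub>C2\<^esub>" by (auto simp: mod_ker_def)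
    obtain x where "x \<in> carrier B" "y = g x" using y(1) unfolding g(3)[symmetric] by (rule imageE)
    then show "y \<in> g ` carrier ?F" using y(2) by (auto simp: mod_ker_def)
  qed (use homD(1)[OF gF] in blast)
  have "mod_ker ?F ?M g = mod_ker B C g"
    using hom_zero[OF lm(2,3) h(3)] by (auto simp: mod_ker_def)
  then have "dec (restr ?F (mod_ker ?F ?M g)) = k" using g(5) by simp
  then show ?thesis using sesmI[OF g(1) h(2) hg hgs] sesmI[OF F M gF gs] g(4) h(6,7) by auto
qed

end

subsection \<open>Dimension shifting\<close>

text \<open>Modules are encoded by multisets over the set \<open>I\<close> of isoclasses of indecomposables, the
  projective ones among them forming \<open>J\<close>.  The quantification over \<open>Q\<close> in \<open>fitting_ses\<close> expresses
  that \<open>t\<close> is a direct summand of an iterated extension of copies of \<open>w\<close>.\<close>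

locale exact_multisets =
  fixes I J :: "'c set" and ses :: "'c multiset \<Rightarrow> 'c multiset \<Rightarrow> 'c multiset \<Rightarrow> bool"
  assumes J_sub: "J \<subseteq> I"
    and ses_obj: "ses a b c \<Longrightarrow> set_mset a \<subseteq> I \<and> set_mset b \<subseteq> I \<and> set_mset c \<subseteq> I"
    and ses_sum: "set_mset a \<subseteq> I \<Longrightarrow> set_mset c \<subseteq> I \<Longrightarrow> ses a (a + c) c"
    and ses_add: "ses a b c \<Longrightarrow> ses a' b' c' \<Longrightarrow> ses (a + a') (b + b') (c + c')"
    and ses_split: "ses a b p \<Longrightarrow> set_mset p \<subseteq> J \<Longrightarrow> b = a + p"
    and ses_pullback: "ses a b c \<Longrightarrow> ses a' b' c \<Longrightarrow> \<exists>e. ses a e b' \<and> ses a' e b"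
    and ses_quotient: "ses a b c \<Longrightarrow> ses b d e \<Longrightarrow> \<exists>f. ses a d f \<and> ses c f e"
    and ses_preimage: "ses k b c \<Longrightarrow> ses c1 c c2 \<Longrightarrow> \<exists>f. ses f b c2 \<and> ses k f c1"
    and enough_projectives: "set_mset m \<subseteq> I \<Longrightarrow> \<exists>k p. set_mset p \<subseteq> J \<and> ses k p m"
    and fitting_ses: "ses y (y + q) w \<Longrightarrow> \<exists>t z. y = t + z \<and> ses t (t + q) w \<and>
      (\<forall>Q. Q w \<longrightarrow> (\<forall>a b. Q a \<longrightarrow> ses w b a \<longrightarrow> Q b) \<longrightarrow> (\<exists>x. Q x \<and> t \<subseteq># x))"
begin

definition obj :: "'c multiset \<Rightarrow> bool" where "obj m \<longleftrightarrow> set_mset m \<subseteq> I"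
definition proj :: "'c multiset \<Rightarrow> bool" where "proj m \<longleftrightarrow> set_mset m \<subseteq> J"

lemma obj_simps [simp]: "obj {#}" "obj (a + b) \<longleftrightarrow> obj a \<and> obj b" "obj (add_mset x a) \<longleftrightarrow> x \<in> I \<and> obj a"
  and proj_simps [simp]: "proj {#}" "proj (a + b) \<longleftrightarrow> proj a \<and> proj b" "proj (add_mset x a) \<longleftrightarrow> x \<in> J \<and> proj a"
  by (auto simp: obj_def proj_def)

lemma proj_obj: "proj m \<Longrightarrow> obj m"
  using J_sub by (auto simp: obj_def proj_def)

lemmas ses_closed = ses_obj[folded obj_def]
  and ses_add_right = ses_sum[folded obj_def]
  and ses_projective = ses_split[folded proj_def]
  and projective_surj = enough_projectives[folded obj_def proj_def]

primrec pdim_le :: "nat \<Rightarrow> 'c multiset \<Rightarrow> bool" where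
  "pdim_le 0 m = proj m"
| "pdim_le (Suc n) m = (\<exists>k p. proj p \<and> ses k p m \<and> pdim_le n k)"

lemma pdim_le_proj: "proj p \<Longrightarrow> pdim_le n p"
proof (induction n arbitrary: p)
  case (Suc n)
  have "ses {#} ({#} + p) p" using Suc.prems proj_obj by (intro ses_add_right) auto
  then show ?case using Suc.prems Suc.IH[of "{#}"] by auto
qed auto

lemma pdim_le_Suc: "pdim_le n m \<Longrightarrow> pdim_le (Suc n) m"
proof (induction n arbitrary: m)
  case 0
  then show ?case using pdim_le_proj[of m "Suc 0"] by simp
next
  case (Suc n)
  then obtain k p where "proj p" "ses k p m" "pdim_le n k" by auto
  then show ?case using Suc.IH[of k] pdim_le.simps(2)[of "Suc n" m] by blast
qed

lemma pdim_le_mono: "n \<le> n' \<Longrightarrow> pdim_le n m \<Longrightarrow> pdim_le n' m"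
  by (induction n' rule: dec_induct) (simp_all add: pdim_le_Suc del: pdim_le.simps)

lemma pdim_le_add: "pdim_le n m \<Longrightarrow> pdim_le n m' \<Longrightarrow> pdim_le n (m + m')"
proof (induction n arbitrary: m m')
  case (Suc n)
  then obtain k p k' p' where "proj p" "ses k p m" "pdim_le n k" "proj p'" "ses k' p' m'" "pdim_le n k'"
    by auto
  then have "proj (p + p')" "ses (k + k') (p + p') (m + m')" "pdim_le n (k + k')"
    using Suc.IH ses_add by auto
  then show ?case unfolding pdim_le.simps by blast
qed auto

text \<open>Schanuel's lemma: the pullback of the two presentations is an extension with projective
  end term on either side, so it splits both ways. The isomorphism has become an equality of
  multisets.\<close>

lemma schanuel_eq:
  assumes "ses k p m" "proj p" "ses k' p' m" "proj p'"
  shows "k + p' = k' + p"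
  using ses_pullback[OF assms(1,3)] ses_projective assms by metis

lemma pdim_le_obj: "pdim_le n m \<Longrightarrow> obj m"
  by (cases n) (use proj_obj ses_closed in \<open>simp, fastforce\<close>)

text \<open>A presentation of a sum need not be a sum of presentations. Schanuel's lemma compares
  the given one with the sum of presentations of \<open>x\<close> and \<open>y\<close>, and this
  makes \<open>kx\<close> a summand of a multiset of dimension at most \<open>n\<close>.\<close>

lemma pdim_le_summand: "pdim_le n (x + y) \<Longrightarrow> pdim_le n x"
proof (induction n arbitrary: x y)
  case (Suc n)
  have "obj x" "obj y" using pdim_le_obj[OF Suc.prems] by auto
  then obtain kx px ky py where x: "proj px" "ses kx px x" and y: "proj py" "ses ky py y"
    using projective_surj by meson
  obtain k p where p: "proj p" "ses k p (x + y)" "pdim_le n k" using Suc.prems by auto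
  have "proj (px + py)" using x y by simp
  then have "k + (px + py) = (kx + ky) + p"
    using schanuel_eq[OF p(2,1) ses_add[OF x(2) y(2)]] by simp
  moreover have "pdim_le n (k + (px + py))"
    using p(3) x y by (simp add: pdim_le_add pdim_le_proj)
  ultimately have "pdim_le n (kx + (ky + p))" by (simp add: add.assoc)
  then have "pdim_le n kx" by (rule Suc.IH)
  then show ?case using x unfolding pdim_le.simps by blast
qed auto

lemma pdim_le_subset: "pdim_le n x \<Longrightarrow> y \<subseteq># x \<Longrightarrow> pdim_le n y"
  using pdim_le_summand[of n y "x - y"] by simp

text \<open>By Schanuel's lemma the kernel of an arbitrary presentation is a summand of a good
  kernel plus a projective, so the existential in \<open>pdim_le\<close> may be read as
  universal.\<close>

lemma pdim_le_kernel:
  assumes "pdim_le (Suc n) m" "proj p" "ses k p m"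
  shows "pdim_le n k"
proof -
  obtain k' p' where k': "proj p'" "ses k' p' m" "pdim_le n k'" using assms(1) by auto
  have "k + p' = k' + p" using schanuel_eq assms k' by blast
  moreover have "pdim_le n (k' + p)" using k' assms(2) by (simp add: pdim_le_add pdim_le_proj)
  ultimately show ?thesis using pdim_le_summand by metis
qed

text \<open>The pullback of a presentation of \<open>c\<close> along \<open>b\<close> is
  \<open>e = a + p\<close>. A projective \<open>q\<close> that covers \<open>e\<close> also covers
  \<open>b\<close>, and the kernel \<open>f\<close> of this second map is an extension of
  \<open>k\<close> by \<open>l\<close>, to which induction applies.\<close>

lemma pdim_le_extension: "ses a b c \<Longrightarrow> pdim_le n a \<Longrightarrow> pdim_le n c \<Longrightarrow> pdim_le n b"
proof (induction n arbitrary: a b c)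
  case 0
  then have "b = a + c" using ses_projective by simp
  then show ?case using 0 by simp
next
  case (Suc n)
  obtain k p where p: "proj p" "ses k p c" "pdim_le n k" using Suc.prems by auto
  obtain e where e: "ses a e p" "ses k e b" using ses_pullback[OF Suc.prems(1) p(2)] by blast
  have "e = a + p" using ses_projective e p by blast
  then have "pdim_le (Suc n) e" using Suc.prems(2) p(1) by (metis pdim_le_add pdim_le_proj)
  then obtain l q where q: "proj q" "ses l q e" "pdim_le n l" by auto
  obtain f where f: "ses f q b" "ses l f k" using ses_preimage[OF q(2) e(2)] by blast
  show ?case using Suc.IH[OF f(2)] q p f by auto
qed

text \<open>A projective covering \<open>b\<close> covers \<open>c\<close>, and the new kernel is an
  extension of \<open>a\<close> by the old one.\<close>

lemma pdim_le_cokernel: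
  assumes "ses a b c" "pdim_le n a" "pdim_le (Suc n) b"
  shows "pdim_le (Suc n) c"
proof -
  obtain l q where q: "proj q" "ses l q b" "pdim_le n l" using assms(3) by auto
  obtain f where f: "ses f q c" "ses l f a" using ses_preimage[OF q(2) assms(1)] by blast
  then have "pdim_le n f" using pdim_le_extension q assms by blast
  then show ?thesis using q f by auto
qed

section \<open>Syzygies up to projective summands\<close>

definition nonproj :: "'c multiset \<Rightarrow> 'c multiset" where
  "nonproj m = filter_mset (\<lambda>x. x \<notin> J) m"

lemma nonproj_add [simp]: "nonproj (a + b) = nonproj a + nonproj b"
  by (simp add: nonproj_def)

lemma nonproj_empty [simp]: "nonproj {#} = {#}"
  by (simp add: nonproj_def)

lemma nonproj_proj: "nonproj m = {#} \<longleftrightarrow> proj m"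
  unfolding nonproj_def proj_def set_mset_eq_empty_iff[symmetric] by auto

lemma nonproj_decomp: "\<exists>p. m = nonproj m + p \<and> proj p"
proof (intro exI conjI)
  show "m = nonproj m + filter_mset (\<lambda>x. x \<in> J) m"
    unfolding nonproj_def using multiset_partition[of m "\<lambda>x. x \<notin> J"] by simp
qed (auto simp: proj_def)

lemma pdim_le_nonproj: "obj m \<Longrightarrow> pdim_le n (nonproj m) \<longleftrightarrow> pdim_le n m"
  using nonproj_decomp[of m] by (metis pdim_le_add pdim_le_proj pdim_le_summand)

lemma pdim_le_nonproj_cong: "obj m \<Longrightarrow> obj m' \<Longrightarrow> nonproj m = nonproj m' \<Longrightarrow> pdim_le n m \<longleftrightarrow> pdim_le n m'"
  by (metis pdim_le_nonproj)

text \<open>The presentation need not be a projective cover, so \<open>k\<close> is determined by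
  \<open>m\<close> only up to projective summands; \<open>syz_nonproj\<close> makes this
  precise.\<close>

definition syz :: "'c multiset \<Rightarrow> 'c multiset \<Rightarrow> bool" where
  "syz k m \<longleftrightarrow> (\<exists>p. proj p \<and> ses k p m)"

lemma syz_obj: "syz k m \<Longrightarrow> obj k \<and> obj m"
  unfolding syz_def using ses_closed by blast

lemma syz_exists: "obj m \<Longrightarrow> \<exists>k. syz k m"
  unfolding syz_def using projective_surj by blast

lemma syz_add: "syz k m \<Longrightarrow> syz k' m' \<Longrightarrow> syz (k + k') (m + m')"
  unfolding syz_def using ses_add by (metis proj_simps(2))

text \<open>A projective has zero as one of its syzygies. Adding projectives therefore makes
  \<open>m\<close> and \<open>m'\<close> equal without changing \<open>k\<close> and
  \<open>k'\<close>, and Schanuel's lemma compares the two presentations.\<close>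

lemma syz_nonproj: 
  assumes "syz k m" "syz k' m'" "nonproj m = nonproj m'"
  shows "nonproj k = nonproj k'"
proof -
  have unique: "nonproj k = nonproj k'" if k: "syz k m" "syz k' m" for k k' m
  proof -
    obtain p p' where p: "proj p" "ses k p m" "proj p'" "ses k' p' m"
      using k unfolding syz_def by blast
    then have "k + p' = k' + p" using schanuel_eq by meson
    then have "nonproj k + nonproj p' = nonproj k' + nonproj p" by (metis nonproj_add)
    moreover have "nonproj p = {#}" "nonproj p' = {#}" using p nonproj_proj by auto
    ultimately show ?thesis by simp
  qed
  have proj: "syz k (m + p)" if "syz k m" "proj p" for k m p
  proof -
    have "ses {#} ({#} + p) p" using that proj_obj by (intro ses_add_right) auto
    then have "syz {#} p" using that by (auto simp: syz_def)
    then show ?thesis using syz_add[OF that(1), of "{#}" p] by simp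
  qed
  obtain p where p: "m = nonproj m + p" "proj p" using nonproj_decomp by blast
  obtain p' where p': "m' = nonproj m' + p'" "proj p'" using nonproj_decomp by blast
  have "m + p' = nonproj m + p + p'" using p(1) by simp
  also have "\<dots> = m' + p" using p'(1) assms(3) by (simp add: add_ac)
  finally have "m + p' = m' + p" .
  then show ?thesis
    using unique[OF proj[OF assms(1) \<open>proj p'\<close>]] proj[OF assms(2) \<open>proj p\<close>] by simp
qed

text \<open>Exactness up to projective summands in each of the three terms, in analogy with a
  distinguished triangle of a stable category, with \<open>syz\<close> as shift.\<close>

definition tri :: "'c multiset \<Rightarrow> 'c multiset \<Rightarrow> 'c multiset \<Rightarrow> bool" where
  "tri a b c \<longleftrightarrow> (\<exists>a' b' c'. ses a' b' c' \<and> nonproj a' = nonproj a \<and> nonproj b' = nonproj b \<and> nonproj c' = nonproj c)"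

text \<open>The pullback of the sequence along a projective presentation of its end term splits as
  \<open>a' + p\<close>, and it is an extension of \<open>b'\<close> by a syzygy of
  \<open>c'\<close>.\<close>

lemma tri_rotate:
  assumes "tri a b c" "syz k c"
  shows "tri k a b"
proof -
  obtain a' b' c' where s: "ses a' b' c'" "nonproj a' = nonproj a" "nonproj b' = nonproj b" "nonproj c' = nonproj c"
    using assms by (auto simp: tri_def)
  obtain k' p where k': "proj p" "ses k' p c'" using projective_surj ses_closed[OF s(1)] by meson
  then have "syz k' c'" unfolding syz_def by blast
  then have k: "nonproj k' = nonproj k" using syz_nonproj[OF _ assms(2) s(4)] by blast
  obtain e where e: "ses a' e p" "ses k' e b'" using ses_pullback[OF s(1) k'(2)] by blast
  have "e = a' + p" using ses_projective e k' by blast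
  then have "nonproj e = nonproj a" using s(2) k'(1) nonproj_proj[of p] by simp
  then show ?thesis unfolding tri_def using e(2) k s by blast
qed

text \<open>Three rotations replace every term by its syzygy.\<close>

lemma tri_syz: "tri a b c \<Longrightarrow> syz a' a \<Longrightarrow> syz b' b \<Longrightarrow> syz c' c \<Longrightarrow> tri a' b' c'"
  using tri_rotate by meson

primrec syzn :: "nat \<Rightarrow> 'c multiset \<Rightarrow> 'c multiset \<Rightarrow> bool" where
  "syzn 0 k m = (k = m \<and> obj m)"
| "syzn (Suc n) k m = (\<exists>l. syzn n l m \<and> syz k l)"

lemma syzn_obj: "syzn n k m \<Longrightarrow> obj k \<and> obj m"
  by (induction n arbitrary: k) (simp, use syz_obj in fastforce)

lemma syzn_exists: "obj m \<Longrightarrow> \<exists>k. syzn n k m"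
proof (induction n)
  case (Suc n)
  then obtain l where "syzn n l m" by blast
  then show ?case using syzn_obj syz_exists[of l] by auto
qed auto

lemma syzn_nonproj: "syzn n k m \<Longrightarrow> syzn n k' m' \<Longrightarrow> nonproj m = nonproj m' \<Longrightarrow> nonproj k = nonproj k'"
proof (induction n arbitrary: k k')
  case (Suc n)
  then obtain l l' where "syzn n l m" "syz k l" "syzn n l' m'" "syz k' l'" by auto
  then show ?case using Suc.IH[of l l'] Suc.prems(3) syz_nonproj[of k l k' l'] by blast
qed auto

lemma tri_syzn: "tri a b c \<Longrightarrow> syzn n a' a \<Longrightarrow> syzn n b' b \<Longrightarrow> syzn n c' c \<Longrightarrow> tri a' b' c'"
proof (induction n arbitrary: a' b' c')
  case (Suc n)
  then obtain a1 b1 c1 where "syzn n a1 a" "syz a' a1" "syzn n b1 b" "syz b' b1"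
      "syzn n c1 c" "syz c' c1"
    by auto
  then show ?case using Suc.IH Suc.prems(1) tri_syz by blast
qed auto

lemma pdim_le_syz: "syz k m \<Longrightarrow> pdim_le (Suc n) m \<longleftrightarrow> pdim_le n k"
  unfolding syz_def by (meson pdim_le_kernel pdim_le.simps(2))

lemma pdim_le_syzn: "syzn q k m \<Longrightarrow> pdim_le (q + n) m \<longleftrightarrow> pdim_le n k"
proof (induction q arbitrary: k n)
  case (Suc q)
  then obtain l where "syzn q l m" "syz k l" by auto
  then show ?case using Suc.IH[of l "Suc n"] pdim_le_syz[of k l n] by simp
qed auto

lemma ses_tri: "ses a b c \<Longrightarrow> tri a b c"
  by (auto simp: tri_def)

text \<open>The \<open>n\<close>-th syzygy of \<open>c\<close> is projective, so the sequence of
  \<open>n\<close>-th syzygies splits.\<close>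

lemma syzygies_eventually_equal:
  assumes "ses a b c" "pdim_le n c" "syzn n a' a" "syzn n b' b"
  shows "nonproj a' = nonproj b'"
proof -
  obtain c' where c': "syzn n c' c" using syzn_exists ses_closed assms(1) by meson
  then have "proj c'" using pdim_le_syzn[of n c' c 0] assms(2) by simp
  obtain a1 b1 c1 where s: "ses a1 b1 c1" "nonproj a1 = nonproj a'" "nonproj b1 = nonproj b'" "nonproj c1 = nonproj c'"
    using tri_syzn[OF ses_tri[OF assms(1)] assms(3,4) c'] by (auto simp: tri_def)
  have "proj c1" using s(4) \<open>proj c'\<close> nonproj_proj by metis
  then have "b1 = a1 + c1" using ses_projective s by blast
  then show ?thesis using s \<open>proj c1\<close> nonproj_proj[of c1] by simp
qed

section \<open>The bound of Igusa and Todorov\<close>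

lemma pdim_le_mset: "obj t \<Longrightarrow> (\<And>x. x \<in># t \<Longrightarrow> pdim_le s {#x#}) \<Longrightarrow> pdim_le s t"
proof (induction t)
  case empty
  then show ?case by (simp add: pdim_le_proj)
next
  case (add x t)
  then show ?case using pdim_le_add[of s "{#x#}" t] by auto
qed

text \<open>The exponent \<open>n\<close> is used through its existence: it makes dimensions finite.
  In the bound, \<open>q\<close> is the shift to syzygies with equal nonprojective parts,
  \<open>s\<close> bounds the part \<open>t\<close>, and one more unit is lost in passing from
  \<open>t\<close> to the cokernel \<open>w\<close>.\<close>

lemma igusa_todorov_bound:
  assumes abc: "ses a b c" and a1: "syzn q a1 a" and b1: "syzn q b1 b" and eq: "nonproj a1 = nonproj b1"
    and n: "pdim_le n c"
    and bound: "\<And>x n. x \<in># nonproj a1 \<Longrightarrow> pdim_le n {#x#} \<Longrightarrow> pdim_le s {#x#}"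
  shows "pdim_le (q + s + 1) c"
proof -
  obtain c1 where c1: "syzn q c1 c" using syzn_exists ses_closed abc by meson
  have n1: "pdim_le n c1" using pdim_le_syzn[OF c1, of n] n pdim_le_mono[of n "q + n"] by simp
  obtain a' b' c' where s: "ses a' b' c'" "nonproj a' = nonproj a1" "nonproj b' = nonproj b1" "nonproj c' = nonproj c1"
    using tri_syzn[OF ses_tri[OF abc] a1 b1 c1] by (auto simp: tri_def)
  define y where "y = nonproj a1"
  obtain p1 where p1: "a' = y + p1" "proj p1" using nonproj_decomp[of a'] s by (metis y_def)
  obtain p2 where p2: "b' = y + p2" "proj p2" using nonproj_decomp[of b'] s eq by (metis y_def)
  have obj: "obj a'" "obj b'" "obj c'" "obj c1" using ses_closed[OF s(1)] syzn_obj c1 by auto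
  have n': "pdim_le n c'" using n1 pdim_le_nonproj_cong obj s by metis
  \<comment> \<open>\<open>a'\<close> and \<open>b'\<close> share \<open>y\<close> but differ by
    projectives. Dividing \<open>b'\<close> by \<open>y\<close> instead of \<open>a'\<close> gives
    the shape required by \<open>fitting_ses\<close>, and the quotient \<open>w\<close> is an
    extension of \<open>c'\<close> by \<open>p1\<close>.\<close>
  have "ses y a' p1" using ses_add_right[of y p1] obj(1) p1 by simp
  then obtain w where w: "ses y (y + p2) w" "ses p1 w c'"
    using ses_quotient s(1) p2(1) by blast
  have "pdim_le n w" using pdim_le_extension[OF w(2)] pdim_le_proj p1 n' by blast
  obtain t z where t: "y = t + z" "ses t (t + p2) w"
      "\<forall>Q. Q w \<longrightarrow> (\<forall>a b. Q a \<longrightarrow> ses w b a \<longrightarrow> Q b) \<longrightarrow> (\<exists>x. Q x \<and> t \<subseteq># x)"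
    using fitting_ses[OF w(1)] by blast
  \<comment> \<open>Multisets of dimension at most \<open>n\<close> contain \<open>w\<close> and are
    closed under extensions by \<open>w\<close>, so some iterated extension containing
    \<open>t\<close> has finite dimension.\<close>
  obtain x where x: "pdim_le n x" "t \<subseteq># x"
    using t(3)[rule_format, of "pdim_le n", OF \<open>pdim_le n w\<close>] pdim_le_extension[OF _ \<open>pdim_le n w\<close>] by metis
  have tn: "pdim_le n t" using pdim_le_subset x by blast
  have "pdim_le s t"
  proof (rule pdim_le_mset)
    fix v assume v: "v \<in># t"
    then have "pdim_le n {#v#}" using pdim_le_subset[OF tn] by simp
    moreover have "v \<in># nonproj a1" using v t(1) by (simp add: y_def[symmetric])
    ultimately show "pdim_le s {#v#}" using bound by blast
  qed (use pdim_le_obj[OF tn] in auto)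
  then have "pdim_le (Suc s) (t + p2)" using pdim_le_add pdim_le_proj p2 pdim_le_Suc by blast
  then have "pdim_le (Suc s) w" using pdim_le_cokernel[OF t(2)] \<open>pdim_le s t\<close> by blast
  then have "pdim_le (Suc s) c'" using pdim_le_cokernel[OF w(2)] pdim_le_proj p1 by blast
  then have "pdim_le (Suc s) c1" using pdim_le_nonproj_cong obj s by metis
  then show ?thesis using pdim_le_syzn[OF c1, of "Suc s"] by simp
qed

lemma syzn_add: "syzn n k m \<Longrightarrow> syzn n k' m' \<Longrightarrow> syzn n (k + k') (m + m')"
proof (induction n arbitrary: k k')
  case (Suc n)
  then obtain l l' where "syzn n l m" "syz k l" "syzn n l' m'" "syz k' l'" by auto
  then show ?case using Suc.IH[of l l'] syz_add[of k l k' l'] by auto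
qed auto

lemma syz_proj: "proj p \<Longrightarrow> syz k p \<Longrightarrow> proj k"
  using pdim_le_syz[of k p 0] pdim_le_proj[of p "Suc 0"] by simp

end

context finite_length_modules
begin

subsection \<open>Projective modules and projective covers\<close>

lemma projective_U: "projective L P \<Longrightarrow> P \<in> U"
  by (simp add: projective_def)

lemma projective_lift:
  assumes "projective L P" "M \<in> U" "N \<in> U" "g \<in> hom M N" "g ` carrier M = carrier N" "f \<in> hom P N"
  obtains h where "h \<in> hom P M" "\<And>x. x \<in> carrier P \<Longrightarrow> g (h x) = f x"
proof -
  have "\<exists>h\<in>hom P M. \<forall>x\<in>carrier P. g (h x) = f x"
    using assms(1)[unfolded projective_def, THEN conjunct2, rule_format, OF assms(2,3,4,6,5)] .
  then show thesis using that by blast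
qed

lemma projectiveI:
  assumes "P \<in> U"
    and "\<And>M N g f. M \<in> U \<Longrightarrow> N \<in> U \<Longrightarrow> g \<in> hom M N \<Longrightarrow> f \<in> hom P N \<Longrightarrow>
      g ` carrier M = carrier N \<Longrightarrow> \<exists>h\<in>hom P M. \<forall>x\<in>carrier P. g (h x) = f x"
  shows "projective L P"
  unfolding projective_def using assms by simp

lemma projective_retract:
  assumes P: "projective L P" and A: "A \<in> U" and i: "i \<in> hom A P" and p: "p \<in> hom P A"
    and pi: "\<And>a. a \<in> carrier A \<Longrightarrow> p (i a) = a"
  shows "projective L A"
proof (rule projectiveI[OF A])
  fix M N :: "'a fgmod" and g f
  assume *: "M \<in> U" "N \<in> U" "g \<in> hom M N" "f \<in> hom A N" "g ` carrier M = carrier N"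
  obtain h where h: "h \<in> hom P M" "\<And>x. x \<in> carrier P \<Longrightarrow> g (h x) = f (p x)"
    using projective_lift[OF P *(1,2,3,5) hom_comp[OF p *(4)]] by blast
  show "\<exists>h\<in>hom A M. \<forall>x\<in>carrier A. g (h x) = f x"
    using hom_comp[OF i h(1)] h(2) homD(1)[OF i] pi by (intro bexI[of _ "\<lambda>x. h (i x)"]) auto
qed

lemma projective_bsum:
  assumes "P \<in> U" "projective L A" "projective L B" "bsum P A B"
  shows "projective L P"
proof (rule projectiveI[OF assms(1)])
  fix M N :: "'a fgmod" and g f
  assume *: "M \<in> U" "N \<in> U" "g \<in> hom M N" "f \<in> hom P N" "g ` carrier M = carrier N"
  obtain i j p q where b: "biprod P A B i j p q" using assms(4) by (auto simp: bsum_def)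
  note D = biprodD[OF b]
  obtain h where h: "h \<in> hom A M" "\<And>x. x \<in> carrier A \<Longrightarrow> g (h x) = f (i x)"
    using projective_lift[OF assms(2) *(1,2,3,5) hom_comp[OF D(1) *(4)]] by blast
  obtain k where k: "k \<in> hom B M" "\<And>x. x \<in> carrier B \<Longrightarrow> g (k x) = f (j x)"
    using projective_lift[OF assms(3) *(1,2,3,5) hom_comp[OF D(2) *(4)]] by blast
  have "g (h (p x) \<oplus>\<^bsub>M\<^esub> k (q x)) = f x" if "x \<in> carrier P" for x
    using that D homD(1)[OF h(1)] homD(1)[OF k(1)]
    by (simp add: homD(2)[OF *(3)] h(2) k(2) flip: homD(2)[OF *(4)])
  then show "\<exists>h\<in>hom P M. \<forall>x\<in>carrier P. g (h x) = f x"
    by (intro bexI[OF _ hom_add[OF U_lm[OF *(1)] hom_comp[OF D(3) h(1)] hom_comp[OF D(4) k(1)]]]) simp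
qed

lemma projective_summand:
  assumes "projective L P" "A \<in> U" "bsum P A B"
  shows "projective L A"
proof -
  obtain i j p q where b: "biprod P A B i j p q" using assms(3) by (auto simp: bsum_def)
  note D = biprodD[OF b]
  show ?thesis by (rule projective_retract[OF assms(1,2) D(1,3,5)])
qed

lemma projective_iso:
  assumes "projective L P" "Q \<in> U" "mod_iso L P Q"
  shows "projective L Q"
proof -
  obtain f g where f: "f \<in> hom P Q" "g \<in> hom Q P"
    "\<And>x. x \<in> carrier P \<Longrightarrow> f x \<in> carrier Q" "\<And>x. x \<in> carrier Q \<Longrightarrow> g x \<in> carrier P"
    "\<And>x. x \<in> carrier P \<Longrightarrow> g (f x) = x" "\<And>y. y \<in> carrier Q \<Longrightarrow> f (g y) = y"
    using mod_iso_pair[OF U_lm[OF projective_U[OF assms(1)]] assms(3)] by blast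
  show ?thesis by (rule projective_retract[OF assms(1,2) f(2,1,6)])
qed

lemma projective_zero:
  assumes "P \<in> U" "zero_mod P"
  shows "projective L P"
proof (rule projectiveI[OF assms(1)])
  fix M N :: "'a fgmod" and g f
  assume *: "M \<in> U" "N \<in> U" "g \<in> hom M N" "f \<in> hom P N" "g ` carrier M = carrier N"
  have "g \<zero>\<^bsub>M\<^esub> = f x" if "x \<in> carrier P" for x
    using that assms hom_zero[OF U_lm[OF *(1)] U_lm[OF *(2)] *(3)]
      hom_zero[OF U_lm[OF assms(1)] U_lm[OF *(2)] *(4)] by (auto simp: zero_mod_def)
  then show "\<exists>h\<in>hom P M. \<forall>x\<in>carrier P. g (h x) = f x"
    using hom_zero_map[OF U_lm[OF *(1)], of P] by (intro bexI[of _ "\<lambda>_. \<zero>\<^bsub>M\<^esub>"]) auto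
qed

text \<open>The elements of the regular module do not have the type used in \<open>U\<close>.
  \<open>F\<close> is its copy there and \<open>e\<close> the image of the unit, so maps out of
  \<open>F\<close> are determined by a free choice of value at \<open>e\<close>.\<close>

lemma self_mod_cover:
  obtains F e where "projective L F" "e \<in> carrier F"
    "\<And>M m. M \<in> U \<Longrightarrow> m \<in> carrier M \<Longrightarrow> \<exists>f\<in>hom F M. f e = m"
proof -
  have sub: "submod (mspan self_mod {\<one>}) self_mod" by (rule mspan_submod[OF self_mod_lm]) simp
  have one: "\<one> \<in> mspan self_mod {\<one>}" using mspan_superset[of "{\<one>}" self_mod] by simp
  have "x \<in> mspan self_mod {\<one>}" if "x \<in> carrier L" for x
    using submodD(5)[OF sub that one] that by simp
  then have "carrier self_mod \<subseteq> mspan self_mod {\<one>}" by auto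
  then have "mspan self_mod {\<one>} = carrier self_mod"
    using submodD(1)[OF sub] by (rule subset_antisym[rotated])
  then have "fg_left_module L self_mod"
    unfolding fg_iff_mspan using self_mod_lm by (intro conjI exI[of _ "{\<one>}"]) auto
  then obtain F where F: "F \<in> U" "mod_iso L self_mod F" by (rule U_universal)
  obtain h h' where h: "h \<in> hom self_mod F" "h' \<in> hom F self_mod"
    "\<And>x. x \<in> carrier self_mod \<Longrightarrow> h x \<in> carrier F" "\<And>x. x \<in> carrier F \<Longrightarrow> h' x \<in> carrier self_mod"
    "\<And>x. x \<in> carrier self_mod \<Longrightarrow> h' (h x) = x" "\<And>y. y \<in> carrier F \<Longrightarrow> h (h' y) = y"
    using mod_iso_pair[OF self_mod_lm F(2)] by blast
  note h' = h[unfolded self_mod_simps]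
  have ext: "(\<lambda>x. h' x \<odot>\<^bsub>M\<^esub> m) \<in> hom F M" if "M \<in> U" "m \<in> carrier M" for M m
    using that U_lm[OF that(1)] h'(4)
    by (intro homI) (auto simp: homD(2,3)[OF h(2)] add_smult mult_smult)
  show thesis
  proof (rule that[of F "h \<one>"])
    show "h \<one> \<in> carrier F" by (rule h'(3)) simp
    show "\<exists>f\<in>hom F M. f (h \<one>) = m" if "M \<in> U" "m \<in> carrier M" for M m
      using ext[OF that] U_lm[OF that(1)] that(2) by (intro bexI[of _ "\<lambda>x. h' x \<odot>\<^bsub>M\<^esub> m"]) (auto simp: h'(5))
    show "projective L F"
    proof (rule projectiveI[OF F(1)])
      fix M N :: "'a fgmod" and g f
      assume *: "M \<in> U" "N \<in> U" "g \<in> hom M N" "f \<in> hom F N" "g ` carrier M = carrier N"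
      have "f (h \<one>) \<in> g ` carrier M" unfolding *(5) by (rule homD(1)[OF *(4) h'(3)]) simp
      then obtain m where m: "m \<in> carrier M" "f (h \<one>) = g m" by blast
      have "g (h' x \<odot>\<^bsub>M\<^esub> m) = f x" if x: "x \<in> carrier F" for x
      proof -
        have hx: "h' x \<in> carrier L" by (rule h'(4)[OF x])
        have "g (h' x \<odot>\<^bsub>M\<^esub> m) = h' x \<odot>\<^bsub>N\<^esub> f (h \<one>)" using homD(3)[OF *(3) hx m(1)] m(2) by simp
        also have "\<dots> = f (h' x \<odot>\<^bsub>F\<^esub> h \<one>)" using homD(3)[OF *(4) hx h'(3)[OF one_closed]] by simp
        also have "h' x \<odot>\<^bsub>F\<^esub> h \<one> = h (h' x \<odot>\<^bsub>self_mod\<^esub> \<one>)"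
          using homD(3)[OF h(1) hx, of \<one>] by simp
        also have "\<dots> = x" using hx h(6)[OF x] by simp
        finally show ?thesis .
      qed
      then show "\<exists>h\<in>hom F M. \<forall>x\<in>carrier F. g (h x) = f x"
        by (intro bexI[OF _ ext[OF *(1) m(1)]]) simp
    qed
  qed
qed

lemma enough_proj:
  assumes M: "M \<in> U"
  obtains P f where "projective L P" "f \<in> hom P M" "f ` carrier P = carrier M"
proof -
  obtain S where S: "finite S" "S \<subseteq> carrier M" "mspan M S = carrier M"
    using M unfolding U_iff fg_iff_mspan by blast
  have "\<exists>P f. projective L P \<and> f \<in> hom P M \<and> S \<subseteq> f ` carrier P"
    using S(1,2)
  proof (induction S)
    case empty
    obtain Z where "Z \<in> U" "zero_mod Z" by (rule zero_exists)
    then show ?case using projective_zero hom_zero_map[OF U_lm[OF M], of Z] by blast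
  next
    case (insert s S)
    then obtain P f where P: "projective L P" "f \<in> hom P M" "S \<subseteq> f ` carrier P" by blast
    obtain F e where F: "projective L F" "e \<in> carrier F"
      "\<And>M m. M \<in> U \<Longrightarrow> m \<in> carrier M \<Longrightarrow> \<exists>f\<in>hom F M. f e = m" using self_mod_cover by metis
    have s: "s \<in> carrier M" using insert.prems by simp
    obtain g where g: "g \<in> hom F M" "g e = s" using F(3)[OF M s] by blast
    obtain Z where Z: "Z \<in> U" "bsum Z P F"
      using bsum_exists[OF projective_U[OF P(1)] projective_U[OF F(1)]] .
    obtain i j p q where b: "biprod Z P F i j p q" using Z(2) by (auto simp: bsum_def)
    note D = biprodD[OF b]
    note lm = U_lm[OF M] U_lm[OF projective_U[OF P(1)]] U_lm[OF projective_U[OF F(1)]]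
    let ?h = "\<lambda>x. f (p x) \<oplus>\<^bsub>M\<^esub> g (q x)"
    have h: "?h \<in> hom Z M" by (intro hom_add lm hom_comp[OF D(3) P(2)] hom_comp[OF D(4) g(1)])
    have hs: "s = ?h (j e)" using F(2) lm s by (simp add: D g(2) hom_zero[OF lm(2,1) P(2)])
    have "s \<in> ?h ` carrier Z" by (rule image_eqI[of s ?h "j e", OF hs D(11)[OF F(2)]])
    moreover have "t \<in> ?h ` carrier Z" if t: "t \<in> S" for t
    proof -
      obtain x where x: "x \<in> carrier P" "t = f x" using P(3) t by blast
      then have hx: "t = ?h (i x)" using lm homD(1)[OF P(2)] by (simp add: D hom_zero[OF lm(3,1) g(1)])
      show ?thesis by (rule image_eqI[of t ?h "i x", OF hx D(10)[OF x(1)]])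
    qed
    ultimately have "insert s S \<subseteq> ?h ` carrier Z" by blast
    then show ?case using projective_bsum[OF Z(1) P(1) F(1) Z(2)] h by blast
  qed
  then obtain P f where P: "projective L P" "f \<in> hom P M" "S \<subseteq> f ` carrier P" by blast
  have P': "lm P" using projective_U[OF P(1)] by simp
  have I: "submod (f ` carrier P) M"
    by (rule image_submod[OF P' U_lm[OF M] P(2) submod_carrier[OF P']])
  have "carrier M \<subseteq> f ` carrier P" using mspan_least[OF I P(3)] S(3) by simp
  then show thesis using that P submodD(1)[OF I] by blast
qed

text \<open>Among the projective submodules of a projective \<open>P\<close> that still map onto \<open>M\<close>, a minimal one
  is a projective cover, by Fitting's lemma applied to a lift of the projection.\<close>

lemma projective_cover_exists:
  assumes M: "M \<in> U"
  shows "\<exists>P \<pi>. projective_cover L P \<pi> M"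
proof -
  obtain P f where P: "projective L P" "f \<in> hom P M" "f ` carrier P = carrier M"
    using enough_proj[OF M] .
  have PU: "P \<in> U" "lm P" using projective_U[OF P(1)] by auto
  let ?S = "{H. submod H P \<and> projective L (restr P H) \<and> f ` H = carrier M}"
  have "restr P (carrier P) = P" by simp
  then have "carrier P \<in> ?S" using P submod_carrier[OF PU(2)] by simp
  then obtain H where "H \<in> ?S" and min: "\<And>K. K \<in> ?S \<Longrightarrow> K \<subseteq> H \<Longrightarrow> K = H"
    using fin_len_min[OF fg_fin_len[OF PU(1)], of "carrier P" ?S] by blast
  then have H: "submod H P" "projective L (restr P H)" "f ` H = carrier M" by auto
  let ?Q = "restr P H"
  have QU: "?Q \<in> U" "lm ?Q" using projective_U[OF H(2)] by auto
  have fQ: "f \<in> hom ?Q M" by (rule hom_restr_dom[OF P(2) submodD(1)[OF H(1)]])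
  have "projective_cover L ?Q f M"
    unfolding projective_cover_def
  proof (intro conjI allI impI)
    show "f ` carrier ?Q = carrier M" using H(3) by simp
    fix K assume K: "submod K ?Q" and sup: "mod_ker ?Q M f <+>\<^bsub>?Q\<^esub> K = carrier ?Q"
    have KD: "K \<subseteq> H" using submodD(1)[OF K] by simp
    let ?K = "restr ?Q K"
    have KU: "?K \<in> U" by (rule U_restr[OF QU(1) K])
    have fK: "f \<in> hom ?K M" by (rule hom_restr_dom[OF fQ submodD(1)[OF K]])
    have fKs: "f ` carrier ?K = carrier M"
    proof (intro subset_antisym subsetI)
      fix y assume "y \<in> carrier M"
      then obtain x where x: "x \<in> carrier ?Q" "y = f x" unfolding H(3)[symmetric] by auto
      then obtain u v where uv: "u \<in> mod_ker ?Q M f" "v \<in> K" "x = u \<oplus>\<^bsub>?Q\<^esub> v"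
        unfolding sup[symmetric] set_add_def' by blast
      have c: "u \<in> carrier ?Q" "f u = \<zero>\<^bsub>M\<^esub>" "v \<in> carrier ?Q"
        using uv(1,2) KD by (auto simp: mod_ker_def)
      have "y = f v"
        unfolding x(2) uv(3) homD(2)[OF fQ c(1,3)] c(2) using homD(1)[OF fQ c(3)] U_lm[OF M] by simp
      then show "y \<in> f ` carrier ?K" using uv(2) by simp
    qed (use homD(1)[OF fK] in blast)
    \<comment> \<open>As \<open>f h = f\<close>, the stable image of the powers of \<open>h\<close>
      still maps onto \<open>M\<close>, and as a summand of \<open>?Q\<close> it is projective.
      Minimality makes it all of \<open>H\<close>, so \<open>h\<close> is onto \<open>H\<close>; but
      its image lies in \<open>K\<close>.\<close>
    obtain h where h: "h \<in> hom ?Q ?K" "\<And>x. x \<in> carrier ?Q \<Longrightarrow> f (h x) = f x"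
      using projective_lift[OF H(2) KU M fK fKs fQ] by blast
    have hQ: "h \<in> hom ?Q ?Q" using h(1) KD by (auto simp: mod_hom_def)
    obtain k where k: "bij_betw h ((h ^^ k) ` carrier ?Q) ((h ^^ k) ` carrier ?Q)"
      using fitting[OF QU(2) fg_fin_len[OF QU(1)] hQ] .
    let ?I = "(h ^^ k) ` carrier ?Q"
    have hk: "(h ^^ n) \<in> hom ?Q ?Q" for n by (rule hom_funpow[OF hQ])
    have I: "submod ?I ?Q" by (rule image_submod[OF QU(2,2) hk submod_carrier[OF QU(2)]])
    have IU: "restr ?Q ?I \<in> U" by (rule U_restr[OF QU(1) I])
    have "projective L (restr ?Q ?I)"
      by (rule projective_summand[OF H(2) IU fitting_bsum[OF QU(2) hQ k]])
    then have 1: "projective L (restr P ?I)" by simp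
    have fh: "f ((h ^^ n) x) = f x" if "x \<in> carrier ?Q" for n x
    proof (induction n)
      case (Suc n)
      then show ?case using h(2)[OF homD(1)[OF hk that]] by simp
    qed simp
    have "f ` ?I = f ` carrier ?Q" unfolding image_image using fh by (intro image_cong) auto
    then have 2: "f ` ?I = carrier M" using H(3) by simp
    have 3: "submod ?I P" "?I \<subseteq> H" using I submod_restr[OF PU(2) H(1)] by auto
    have "?I = H" by (rule min) (use 1 2 3 in auto)
    then have "h ` H = H" using bij_betw_imp_surj_on[OF k] by simp
    moreover have "h ` H \<subseteq> K" using homD(1)[OF h(1)] by auto
    ultimately show "K = carrier ?Q" using KD by auto
  qed fact+
  then show ?thesis by blast
qed

lemma syzygy_cover:
  assumes "M \<in> U"
  obtains P \<pi> where "projective L P" "\<pi> \<in> hom P M" "\<pi> ` carrier P = carrier M"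
    "syzygy L M = restr P (mod_ker P M \<pi>)"
proof -
  have "\<exists>K P \<pi>. projective_cover L P \<pi> M \<and> K = restr P (mod_ker P M \<pi>)"
    using projective_cover_exists[OF assms] by blast
  then have "\<exists>P \<pi>. projective_cover L P \<pi> M \<and> syzygy L M = restr P (mod_ker P M \<pi>)"
    unfolding syzygy_def by (rule someI_ex)
  then obtain P \<pi> where c: "projective_cover L P \<pi> M" "syzygy L M = restr P (mod_ker P M \<pi>)" by blast
  show thesis by (rule that[of P \<pi>]) (use c in \<open>simp_all add: projective_cover_def\<close>)
qed

lemma syzygy_U: "M \<in> U \<Longrightarrow> syzygy L M \<in> U"
  by (rule syzygy_cover[of M]) (auto intro: ker_U projective_U)

definition PC :: "'a fgmod set set" where "PC = ic ` {X. indecomposable L X \<and> projective L X}"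

lemma ic_PC: "indecomposable L X \<Longrightarrow> ic X \<in> PC \<longleftrightarrow> projective L X"
proof
  assume X: "indecomposable L X" and "ic X \<in> PC"
  then obtain Y where Y: "indecomposable L Y" "projective L Y" "ic X = ic Y" by (auto simp: PC_def)
  then have "mod_iso L Y X" using ic_eq_iff[of Y X] indecomposable_U X by simp
  then show "projective L X" using projective_iso[OF Y(2) indecomposable_U[OF X]] by blast
qed (auto simp: PC_def)

lemma projective_dec:
  assumes "M \<in> U"
  shows "projective L M \<longleftrightarrow> set_mset (dec M) \<subseteq> PC"
proof
  assume P: "projective L M"
  show "set_mset (dec M) \<subseteq> PC"
  proof
    fix c assume "c \<in># dec M"
    then obtain X N where X: "indecomposable L X" "c = ic X" "N \<in> U" "bsum M X N"
      by (rule dec_member[OF assms])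
    then show "c \<in> PC" using projective_summand[OF P indecomposable_U[OF X(1)] X(4)] ic_PC by simp
  qed
next
  assume c: "set_mset (dec M) \<subseteq> PC"
  have "\<exists>P. projective L P \<and> dec P = m" if "set_mset m \<subseteq> PC" for m
    using that
  proof (induction m)
    case empty
    obtain Z where "Z \<in> U" "zero_mod Z" by (rule zero_exists)
    then show ?case using projective_zero dec_zero by blast
  next
    case (add c m)
    then obtain P where P: "projective L P" "dec P = m" by auto
    obtain X where X: "indecomposable L X" "projective L X" "c = ic X"
      using add.prems by (auto simp: PC_def)
    obtain Z where Z: "Z \<in> U" "bsum Z X P"
      using bsum_exists[OF indecomposable_U[OF X(1)] projective_U[OF P(1)]] .
    have "dec Z = add_mset c m"
      using dec_bsum[OF Z(1) indecomposable_U[OF X(1)] projective_U[OF P(1)] Z(2)]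
        dec_indecomposable[OF X(1)] X(3) P(2) by simp
    then show ?case using projective_bsum[OF Z(1) X(2) P(1) Z(2)] by blast
  qed
  then obtain P where P: "projective L P" "dec P = dec M" using c by blast
  then show "projective L M"
    using projective_iso[OF P(1) assms] dec_eq_iso[OF projective_U[OF P(1)] assms] by blast
qed

lemma sesm_split:
  assumes "sesm a b p" "set_mset p \<subseteq> PC"
  shows "b = a + p"
proof -
  obtain B P g where g: "B \<in> U" "P \<in> U" "g \<in> hom B P" "g ` carrier B = carrier P"
    "dec B = b" "dec P = p" "dec (restr B (mod_ker B P g)) = a"
    using assms(1) by (rule sesmE)
  have P: "projective L P" using projective_dec[OF g(2)] g(6) assms(2) by simp
  obtain s where s: "s \<in> hom P B" "\<And>x. x \<in> carrier P \<Longrightarrow> g (s x) = x"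
    using projective_lift[OF P g(1,2,3,4) hom_id] by blast
  have "bij_betw (\<lambda>x. g (s x)) (carrier P) (carrier P)"
    using s(2) by (intro bij_betw_byWitness[of _ "\<lambda>x. x"]) auto
  then have "bsum B P (restr B (mod_ker B P g))"
    by (rule bsum_split[OF U_lm[OF g(1)] U_lm[OF g(2)] U_lm[OF g(2)] s(1) g(3)])
  then show ?thesis
    using dec_bsum[OF g(1,2) ker_U[OF g(1) U_lm[OF g(2)] g(3)]] g(5-7) by (simp add: add.commute)
qed

lemma sesm_syzygy:
  assumes "M \<in> U"
  shows "\<exists>p. set_mset p \<subseteq> PC \<and> sesm (dec (syzygy L M)) p (dec M)"
proof -
  obtain P \<pi> where P: "projective L P" "\<pi> \<in> hom P M" "\<pi> ` carrier P = carrier M"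
    "syzygy L M = restr P (mod_ker P M \<pi>)" using syzygy_cover[OF assms] .
  show ?thesis
    using sesmI[OF projective_U[OF P(1)] assms P(2,3)] P(1,4) projective_dec[OF projective_U[OF P(1)]]
    by auto
qed

subsection \<open>Fitting's lemma for short exact sequences\<close>

text \<open>Write the monomorphism as \<epsilon> into \<open>Y \<oplus> V\<close>, with component
  \<open>a\<close> in \<open>Y\<close>, and split \<open>Y\<close> into the stable image
  \<open>?I\<close> and the kernel \<open>?T\<close> of a power of \<open>a\<close>. On
  \<open>?I\<close> the component is invertible, so \<epsilon> of it splits off from both the kernel
  and the middle term. On \<open>?T\<close> it is nilpotent, which makes \<open>?T\<close> a summand
  of the cokernel at the end of a tower of copies of \<open>W\<close>.\<close>

lemma sesm_fitting:
  assumes "sesm y (y + q) w"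
  shows "\<exists>t z. y = t + z \<and> sesm t (t + q) w \<and>
    (\<forall>Q. Q w \<longrightarrow> (\<forall>a b. Q a \<longrightarrow> sesm w b a \<longrightarrow> Q b) \<longrightarrow> (\<exists>x. Q x \<and> t \<subseteq># x))"
proof -
  obtain B W g where g: "B \<in> U" "W \<in> U" "g \<in> hom B W" "g ` carrier B = carrier W"
    "dec B = y + q" "dec W = w" "dec (restr B (mod_ker B W g)) = y"
    using assms by (rule sesmE)
  obtain Y V where Y: "Y \<in> U" "V \<in> U" "dec Y = y" "dec V = q" "bsum B Y V"
    using dec_split[OF g(1,5)] .
  obtain i j p p' where b: "biprod B Y V i j p p'" using Y(5) by (auto simp: bsum_def)
  note D = biprodD[OF b]
  note lm = U_lm[OF g(1)] U_lm[OF g(2)] U_lm[OF Y(1)] U_lm[OF Y(2)]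
  let ?K = "mod_ker B W g"
  have Ks: "submod ?K B" by (rule ker_submod[OF lm(1,2) g(3)])
  have KU: "restr B ?K \<in> U" by (rule ker_U[OF g(1) lm(2) g(3)])
  have "mod_iso L Y (restr B ?K)" using dec_eq_iso[OF Y(1) KU] Y(3) g(7) by simp
  then obtain \<epsilon> where e0: "\<epsilon> \<in> hom Y (restr B ?K)" "bij_betw \<epsilon> (carrier Y) (carrier (restr B ?K))"
    by (auto simp: mod_iso_def)
  have e: "\<epsilon> \<in> hom Y B" using hom_comp[OF e0(1) hom_incl[OF submodD(1)[OF Ks]]] .
  have einj: "inj_on \<epsilon> (carrier Y)" by (rule bij_betw_imp_inj_on[OF e0(2)])
  have eimg: "\<epsilon> ` carrier Y = ?K" using bij_betw_imp_surj_on[OF e0(2)] by simp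
  define a where "a = (\<lambda>x. p (\<epsilon> x))"
  have a: "a \<in> hom Y Y" unfolding a_def by (rule hom_comp[OF e D(3)])
  obtain k0 where k0: "bij_betw a ((a ^^ k0) ` carrier Y) ((a ^^ k0) ` carrier Y)"
    using fitting[OF lm(3) fg_fin_len[OF Y(1)] a] .
  \<comment> \<open>Fitting's lemma may return the exponent 0, but the tower below starts at stage
    1.\<close>
  define k where "k = Suc k0"
  have "(a ^^ k) ` carrier Y = a ` (a ^^ k0) ` carrier Y" by (simp add: k_def image_image)
  then have k: "bij_betw a ((a ^^ k) ` carrier Y) ((a ^^ k) ` carrier Y)" and "k \<ge> 1"
    using k0 bij_betw_imp_surj_on[OF k0] by (auto simp: k_def)
  let ?I = "(a ^^ k) ` carrier Y" and ?T = "mod_ker Y Y (a ^^ k)"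
  have ak: "(a ^^ n) \<in> hom Y Y" for n by (rule hom_funpow[OF a])
  have Is: "submod ?I Y" by (rule image_submod[OF lm(3,3) ak submod_carrier[OF lm(3)]])
  have Ts: "submod ?T Y" by (rule ker_submod[OF lm(3,3) ak])
  have IU: "restr Y ?I \<in> U" and TU: "restr Y ?T \<in> U" by (rule U_restr[OF Y(1) Is], rule U_restr[OF Y(1) Ts])
  have IY: "?I \<subseteq> carrier Y" and TY: "?T \<subseteq> carrier Y" using submodD(1)[OF Is] submodD(1)[OF Ts] by auto
  define t where "t = dec (restr Y ?T)"
  define z where "z = dec (restr Y ?I)"
  have ytz: "y = t + z"
    using dec_bsum[OF Y(1) IU TU fitting_bsum[OF lm(3) a k]] Y(3) by (simp add: t_def z_def add.commute)
  have akI: "bij_betw (a ^^ n) ?I ?I" for n by (rule funpow_bij_betw[OF k])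
  have "sesm t (t + q) w"
  proof -
    let ?H = "\<epsilon> ` ?I"
    have eI: "\<epsilon> \<in> hom (restr Y ?I) B" by (rule hom_restr_dom[OF e IY])
    have Hs: "submod ?H B" by (rule image_submod[OF lm(3,1) e Is])
    have HK: "?H \<subseteq> ?K" using eimg IY by blast
    have HU: "restr B ?H \<in> U" by (rule U_restr[OF g(1) Hs])
    have lmH: "lm (restr B ?H)" "lm (restr Y ?I)" using HU IU by auto
    have "mod_iso L (restr Y ?I) (restr B ?H)"
      using inj_image_iso[OF lmH(2) lm(1) eI] inj_on_subset[OF einj IY] by simp
    then have zH: "dec (restr B ?H) = z" using dec_iso[OF IU HU] by (simp add: z_def)
    obtain F u where u: "F \<in> U" "u \<in> hom B F" "u ` carrier B = carrier F" "mod_ker B F u = ?H"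
      using quotient_U[OF g(1) Hs] .
    have lmF: "lm F" using u(1) by simp
    obtain v where v: "v \<in> hom F W" "v ` carrier F = carrier W" "\<And>x. x \<in> carrier B \<Longrightarrow> v (u x) = g x"
      "u ` ?K = mod_ker F W v"
      using quotient_factor[OF lm(1,2) lmF g(3,4) u(2,3)] u(4) HK by auto
    let ?N = "restr F (mod_ker F W v)"
    have NU: "?N \<in> U" by (rule ker_U[OF u(1) lm(2) v(1)])
    \<comment> \<open>Composed with \<epsilon> on \<open>?I\<close>, this map is the restriction of
      \<open>a^(k+1)\<close>, hence bijective onto \<open>?I\<close>: it is the retraction that
      splits off \<epsilon> of \<open>?I\<close>.\<close>
    let ?r = "\<lambda>x. (a ^^ k) (p x)"
    have r: "?r \<in> hom B (restr Y ?I)"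
    proof (rule hom_restr_cod[OF hom_comp[OF D(3) ak]])
      show "(\<lambda>x. (a ^^ k) (p x)) ` carrier B \<subseteq> ?I" using D(12) by blast
    qed
    have bij: "bij_betw ?r ?H ?I"
    proof -
      have "bij_betw \<epsilon> ?I ?H" using inj_on_subset[OF einj IY] by (simp add: bij_betw_def)
      then have be: "bij_betw (inv_into ?I \<epsilon>) ?H ?I" by (rule bij_betw_inv_into)
      have "bij_betw (a ^^ Suc k) ?I ?I" by (rule akI)
      from bij_betw_trans[OF be this] have "bij_betw ((a ^^ Suc k) \<circ> inv_into ?I \<epsilon>) ?H ?I" .
      moreover have "((a ^^ Suc k) \<circ> inv_into ?I \<epsilon>) x = ?r x" if x: "x \<in> ?H" for x
      proof -
        have "\<epsilon> (inv_into ?I \<epsilon> x) = x" using x by (rule f_inv_into_f)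
        moreover have "(a ^^ Suc k) m = (a ^^ k) (a m)" for m by (simp add: funpow_swap1)
        ultimately show ?thesis by (simp add: a_def del: funpow.simps)
      qed
      ultimately show ?thesis by (subst bij_betw_cong[of ?H _ "(a ^^ Suc k) \<circ> inv_into ?I \<epsilon>"]) auto
    qed
    have s1: "short_exact L (restr B ?H) (\<lambda>x. x) B u F"
      using short_exact_surj[OF u(2,3)] u(4) by simp
    have b1: "bsum B (restr B ?H) F"
      by (rule short_exact_retract[OF lmH(1) lm(1) lmF lmH(2) s1 r]) (use bij in simp)
    have "dec F = t + q"
      using dec_bsum[OF g(1) HU u(1) b1] g(5) zH ytz by simp
    moreover have "dec ?N = t"
    proof -
      have uN: "u \<in> hom (restr B ?K) ?N"
        using v(4) by (intro hom_restr_cod hom_restr_dom[OF u(2)] submodD(1)[OF Ks]) simp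
      have "mod_ker (restr B ?K) ?N u = ?K \<inter> mod_ker B F u"
        using submodD(1)[OF Ks] unfolding mod_ker_def[of "restr B ?K" ?N] mod_ker_def[of B F] by auto
      then have "mod_ker (restr B ?K) ?N u = ?H" using HK unfolding u(4) by blast
      then have s2: "short_exact L (restr B ?H) (\<lambda>x. x) (restr B ?K) u ?N"
        using short_exact_surj[OF uN] v(4) by simp
      have "bsum (restr B ?K) (restr B ?H) ?N"
        by (rule short_exact_retract[OF lmH(1) U_lm[OF KU] U_lm[OF NU] lmH(2) s2
            hom_restr_dom[OF r submodD(1)[OF Ks]]]) (use bij in simp)
      then show ?thesis using dec_bsum[OF KU HU NU] g(7) zH ytz by simp
    qed
    ultimately show ?thesis using sesmI[OF u(1) g(2) v(1,2)] g(6) by simp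
  qed
  moreover have "\<exists>x. Q x \<and> t \<subseteq># x" if Qw: "Q w" and Qe: "\<And>a b. Q a \<Longrightarrow> sesm w b a \<Longrightarrow> Q b" for Q
  proof -
    \<comment> \<open>By construction \<open>X\<close> will be \<open>Y\<close> plus
      \<open>n\<close> copies of \<open>V\<close>, with projection \<open>r\<close> to
      \<open>Y\<close> and inclusion \<open>s\<close> of \<open>Y\<close>. The map \<open>f\<close>
      is the iterated embedding, with component \<open>a^n\<close> in \<open>Y\<close>, and
      \<open>N\<close> is its cokernel.\<close>
    define stage where "stage n X N f r s h \<longleftrightarrow> X \<in> U \<and> N \<in> U \<and> f \<in> hom Y X \<and> r \<in> hom X Y \<and>
        s \<in> hom Y X \<and> h \<in> hom X N \<and> inj_on f (carrier Y) \<and>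
        (\<forall>x\<in>carrier Y. r (f x) = (a ^^ n) x) \<and> (\<forall>x\<in>carrier Y. r (s x) = x) \<and>
        h ` carrier X = carrier N \<and> mod_ker X N h = f ` carrier Y \<and> Q (dec N)"
      for n :: nat and X N :: "'a fgmod" and f r s h
    have tower: "\<exists>X N f r s h. stage n X N f r s h" if "n \<ge> 1" for n
      using that
    proof (induction n rule: dec_induct)
      case base
      have "stage 1 B W \<epsilon> p i g"
        unfolding stage_def using g(1-4,6) e einj D(1,3,5) eimg Qw by (simp add: a_def)
      then show ?case by blast
    next
      case (step n)
      then obtain X N f r s h where nonproj: "stage n X N f r s h" by blast
      then have X: "X \<in> U" "N \<in> U" "f \<in> hom Y X" "r \<in> hom X Y" "s \<in> hom Y X"
        "h \<in> hom X N" "inj_on f (carrier Y)" "\<And>x. x \<in> carrier Y \<Longrightarrow> r (f x) = (a ^^ n) x"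
        "\<And>x. x \<in> carrier Y \<Longrightarrow> r (s x) = x" "h ` carrier X = carrier N"
        "mod_ker X N h = f ` carrier Y" "Q (dec N)"
        unfolding stage_def by simp_all
      obtain Z where Z: "Z \<in> U" "bsum Z X V" using bsum_exists[OF X(1) Y(2)] .
      obtain i2 j2 p2 q2 where b2: "biprod Z X V i2 j2 p2 q2" using Z(2) by (auto simp: bsum_def)
      note E = biprodD[OF b2]
      note lm' = U_lm[OF X(1)] U_lm[OF X(2)] U_lm[OF Z(1)]
      \<comment> \<open>\<open>?m\<close> is the sum of \<open>f\<close> and the identity of
        \<open>V\<close>, a monomorphism from \<open>Y \<oplus> V\<close> to
        \<open>X \<oplus> V\<close> with cokernel \<open>N\<close>. So the cokernel of its composite
        with \<epsilon> is an extension of \<open>N\<close> by the cokernel \<open>W\<close> of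
        \<epsilon>, and the component in \<open>Y\<close> gains one factor \<open>a\<close>.\<close>
      let ?m = "\<lambda>x. i2 (f (p x)) \<oplus>\<^bsub>Z\<^esub> j2 (p' x)"
      have m: "?m \<in> hom B Z"
        by (intro hom_add lm' hom_comp[OF hom_comp[OF D(3) X(3)] E(1)] hom_comp[OF D(4) E(2)])
      have pm: "p2 (?m x) = f (p x)" "q2 (?m x) = p' x" if "x \<in> carrier B" for x
        using that lm' lm homD(1)[OF X(3)] D(12,13)
        by (simp_all add: E homD(2)[OF E(3)] homD(2)[OF E(4)])
      have minj: "inj_on ?m (carrier B)"
      proof (rule inj_onI)
        fix x x' assume x: "x \<in> carrier B" "x' \<in> carrier B" and eq: "?m x = ?m x'"
        have "f (p x) = f (p x')" "p' x = p' x'" using pm[OF x(1)] pm[OF x(2)] eq by auto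
        then have "p x = p x'" using inj_onD[OF X(7)] D(12)[OF x(1)] D(12)[OF x(2)] by blast
        then have "i (p x) \<oplus>\<^bsub>B\<^esub> j (p' x) = i (p x') \<oplus>\<^bsub>B\<^esub> j (p' x')" using \<open>p' x = p' x'\<close> by simp
        then show "x = x'" unfolding D(9)[OF x(1)] D(9)[OF x(2)] .
      qed
      let ?G = "\<lambda>x. h (p2 x)"
      have G: "?G \<in> hom Z N" by (rule hom_comp[OF E(3) X(6)])
      have Gs: "?G ` carrier Z = carrier N"
      proof (intro subset_antisym subsetI)
        fix y assume "y \<in> carrier N"
        then obtain x where x: "x \<in> carrier X" "y = h x" unfolding X(10)[symmetric] by (rule imageE)
        then show "y \<in> ?G ` carrier Z" using E(5,10) by (intro image_eqI[of _ _ "i2 x"]) auto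
      qed (use homD(1)[OF G] in blast)
      have Gk: "mod_ker Z N ?G = ?m ` carrier B"
      proof (intro subset_antisym subsetI)
        fix x assume "x \<in> mod_ker Z N ?G"
        then have x: "x \<in> carrier Z" "p2 x \<in> mod_ker X N h" using E(12) by (auto simp: mod_ker_def)
        then obtain y' where y': "y' \<in> carrier Y" "p2 x = f y'" unfolding X(11) by blast
        let ?b = "i y' \<oplus>\<^bsub>B\<^esub> j (q2 x)"
        have bc: "?b \<in> carrier B" using D(10)[OF y'(1)] D(11)[OF E(13)[OF x(1)]] lm by simp
        have "p ?b = y'" "p' ?b = q2 x"
          using y' x lm E(13)[OF x(1)] by (simp_all add: D homD(2)[OF D(3)] homD(2)[OF D(4)])
        then have mb: "x = ?m ?b" using y'(2) E(9)[OF x(1)] by simp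
        show "x \<in> ?m ` carrier B" by (rule image_eqI[of x ?m ?b, OF mb bc])
      next
        fix x assume "x \<in> ?m ` carrier B"
        then obtain b' where b': "b' \<in> carrier B" "x = ?m b'" by blast
        have "f (p b') \<in> mod_ker X N h" unfolding X(11) using D(12)[OF b'(1)] by blast
        then show "x \<in> mod_ker Z N ?G"
          using b' pm[OF b'(1)] homD(1)[OF m b'(1)] by (simp add: mod_ker_def)
      qed
      let ?f = "\<lambda>x. ?m (\<epsilon> x)"
      have f: "?f \<in> hom Y Z" by (rule hom_comp[OF e m])
      have ec: "\<epsilon> x \<in> carrier B" if "x \<in> carrier Y" for x by (rule homD(1)[OF e that])
      have finj: "inj_on ?f (carrier Y)"
      proof (rule inj_onI)
        fix x x' assume x: "x \<in> carrier Y" "x' \<in> carrier Y" and eq: "?f x = ?f x'"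
        have "\<epsilon> x = \<epsilon> x'" by (rule inj_onD[OF minj eq ec[OF x(1)] ec[OF x(2)]])
        then show "x = x'" using inj_onD[OF einj] x by blast
      qed
      have fs: "submod (?f ` carrier Y) Z" by (rule image_submod[OF lm(3) lm'(3) f submod_carrier[OF lm(3)]])
      have fim: "?f ` carrier Y = ?m ` ?K" unfolding eimg[symmetric] image_image ..
      obtain N' u where u: "N' \<in> U" "u \<in> hom Z N'" "u ` carrier Z = carrier N'" "mod_ker Z N' u = ?f ` carrier Y"
        using quotient_U[OF Z(1) fs] .
      have lmN': "lm N'" using u(1) by simp
      have "mod_ker Z N' u \<subseteq> mod_ker Z N ?G"
        unfolding u(4) Gk fim using submodD(1)[OF Ks] by (rule image_mono)
      then obtain v where v: "v \<in> hom N' N" "v ` carrier N' = carrier N"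
        "u ` mod_ker Z N ?G = mod_ker N' N v"
        using quotient_factor[OF lm'(3,2) lmN' G Gs u(2,3)] by metis
      let ?N = "restr N' (mod_ker N' N v)"
      have NU: "?N \<in> U" by (rule ker_U[OF u(1) lm'(2) v(1)])
      have um: "(\<lambda>x. u (?m x)) \<in> hom B ?N"
      proof (rule hom_restr_cod[OF hom_comp[OF m u(2)]])
        show "(\<lambda>x. u (?m x)) ` carrier B \<subseteq> mod_ker N' N v"
          unfolding v(3)[symmetric] Gk by blast
      qed
      have ums: "(\<lambda>x. u (?m x)) ` carrier B = carrier ?N"
        using v(3) unfolding Gk by (simp add: image_image)
      have umk: "mod_ker B ?N (\<lambda>x. u (?m x)) = ?K"
      proof (intro subset_antisym subsetI)
        fix x assume "x \<in> mod_ker B ?N (\<lambda>x. u (?m x))"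
        then have x: "x \<in> carrier B" "u (?m x) = \<zero>\<^bsub>N'\<^esub>" by (auto simp: mod_ker_def)
        then have "?m x \<in> mod_ker Z N' u" using homD(1)[OF m x(1)] by (simp add: mod_ker_def)
        then obtain x' where x': "x' \<in> ?K" "?m x = ?m x'" unfolding u(4) fim by blast
        have "x = x'" by (rule inj_onD[OF minj x'(2) x(1) subsetD[OF submodD(1)[OF Ks] x'(1)]])
        then show "x \<in> ?K" using x'(1) by simp
      next
        fix x assume x: "x \<in> ?K"
        then have "?m x \<in> mod_ker Z N' u" unfolding u(4) fim by blast
        then show "x \<in> mod_ker B ?N (\<lambda>x. u (?m x))"
          using subsetD[OF submodD(1)[OF Ks] x] by (simp add: mod_ker_def)
      qed
      have "mod_iso L ?N W"
        by (rule same_kernel_iso[OF lm(1) U_lm[OF NU] lm(2) um ums g(3,4) umk])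
      then have "dec ?N = w" using dec_iso[OF NU g(2)] g(6) by simp
      then have Q': "Q (dec N')" using sesmI[OF u(1) X(2) v(1,2)] Qe[OF X(12)] by simp
      have r': "(\<lambda>x. r (p2 x)) \<in> hom Z Y" and s': "(\<lambda>x. i2 (s x)) \<in> hom Y Z"
        by (rule hom_comp[OF E(3) X(4)], rule hom_comp[OF X(5) E(1)])
      have rf: "r (p2 (?f x)) = (a ^^ Suc n) x" if "x \<in> carrier Y" for x
      proof -
        have 1: "r (p2 (?f x)) = (a ^^ n) (p (\<epsilon> x))"
          unfolding pm(1)[OF ec[OF that]] by (rule X(8)[OF D(12)[OF ec[OF that]]])
        have 2: "p (\<epsilon> x) = a x" by (simp only: a_def)
        have 3: "(a ^^ n) (a x) = (a ^^ Suc n) x" by (simp add: funpow_swap1)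
        show ?thesis using 1 unfolding 2 3 .
      qed
      have rs: "r (p2 (i2 (s x))) = x" if "x \<in> carrier Y" for x
        using that X(9) homD(1)[OF X(5)] E(5) by simp
      have "stage (Suc n) Z N' ?f (\<lambda>x. r (p2 x)) (\<lambda>x. i2 (s x)) u"
        unfolding stage_def
        by (intro conjI ballI Z(1) u f r' s' finj Q' rf rs)
      then show ?case by blast
    qed
    obtain X N f r s h where nonproj: "stage k X N f r s h" using tower[OF \<open>k \<ge> 1\<close>] by blast
    then have X: "X \<in> U" "N \<in> U" "f \<in> hom Y X" "r \<in> hom X Y" "s \<in> hom Y X"
      "h \<in> hom X N" "\<And>x. x \<in> carrier Y \<Longrightarrow> r (f x) = (a ^^ k) x"
      "\<And>x. x \<in> carrier Y \<Longrightarrow> r (s x) = x" "h ` carrier X = carrier N"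
      "mod_ker X N h = f ` carrier Y" "Q (dec N)"
      unfolding stage_def by simp_all
    note lm' = U_lm[OF X(1)] U_lm[OF X(2)]
    \<comment> \<open>\<open>S\<close> is \<open>Y\<close> modulo the image of \<open>a^k\<close>.
      Since \<open>r f = a^k\<close>, the map from \<open>X\<close> to \<open>S\<close> vanishes on
      the image of \<open>f\<close> and factors through \<open>N\<close>. On the copy of
      \<open>?T\<close> given by \<open>s\<close> it becomes the natural isomorphism from
      \<open>?T\<close> to \<open>S\<close>, so \<open>?T\<close> is a summand of
      \<open>N\<close>.\<close>
    obtain S c where c: "S \<in> U" "c \<in> hom Y S" "c ` carrier Y = carrier S" "mod_ker Y S c = ?I"
      using quotient_U[OF Y(1) Is] .
    have lmS: "lm S" using c(1) by simp
    have cr: "(\<lambda>x. c (r x)) \<in> hom X S" by (rule hom_comp[OF X(4) c(2)])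
    have "c (r x) = \<zero>\<^bsub>S\<^esub>" if "x \<in> carrier X" "h x = \<zero>\<^bsub>N\<^esub>" for x
    proof -
      have "x \<in> mod_ker X N h" using that by (simp add: mod_ker_def)
      then obtain y' where y': "y' \<in> carrier Y" "x = f y'" unfolding X(10) by blast
      then have "r x \<in> mod_ker Y S c" unfolding c(4) using X(7) by simp
      then show ?thesis by (simp add: mod_ker_def)
    qed
    then obtain \<rho> where \<rho>: "\<rho> \<in> hom N S" "\<And>x. x \<in> carrier X \<Longrightarrow> \<rho> (h x) = c (r x)"
      using factor_hom[OF lm' lmS X(6,9) cr] by blast
    have hs: "(\<lambda>x. h (s x)) \<in> hom (restr Y ?T) N"
      by (rule hom_restr_dom[OF hom_comp[OF X(5,6)] TY])
    have \<rho>hs: "\<rho> (h (s x)) = c x" if "x \<in> carrier Y" for x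
      using \<rho>(2)[OF homD(1)[OF X(5) that]] X(8)[OF that] by simp
    have cT: "bij_betw c ?T (carrier S)"
      unfolding bij_betw_def
    proof (intro conjI subset_antisym subsetI)
      have cT': "c \<in> hom (restr Y ?T) S" by (rule hom_restr_dom[OF c(2) TY])
      have "inj_on c (carrier (restr Y ?T))"
      proof (rule hom_injI[OF U_lm[OF TU] lmS cT'])
        fix x assume "x \<in> carrier (restr Y ?T)" "c x = \<zero>\<^bsub>S\<^esub>"
        then have x: "x \<in> carrier Y" "(a ^^ k) x = \<zero>\<^bsub>Y\<^esub>" "c x = \<zero>\<^bsub>S\<^esub>" by (auto simp: mod_ker_def)
        then have "x \<in> ?I" unfolding c(4)[symmetric] by (simp add: mod_ker_def)
        moreover have "(a ^^ k) x = (a ^^ k) \<zero>\<^bsub>Y\<^esub>" using x(2) hom_zero[OF lm(3,3) ak] by simp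
        ultimately show "x = \<zero>\<^bsub>restr Y ?T\<^esub>"
          using inj_onD[OF bij_betw_imp_inj_on[OF akI]] submodD(3)[OF Is] by simp
      qed
      then show "inj_on c ?T" by simp
      fix v assume "v \<in> carrier S"
      then obtain y' where y': "y' \<in> carrier Y" "v = c y'" unfolding c(3)[symmetric] by (rule imageE)
      have "(a ^^ k) y' \<in> (a ^^ k) ` ?I" unfolding bij_betw_imp_surj_on[OF akI] using y'(1) by (rule imageI)
      then obtain x where x: "x \<in> ?I" "(a ^^ k) y' = (a ^^ k) x" by blast
      have xY: "x \<in> carrier Y" using x(1) IY by blast
      have "c x = \<zero>\<^bsub>S\<^esub>" using x(1) unfolding c(4)[symmetric] by (simp add: mod_ker_def)
      then have "c (y' \<oplus>\<^bsub>Y\<^esub> \<ominus>\<^bsub>Y\<^esub> x) = v"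
        using y' xY lm lmS homD(1)[OF c(2)] by (simp add: homD(2)[OF c(2)] hom_neg[OF lm(3) lmS c(2)])
      moreover have "y' \<oplus>\<^bsub>Y\<^esub> \<ominus>\<^bsub>Y\<^esub> x \<in> ?T"
        using y'(1) xY x(2) lm homD(1)[OF ak]
        by (simp add: mod_ker_def homD(2)[OF ak] hom_neg[OF lm(3,3) ak])
      ultimately show "v \<in> c ` ?T" by blast
    qed (use homD(1)[OF c(2)] TY in blast)
    have "bij_betw (\<lambda>x. \<rho> (h (s x))) (carrier (restr Y ?T)) (carrier S)"
      using cT \<rho>hs TY by (subst bij_betw_cong[of _ _ c]) auto
    then have "bsum N (restr Y ?T) (restr N (mod_ker N S \<rho>))"
      by (rule bsum_split[OF lm'(2) U_lm[OF TU] lmS hs \<rho>(1)])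
    then have "dec N = t + dec (restr N (mod_ker N S \<rho>))"
      using dec_bsum[OF X(2) TU ker_U[OF X(2) lmS \<rho>(1)]] by (simp add: t_def)
    then show ?thesis using X(11) by (intro exI[of _ "dec N"]) simp
  qed
  ultimately show ?thesis using ytz by blast
qed

end

sublocale finite_length_modules \<subseteq> exact_multisets IC PC sesm
proof
  show "PC \<subseteq> IC" by (auto simp: PC_def IC_def)
  show "\<exists>k p. set_mset p \<subseteq> PC \<and> sesm k p m" if m: "set_mset m \<subseteq> IC" for m
  proof -
    obtain M where "M \<in> U" "dec M = m" using dec_surj[OF m] .
    then show ?thesis using sesm_syzygy[of M] by blast
  qed
qed (fact sesm_closed sesm_sum sesm_add sesm_split sesm_pullback sesm_quotient sesm_preimage sesm_fitting)+

subsection \<open>Ranks of subgroups of free abelian groups\<close>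

lemma frag_sum_cmul_lookup:
  "Poly_Mapping.lookup (\<Sum>b\<in>B. frag_cmul (c b) (f b)) x = (\<Sum>b\<in>B. c b * Poly_Mapping.lookup (f b) x)"
  by (simp add: lookup_sum)

lemma common_denominator:
  assumes "finite B"
  shows "\<exists>d::int. d > 0 \<and> (\<forall>b\<in>B. \<exists>k::int. of_int d * u b = (of_int k :: rat))"
  using assms
proof (induction B)
  case empty
  show ?case by (intro exI[of _ 1]) simp
next
  case (insert b B)
  then obtain d where d: "d > 0" "\<forall>b\<in>B. \<exists>k::int. of_int d * u b = (of_int k :: rat)" by blast
  obtain p q where pq: "u b = Fract p q" "q > 0" by (cases "u b") auto
  have "of_int q * u b = of_int p" using pq by (simp add: Fract_of_int_quotient)
  then have "of_int (d * q) * u b = of_int (d * p)" by simp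
  moreover have "\<exists>k. of_int (d * q) * u b' = (of_int k :: rat)" if b': "b' \<in> B" for b'
  proof -
    obtain k where k: "of_int d * u b' = (of_int k :: rat)" using bspec[OF d(2) b'] by blast
    have "of_int (d * q) * u b' = of_int q * (of_int d * u b')" by simp
    also have "\<dots> = of_int (q * k)" unfolding k by simp
    finally show ?thesis by blast
  qed
  moreover have "d * q > 0" using d(1) pq(2) by simp
  ultimately show ?case by (intro exI[of _ "d * q"]) blast
qed

lemma sum_fun_apply: "(\<Sum>i\<in>A. f i) x = (\<Sum>i\<in>A. f i x)" for f :: "'i \<Rightarrow> 'b \<Rightarrow> rat"
  by (induction A rule: infinite_finite_induct) auto

text \<open>Integral independence becomes rational independence after clearing denominators, and
  over the rationals \<open>B\<close> lies in the span of the unit vectors indexed by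
  \<open>C\<close>.\<close>

lemma int_independent_card_le:
  fixes B :: "('b \<Rightarrow>\<^sub>0 int) set"
  assumes C: "finite C" and B: "finite B" "int_independent B" "\<And>b. b \<in> B \<Longrightarrow> Poly_Mapping.keys b \<subseteq> C"
  shows "card B \<le> card C"
proof -
  interpret V: vector_space "\<lambda>(q::rat) (f::'b \<Rightarrow> rat) x. q * f x"
    by standard (auto simp: fun_eq_iff algebra_simps)
  define e :: "('b \<Rightarrow>\<^sub>0 int) \<Rightarrow> 'b \<Rightarrow> rat" where "e z = (\<lambda>x. of_int (Poly_Mapping.lookup z x))" for z
  have inj: "inj e"
    by (rule injI) (auto simp: e_def fun_eq_iff intro: poly_mapping_eqI)
  have ind: "\<not> V.dependent (e ` B)"
  proof
    assume "V.dependent (e ` B)"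
    then obtain u v0 where u: "(\<Sum>v\<in>e ` B. (\<lambda>x. u v * v x)) = 0" "v0 \<in> e ` B" "u v0 \<noteq> 0"
      using V.dependent_finite[of "e ` B"] B(1) by auto
    obtain d where d: "d > 0" "\<forall>b\<in>B. \<exists>k::int. of_int d * u (e b) = (of_int k :: rat)"
      using common_denominator[OF B(1), of "\<lambda>b. u (e b)"] by blast
    then obtain c :: "_ \<Rightarrow> int" where c: "\<And>b. b \<in> B \<Longrightarrow> of_int d * u (e b) = (of_int (c b) :: rat)" by metis
    have "(\<Sum>b\<in>B. frag_cmul (c b) b) = 0"
    proof (rule poly_mapping_eqI)
      fix x
      have "(\<Sum>v\<in>e ` B. u v * v x) = 0" using fun_cong[OF u(1), of x] by (simp add: sum_fun_apply)
      then have "(\<Sum>b\<in>B. u (e b) * e b x) = 0"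
        by (subst (asm) sum.reindex) (use inj in \<open>auto intro: inj_on_subset\<close>)
      then have "0 = of_int d * (\<Sum>b\<in>B. u (e b) * e b x)" by simp
      also have "\<dots> = (\<Sum>b\<in>B. of_int (c b) * e b x)"
        unfolding sum_distrib_left by (intro sum.cong refl) (simp add: c[symmetric])
      also have "\<dots> = of_int (\<Sum>b\<in>B. c b * Poly_Mapping.lookup b x)" by (simp add: e_def)
      finally have "0 = (\<Sum>b\<in>B. c b * Poly_Mapping.lookup b x)" by (simp only: of_int_0_eq_iff)
      then show "Poly_Mapping.lookup (\<Sum>b\<in>B. frag_cmul (c b) b) x = Poly_Mapping.lookup 0 x"
        unfolding frag_sum_cmul_lookup by simp
    qed
    then have c0: "\<forall>b\<in>B. c b = 0" using B(2) unfolding int_independent_def by blast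
    obtain b where b: "b \<in> B" "v0 = e b" using u(2) by blast
    have "of_int d * u (e b) = (0 :: rat)" using c[OF b(1)] c0 b(1) by simp
    then show False using d(1) u(3) b(2) by simp
  qed
  let ?T = "(\<lambda>c. e (frag_of c)) ` C"
  have "e b \<in> V.span ?T" if b: "b \<in> B" for b
  proof -
    have "e b = (\<Sum>c\<in>C. (\<lambda>x. of_int (Poly_Mapping.lookup b c) * e (frag_of c) x))"
    proof
      fix x
      have "(\<Sum>c\<in>C. of_int (Poly_Mapping.lookup b c) * e (frag_of c) x) =
          (\<Sum>c\<in>C. if c = x then of_int (Poly_Mapping.lookup b c) else 0)"
        by (intro sum.cong refl) (simp add: e_def lookup_single when_def)
      also have "\<dots> = e b x"
      proof (cases "x \<in> C")
        case True
        then show ?thesis using C by (simp add: e_def sum.delta)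
      next
        case False
        then have "Poly_Mapping.lookup b x = 0" using B(3)[OF b] by (meson in_keys_iff subsetD)
        then show ?thesis using C False by (simp add: e_def sum.delta)
      qed
      finally show "e b x = (\<Sum>c\<in>C. (\<lambda>x. of_int (Poly_Mapping.lookup b c) * e (frag_of c) x)) x"
        by (simp add: sum_fun_apply)
    qed
    also have "\<dots> \<in> V.span ?T" by (intro V.span_sum V.span_scale V.span_base) blast
    finally show ?thesis .
  qed
  then have "card (e ` B) \<le> card ?T"
    using V.independent_span_bound[OF _ ind, of ?T] C by blast
  also have "\<dots> \<le> card C" by (rule card_image_le[OF C])
  finally show ?thesis using inj by (simp add: card_image inj_on_subset)
qed

lemma int_rank_ge: "finite B \<Longrightarrow> B \<subseteq> H \<Longrightarrow> int_independent B \<Longrightarrow> enat (card B) \<le> int_rank H"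
  unfolding int_rank_def by (rule SUP_upper2[of B]) auto

lemma int_rank_le:
  "(\<And>B. finite B \<Longrightarrow> B \<subseteq> H \<Longrightarrow> int_independent B \<Longrightarrow> enat (card B) \<le> n) \<Longrightarrow> int_rank H \<le> n"
  unfolding int_rank_def by (rule SUP_least) auto

lemma int_rank_keys_le: "finite C \<Longrightarrow> H \<subseteq> {x. Poly_Mapping.keys x \<subseteq> C} \<Longrightarrow> int_rank H \<le> enat (card C)"
proof (rule int_rank_le)
  fix B assume "finite C" "H \<subseteq> {x. Poly_Mapping.keys x \<subseteq> C}" "finite B" "B \<subseteq> H" "int_independent B"
  then have "card B \<le> card C" by (intro int_independent_card_le) auto
  then show "enat (card B) \<le> enat (card C)" by simp
qed

lemma int_rank_mono: "H \<subseteq> K \<Longrightarrow> int_rank H \<le> int_rank K"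
  by (rule int_rank_le) (auto intro: int_rank_ge)

lemma int_rank_attained:
  assumes "int_rank H < \<infinity>"
  obtains B where "finite B" "B \<subseteq> H" "int_independent B" "int_rank H = enat (card B)"
proof -
  let ?S = "{B. finite B \<and> B \<subseteq> H \<and> int_independent B}"
  obtain n where n: "int_rank H = enat n" using assms by (cases "int_rank H") auto
  have "{} \<in> ?S" by (simp add: int_independent_def)
  moreover have "\<forall>B. B \<in> ?S \<longrightarrow> card B < Suc n"
  proof (intro allI impI)
    fix B assume "B \<in> ?S"
    then show "card B < Suc n" using int_rank_ge[of B H] unfolding n by simp
  qed
  ultimately obtain B where B: "B \<in> ?S" "\<forall>B'. B' \<in> ?S \<longrightarrow> card B' \<le> card B"
    using ex_has_greatest_nat[of "\<lambda>B. B \<in> ?S" "{}" card "Suc n"] by auto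
  have "int_rank H \<le> enat (card B)" using B by (intro int_rank_le) auto
  moreover have "enat (card B) \<le> int_rank H" using B(1) by (auto intro: int_rank_ge)
  ultimately show thesis using that[of B] B(1) by (simp add: antisym)
qed

definition additive_map :: "(('b \<Rightarrow>\<^sub>0 int) \<Rightarrow> ('b \<Rightarrow>\<^sub>0 int)) \<Rightarrow> bool" where
  "additive_map f \<longleftrightarrow> (\<forall>x y. f (x + y) = f x + f y)"

lemma additive_mapD:
  assumes "additive_map f"
  shows "f (x + y) = f x + f y" and "f 0 = 0" and "f (- x) = - f x" and "f (x - y) = f x - f y"
    and "f (frag_cmul k x) = frag_cmul k (f x)" and "f (sum g A) = (\<Sum>a\<in>A. f (g a))"
proof -
  show add: "f (x + y) = f x + f y" for x y using assms by (simp add: additive_map_def)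
  show zero: "f 0 = 0" using add[of 0 0] by simp
  show neg: "f (- x) = - f x" for x using add[of x "- x"] zero by (simp add: eq_neg_iff_add_eq_0 add.commute)
  show "f (x - y) = f x - f y" using add[of x "- y"] neg by simp
  have nat: "f (frag_cmul (int n) x) = frag_cmul (int n) (f x)" for n x
    by (induction n) (simp_all add: zero frag_cmul_distrib add)
  show "f (frag_cmul k x) = frag_cmul k (f x)"
  proof (cases k rule: int_cases2)
    case (nonneg n)
    then show ?thesis using nat by simp
  next
    case (nonpos n)
    then show ?thesis using nat[of n x] neg[of "frag_cmul (int n) x"] by simp
  qed
  show "f (sum g A) = (\<Sum>a\<in>A. f (g a))"
    by (induction A rule: infinite_finite_induct) (auto simp: zero add)
qed

lemma additive_map_funpow: "additive_map f \<Longrightarrow> additive_map (f ^^ n)"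
  by (induction n) (auto simp: additive_map_def)

lemma lift_independent:
  assumes f: "additive_map f" and B: "finite B" "B \<subseteq> f ` H" "int_independent B"
  obtains B' where "finite B'" "B' \<subseteq> H" "int_independent B'" "card B' = card B" "f ` B' = B" "inj_on f B'"
proof -
  obtain g where g: "\<And>b. b \<in> B \<Longrightarrow> g b \<in> H \<and> f (g b) = b" using B(2) by (metis image_iff subsetD)
  have inj: "inj_on g B" using g by (metis inj_onI)
  show thesis
  proof (rule that[of "g ` B"])
    show "int_independent (g ` B)"
      unfolding int_independent_def
    proof (intro allI impI ballI)
      fix c v assume 0: "(\<Sum>b\<in>g ` B. frag_cmul (c b) b) = 0" and v: "v \<in> g ` B"
      have "(\<Sum>b\<in>B. frag_cmul (c (g b)) (g b)) = 0" using 0 by (simp add: sum.reindex[OF inj])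
      then have "f (\<Sum>b\<in>B. frag_cmul (c (g b)) (g b)) = 0" using additive_mapD(2)[OF f] by simp
      then have "(\<Sum>b\<in>B. frag_cmul (c (g b)) b) = 0"
        using g by (simp add: additive_mapD(5,6)[OF f] cong: sum.cong)
      then show "c v = 0" using B(3) v unfolding int_independent_def by auto
    qed
    show "f ` g ` B = B" using g by (force simp: image_image)
    show "inj_on f (g ` B)" using g by (auto intro!: inj_onI)
  qed (use B g inj in \<open>auto simp: card_image\<close>)
qed

lemma int_rank_image_le: "additive_map f \<Longrightarrow> int_rank (f ` H) \<le> int_rank H"
proof (rule int_rank_le)
  fix B assume f: "additive_map f" and B: "finite B" "B \<subseteq> f ` H" "int_independent B"
  obtain B' where "finite B'" "B' \<subseteq> H" "int_independent B'" "card B' = card B"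
    using lift_independent[OF f B] by metis
  then show "enat (card B) \<le> int_rank H" using int_rank_ge[of B' H] by simp
qed

lemma int_independent_nonzero: "finite B \<Longrightarrow> int_independent B \<Longrightarrow> b \<in> B \<Longrightarrow> b \<noteq> 0"
proof
  assume B: "finite B" "int_independent B" "b \<in> B" "b = 0"
  have "(\<Sum>x\<in>B. frag_cmul (if x = b then 1 else 0) x) = (\<Sum>x\<in>B. 0)"
    by (intro sum.cong) (auto simp: B(4))
  then show False using B(2,3) unfolding int_independent_def by (force dest: spec[of _ "\<lambda>x. if x = b then 1 else 0"])
qed

lemma frag_cmul_eq_0: "frag_cmul k x = 0 \<Longrightarrow> k = 0 \<or> x = 0"
  by (metis lookup_frag_cmul lookup_zero mult_eq_0_iff poly_mapping_eqI)

text \<open>Lift a maximal independent subset of the image to \<open>H\<close>. A nonzero kernel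
  element could be added to the lift without destroying independence, because the ambient group is
  torsion free, and the rank of \<open>H\<close> would exceed that of its image.\<close>

lemma int_rank_kernel:
  assumes f: "additive_map f" and fin: "int_rank H < \<infinity>" and eq: "int_rank (f ` H) = int_rank H"
    and h: "h \<in> H" "f h = 0"
  shows "h = 0"
proof (rule ccontr)
  assume nz: "h \<noteq> 0"
  obtain B where B: "finite B" "B \<subseteq> f ` H" "int_independent B" "int_rank (f ` H) = enat (card B)"
    using int_rank_attained[of "f ` H"] fin eq by auto
  obtain B' where B': "finite B'" "B' \<subseteq> H" "int_independent B'" "card B' = card B" "f ` B' = B" "inj_on f B'"
    using lift_independent[OF f B(1-3)] by metis
  have hB: "h \<notin> B'"
  proof
    assume "h \<in> B'"
    then have "f h \<in> B" using B'(5) by blast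
    then show False using int_independent_nonzero[OF B(1,3)] h(2) by blast
  qed
  have "int_independent (insert h B')"
    unfolding int_independent_def
  proof (intro allI impI)
    fix c assume "(\<Sum>b\<in>insert h B'. frag_cmul (c b) b) = 0"
    then have s: "frag_cmul (c h) h + (\<Sum>b\<in>B'. frag_cmul (c b) b) = 0" using hB B'(1) by simp
    then have "f (frag_cmul (c h) h + (\<Sum>b\<in>B'. frag_cmul (c b) b)) = 0" using additive_mapD(2)[OF f] by simp
    then have "(\<Sum>b\<in>B'. frag_cmul (c b) (f b)) = 0"
      by (simp add: additive_mapD(1,5,6)[OF f] h(2))
    then have "(\<Sum>b\<in>B. frag_cmul (c (inv_into B' f b)) b) = 0"
      unfolding B'(5)[symmetric] by (simp add: sum.reindex[OF B'(6)] inv_into_f_f[OF B'(6)] cong: sum.cong)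
    then have *: "\<forall>b\<in>B. c (inv_into B' f b) = 0" 
      using B(3)[unfolded int_independent_def, rule_format, of "\<lambda>b. c (inv_into B' f b)"] by blast
    have c0: "c b = 0" if "b \<in> B'" for b
      using bspec[OF *, of "f b"] that B'(5) inv_into_f_f[OF B'(6) that] by auto
    then have "frag_cmul (c h) h = 0" using s by (simp cong: sum.cong)
    then show "\<forall>b\<in>insert h B'. c b = 0" using frag_cmul_eq_0 nz c0 by blast
  qed
  then have "enat (card (insert h B')) \<le> int_rank H"
    using B' h(1) by (intro int_rank_ge) auto
  then show False using hB B' B(4) eq by simp
qed

text \<open>Only a nonzero multiple of \<open>v\<close> is expressed through \<open>B\<close>, since
  rank does not distinguish a group from its subgroups of finite index.\<close>

lemma rank_dependent:
  assumes "B \<subseteq> H" "finite B" "int_independent B" "int_rank H = enat (card B)" "v \<in> H" "v \<notin> B"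
  obtains k c where "k \<noteq> 0" "frag_cmul k v = (\<Sum>b\<in>B. frag_cmul (c b) b)"
proof -
  have "\<not> int_independent (insert v B)"
  proof
    assume "int_independent (insert v B)"
    then have "enat (card (insert v B)) \<le> int_rank H" using assms by (intro int_rank_ge) auto
    then show False using assms by simp
  qed
  then obtain c where c: "(\<Sum>b\<in>insert v B. frag_cmul (c b) b) = 0" "\<exists>b\<in>insert v B. c b \<noteq> 0"
    unfolding int_independent_def by blast
  then have s: "frag_cmul (c v) v + (\<Sum>b\<in>B. frag_cmul (c b) b) = 0" using assms(2,6) by simp
  have "c v \<noteq> 0"
  proof
    assume v0: "c v = 0"
    then have "(\<Sum>b\<in>B. frag_cmul (c b) b) = 0" using s by simp
    then have "\<forall>b\<in>B. c b = 0" using assms(3) unfolding int_independent_def by blast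
    then show False using c(2) v0 by blast
  qed
  moreover have "frag_cmul (- c v) v = - frag_cmul (c v) v" by (rule poly_mapping_eqI) simp
  then have "frag_cmul (- c v) v = (\<Sum>b\<in>B. frag_cmul (c b) b)" using minus_unique[OF s] by simp
  ultimately show thesis using that[of "- c v" c] by simp
qed

lemma enat_decseq_eventually_constant:
  fixes r :: "nat \<Rightarrow> enat"
  assumes "\<And>k. r (Suc k) \<le> r k"
  shows "\<exists>n. \<forall>k\<ge>n. r k = r n"
proof -
  have anti: "r k \<le> r n" if "n \<le> k" for n k
    using that by (induction k rule: dec_induct) (auto intro: order_trans[OF assms])
  obtain n where "\<And>m. r n \<le> r m"
    using exists_least_iff[of "\<lambda>x. x \<in> range r"] by (metis linorder_not_less rangeE rangeI)
  then show ?thesis using anti by (meson antisym)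
qed

context finite_length_modules
begin

subsection \<open>Projective dimension\<close>

text \<open>Removing \<open>P 0\<close> leaves a resolution, shorter by one, of the kernel of the
  augmentation.\<close>

lemma resolution_pdim_le:
  "M \<in> U \<Longrightarrow> projective_resolution L n P d M \<Longrightarrow> pdim_le n (dec M)"
proof (induction n arbitrary: M P d)
  case 0
  have R: "projective L (P 0)" "d 0 \<in> hom (P 0) M" "d 0 ` carrier (P 0) = carrier M"
    "inj_on (d 0) (carrier (P 0))"
    using 0(2) by (auto simp: projective_resolution_def Let_def)
  then have "mod_iso L (P 0) M" by (auto simp: mod_iso_def bij_betw_def)
  then have "projective L M" using projective_iso[OF R(1) 0(1)] by blast
  then show ?case using projective_dec[OF 0(1)] by (simp add: proj_def)
next
  case (Suc n)
  let ?Q = "\<lambda>i. case i of 0 \<Rightarrow> M | Suc j \<Rightarrow> P j"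
  have R: "\<And>i. i \<le> Suc n \<Longrightarrow> projective L (P i)" "\<And>i. i \<le> Suc n \<Longrightarrow> d i \<in> hom (P i) (?Q i)"
    "d 0 ` carrier (P 0) = carrier M"
    "\<And>i. i < Suc n \<Longrightarrow> d (Suc i) ` carrier (P (Suc i)) = mod_ker (P i) (?Q i) (d i)"
    "inj_on (d (Suc n)) (carrier (P (Suc n)))"
    using Suc.prems(2) unfolding projective_resolution_def Let_def by blast+
  have d0: "d 0 \<in> hom (P 0) M" using R(2)[of 0] by simp
  have P0: "projective L (P 0)" using R(1)[of 0] by simp
  let ?K = "restr (P 0) (mod_ker (P 0) M (d 0))"
  have KU: "?K \<in> U" by (rule ker_U[OF projective_U[OF P0] U_lm[OF Suc.prems(1)] d0])
  let ?Q' = "\<lambda>i. case i of 0 \<Rightarrow> ?K | Suc j \<Rightarrow> P (Suc j)"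
  have d1: "d (Suc 0) ` carrier (P (Suc 0)) = mod_ker (P 0) M (d 0)" using R(4)[of 0] by simp
  have "projective_resolution L n (\<lambda>i. P (Suc i)) (\<lambda>i. d (Suc i)) ?K"
    unfolding projective_resolution_def Let_def
  proof (intro conjI allI impI)
    fix i assume "i \<le> n"
    then show "projective L (P (Suc i))" using R(1) by simp
    show "d (Suc i) \<in> hom (P (Suc i)) (?Q' i)"
    proof (cases i)
      case 0
      have "d (Suc 0) \<in> hom (P (Suc 0)) (P 0)" using R(2)[of "Suc 0"] by simp
      then have "d (Suc 0) \<in> hom (P (Suc 0)) ?K" using d1 by (intro hom_restr_cod) simp_all
      then show ?thesis using 0 by simp
    next
      case (Suc j)
      then show ?thesis using R(2)[of "Suc i"] \<open>i \<le> n\<close> by simp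
    qed
  next
    show "d (Suc 0) ` carrier (P (Suc 0)) = carrier ?K" using d1 by simp
  next
    fix i assume i: "i < n"
    have "mod_ker (P (Suc i)) (?Q' i) (d (Suc i)) = mod_ker (P (Suc i)) (P i) (d (Suc i))"
      by (cases i) (simp_all add: mod_ker_def)
    then show "d (Suc (Suc i)) ` carrier (P (Suc (Suc i))) = mod_ker (P (Suc i)) (?Q' i) (d (Suc i))"
      using R(4)[of "Suc i"] i by simp
  next
    show "inj_on (d (Suc n)) (carrier (P (Suc n)))" by (rule R(5))
  qed
  then have K: "pdim_le n (dec ?K)" by (rule Suc.IH[OF KU])
  have "proj (dec (P 0))" using projective_dec[OF projective_U[OF P0]] P0 by (simp add: proj_def)
  then show ?case
    using sesmI[OF projective_U[OF P0] Suc.prems(1) d0 R(3)] K unfolding pdim_le.simps by blast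
qed

lemma pdim_le_resolution:
  "M \<in> U \<Longrightarrow> pdim_le n (dec M) \<Longrightarrow> \<exists>P d. projective_resolution L n P d M"
proof (induction n arbitrary: M)
  case 0
  have M: "projective L M" using projective_dec[OF 0(1)] 0(2) by (simp add: proj_def)
  have "projective_resolution L 0 (\<lambda>_. M) (\<lambda>_ x. x) M"
    unfolding projective_resolution_def using M hom_id[of M] by (simp add: Let_def)
  then show ?case by blast
next
  case (Suc n)
  obtain k p where kp: "proj p" "sesm k p (dec M)" "pdim_le n k" using Suc.prems(2) by auto
  obtain B g where g: "B \<in> U" "g \<in> hom B M" "g ` carrier B = carrier M" "dec B = p"
    "dec (restr B (mod_ker B M g)) = k" using sesm_target[OF kp(2) Suc.prems(1) refl] .
  have B: "projective L B" using projective_dec[OF g(1)] g(4) kp(1) by (simp add: proj_def)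
  let ?K = "restr B (mod_ker B M g)"
  have KU: "?K \<in> U" by (rule ker_U[OF g(1) U_lm[OF Suc.prems(1)] g(2)])
  obtain P d where Pd: "projective_resolution L n P d ?K"
    using Suc.IH[OF KU] kp(3) g(5) by auto
  let ?Q = "\<lambda>i. case i of 0 \<Rightarrow> ?K | Suc j \<Rightarrow> P j"
  have R: "\<And>i. i \<le> n \<Longrightarrow> projective L (P i)" "\<And>i. i \<le> n \<Longrightarrow> d i \<in> hom (P i) (?Q i)"
    "d 0 ` carrier (P 0) = carrier ?K"
    "\<And>i. i < n \<Longrightarrow> d (Suc i) ` carrier (P (Suc i)) = mod_ker (P i) (?Q i) (d i)"
    "inj_on (d n) (carrier (P n))"
    using Pd unfolding projective_resolution_def Let_def by blast+
  let ?P = "\<lambda>i. case i of 0 \<Rightarrow> B | Suc j \<Rightarrow> P j" and ?d = "\<lambda>i. case i of 0 \<Rightarrow> g | Suc j \<Rightarrow> d j"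
  let ?R = "\<lambda>i. case i of 0 \<Rightarrow> M | Suc j \<Rightarrow> ?P j"
  have "projective_resolution L (Suc n) ?P ?d M"
    unfolding projective_resolution_def Let_def
  proof (intro conjI allI impI)
    fix i assume i: "i \<le> Suc n"
    show "projective L (?P i)" using R(1) B i by (cases i) simp_all
    show "?d i \<in> hom (?P i) (?R i)"
    proof (cases i)
      case 0
      then show ?thesis using g(2) by simp
    next
      case (Suc j)
      have j: "j \<le> n" using Suc i by simp
      show ?thesis
      proof (cases j)
        case 0
        have "d 0 \<in> hom (P 0) ?K" using R(2)[of 0] by simp
        then have "d 0 \<in> hom (P 0) B" using hom_comp[OF _ hom_incl[of "mod_ker B M g" B]]
          by (auto simp: mod_ker_def)
        then show ?thesis using Suc 0 by simp
      next
        case (Suc k)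
        then show ?thesis using R(2)[OF j] \<open>i = Suc j\<close> by simp
      qed
    qed
  next
    show "?d 0 ` carrier (?P 0) = carrier M" using g(3) by simp
  next
    fix i assume i: "i < Suc n"
    show "?d (Suc i) ` carrier (?P (Suc i)) = mod_ker (?P i) (?R i) (?d i)"
    proof (cases i)
      case 0
      then show ?thesis using R(3) by simp
    next
      case (Suc j)
      have "mod_ker (P j) (?Q j) (d j) = mod_ker (P j) (?P j) (d j)"
        by (cases j) (simp_all add: mod_ker_def)
      then show ?thesis using R(4)[of j] Suc i by simp
    qed
  next
    show "inj_on (?d (Suc n)) (carrier (?P (Suc n)))" using R(5) by simp
  qed
  then show ?case by blast
qed

lemma pd_eq: "M \<in> U \<Longrightarrow> pd L M = Inf {enat n | n. pdim_le n (dec M)}"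
  unfolding pd_def using resolution_pdim_le pdim_le_resolution by (intro arg_cong[of _ _ Inf] Collect_cong) blast

lemma pd_le_iff: "M \<in> U \<Longrightarrow> pd L M \<le> enat n \<longleftrightarrow> pdim_le n (dec M)"
proof
  assume M: "M \<in> U" and le: "pd L M \<le> enat n"
  have "{enat n | n. pdim_le n (dec M)} \<noteq> {}"
  proof
    assume "{enat n | n. pdim_le n (dec M)} = {}"
    then show False using le unfolding pd_eq[OF M] by (simp add: Inf_enat_def)
  qed
  then have "pd L M \<in> {enat n | n. pdim_le n (dec M)}"
    unfolding pd_eq[OF M] Inf_enat_def by (auto intro: LeastI)
  then obtain k where "pd L M = enat k" "pdim_le k (dec M)" by blast
  then show "pdim_le n (dec M)" using le pdim_le_mono[of k n] by simp
next
  assume M: "M \<in> U" and "pdim_le n (dec M)"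
  then show "pd L M \<le> enat n" unfolding pd_eq[OF M] by (intro Inf_lower) blast
qed

lemma pd_finite_iff: "M \<in> U \<Longrightarrow> pd L M < \<infinity> \<longleftrightarrow> (\<exists>n. pdim_le n (dec M))"
proof
  assume M: "M \<in> U" and "pd L M < \<infinity>"
  then obtain n where "pd L M = enat n" by auto
  then show "\<exists>n. pdim_le n (dec M)" using pd_le_iff[OF M, of n] by auto
next
  assume M: "M \<in> U" and "\<exists>n. pdim_le n (dec M)"
  then obtain n where "pdim_le n (dec M)" by blast
  then have "pd L M \<le> enat n" using pd_le_iff[OF M] by blast
  then show "pd L M < \<infinity>" by (rule order.strict_trans1) simp
qed

lemma fin_dim_pdim_le:
  assumes "fin_dim L \<C> \<le> enat N" "X \<in> \<C>" "X \<in> U" "pdim_le n (dec X)"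
  shows "pdim_le N (dec X)"
proof -
  have "X \<in> {X \<in> \<C>. pd L X < \<infinity>}" using assms pd_finite_iff by blast
  then have "pd L X \<le> fin_dim L \<C>" unfolding fin_dim_def by (rule SUP_upper)
  then show ?thesis using pd_le_iff[OF assms(3)] assms(1) order_trans by blast
qed


subsection \<open>Iterated syzygies and additive closures\<close>

lemma syz_syzygy: "M \<in> U \<Longrightarrow> syz (dec (syzygy L M)) (dec M)"
  using sesm_syzygy[of M] by (auto simp: syz_def proj_def)

lemma syzygy_funpow: "M \<in> U \<Longrightarrow> (syzygy L ^^ n) M \<in> U \<and> syzn n (dec ((syzygy L ^^ n) M)) (dec M)"
proof (induction n)
  case 0
  then show ?case using dec_IC by (simp add: obj_def)
next
  case (Suc n)
  then have "(syzygy L ^^ n) M \<in> U" "syzn n (dec ((syzygy L ^^ n) M)) (dec M)" by auto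
  then show ?case using syzygy_U syz_syzygy by auto
qed

lemma isum_dsum_iff:
  assumes "set Xs \<subseteq> U" "M \<in> U"
  shows "isum M Xs \<longleftrightarrow> mod_iso L M (dsum Xs)"
  using assms
proof (induction Xs arbitrary: M)
  case Nil
  let ?E = "dsum ([] :: 'a fgmod list)"
  have E: "lm ?E" "zero_mod ?E" by (rule dsum_Nil)+
  show ?case
  proof
    assume "isum M []"
    then have M: "zero_mod M" by simp
    have "bsum M M ?E" by (rule bsum_zero[OF U_lm[OF Nil(2)] E])
    then have "bsum M ?E M" by (rule bsum_comm[OF U_lm[OF Nil(2)]])
    then show "mod_iso L M ?E" using bsum_zero_iff[OF U_lm[OF Nil(2)] E(1) U_lm[OF Nil(2)] M] by blast
  next
    assume "mod_iso L M ?E"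
    then obtain f where f: "f \<in> hom M ?E" "bij_betw f (carrier M) (carrier ?E)" by (auto simp: mod_iso_def)
    have "x = \<zero>\<^bsub>M\<^esub>" if "x \<in> carrier M" for x
    proof (rule hom_inj_zero[OF U_lm[OF Nil(2)] E(1) f(1) bij_betw_imp_inj_on[OF f(2)] that])
      show "f x = \<zero>\<^bsub>?E\<^esub>" using homD(1)[OF f(1) that] E(2) by (simp add: zero_mod_def)
    qed
    then show "isum M []" using Nil(2) by (auto simp: zero_mod_def)
  qed
next
  case (Cons X Xs)
  have X: "X \<in> U" and Xs: "set Xs \<subseteq> U" using Cons.prems by auto
  have lmXs: "lm (dsum Xs)" and lmC: "lm (dsum (X # Xs))"
    by (rule dsum_lm; use X Xs in auto)+
  have D: "bsum (dsum (X # Xs)) X (dsum Xs)" by (rule dsum_Cons) (use X Xs in auto)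
  show ?case
  proof
    assume "isum M (X # Xs)"
    then obtain N where N: "N \<in> U" "bsum M X N" "isum N Xs" by auto
    then have iso: "mod_iso L N (dsum Xs)" using Cons.IH[OF Xs N(1)] by blast
    have "bsum M X (dsum Xs)"
      by (rule bsum_iso[OF U_lm[OF Cons.prems(2)] U_lm[OF X] U_lm[OF N(1)] U_lm[OF X] lmXs
          mod_iso_refl mod_iso_refl iso N(2)])
    then show "mod_iso L M (dsum (X # Xs))"
      by (rule bsum_unique[OF U_lm[OF Cons.prems(2)] lmC U_lm[OF X] lmXs _ D])
  next
    assume i: "mod_iso L M (dsum (X # Xs))"
    have s: "bsum M X (dsum Xs)"
      by (rule bsum_iso[OF lmC U_lm[OF X] lmXs U_lm[OF X] lmXs
          mod_iso_sym[OF U_lm[OF Cons.prems(2)] i] mod_iso_refl mod_iso_refl D])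
    \<comment> \<open>The elements of \<open>dsum Xs\<close> are lists. As a direct summand of
      \<open>M\<close> it is finitely generated, so it has a copy in \<open>U\<close>, to which the
      induction hypothesis applies.\<close>
    have "bsum M (dsum Xs) X" by (rule bsum_comm[OF U_lm[OF Cons.prems(2)] s])
    then obtain a b c d where bb: "biprod M (dsum Xs) X a b c d" by (auto simp: bsum_def)
    note B = biprodD[OF bb]
    have "c ` carrier M = carrier (dsum Xs)"
    proof (intro subset_antisym subsetI)
      fix y assume y: "y \<in> carrier (dsum Xs)"
      show "y \<in> c ` carrier M" by (rule image_eqI[of y c "a y", OF B(5)[OF y, symmetric] B(10)[OF y]])
    qed (use B(12) in blast)
    then have "fg_left_module L (dsum Xs)"
      using fg_image[OF _ lmXs B(3)] Cons.prems(2) by (simp add: U_iff)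
    then obtain N where N: "N \<in> U" "mod_iso L (dsum Xs) N" by (rule U_universal)
    have "isum N Xs" using Cons.IH[OF Xs N(1)] mod_iso_sym[OF lmXs N(2)] by blast
    moreover have "bsum M X N"
      by (rule bsum_iso[OF U_lm[OF Cons.prems(2)] U_lm[OF X] lmXs U_lm[OF X] U_lm[OF N(1)]
          mod_iso_refl mod_iso_refl N(2) s])
    ultimately show "isum M (X # Xs)" using N(1) by auto
  qed
qed

lemma isum_exists:
  assumes "set Xs \<subseteq> U"
  shows "\<exists>M\<in>U. isum M Xs \<and> dec M = (\<Sum>X\<leftarrow>Xs. dec X)"
  using assms
proof (induction Xs)
  case Nil
  obtain Z where "Z \<in> U" "zero_mod Z" by (rule zero_exists)
  then show ?case using dec_zero by auto
next
  case (Cons X Xs)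
  then obtain N where N: "N \<in> U" "isum N Xs" "dec N = (\<Sum>X\<leftarrow>Xs. dec X)" by auto
  have X: "X \<in> U" using Cons.prems by simp
  obtain M where M: "M \<in> U" "bsum M X N" using bsum_exists[OF X N(1)] .
  have "dec M = (\<Sum>X\<leftarrow>(X # Xs). dec X)" using dec_bsum[OF M(1) X N(1) M(2)] N(3) by simp
  then show ?case using M N by auto
qed

lemma direct_summand_iff:
  assumes "Y \<in> U"
  shows "direct_summand L X Y \<longleftrightarrow> X \<in> U \<and> dec X \<subseteq># dec Y"
proof
  assume "direct_summand L X Y"
  then obtain Z where Z: "X \<in> U" "Z \<in> U" "mod_iso L Y (dsum [X, Z])" by (auto simp: direct_summand_def)
  then have "bsum Y X Z" using bsum_dsum_iff[OF U_lm[OF assms] U_lm[OF Z(1)] U_lm[OF Z(2)]] by blast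
  then show "X \<in> U \<and> dec X \<subseteq># dec Y" using dec_bsum[OF assms Z(1,2)] Z(1) by simp
next
  assume X: "X \<in> U \<and> dec X \<subseteq># dec Y"
  have "set_mset (dec Y - dec X) \<subseteq> IC" using dec_IC[OF assms] by (meson in_diffD subset_iff)
  then obtain Z where Z: "Z \<in> U" "dec Z = dec Y - dec X" using dec_surj by blast
  have "bsum Y X Z" using bsum_iff_dec[OF assms _ Z(1), of X] X Z(2) by simp
  then have "mod_iso L Y (dsum [X, Z])"
    using bsum_dsum_iff[OF U_lm[OF assms] U_lm[of X] U_lm[OF Z(1)]] X by blast
  then show "direct_summand L X Y" using X Z(1) by (auto simp: direct_summand_def)
qed

lemma add_cl_iff:
  assumes "\<C> \<subseteq> U"
  shows "X \<in> add_cl L \<C> \<longleftrightarrow> X \<in> U \<and> (\<exists>Cs. set Cs \<subseteq> \<C> \<and> dec X \<subseteq># (\<Sum>C\<leftarrow>Cs. dec C))"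
proof -
  have "direct_summand L X (dsum Cs) \<longleftrightarrow> X \<in> U \<and> dec X \<subseteq># (\<Sum>C\<leftarrow>Cs. dec C)" if Cs: "set Cs \<subseteq> \<C>" for Cs
  proof -
    have U: "set Cs \<subseteq> U" using Cs assms by blast
    obtain M where M: "M \<in> U" "isum M Cs" "dec M = (\<Sum>C\<leftarrow>Cs. dec C)" using isum_exists[OF U] by blast
    have i: "mod_iso L M (dsum Cs)" using isum_dsum_iff[OF U M(1)] M(2) by blast
    have lm: "lm (dsum Cs)" by (rule dsum_lm) (use U in auto)
    have "mod_iso L (dsum Cs) K \<longleftrightarrow> mod_iso L M K" for K :: "('a, (nat \<Rightarrow> 'a) set list) module"
      using mod_iso_trans[OF i, of K] mod_iso_trans[OF mod_iso_sym[OF U_lm[OF M(1)] i], of K] by blast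
    then have "direct_summand L X (dsum Cs) \<longleftrightarrow> direct_summand L X M"
      unfolding direct_summand_def by simp
    then show ?thesis using direct_summand_iff[OF M(1)] M(3) by simp
  qed
  then show ?thesis unfolding add_cl_def by blast
qed


subsection \<open>The Igusa--Todorov group\<close>

definition frag_mset :: "'c multiset \<Rightarrow> ('c \<Rightarrow>\<^sub>0 int)" where "frag_mset m = (\<Sum>x\<in>#m. frag_of x)"

lemma frag_mset_simps [simp]: "frag_mset {#} = 0"
  "frag_mset (add_mset x m) = frag_of x + frag_mset m"
  "frag_mset (m + n) = frag_mset m + frag_mset n"
  by (simp_all add: frag_mset_def)

lemma lookup_frag_mset: "Poly_Mapping.lookup (frag_mset m) x = int (count m x)"
  by (induction m) (simp_all add: lookup_add lookup_single when_def)

lemma frag_mset_inject: "frag_mset m = frag_mset n \<Longrightarrow> m = n"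
  by (metis lookup_frag_mset multiset_eqI of_nat_eq_iff)

lemma keys_frag_mset: "Poly_Mapping.keys (frag_mset m) = set_mset m"
  by (auto simp: in_keys_iff lookup_frag_mset)

lemma IT_class_eq:
  assumes "X \<in> U"
  shows "IT_class L X = frag_mset (nonproj (dec X))"
proof -
  have sum: "(\<Sum>X\<leftarrow>Xs. if projective L X then 0 else frag_of (ic X)) = frag_mset (nonproj (mset (map ic Xs)))"
    if "\<forall>X\<in>set Xs. indecomposable L X" for Xs
    using that
  proof (induction Xs)
    case (Cons X Xs)
    then show ?case using ic_PC[of X] by (simp add: nonproj_def)
  qed simp
  obtain Xs where Xs: "\<And>X. X \<in> set Xs \<Longrightarrow> indecomposable L X" "isum X Xs" "dec X = mset (map ic Xs)"
    using dec_list[OF assms] by blast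
  show ?thesis
    unfolding IT_class_def
  proof (rule the_equality)
    have "set Xs \<subseteq> U" using Xs(1) indecomposable_U by blast
    then have "mod_iso L X (dsum Xs)" using isum_dsum_iff assms Xs(2) by blast
    then show "\<exists>Xs. (\<forall>X\<in>set Xs. indecomposable L X) \<and> mod_iso L X (dsum Xs) \<and>
       frag_mset (nonproj (dec X)) = (\<Sum>X\<leftarrow>Xs. if projective L X then 0 else frag_of (ic X))"
      using Xs(1,3) sum[of Xs] by (intro exI[of _ Xs]) simp
  next
    fix k assume "\<exists>Xs. (\<forall>X\<in>set Xs. indecomposable L X) \<and> mod_iso L X (dsum Xs) \<and>
       k = (\<Sum>X\<leftarrow>Xs. if projective L X then 0 else frag_of (ic X))"
    then obtain Ys where Ys: "\<forall>X\<in>set Ys. indecomposable L X" "mod_iso L X (dsum Ys)"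
      "k = (\<Sum>X\<leftarrow>Ys. if projective L X then 0 else frag_of (ic X))" by blast
    have "set Ys \<subseteq> U" using Ys(1) indecomposable_U by blast
    then have "isum X Ys" using isum_dsum_iff assms Ys(2) by blast
    then have "dec X = mset (map ic Ys)" using dec_eqI[OF assms] Ys(1) by blast
    then show "k = frag_mset (nonproj (dec X))" using sum[OF Ys(1)] Ys(3) by simp
  qed
qed

lemma IT_L_additive: "additive_map (IT_L L)"
  by (simp add: additive_map_def IT_L_def frag_extend_add)

lemma IT_Ln_additive: "additive_map (IT_L L ^^ n)"
  by (rule additive_map_funpow[OF IT_L_additive])

text \<open>\<open>IT_L\<close> takes syzygies of representatives chosen by \<open>SOME\<close>,
  with chosen projective covers. Modulo projective summands the result does not depend on these
  choices, so it agrees with any syzygy in the sense of \<open>syz\<close>.\<close>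

lemma IT_L_frag_mset: "obj m \<Longrightarrow> syz k m \<Longrightarrow> IT_L L (frag_mset (nonproj m)) = frag_mset (nonproj k)"
proof (induction m arbitrary: k)
  case empty
  then have "proj k" using syz_proj[of "{#}" k] by simp
  then have "nonproj k = {#}" using nonproj_proj by blast
  then show ?case using additive_mapD(2)[OF IT_L_additive] by simp
next
  case (add c m)
  have c: "c \<in> IC" and m: "obj m" using add.prems(1) by auto
  obtain k1 where k1: "syz k1 {#c#}" using syz_exists[of "{#c#}"] c by auto
  obtain k2 where k2: "syz k2 m" using syz_exists[OF m] by blast
  have "syz (k1 + k2) ({#c#} + m)" by (rule syz_add[OF k1 k2])
  then have k: "nonproj k = nonproj k1 + nonproj k2" using syz_nonproj[OF add.prems(2)] by simp
  show ?case
  proof (cases "c \<in> PC")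
    case True
    then have "proj k1" using syz_proj[OF _ k1] by simp
    then have "nonproj k1 = {#}" using nonproj_proj by blast
    moreover have "nonproj (add_mset c m) = nonproj m" using True by (simp add: nonproj_def)
    ultimately show ?thesis using add.IH[OF m k2] k by simp
  next
    case False
    obtain X where X: "indecomposable L X" "c = ic X" using c by (auto simp: IC_def)
    define Y where "Y = (SOME X. X \<in> c)"
    have "X \<in> c" using X indecomposable_U[OF X(1)] mod_iso_refl by (auto simp: isoclass_def)
    then have "Y \<in> c" unfolding Y_def by (rule someI)
    then have Y: "Y \<in> U" "mod_iso L X Y" using X(2) by (auto simp: isoclass_def)
    have "dec Y = {#c#}" using dec_iso[OF indecomposable_U[OF X(1)] Y] dec_indecomposable[OF X(1)] X(2) by simp
    then have "nonproj (dec (syzygy L Y)) = nonproj k1" using syz_nonproj[OF _ k1] syz_syzygy[OF Y(1)] by simp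
    then have "IT_L L (frag_of c) = frag_mset (nonproj k1)"
      using IT_class_eq[OF syzygy_U[OF Y(1)]] by (simp add: IT_L_def Y_def)
    moreover have "nonproj (add_mset c m) = add_mset c (nonproj m)" using False by (simp add: nonproj_def)
    ultimately show ?thesis
      using add.IH[OF m k2] k by (simp add: additive_mapD(1)[OF IT_L_additive])
  qed
qed

lemma IT_Ln_frag_mset: "syzn n k m \<Longrightarrow> (IT_L L ^^ n) (frag_mset (nonproj m)) = frag_mset (nonproj k)"
proof (induction n arbitrary: k)
  case (Suc n)
  then obtain l where l: "syzn n l m" "syz k l" by auto
  have "obj l" using syz_obj[OF l(2)] by blast
  then show ?case using Suc.IH[OF l(1)] IT_L_frag_mset[OF _ l(2)] by simp
qed simp

text \<open>Being generated by part of a basis, the subgroup consists of the elements supported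
  there, and membership becomes a condition on keys.\<close>

lemma IT_span_eq:
  assumes "X \<in> U"
  shows "IT_span L X = {x. Poly_Mapping.keys x \<subseteq> set_mset (nonproj (dec X))}"
proof -
  let ?C = "set_mset (nonproj (dec X))" and ?I = "ic ` nonproj_indec L"
  have gens: "{frag_of (ic Z) | Z. Z \<in> nonproj_indec L \<and> direct_summand L Z X} = frag_of ` ?C"
  proof (intro subset_antisym subsetI)
    fix x assume "x \<in> {frag_of (ic Z) | Z. Z \<in> nonproj_indec L \<and> direct_summand L Z X}"
    then obtain Z where Z: "x = frag_of (ic Z)" "indecomposable L Z" "\<not> projective L Z" "direct_summand L Z X"
      by (auto simp: nonproj_indec_def)
    have "ic Z \<in># dec X"
      using direct_summand_iff[OF assms, of Z] Z(4) dec_indecomposable[OF Z(2)] by simp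
    then show "x \<in> frag_of ` ?C" using Z(1,3) ic_PC[OF Z(2)] by (simp add: nonproj_def)
  next
    fix x assume "x \<in> frag_of ` ?C"
    then obtain c where c: "x = frag_of c" "c \<in># dec X" "c \<notin> PC" by (auto simp: nonproj_def)
    obtain Z N where Z: "indecomposable L Z" "c = ic Z" by (rule dec_member[OF assms c(2)])
    have "direct_summand L Z X"
      using direct_summand_iff[OF assms, of Z] indecomposable_U[OF Z(1)] dec_indecomposable[OF Z(1)] Z(2) c(2)
      by simp
    then show "x \<in> {frag_of (ic Z) | Z. Z \<in> nonproj_indec L \<and> direct_summand L Z X}"
      using Z c ic_PC[OF Z(1)] by (auto simp: nonproj_indec_def)
  qed
  have CI: "?C \<subseteq> ?I"
  proof
    fix c assume "c \<in> ?C"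
    then have c: "c \<in># dec X" "c \<notin> PC" by (auto simp: nonproj_def)
    obtain Z N where Z: "indecomposable L Z" "c = ic Z" by (rule dec_member[OF assms c(1)])
    then show "c \<in> ?I" using c(2) ic_PC[OF Z(1)] by (auto simp: nonproj_indec_def)
  qed
  show ?thesis
    unfolding IT_span_def gens IT_group_def
  proof (intro subset_antisym subsetI)
    fix x assume "x \<in> generate (free_Abelian_group ?I) (frag_of ` ?C)"
    then show "x \<in> {x. Poly_Mapping.keys x \<subseteq> ?C}"
    proof (induction rule: generate.induct)
      case (inv h)
      then have "Poly_Mapping.keys h \<subseteq> ?C" by auto
      then show ?case using CI by (subst inv_free_Abelian_group) auto
    next
      case (eng h1 h2)
      then show ?case using keys_add[of h1 h2] by auto
    qed auto
  next
    fix x :: "'a fgmod set \<Rightarrow>\<^sub>0 int" assume "x \<in> {x. Poly_Mapping.keys x \<subseteq> ?C}"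
    then have x: "Poly_Mapping.keys x \<subseteq> ?C" by simp
    show "x \<in> generate (free_Abelian_group ?I) (frag_of ` ?C)"
      using x
    proof (induction rule: frag_induction)
      case zero
      show ?case using generate.one[of "free_Abelian_group ?I"] by simp
    next
      case (one c)
      then show ?case by (intro generate.incl) auto
    next
      case (diff a b)
      have "generate (free_Abelian_group ?I) (frag_of ` ?C) \<subseteq> carrier (free_Abelian_group ?I)"
        using CI by (intro group.generate_incl) auto
      then have "b \<in> carrier (free_Abelian_group ?I)" using diff(2) by blast
      then have bI: "Poly_Mapping.keys b \<subseteq> ?I" by (simp only: carrier_free_Abelian_group_iff)
      have "inv\<^bsub>free_Abelian_group ?I\<^esub> b \<in> generate (free_Abelian_group ?I) (frag_of ` ?C)"
        using CI diff by (intro group.generate_m_inv_closed) auto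
      moreover have "inv\<^bsub>free_Abelian_group ?I\<^esub> b = - b"
        by (rule inv_free_Abelian_group[OF bI])
      ultimately show ?case using generate.eng[OF diff(1), of "- b"] by simp
    qed
  qed
qed

abbreviation cls :: "'a fgmod \<Rightarrow> ('a fgmod set \<Rightarrow>\<^sub>0 int)" where "cls X \<equiv> frag_mset (nonproj (dec X))"

lemma keys_diff_subset: "Poly_Mapping.keys (x - y) \<subseteq> Poly_Mapping.keys x \<union> Poly_Mapping.keys y"
  by (auto simp: in_keys_iff lookup_minus)

text \<open>From \<open>IT_Phi L X\<close> on the ranks are constant, so by
  \<open>int_rank_kernel\<close> no nonzero element of the images of the span is killed by
  \<open>IT_L\<close>. What some power kills is therefore killed by the \<open>q\<close>-th power
  already.\<close>

lemma Phi_kernel: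
  assumes X: "X \<in> U" and h: "h \<in> IT_span L X" and m: "(IT_L L ^^ m) h = 0" and q: "IT_Phi L X \<le> q"
  shows "(IT_L L ^^ q) h = 0"
proof -
  let ?L = "IT_L L" and ?H = "IT_span L X"
  let ?r = "\<lambda>k. int_rank ((?L ^^ k) ` ?H)"
  have image: "(?L ^^ Suc k) ` ?H = ?L ` (?L ^^ k) ` ?H" for k by (simp add: image_image)
  have fin: "?r k \<le> enat (card (set_mset (nonproj (dec X))))" for k
  proof (rule order_trans[OF int_rank_image_le[OF IT_Ln_additive]])
    show "int_rank ?H \<le> enat (card (set_mset (nonproj (dec X))))"
      by (rule int_rank_keys_le) (simp_all add: IT_span_eq[OF X])
  qed
  have "?r (Suc k) \<le> ?r k" for k unfolding image by (rule int_rank_image_le[OF IT_L_additive])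
  \<comment> \<open>The ranks decrease, so a stable exponent exists and the \<open>LEAST\<close> in
    \<open>IT_Phi\<close> is attained.\<close>
  then obtain n where n: "\<forall>k\<ge>n. ?r k = ?r n" using enat_decseq_eventually_constant[of ?r] by blast
  have "\<forall>k\<ge>n. ?r k = ?r (k + 1)"
  proof (intro allI impI)
    fix k assume "n \<le> k"
    then show "?r k = ?r (k + 1)" using n[rule_format, of k] n[rule_format, of "k + 1"] by simp
  qed
  then have Phi: "\<forall>k\<ge>IT_Phi L X. ?r k = ?r (k + 1)" unfolding IT_Phi_def by (rule LeastI)
  have step: "(?L ^^ k) h = 0" if k: "IT_Phi L X \<le> k" "(?L ^^ Suc k) h = 0" for k
  proof (rule int_rank_kernel[OF IT_L_additive, of "(?L ^^ k) ` ?H"])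
    show "?r k < \<infinity>" using fin[of k] by (rule order.strict_trans1) simp
    show "int_rank (?L ` (?L ^^ k) ` ?H) = ?r k" using Phi k(1) image[of k] by simp
  qed (use h k(2) in auto)
  show ?thesis
  proof (cases "m \<le> q")
    case True
    then obtain i where "q = i + m" by (metis add.commute le_Suc_ex)
    then show ?thesis using m additive_mapD(2)[OF IT_Ln_additive] by (simp add: funpow_add)
  next
    case False
    then have "q \<le> m" by simp
    then show ?thesis
      by (induction q rule: inc_induct) (use m q step in \<open>auto dest: Suc_leD\<close>)
  qed
qed

lemma eventually_zero:
  assumes "sesm a b c" "pdim_le n c"
  shows "(IT_L L ^^ n) (frag_mset (nonproj a) - frag_mset (nonproj b)) = 0"
proof -
  have obj: "obj a" "obj b" using ses_closed[OF assms(1)] by auto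
  obtain a' where a': "syzn n a' a" using syzn_exists[OF obj(1)] by blast
  obtain b' where b': "syzn n b' b" using syzn_exists[OF obj(2)] by blast
  have "nonproj a' = nonproj b'" by (rule syzygies_eventually_equal[OF assms a' b'])
  then show ?thesis using IT_Ln_frag_mset[OF a'] IT_Ln_frag_mset[OF b'] by (simp add: additive_mapD(4)[OF IT_Ln_additive])
qed

lemma nonproj_eq_of_zero:
  assumes "(IT_L L ^^ q) (frag_mset (nonproj a) - frag_mset (nonproj b)) = 0" "syzn q a1 a" "syzn q b1 b"
  shows "nonproj a1 = nonproj b1"
proof -
  have "frag_mset (nonproj a1) - frag_mset (nonproj b1) = 0"
    using assms(1) IT_Ln_frag_mset[OF assms(2)] IT_Ln_frag_mset[OF assms(3)] by (simp add: additive_mapD(4)[OF IT_Ln_additive])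
  then show ?thesis using frag_mset_inject[of "nonproj a1" "nonproj b1"] by simp
qed

subsection \<open>Uniform bounds\<close>

text \<open>The direct sum \<open>X\<close> of kernel and middle term lies in \<E>. The difference
  of their classes lies in its span, so \<open>IT_Phi L X\<close> is a valid exponent; and the
  summands of the syzygy of \<open>E1\<close> are summands of that of \<open>X\<close>, whose finite
  dimensions are bounded by the second part of \<open>IT_Psi L X\<close>.\<close>

lemma bounded_of_Psi_dim:
  assumes E: "module_class L \<E>" "closed_under_sums L \<E>" "Psi_dim L \<E> < \<infinity>"
    and ex: "\<forall>C\<in>P_fin L U. \<exists>E0\<in>\<E>. \<exists>E1\<in>\<E>. \<exists>f g. short_exact L E1 f E0 g ((syzygy L ^^ m) C)"
  shows "\<exists>N. \<forall>C\<in>P_fin L U. pdim_le N (dec C)"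
proof -
  obtain s where s: "Psi_dim L \<E> = enat s" using E(3) by auto
  have EU: "\<E> \<subseteq> U" using E(1) by (simp add: module_class_def)
  \<comment> \<open>The terms are the shift \<open>m\<close>, at most \<open>s\<close> for
    \<open>IT_Phi L X\<close>, another \<open>s\<close> for the summands, and 1 from
    \<open>igusa_todorov_bound\<close>.\<close>
  have "pdim_le (m + (s + s + 1)) (dec C)" if C: "C \<in> P_fin L U" for C
  proof -
    have CU: "C \<in> U" using C by (simp add: P_fin_def)
    obtain n where n: "pdim_le n (dec C)" using C pd_finite_iff[OF CU] by (auto simp: P_fin_def)
    let ?C = "(syzygy L ^^ m) C"
    have C': "?C \<in> U" "syzn m (dec ?C) (dec C)" using syzygy_funpow[OF CU] by auto
    have n': "pdim_le n (dec ?C)" using pdim_le_syzn[OF C'(2), of n] pdim_le_mono[OF _ n, of "m + n"] by simp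
    obtain E0 E1 f g where se: "E0 \<in> \<E>" "E1 \<in> \<E>" "short_exact L E1 f E0 g ?C" using ex C by blast
    have U: "E0 \<in> U" "E1 \<in> U" using se EU by auto
    have ses: "sesm (dec E1) (dec E0) (dec ?C)" by (rule short_exact_sesm[OF U(2,1) C'(1) se(3)])
    obtain X where X: "X \<in> U" "bsum X E1 E0" using bsum_exists[OF U(2,1)] .
    have "mod_iso L X (dsum [E1, E0])"
      using bsum_dsum_iff[OF U_lm[OF X(1)] U_lm[OF U(2)] U_lm[OF U(1)]] X(2) by blast
    then have XE: "X \<in> \<E>" using E(2) se X(1) unfolding closed_under_sums_def by blast
    have decX: "dec X = dec E1 + dec E0" by (rule dec_bsum[OF X(1) U(2,1) X(2)])
    let ?q = "IT_Phi L X"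
    have Psi: "IT_Psi L X \<le> enat s" unfolding s[symmetric] Psi_dim_def by (rule SUP_upper[OF XE])
    have qs: "?q \<le> s"
      using Psi unfolding IT_Psi_def by (cases "fin_dim L (add_cl L {(syzygy L ^^ ?q) X})") simp_all
    have fd: "fin_dim L (add_cl L {(syzygy L ^^ ?q) X}) \<le> enat s"
      using Psi unfolding IT_Psi_def by (cases "fin_dim L (add_cl L {(syzygy L ^^ ?q) X})") simp_all
    have "Poly_Mapping.keys (cls E1 - cls E0) \<subseteq> set_mset (nonproj (dec X))"
      using keys_diff_subset[of "cls E1" "cls E0"] unfolding decX keys_frag_mset by simp
    then have "cls E1 - cls E0 \<in> IT_span L X" using IT_span_eq[OF X(1)] by simp
    then have z: "(IT_L L ^^ ?q) (cls E1 - cls E0) = 0"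
      by (rule Phi_kernel[OF X(1) _ eventually_zero[OF ses n'] order_refl])
    have a1: "syzn ?q (dec ((syzygy L ^^ ?q) E1)) (dec E1)" and b1: "syzn ?q (dec ((syzygy L ^^ ?q) E0)) (dec E0)"
      using syzygy_funpow[OF U(2)] syzygy_funpow[OF U(1)] by auto
    have X1: "(syzygy L ^^ ?q) X \<in> U" "syzn ?q (dec ((syzygy L ^^ ?q) X)) (dec X)"
      using syzygy_funpow[OF X(1)] by auto
    have "pdim_le (?q + s + 1) (dec ?C)"
    proof (rule igusa_todorov_bound[OF ses a1 b1 nonproj_eq_of_zero[OF z a1 b1] n'])
      fix x k assume x: "x \<in># nonproj (dec ((syzygy L ^^ ?q) E1))" and k: "pdim_le k {#x#}"
      have "nonproj (dec ((syzygy L ^^ ?q) X)) =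
          nonproj (dec ((syzygy L ^^ ?q) E1) + dec ((syzygy L ^^ ?q) E0))"
        using syzn_nonproj[OF X1(2) syzn_add[OF a1 b1]] decX by simp
      then have "x \<in># nonproj (dec ((syzygy L ^^ ?q) X))" using x by simp
      then have xX: "x \<in># dec ((syzygy L ^^ ?q) X)" by (simp add: nonproj_def)
      obtain T N where T: "indecomposable L T" "x = ic T" by (rule dec_member[OF X1(1) xX])
      note TU = indecomposable_U[OF T(1)]
      have dT: "dec T = {#x#}" using dec_indecomposable[OF T(1)] T(2) by simp
      have "T \<in> add_cl L {(syzygy L ^^ ?q) X}"
        using add_cl_iff[of "{(syzygy L ^^ ?q) X}" T] X1(1) TU dT xX
        by (simp add: exI[of _ "[(syzygy L ^^ ?q) X]"])
      then show "pdim_le s {#x#}" using fin_dim_pdim_le[OF fd _ TU, of k] dT k by simp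
    qed
    then have "pdim_le (m + (?q + s + 1)) (dec C)" using pdim_le_syzn[OF C'(2)] by blast
    then show ?thesis by (rule pdim_le_mono[rotated]) (use qs in simp)
  qed
  then show ?thesis by blast
qed


text \<open>The differences of classes of modules in an additive class form a group; the subgroups
  \<open>W m\<close> of the finitely generated group of \<open>V\<close> that \<open>L\<^sup>m\<close> maps into the image of this group
  increase with \<open>m\<close>, so their ranks stabilise, which yields an exponent independent of the sequence.\<close>

lemma bounded_of_GLIT:
  assumes "GLIT_class L 0 (P_fin L U)"
  shows "\<exists>N. \<forall>C\<in>P_fin L U. pdim_le N (dec C)"
proof -
  let ?L = "IT_L L"
  note Ladd = additive_mapD[OF IT_Ln_additive]
  obtain t V \<D> where t: "t \<ge> 1" and V: "V \<in> U" and D: "module_class L \<D>" "add_cl L \<D> = \<D>"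
      "syzygies L t \<D> \<subseteq> \<D>" "Phi_dim L \<D> < \<infinity>"
    and ex: "\<And>C. C \<in> P_fin L U \<Longrightarrow> \<exists>V0\<in>add_cl L {V}. \<exists>V1\<in>add_cl L {V}. \<exists>D0\<in>\<D>. \<exists>D1\<in>\<D>. \<exists>f g.
        short_exact L (dsum [V1, D1]) f (dsum [V0, D0]) g ((syzygy L ^^ 0) C)"
    using assms unfolding GLIT_class_def by metis
  have DU: "\<D> \<subseteq> U" using D(1) by (simp add: module_class_def)
  obtain d where d: "Phi_dim L \<D> = enat d" using D(4) by auto
  have Phi: "IT_Phi L X \<le> d" if "X \<in> \<D>" for X
  proof -
    have "enat (IT_Phi L X) \<le> Phi_dim L \<D>" unfolding Phi_dim_def by (rule SUP_upper[OF that])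
    then show ?thesis using d by simp
  qed
  have D_sub: "X \<in> \<D>" if "X \<in> U" "set Cs \<subseteq> \<D>" "dec X \<subseteq># (\<Sum>C\<leftarrow>Cs. dec C)" for X Cs
    using add_cl_iff[OF DU, of X] D(2) that by blast
  have D_sum: "\<exists>Z\<in>\<D>. dec Z = dec A + dec B" if AB: "A \<in> \<D>" "B \<in> \<D>" for A B
  proof -
    have U: "A \<in> U" "B \<in> U" using AB DU by auto
    obtain Z where Z: "Z \<in> U" "bsum Z A B" using bsum_exists[OF U] .
    have dZ: "dec Z = dec A + dec B" by (rule dec_bsum[OF Z(1) U Z(2)])
    have "Z \<in> \<D>" by (rule D_sub[OF Z(1), of "[A, B]"]) (use AB dZ in auto)
    then show ?thesis using dZ by blast
  qed
  have D_zero: "\<exists>Z\<in>\<D>. dec Z = {#}"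
  proof -
    obtain Z where Z: "Z \<in> U" "zero_mod Z" by (rule zero_exists)
    have "Z \<in> \<D>" by (rule D_sub[OF Z(1), of "[]"]) (use dec_zero[OF Z] in auto)
    then show ?thesis using dec_zero[OF Z] by blast
  qed
  have D_syz: "(syzygy L ^^ (t * j)) X \<in> \<D>" if X: "X \<in> \<D>" for X j
  proof (induction j)
    case 0
    then show ?case using X by simp
  next
    case (Suc j)
    let ?Y = "(syzygy L ^^ (t * j)) X"
    have YU: "?Y \<in> U" using Suc DU by blast
    have "(syzygy L ^^ t) ?Y \<in> syzygies L t \<D>"
      unfolding syzygies_def using syzygy_funpow[OF YU, of t] Suc mod_iso_refl by blast
    then have "(syzygy L ^^ t) ?Y \<in> \<D>" using D(3) by blast
    then show ?case by (simp add: funpow_add)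
  qed
  define S where "S = {cls D1 - cls D0 | D0 D1. D0 \<in> \<D> \<and> D1 \<in> \<D>}"
  have S_diff: "x - y \<in> S" if xy: "x \<in> S" "y \<in> S" for x y
  proof -
    obtain D0 D1 E0 E1 where DE: "D0 \<in> \<D>" "D1 \<in> \<D>" "E0 \<in> \<D>" "E1 \<in> \<D>"
      "x = cls D1 - cls D0" "y = cls E1 - cls E0" using xy unfolding S_def by blast
    obtain F1 where F1: "F1 \<in> \<D>" "dec F1 = dec D1 + dec E0" using D_sum DE by blast
    obtain F0 where F0: "F0 \<in> \<D>" "dec F0 = dec D0 + dec E1" using D_sum DE by blast
    have "x - y = cls F1 - cls F0" using DE(5,6) F1(2) F0(2) by simp
    then show ?thesis using F1(1) F0(1) unfolding S_def by blast
  qed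
  have S_0: "0 \<in> S"
  proof -
    obtain Z where "Z \<in> \<D>" using D_zero by blast
    then show ?thesis unfolding S_def by (intro CollectI exI[of _ Z]) simp
  qed
  \<comment> \<open>The two modules of a difference are summands of one module in \<D>, whose
    \<open>IT_Phi\<close> is at most \<open>d\<close>. So one exponent serves all of
    \<open>S\<close>, although \<open>S\<close> may have infinite rank.\<close>
  have S_kernel: "(?L ^^ q) x = 0" if x: "x \<in> S" and m: "(?L ^^ m) x = 0" and q: "d \<le> q" for x m q
  proof -
    obtain D0 D1 where DD: "D0 \<in> \<D>" "D1 \<in> \<D>" "x = cls D1 - cls D0" using x unfolding S_def by blast
    obtain X where X: "X \<in> \<D>" "dec X = dec D0 + dec D1" using D_sum[OF DD(1,2)] by blast
    have XU: "X \<in> U" using X(1) DU by blast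
    have "Poly_Mapping.keys x \<subseteq> set_mset (nonproj (dec X))"
      using keys_diff_subset[of "cls D1" "cls D0"] unfolding DD(3) X(2) keys_frag_mset by auto
    then have "x \<in> IT_span L X" using IT_span_eq[OF XU] by simp
    then show ?thesis by (rule Phi_kernel[OF XU _ m]) (use Phi[OF X(1)] q in simp)
  qed
  define W where "W m = {v. Poly_Mapping.keys v \<subseteq> set_mset (nonproj (dec V)) \<and> (\<exists>x\<in>S. (?L ^^ m) v = (?L ^^ m) x)}" for m
  have W_mono: "W m \<subseteq> W (Suc m)" for m by (auto simp: W_def)
  have W_mono': "W m \<subseteq> W n" if "m \<le> n" for m n
    using that by (induction n rule: dec_induct) (use W_mono in blast)+
  have W_0: "0 \<in> W m" for m using S_0 by (auto simp: W_def)
  have W_diff: "v - w \<in> W m" if vw: "v \<in> W m" "w \<in> W m" for v w m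
  proof -
    obtain x y where xy: "x \<in> S" "y \<in> S" "(?L ^^ m) v = (?L ^^ m) x" "(?L ^^ m) w = (?L ^^ m) y"
      using vw unfolding W_def by blast
    have "(?L ^^ m) (v - w) = (?L ^^ m) (x - y)" using xy(3,4) by (simp add: Ladd(4))
    moreover have "Poly_Mapping.keys (v - w) \<subseteq> set_mset (nonproj (dec V))"
      using keys_diff_subset[of v w] vw unfolding W_def by blast
    ultimately show ?thesis using S_diff[OF xy(1,2)] unfolding W_def by blast
  qed
  have group: "frag_cmul k x \<in> G \<and> (\<forall>g\<in>G. x + g \<in> G)"
    if G: "0 \<in> G" "\<And>x y. x \<in> G \<Longrightarrow> y \<in> G \<Longrightarrow> x - y \<in> G" "x \<in> G"
    for k and x :: "'a fgmod set \<Rightarrow>\<^sub>0 int" and G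
  proof -
    have neg: "- y \<in> G" if "y \<in> G" for y using G(2)[OF G(1) that] by simp
    have add: "y + z \<in> G" if "y \<in> G" "z \<in> G" for y z using G(2)[OF that(1) neg[OF that(2)]] by simp
    have nat: "frag_cmul (int n) x \<in> G" for n
      by (induction n) (use G(1) add[OF G(3)] in \<open>simp_all add: frag_cmul_distrib\<close>)
    have "frag_cmul k x \<in> G"
    proof (cases k rule: int_cases2)
      case (nonneg n)
      then show ?thesis using nat by simp
    next
      case (nonpos n)
      then show ?thesis using neg[OF nat[of n]] by simp
    qed
    then show ?thesis using add[OF G(3)] by blast
  qed
  have W_sum: "(\<Sum>b\<in>B. frag_cmul (c b) b) \<in> W m" if "finite B" "B \<subseteq> W m" for B c m
    using that
  proof (induction B)
    case empty
    then show ?case using W_0 by simp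
  next
    case (insert b B)
    have "frag_cmul (c b) b \<in> W m" using group[OF W_0 W_diff, of m b "c b"] insert.prems by simp
    then have "frag_cmul (c b) b + (\<Sum>b\<in>B. frag_cmul (c b) b) \<in> W m"
      using group[OF W_0 W_diff, of m "frag_cmul (c b) b"] insert.IH insert.prems by simp
    then show ?case using insert.hyps by simp
  qed
  have W_rank: "int_rank (W m) \<le> enat (card (set_mset (nonproj (dec V))))" for m
    by (rule int_rank_keys_le) (auto simp: W_def)
  define r where "r m = the_enat (int_rank (W m))" for m
  have r: "int_rank (W m) = enat (r m)" for m
    using W_rank[of m] unfolding r_def by (cases "int_rank (W m)") auto
  have r_le: "r m < Suc (card (set_mset (nonproj (dec V))))" for m using W_rank[of m] unfolding r by simp
  \<comment> \<open>The ranks are bounded by the number of nonprojective isoclasses in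
    \<open>dec V\<close>, so a largest one exists. A maximal independent subset \<open>B\<close> of
    \<open>W m0\<close> is then maximal independent in every later \<open>W n\<close>.\<close>
  obtain m0 where m0: "\<And>m. r m \<le> r m0"
    using ex_has_greatest_nat[of "\<lambda>_. True" 0 r "Suc (card (set_mset (nonproj (dec V))))"] r_le by auto
  obtain B where B: "finite B" "B \<subseteq> W m0" "int_independent B" "int_rank (W m0) = enat (card B)"
    using int_rank_attained[of "W m0"] r[of m0] by auto
  \<comment> \<open>Equality of ranks places \<open>v\<close> in \<open>W m0\<close> only after
    multiplication by a nonzero integer.\<close>
  have stab: "\<exists>k. k \<noteq> 0 \<and> frag_cmul k v \<in> W m0" if v: "v \<in> W m" for v m
  proof (cases "v \<in> B")
    case True
    then show ?thesis using B(2) by (intro exI[of _ 1]) auto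
  next
    case False
    let ?n = "max m m0"
    have sub: "W m \<subseteq> W ?n" "W m0 \<subseteq> W ?n" by (intro W_mono'; simp)+
    have "r m0 \<le> r ?n" using int_rank_mono[OF sub(2)] unfolding r by simp
    then have rk: "int_rank (W ?n) = enat (card B)" using m0[of ?n] B(4) r[of m0] r[of ?n] by simp
    obtain k c where k: "k \<noteq> 0" "frag_cmul k v = (\<Sum>b\<in>B. frag_cmul (c b) b)"
      using rank_dependent[OF _ B(1,3) rk _ False] B(2) sub v by blast
    then show ?thesis using W_sum[OF B(1,2), of c] by auto
  qed
  \<comment> \<open>A multiple of \<open>t\<close>, so that \<open>q\<close>-th syzygies of modules
    in \<D> stay in \<D>; at least \<open>m0\<close> for the relations in \<open>W m0\<close>, and
    at least \<open>d\<close> for \<open>S_kernel\<close>.\<close>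
  define q where "q = t * (m0 + d)"
  have "m0 + d \<le> q" unfolding q_def using t by simp
  then have q: "m0 \<le> q" "d \<le> q" by auto
  let ?Vq = "(syzygy L ^^ q) V"
  have Vq: "?Vq \<in> U" "syzn q (dec ?Vq) (dec V)" using syzygy_funpow[OF V] by auto
  \<comment> \<open>The \<open>q\<close>-th syzygy of \<open>V\<close> has finitely many
    indecomposable summands up to isomorphism; \<open>s\<close> will bound the dimensions of those
    where it is finite.\<close>
  have "\<exists>s. \<forall>x\<in>M. \<forall>n. pdim_le n {#x#} \<longrightarrow> pdim_le s {#x#}" if "finite M" for M
    using that
  proof (induction M)
    case (insert x M)
    then obtain s where s: "\<forall>x\<in>M. \<forall>n. pdim_le n {#x#} \<longrightarrow> pdim_le s {#x#}" by blast
    show ?case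
    proof (cases "\<exists>n. pdim_le n {#x#}")
      case True
      then obtain n where n: "pdim_le n {#x#}" by blast
      have "pdim_le (s + n) {#x#}" using n by (rule pdim_le_mono[rotated]) simp
      moreover have "pdim_le (s + n) {#y#}" if "y \<in> M" "pdim_le k {#y#}" for y k
        by (rule pdim_le_mono[of s]) (use s that in auto)
      ultimately show ?thesis by (intro exI[of _ "s + n"]) blast
    next
      case False
      then show ?thesis using s by (intro exI[of _ s]) blast
    qed
  qed simp
  then obtain s where s: "\<And>x n. x \<in># nonproj (dec ?Vq) \<Longrightarrow> pdim_le n {#x#} \<Longrightarrow> pdim_le s {#x#}"
    using finite_set_mset by metis
  \<comment> \<open>Membership in \<open>add V\<close> bounds the support of a multiset but not its
    multiplicities. The support is enough, since \<open>s\<close> bounds single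
    indecomposables.\<close>
  have addV: "X \<in> U \<and> set_mset (nonproj (dec X)) \<subseteq> set_mset (nonproj (dec V)) \<and>
      (\<forall>k. syzn q k (dec X) \<longrightarrow> set_mset (nonproj k) \<subseteq> set_mset (nonproj (dec ?Vq)))"
    if X: "X \<in> add_cl L {V}" for X
  proof -
    obtain Cs where Cs: "X \<in> U" "set Cs \<subseteq> {V}" "dec X \<subseteq># (\<Sum>C\<leftarrow>Cs. dec C)"
      using X add_cl_iff[of "{V}" X] V by auto
    have 1: "set_mset (\<Sum>C\<leftarrow>Cs. dec C) \<subseteq> set_mset (dec V) \<and>
        (\<exists>w. syzn q w (\<Sum>C\<leftarrow>Cs. dec C) \<and> set_mset (nonproj w) \<subseteq> set_mset (nonproj (dec ?Vq)))"
      using Cs(2)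
    proof (induction Cs)
      case Nil
      obtain w where w: "syzn q w {#}" using syzn_exists[of "{#}" q] by auto
      have "pdim_le (q + 0) {#}" by (rule pdim_le_proj) simp
      then have "proj w" using pdim_le_syzn[OF w, of 0] by simp
      then have "nonproj w = {#}" using nonproj_proj by blast
      then show ?case using w by auto
    next
      case (Cons C Cs)
      then obtain w where w: "set_mset (\<Sum>C\<leftarrow>Cs. dec C) \<subseteq> set_mset (dec V)"
        "syzn q w (\<Sum>C\<leftarrow>Cs. dec C)" "set_mset (nonproj w) \<subseteq> set_mset (nonproj (dec ?Vq))" by auto
      have "C = V" using Cons.prems by simp
      then have "syzn q (dec ?Vq + w) (\<Sum>C\<leftarrow>(C # Cs). dec C)" using syzn_add[OF Vq(2) w(2)] by simp
      moreover have "set_mset (nonproj (dec ?Vq + w)) \<subseteq> set_mset (nonproj (dec ?Vq))" using w(3) by simp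
      moreover have "set_mset (\<Sum>C\<leftarrow>(C # Cs). dec C) \<subseteq> set_mset (dec V)" using w(1) \<open>C = V\<close> by simp
      ultimately show ?case by blast
    qed
    then obtain w where w: "syzn q w (\<Sum>C\<leftarrow>Cs. dec C)" "set_mset (nonproj w) \<subseteq> set_mset (nonproj (dec ?Vq))" by blast
    have "set_mset (dec X) \<subseteq> set_mset (dec V)" using 1 set_mset_mono[OF Cs(3)] by blast
    then have 2: "set_mset (nonproj (dec X)) \<subseteq> set_mset (nonproj (dec V))" by (auto simp: nonproj_def)
    have "set_mset (nonproj k) \<subseteq> set_mset (nonproj (dec ?Vq))" if k: "syzn q k (dec X)" for k
    proof -
      obtain u where u: "(\<Sum>C\<leftarrow>Cs. dec C) = dec X + u" using Cs(3) by (auto simp: mset_subset_eq_exists_conv)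
      have "obj u" using syzn_obj[OF w(1)] unfolding u by simp
      then obtain l where l: "syzn q l u" using syzn_exists by blast
      have "nonproj w = nonproj k + nonproj l" using syzn_nonproj[OF w(1)] syzn_add[OF k l] u by simp
      then show ?thesis using w(2) by simp
    qed
    then show ?thesis using Cs(1) 2 by blast
  qed
  have "pdim_le (q + max s d + 1) (dec C)" if C: "C \<in> P_fin L U" for C
  proof -
    have CU: "C \<in> U" using C by (simp add: P_fin_def)
    obtain n where n: "pdim_le n (dec C)" using C pd_finite_iff[OF CU] by (auto simp: P_fin_def)
    obtain V0 V1 D0 D1 f g where se: "V0 \<in> add_cl L {V}" "V1 \<in> add_cl L {V}" "D0 \<in> \<D>" "D1 \<in> \<D>"
      "short_exact L (dsum [V1, D1]) f (dsum [V0, D0]) g C"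
      using ex[OF C] by auto
    note v0 = addV[OF se(1)] and v1 = addV[OF se(2)]
    have U: "V0 \<in> U" "V1 \<in> U" "D0 \<in> U" "D1 \<in> U" using v0 v1 se(3,4) DU by auto
    obtain A where A: "A \<in> U" "bsum A V1 D1" using bsum_exists[OF U(2,4)] .
    obtain B where B': "B \<in> U" "bsum B V0 D0" using bsum_exists[OF U(1,3)] .
    have lm: "lm (dsum [V1, D1])" "lm (dsum [V0, D0])" by (rule dsum_lm; use U in auto)+
    have isoA: "mod_iso L A (dsum [V1, D1])"
      using bsum_dsum_iff[OF U_lm[OF A(1)] U_lm[OF U(2)] U_lm[OF U(4)]] A(2) by blast
    have isoB: "mod_iso L B (dsum [V0, D0])"
      using bsum_dsum_iff[OF U_lm[OF B'(1)] U_lm[OF U(1)] U_lm[OF U(3)]] B'(2) by blast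
    obtain f' g' where se': "short_exact L A f' B g' C"
      using short_exact_iso[OF lm U_lm[OF CU] U_lm[OF A(1)] U_lm[OF B'(1)] U_lm[OF CU]
          mod_iso_sym[OF U_lm[OF A(1)] isoA] mod_iso_sym[OF U_lm[OF B'(1)] isoB] mod_iso_refl se(5)] by blast
    have decA: "dec A = dec V1 + dec D1" by (rule dec_bsum[OF A(1) U(2,4) A(2)])
    have decB: "dec B = dec V0 + dec D0" by (rule dec_bsum[OF B'(1) U(1,3) B'(2)])
    have ses: "sesm (dec A) (dec B) (dec C)" by (rule short_exact_sesm[OF A(1) B'(1) CU se'])
    define v where "v = cls V1 - cls V0"
    define x where "x = cls D1 - cls D0"
    have vx: "frag_mset (nonproj (dec A)) - frag_mset (nonproj (dec B)) = v + x" unfolding decA decB v_def x_def by simp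
    have zero: "(?L ^^ n) (v + x) = 0" using eventually_zero[OF ses n] unfolding vx .
    have xS: "x \<in> S" "- x \<in> S"
    proof -
      show "x \<in> S" unfolding S_def x_def using se(3,4) by blast
      then show "- x \<in> S" using S_diff[OF S_0] by fastforce
    qed
    \<comment> \<open>Finite dimension of \<open>C\<close> kills \<open>v + x\<close> at a power
      \<open>n\<close> that varies with \<open>C\<close>. This puts \<open>v\<close> into
      \<open>W n\<close>, and \<open>stab\<close> then removes the dependence on
      \<open>n\<close>.\<close>
    have "(?L ^^ n) v = (?L ^^ n) (- x)"
      using zero by (simp add: Ladd(1,3) eq_neg_iff_add_eq_0)
    moreover have "Poly_Mapping.keys v \<subseteq> set_mset (nonproj (dec V))"
      using keys_diff_subset[of "cls V1" "cls V0"] v0 v1 unfolding v_def keys_frag_mset by blast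
    ultimately have "v \<in> W n" using xS(2) unfolding W_def by blast
    then obtain k where k: "k \<noteq> 0" "frag_cmul k v \<in> W m0" using stab by blast
    then obtain y where y: "y \<in> S" "(?L ^^ m0) (frag_cmul k v) = (?L ^^ m0) y" unfolding W_def by blast
    have lift: "(?L ^^ (j + m0)) (frag_cmul k v) = (?L ^^ (j + m0)) y" for j
      using y(2) by (simp add: funpow_add)
    have "frag_cmul k x \<in> S" using group[OF S_0 S_diff xS(1), of k] by blast
    \<comment> \<open>\<open>v\<close> need not come from \<D>, but \<open>k v\<close> and
      \<open>y\<close> agree after \<open>m0\<close> applications of \<open>L\<close>. So
      \<open>k (v + x)\<close> may be replaced by \<open>k x + y\<close>, which lies in
      \<open>S\<close>, where the exponent \<open>d\<close> suffices.\<close>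
    then have wS: "frag_cmul k x + y \<in> S" using group[OF S_0 S_diff] y(1) by blast
    have kvx: "(?L ^^ (j + m0)) (frag_cmul k x + y) = frag_cmul k ((?L ^^ (j + m0)) (v + x))" for j
      using lift[of j] by (simp only: Ladd(1,5)[symmetric] frag_cmul_distrib2) (simp add: Ladd(1) add.commute)
    have "(?L ^^ (n + m0)) (v + x) = (?L ^^ m0) ((?L ^^ n) (v + x))"
      by (simp add: add.commute[of n] funpow_add)
    then have "(?L ^^ (n + m0)) (v + x) = 0" using zero Ladd(2) by simp
    then have "(?L ^^ (n + m0)) (frag_cmul k x + y) = 0" unfolding kvx by simp
    then have "(?L ^^ q) (frag_cmul k x + y) = 0" using S_kernel[OF wS _ q(2)] by blast
    then have "frag_cmul k ((?L ^^ q) (v + x)) = 0" using kvx[of "q - m0"] q(1) by simp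
    \<comment> \<open>The free abelian group is torsion free, so the multiplier \<open>k\<close> can
      be cancelled.\<close>
    then have z: "(?L ^^ q) (frag_mset (nonproj (dec A)) - frag_mset (nonproj (dec B))) = 0"
      unfolding vx using frag_cmul_eq_0 k(1) by blast
    have syzA: "syzn q (dec ((syzygy L ^^ q) V1) + dec ((syzygy L ^^ q) D1)) (dec A)"
      unfolding decA using syzn_add syzygy_funpow[OF U(2)] syzygy_funpow[OF U(4)] by blast
    have syzB: "syzn q (dec ((syzygy L ^^ q) V0) + dec ((syzygy L ^^ q) D0)) (dec B)"
      unfolding decB using syzn_add syzygy_funpow[OF U(1)] syzygy_funpow[OF U(3)] by blast
    show ?thesis
    proof (rule igusa_todorov_bound[OF ses syzA syzB nonproj_eq_of_zero[OF z syzA syzB] n])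
      fix c k assume c: "c \<in># nonproj (dec ((syzygy L ^^ q) V1) + dec ((syzygy L ^^ q) D1))" and k: "pdim_le k {#c#}"
      consider "c \<in># nonproj (dec ((syzygy L ^^ q) V1))" | "c \<in># nonproj (dec ((syzygy L ^^ q) D1))"
        using c by auto
      then show "pdim_le (max s d) {#c#}"
      proof cases
        case 1
        have "syzn q (dec ((syzygy L ^^ q) V1)) (dec V1)" using syzygy_funpow[OF U(2)] by blast
        then have "c \<in># nonproj (dec ?Vq)" using v1 1 by blast
        then have "pdim_le s {#c#}" using s k by blast
        then show ?thesis by (rule pdim_le_mono[rotated]) simp
      next
        case 2
        let ?D = "(syzygy L ^^ q) D1"
        have DD: "?D \<in> \<D>" "?D \<in> U" using D_syz[OF se(4), of "m0 + d"] DU unfolding q_def by auto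
        have cD: "c \<in># dec ?D" using 2 by (simp add: nonproj_def)
        obtain T N where T: "indecomposable L T" "c = ic T" by (rule dec_member[OF DD(2) cD])
        note TU = indecomposable_U[OF T(1)]
        have dT: "dec T = {#c#}" using dec_indecomposable[OF T(1)] T(2) by simp
        have "T \<in> \<D>" by (rule D_sub[OF TU, of "[?D]"]) (use DD(1) cD dT in auto)
        have "cls T \<in> S"
        proof -
          obtain Z where "Z \<in> \<D>" "dec Z = {#}" using D_zero by blast
          then show ?thesis using \<open>T \<in> \<D>\<close> unfolding S_def by (intro CollectI exI[of _ Z] exI[of _ T]) simp
        qed
        moreover have "(?L ^^ k) (cls T) = 0"
        proof -
          have Tk: "syzn k (dec ((syzygy L ^^ k) T)) (dec T)" using syzygy_funpow[OF TU] by blast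
          have "pdim_le (k + 0) (dec T)" using k dT by simp
          then have "proj (dec ((syzygy L ^^ k) T))" using pdim_le_syzn[OF Tk, of 0] by simp
          then have "nonproj (dec ((syzygy L ^^ k) T)) = {#}" using nonproj_proj by blast
          then show ?thesis using IT_Ln_frag_mset[OF Tk] by simp
        qed
        ultimately have zT: "(?L ^^ d) (cls T) = 0" using S_kernel[of "cls T" k d] by blast
        have Td: "syzn d (dec ((syzygy L ^^ d) T)) (dec T)" using syzygy_funpow[OF TU] by blast
        have "nonproj (dec ((syzygy L ^^ d) T)) = {#}"
          using IT_Ln_frag_mset[OF Td] zT frag_mset_inject[of "nonproj (dec ((syzygy L ^^ d) T))" "{#}"] by simp
        then have "proj (dec ((syzygy L ^^ d) T))" using nonproj_proj by blast
        then have "pdim_le d {#c#}" using pdim_le_syzn[OF Td, of 0] dT by simp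
        then show ?thesis by (rule pdim_le_mono[rotated]) simp
      qed
    qed
  qed
  then show ?thesis by blast
qed

lemma fin_dim_finite:
  assumes "\<exists>N. \<forall>C\<in>P_fin L U. pdim_le N (dec C)"
  shows "fin_dim L U < \<infinity>"
proof -
  obtain N where N: "\<forall>C\<in>P_fin L U. pdim_le N (dec C)" using assms by blast
  have "fin_dim L U \<le> enat N"
    unfolding fin_dim_def
  proof (rule SUP_least)
    fix X assume "X \<in> {X \<in> U. pd L X < \<infinity>}"
    then show "pd L X \<le> enat N" using N pd_le_iff[of X N] by (auto simp: P_fin_def)
  qed
  then show ?thesis by (rule order.strict_trans1) simp
qed

lemma special_GLIT_fin_dim:
  assumes "special_GLIT_algebra L"
  shows "fin_dim L U < \<infinity>"
  using assms unfolding special_GLIT_algebra_def special_GLIT_class_def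
proof (elim disjE)
  assume "GLIT_class L 0 (P_fin L U)"
  then show ?thesis by (rule fin_dim_finite[OF bounded_of_GLIT])
next
  assume "\<forall>n. GLIT_class L n (P_fin L U)"
  then have "GLIT_class L 0 (P_fin L U)" by blast
  then show ?thesis by (rule fin_dim_finite[OF bounded_of_GLIT])
next
  assume "\<exists>m \<E>. module_class L \<E> \<and> closed_under_sums L \<E> \<and> Psi_dim L \<E> < \<infinity> \<and>
    (\<forall>C\<in>P_fin L U. \<exists>E0\<in>\<E>. \<exists>E1\<in>\<E>. \<exists>f g. short_exact L E1 f E0 g ((syzygy L ^^ m) C))"
  then obtain m \<E> where E: "module_class L \<E>" "closed_under_sums L \<E>" "Psi_dim L \<E> < \<infinity>"
    "\<forall>C\<in>P_fin L U. \<exists>E0\<in>\<E>. \<exists>E1\<in>\<E>. \<exists>f g. short_exact L E1 f E0 g ((syzygy L ^^ m) C)" by blast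
  show ?thesis by (rule fin_dim_finite[OF bounded_of_Psi_dim[OF E]])
qed

end

theorem theorem3p17:
  fixes R :: "('k, 'r) ring_scheme" and \<Lambda> :: "('a, 's) ring_scheme" and \<phi> :: "'k \<Rightarrow> 'a"
  assumes "artin_algebra R \<Lambda> \<phi>"
  shows "fin_dim \<Lambda> (fg_modules \<Lambda>) < \<infinity> \<longleftrightarrow> special_GLIT_algebra \<Lambda>"
proof -
  interpret artin_algebra R \<Lambda> \<phi> by fact
  interpret M: finite_length_modules \<Lambda>
  proof
    show "left_modules.fin_len \<Lambda> M" if "M \<in> fg_modules \<Lambda>" for M :: "'a fgmod"
      by (rule artin_algebra_fin_len[OF assms]) (use that in \<open>simp add: fg_modules_def\<close>)
  qed
  show ?thesis
    using M.special_GLIT_fin_dim by (auto simp: special_GLIT_algebra_def special_GLIT_class_def)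
qed

end
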